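(* Let $\mathcal{P}$ be a dg operad, $\mathcal{C}$ a dg cooperad, $\alpha:\mathcal{C}\to\mathcal{P}$ an operadic twisting morphism, $A$ a $\mathcal{P}$-algebra, $C$ a $\mathcal{C}$-coalgebra, $\varphi:C\to A$ an algebraic twisting morphism with respect to $\alpha$, and assume that $\mathcal{P}\circ_\alpha C\to A$ is a quasi-free resolution of $A$ whose augmentation restricts to $\varphi$ on $C$. Let $M$ be an $A$-module. Then the following three dg modules are isomorphic: $$(\mathrm{Der}_A(\mathcal{P}\circ_\alpha C,M),\partial)\cong(\mathrm{Hom}_{\mathbb{K}}(C,M),\partial_\varphi)\cong(\mathrm{Hom}_{A\text{-mod}}(A\otimes^{\mathcal{P}}C,M),\partial_\varphi).$$
   Context: Conventions. $\mathbb{K}$ is a field of characteristic $0$; all modules are differential graded (dg), homologically graded, with Koszul sign rule. For a graded map $f$ between dg modules, $\partial(f)=d\circ f-(-1)^{|f|}f\circ d$; $\mathrm{Hom}_{\mathbb{K}}$ and $\mathrm{Hom}_{A\text{-mod}}$ denote all graded maps, resp. all graded maps of $A$-modules. $\mathbb{S}$-modules are families of dg $\mathbb{K}[\mathbb{S}_n]$-modules, $n\ge0$; $\circ$ is the usual composition product with unit $I$; $M\circ(N,N')$ is the part of $M\circ(N\oplus N')$ linear in $N'$; $M\circ_{(1)}N=M\circ(I,N)$; $f\circ' g=\sum_j f\otimes(id\otimes\cdots\otimes g\otimes\cdots\otimes id)$ ($g$ in position $j$). Operads $(\mathcal{P},\gamma)$ and cooperads $(\mathcal{C},\Delta)$ are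 monoids and comonoids for $\circ$, with partial (co)products $\gamma_p:\mathcal{P}\circ_{(1)}\mathcal{P}\to\mathcal{P}$, $\Delta_p:\mathcal{C}\to\mathcal{C}\circ_{(1)}\mathcal{C}$. Invariants and coinvariants of symmetric group actions are identified (characteristic $0$). $\mathcal{P}(A)=\mathcal{P}\circ A$, $\mathcal{P}(A,M)=\mathcal{P}\circ(A,M)$. A $\mathcal{P}$-algebra has $\gamma_A:\mathcal{P}(A)\to A$; an $A$-module has $\gamma_M:\mathcal{P}(A,M)\to M$, associative and unital; a $\mathcal{C}$-coalgebra has $\Delta_C:C\to\mathcal{C}(C)$. $A\otimes^{\mathcal{P}}N$ is the free $A$-module on $N$, i.e. the coequalizer of $\mathcal{P}(\mathcal{P}(A),N)\rightrightarrows\mathcal{P}(A,N)$ given by $\gamma$ and $\gamma_A$, with the induced differential $d_{A\otimes^{\mathcal{P}}N}$. $\mathcal{P}$ is augmented, $\mathcal{C}$ coaugmented, and algebras are non-negatively graded. Twisting morphisms. $\alpha:\mathcal{C}\to\mathcal{P}$ of degree $-1$ is an operadic twisting morphism if $\partial(\alpha)+\gamma_p(\alpha\circ_{(1)}\alpha)\Delta_p=0$. $\varphi:C\to A$ of degree $0$ is an algebraic twisting morphism with respect to $\alpha$ if $\partial(\varphi)+\gamma_A(\alpha\circ\varphi)\Delta_C=0$. Quasi-free resolutions. $\mathcal{P}\circ_\alpha C$ is the $\mathcal{P}$-algebra $\mathcal{P}(C)$ with differential $d_\alpha=d_{\mathcal{P}\circ C}-\delta^l_\alpha$, where $\delta^l_\alpha$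 is $\mathcal{P}(C)\xrightarrow{id\circ'\Delta_C}\mathcal{P}\circ(C,\mathcal{C}(C))\xrightarrow{id\circ(id_C,\alpha\circ id_C)}\mathcal{P}\circ(C,\mathcal{P}(C))\to\mathcal{P}\circ\mathcal{P}(C)\xrightarrow{\gamma\circ id}\mathcal{P}(C)$. It is a quasi-free resolution of $A$ if $C$ has a filtration $F_pC$ with $F_{-1}C=0$ and $\delta^l_\alpha(F_pC)\subset\mathcal{P}(F_{p-1}C)$, and there is a quasi-isomorphism of $\mathcal{P}$-algebras $\mathcal{P}\circ_\alpha C\to A$. (The main case is $C=\mathcal{C}(A)$ with differential $d_{\mathcal{C}(A)}+\delta^r_\alpha$, where $\delta^r_\alpha:\mathcal{C}(A)\xrightarrow{\Delta_p\circ id}(\mathcal{C}\circ_{(1)}\mathcal{C})(A)\xrightarrow{id\circ_{(1)}\alpha\circ id}(\mathcal{C}\circ_{(1)}\mathcal{P})(A)\xrightarrow{id\circ\gamma_A}\mathcal{C}(A)$, and $\varphi:\mathcal{C}(A)\to A$ induced by the counit.) Complexes. With $f:\mathcal{P}\circ_\alpha C\to A$ the augmentation, $\mathrm{Der}_A(\mathcal{P}\circ_\alpha C,M)$ is the set of graded linear maps $D:B=\mathcal{P}\circ_\alpha C\to M$ with $D\gamma_B=\gamma_M(id\circ(f,id_M))(id\circ' D)$, with $\partial(D)=d_M D-(-1)^{|D|}D d_\alpha$. For $g\in\mathrm{Hom}_{\mathbb{K}}(C,M)$, $\alpha[\varphi,g]$ is the composite $C\xrightarrow{\Delta_C}\mathcal{C}(C)\to\mathcal{P}(A,M)\xrightarrow{\gamma_M}M$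 whose middle map applies $\alpha$ to the operadic factor, $g$ to one factor $C$ and $\varphi$ to the others (sum over the position of $g$), and $\partial_\varphi(g):=\partial(g)+\alpha[\varphi,g]$. On $A\otimes^{\mathcal{P}}C$, $\delta^l_\varphi$ is the degree $-1$ map of graded $A$-modules whose restriction to $C$ is the composite $C\xrightarrow{\Delta_C}\mathcal{C}(C)\to\mathcal{P}(A,C)\to A\otimes^{\mathcal{P}}C$ where the middle map applies $\alpha$ to the operadic factor, $\varphi$ to all factors $C$ but one, and the identity to the remaining one (sum over positions). On $\mathrm{Hom}_{A\text{-mod}}(A\otimes^{\mathcal{P}}C,M)$, $\partial_\varphi(h):=d_M\circ h-(-1)^{|h|}h\circ(d_{A\otimes^{\mathcal{P}}C}-\delta^l_\varphi)$. *)

theory Defs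
  imports
    Complex_Main
    "HOL-Library.Poly_Mapping"
    "HOL-Library.Product_Plus"
    "HOL-Library.Function_Algebras"
    "HOL-Combinatorics.Permutations"
begin

section \<open>Differential graded S-modules\<close>

text \<open>
  A dg S-module is a family of vector spaces \<open>grd V n d\<close> (arity \<open>n\<close>, homological degree
  \<open>d\<close>), all of them subspaces of one ambient vector space, with a differential of degree \<open>-1\<close>
  and a right action of the symmetric groups (permutations of \<open>{..<n}\<close>):
  \<open>(x \<sigma>) \<tau> = x (\<sigma> \<circ> \<tau>)\<close>.
  A dg module is a dg S-module concentrated in arity \<open>0\<close>.

  A graded map is a family \<open>f n d\<close> of maps defined on the components of its source; its degree is
  carried along separately.
\<close>

record ('k, 'v) dgs =
  scl :: "'k \<Rightarrow> 'v \<Rightarrow> 'v"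
  grd :: "nat \<Rightarrow> int \<Rightarrow> 'v set"
  dif :: "nat \<Rightarrow> int \<Rightarrow> 'v \<Rightarrow> 'v"
  act :: "nat \<Rightarrow> int \<Rightarrow> (nat \<Rightarrow> nat) \<Rightarrow> 'v \<Rightarrow> 'v"

type_synonym ('v, 'w) gmap = "nat \<Rightarrow> int \<Rightarrow> 'v \<Rightarrow> 'w"

definition eq_on :: "('k, 'v) dgs \<Rightarrow> ('v, 'w) gmap \<Rightarrow> ('v, 'w) gmap \<Rightarrow> bool" where
  "eq_on V f g \<longleftrightarrow> (\<forall>n d. \<forall>x\<in>grd V n d. f n d x = g n d x)"

definition idm :: "('v, 'v) gmap" where
  "idm = (\<lambda>n d x. x)"

text \<open>Composition; the degree of the inner map is given in the brackets.\<close>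

definition gcomp :: "('v, 'w) gmap \<Rightarrow> int \<Rightarrow> ('u, 'v) gmap \<Rightarrow> ('u, 'w) gmap"
    ("_ \<bullet>[_] _" [56, 0, 55] 55) where
  "g \<bullet>[p] f = (\<lambda>n d x. g n (d + p) (f n d x))"

definition glinear ::
    "int \<Rightarrow> ('k, 'v::ab_group_add) dgs \<Rightarrow> ('k, 'w::ab_group_add) dgs \<Rightarrow> ('v, 'w) gmap \<Rightarrow> bool" where
  "glinear p V W f \<longleftrightarrow> (\<forall>n d.
     (\<forall>x\<in>grd V n d. f n d x \<in> grd W n (d + p)) \<and>
     (\<forall>x\<in>grd V n d. \<forall>y\<in>grd V n d. f n d (x + y) = f n d x + f n d y) \<and>
     (\<forall>c. \<forall>x\<in>grd V n d. f n d (scl V c x) = scl W c (f n d x)))"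

definition ghom ::
    "int \<Rightarrow> ('k, 'v::ab_group_add) dgs \<Rightarrow> ('k, 'w::ab_group_add) dgs \<Rightarrow> ('v, 'w) gmap \<Rightarrow> bool" where
  "ghom p V W f \<longleftrightarrow> glinear p V W f \<and>
     (\<forall>n d \<sigma>. \<sigma> permutes {..<n} \<longrightarrow>
        (\<forall>x\<in>grd V n d. f n d (act V n d \<sigma> x) = act W n (d + p) \<sigma> (f n d x)))"

definition smodule :: "('k::field_char_0, 'v::ab_group_add) dgs \<Rightarrow> bool" where
  "smodule V \<longleftrightarrow>
     vector_space (scl V) \<and>
     (\<forall>n d. module.subspace (scl V) (grd V n d)) \<and>
     ghom (-1) V V (dif V) \<and>
     (\<forall>n d. \<forall>x\<in>grd V n d. dif V n (d - 1) (dif V n d x) = 0) \<and>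
     (\<forall>n \<sigma>. \<sigma> permutes {..<n} \<longrightarrow>
        (\<forall>d. (\<forall>x\<in>grd V n d. act V n d \<sigma> x \<in> grd V n d) \<and>
             (\<forall>x\<in>grd V n d. \<forall>y\<in>grd V n d. act V n d \<sigma> (x + y) = act V n d \<sigma> x + act V n d \<sigma> y) \<and>
             (\<forall>c. \<forall>x\<in>grd V n d. act V n d \<sigma> (scl V c x) = scl V c (act V n d \<sigma> x)))) \<and>
     (\<forall>n d. \<forall>x\<in>grd V n d. act V n d id x = x) \<and>
     (\<forall>n \<sigma> \<tau>. \<sigma> permutes {..<n} \<longrightarrow> \<tau> permutes {..<n} \<longrightarrow>
        (\<forall>d. \<forall>x\<in>grd V n d. act V n d \<tau> (act V n d \<sigma> x) = act V n d (\<sigma> \<circ> \<tau>) x))"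

definition dg_module :: "('k::field_char_0, 'v::ab_group_add) dgs \<Rightarrow> bool" where
  "dg_module V \<longleftrightarrow> smodule V \<and> (\<forall>n d. n > 0 \<longrightarrow> grd V n d = {0})"

definition nonneg_graded :: "('k, 'v::zero) dgs \<Rightarrow> bool" where
  "nonneg_graded V \<longleftrightarrow> (\<forall>n d. d < 0 \<longrightarrow> grd V n d = {0})"

definition dg_hom ::
    "('k, 'v::ab_group_add) dgs \<Rightarrow> ('k, 'w::ab_group_add) dgs \<Rightarrow> ('v, 'w) gmap \<Rightarrow> bool" where
  "dg_hom V W f \<longleftrightarrow> ghom 0 V W f \<and> eq_on V (dif W \<bullet>[0] f) (f \<bullet>[-1] dif V)"

definition dg_iso ::
    "('k::field_char_0, 'v::ab_group_add) dgs \<Rightarrow> ('k, 'w::ab_group_add) dgs \<Rightarrow> bool" where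
  "dg_iso V W \<longleftrightarrow> dg_module V \<and> dg_module W \<and>
     (\<exists>F. dg_hom V W F \<and> (\<forall>n d. bij_betw (F n d) (grd V n d) (grd W n d)))"

definition cycles :: "('k, 'v::zero) dgs \<Rightarrow> nat \<Rightarrow> int \<Rightarrow> 'v set" where
  "cycles V n d = {x \<in> grd V n d. dif V n d x = 0}"

definition boundaries :: "('k, 'v) dgs \<Rightarrow> nat \<Rightarrow> int \<Rightarrow> 'v set" where
  "boundaries V n d = dif V n (d + 1) ` grd V n (d + 1)"

text \<open>The last two conditions are injectivity and surjectivity on homology.\<close>

definition quasi_iso ::
    "('k, 'v::ab_group_add) dgs \<Rightarrow> ('k, 'w::ab_group_add) dgs \<Rightarrow> ('v, 'w) gmap \<Rightarrow> bool" where
  "quasi_iso V W f \<longleftrightarrow> dg_hom V W f \<and> (\<forall>n d.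
     (\<forall>z\<in>cycles V n d. f n d z \<in> boundaries W n d \<longrightarrow> z \<in> boundaries V n d) \<and>
     (\<forall>w\<in>cycles W n d. \<exists>z\<in>cycles V n d. w - f n d z \<in> boundaries W n d))"

definition dsum :: "('k, 'v) dgs \<Rightarrow> ('k, 'w) dgs \<Rightarrow> ('k, 'v \<times> 'w) dgs" where
  "dsum V W =
     \<lparr>scl = (\<lambda>c. map_prod (scl V c) (scl W c)),
      grd = (\<lambda>n d. grd V n d \<times> grd W n d),
      dif = (\<lambda>n d. map_prod (dif V n d) (dif W n d)),
      act = (\<lambda>n d \<sigma>. map_prod (act V n d \<sigma>) (act W n d \<sigma>))\<rparr>"

definition fstm :: "('v \<times> 'w, 'v) gmap" where
  "fstm = (\<lambda>n d. fst)"

definition sndm :: "('v \<times> 'w, 'w) gmap" where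
  "sndm = (\<lambda>n d. snd)"

definition inlm :: "('v, 'v \<times> 'w::zero) gmap" where
  "inlm = (\<lambda>n d x. (x, 0))"

definition inrm :: "('w, 'v::zero \<times> 'w) gmap" where
  "inrm = (\<lambda>n d y. (0, y))"

definition copair :: "('v, 'u::plus) gmap \<Rightarrow> ('w, 'u) gmap \<Rightarrow> ('v \<times> 'w, 'u) gmap" where
  "copair f g = (\<lambda>n d (x, y). f n d x + g n d y)"

section \<open>Quotients\<close>

text \<open>
  \<open>qproj s R\<close> is a chosen linear projection with kernel \<open>R\<close>, for a subspace \<open>R\<close>; it exists
  over a field. The quotient \<open>V / R\<close> is represented by the complement \<open>qproj s R ` V\<close>, so that
  \<open>qproj s R\<close> itself is the quotient map.
\<close>

definition qproj :: "('k::field \<Rightarrow> 'v \<Rightarrow> 'v) \<Rightarrow> 'v set \<Rightarrow> 'v \<Rightarrow> 'v::ab_group_add" where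
  "qproj s R = (SOME \<pi>. Vector_Spaces.linear s s \<pi> \<and> (\<forall>x. x - \<pi> x \<in> R) \<and> (\<forall>x\<in>R. \<pi> x = 0))"

definition quotient ::
    "('k::field, 'v::ab_group_add) dgs \<Rightarrow> (nat \<Rightarrow> int \<Rightarrow> 'v set) \<Rightarrow> ('k, 'v) dgs" where
  "quotient V R = V\<lparr>
     grd := (\<lambda>n d. qproj (scl V) (R n d) ` grd V n d),
     dif := (\<lambda>n d x. qproj (scl V) (R n (d - 1)) (dif V n d x)),
     act := (\<lambda>n d \<sigma> x. qproj (scl V) (R n d) (act V n d \<sigma> x))\<rparr>"

section \<open>The composition product\<close>

text \<open>
  \<open>M \<circ> N\<close> in arity \<open>n\<close> is spanned by two-level trees \<open>((p, m), [(s\<^sub>1, e\<^sub>1, x\<^sub>1), \<dots>, (s\<^sub>k, e\<^sub>k, x\<^sub>k)])\<close>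
  with \<open>m\<close> in \<open>M\<close> of arity \<open>k\<close> and degree \<open>p\<close>, and \<open>x\<^sub>j\<close> in \<open>N\<close> of arity \<open>length s\<^sub>j\<close> and degree
  \<open>e\<^sub>j\<close>. The list \<open>s\<^sub>j\<close> consists of the labels of the inputs of \<open>x\<^sub>j\<close>, every label in \<open>{..<n}\<close> being
  used exactly once. The label lists encode the induction from
  \<open>S\<^bsub>i\<^sub>1\<^esub> \<times> \<dots> \<times> S\<^bsub>i\<^sub>k\<^esub>\<close> to \<open>S\<^sub>n\<close>; the relations impose multilinearity and take coinvariants.
\<close>

type_synonym ('m, 'n) tree = "(int \<times> 'm) \<times> (nat list \<times> int \<times> 'n) list"

definition degs :: "(nat list \<times> int \<times> 'n) list \<Rightarrow> int" where
  "degs xs = (\<Sum>(s, e, x)\<leftarrow>xs. e)"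

definition trees :: "('k, 'm) dgs \<Rightarrow> ('k, 'n) dgs \<Rightarrow> nat \<Rightarrow> int \<Rightarrow> ('m, 'n) tree set" where
  "trees M N n d = {((p, m), xs) | p m xs.
     m \<in> grd M (length xs) p \<and>
     (\<forall>(s, e, x)\<in>set xs. x \<in> grd N (length s) e) \<and>
     distinct (concat (map fst xs)) \<and> set (concat (map fst xs)) = {..<n} \<and>
     p + degs xs = d}"

definition psc :: "'k::semiring_0 \<Rightarrow> ('g \<Rightarrow>\<^sub>0 'k) \<Rightarrow> ('g \<Rightarrow>\<^sub>0 'k)" where
  "psc c = Poly_Mapping.map ((*) c)"

text \<open>Linear extension to formal linear combinations, with values in formal linear combinations.\<close>

definition lext :: "('g \<Rightarrow> ('h \<Rightarrow>\<^sub>0 'k)) \<Rightarrow> ('g \<Rightarrow>\<^sub>0 'k::comm_ring_1) \<Rightarrow> ('h \<Rightarrow>\<^sub>0 'k)" where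
  "lext F u = (\<Sum>g\<in>Poly_Mapping.keys u. psc (Poly_Mapping.lookup u g) (F g))"

text \<open>Koszul sign of the passage from a list with degrees \<open>ds\<close> to \<open>permute_list \<sigma>\<close> of it.\<close>

definition koszul :: "(nat \<Rightarrow> nat) \<Rightarrow> int list \<Rightarrow> 'k::field" where
  "koszul \<sigma> ds =
     (\<Prod>(i, j) | i < j \<and> j < length ds \<and> \<sigma> j < \<sigma> i. (-1) powi (ds ! \<sigma> i * ds ! \<sigma> j))"

text \<open>
  The action of \<open>\<sigma>\<close> relabels by \<open>inv \<sigma>\<close>: a tree \<open>x\<close> whose inputs are labelled by \<open>s\<close> stands
  for \<open>x \<rho>\<close>, where \<open>\<rho>\<close> is inverse to \<open>j \<mapsto> s ! j\<close>.
\<close>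

definition free_comp ::
    "('k::field, 'm) dgs \<Rightarrow> ('k, 'n) dgs \<Rightarrow> ('k, ('m, 'n) tree \<Rightarrow>\<^sub>0 'k) dgs" where
  "free_comp M N =
     \<lparr>scl = psc,
      grd = (\<lambda>n d. module.span psc ((\<lambda>t. Poly_Mapping.single t 1) ` trees M N n d)),
      dif = (\<lambda>n d. lext (\<lambda>((p, m), xs).
        Poly_Mapping.single ((p - 1, dif M (length xs) p m), xs) 1 +
        (\<Sum>j<length xs. case xs ! j of (s, e, x) \<Rightarrow>
           Poly_Mapping.single ((p, m), xs[j := (s, e - 1, dif N (length s) e x)])
             ((-1) powi (p + degs (take j xs)))))),
      act = (\<lambda>n d \<sigma>. lext (\<lambda>(r, xs).
        Poly_Mapping.single (r, map (\<lambda>(s, y). (map (inv \<sigma>) s, y)) xs) 1))\<rparr>"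

inductive_set comp_rels ::
    "('k::field, 'm::plus) dgs \<Rightarrow> ('k, 'n::plus) dgs \<Rightarrow> nat \<Rightarrow> int \<Rightarrow> (('m, 'n) tree \<Rightarrow>\<^sub>0 'k) set"
  for M N n d where
  add_root: "\<lbrakk>((p, m), xs) \<in> trees M N n d; ((p, m'), xs) \<in> trees M N n d\<rbrakk> \<Longrightarrow>
    Poly_Mapping.single ((p, m + m'), xs) 1
      - Poly_Mapping.single ((p, m), xs) 1 - Poly_Mapping.single ((p, m'), xs) 1
    \<in> comp_rels M N n d"
| scl_root: "((p, m), xs) \<in> trees M N n d \<Longrightarrow>
    Poly_Mapping.single ((p, scl M c m), xs) 1 - Poly_Mapping.single ((p, m), xs) c
    \<in> comp_rels M N n d"
| add_leaf: "\<lbrakk>(r, xs @ (s, e, x) # ys) \<in> trees M N n d; (r, xs @ (s, e, x') # ys) \<in> trees M N n d\<rbrakk> \<Longrightarrow>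
    Poly_Mapping.single (r, xs @ (s, e, x + x') # ys) 1
      - Poly_Mapping.single (r, xs @ (s, e, x) # ys) 1
      - Poly_Mapping.single (r, xs @ (s, e, x') # ys) 1
    \<in> comp_rels M N n d"
| scl_leaf: "(r, xs @ (s, e, x) # ys) \<in> trees M N n d \<Longrightarrow>
    Poly_Mapping.single (r, xs @ (s, e, scl N c x) # ys) 1
      - Poly_Mapping.single (r, xs @ (s, e, x) # ys) c
    \<in> comp_rels M N n d"
| sym_root: "\<lbrakk>((p, m), xs) \<in> trees M N n d; \<sigma> permutes {..<length xs}\<rbrakk> \<Longrightarrow>
    Poly_Mapping.single ((p, act M (length xs) p \<sigma> m), permute_list \<sigma> xs) 1
      - Poly_Mapping.single ((p, m), xs) (koszul \<sigma> (map (\<lambda>(s, e, x). e) xs))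
    \<in> comp_rels M N n d"
| sym_leaf: "\<lbrakk>(r, xs @ (s, e, x) # ys) \<in> trees M N n d; \<sigma> permutes {..<length s}\<rbrakk> \<Longrightarrow>
    Poly_Mapping.single (r, xs @ (permute_list \<sigma> s, e, act N (length s) e \<sigma> x) # ys) 1
      - Poly_Mapping.single (r, xs @ (s, e, x) # ys) 1
    \<in> comp_rels M N n d"

definition comp_rel ::
    "('k::field, 'm::plus) dgs \<Rightarrow> ('k, 'n::plus) dgs \<Rightarrow> nat \<Rightarrow> int \<Rightarrow> (('m, 'n) tree \<Rightarrow>\<^sub>0 'k) set" where
  "comp_rel M N n d = module.span psc (comp_rels M N n d)"

definition circ ::
    "('k::field, 'm::plus) dgs \<Rightarrow> ('k, 'n::plus) dgs \<Rightarrow> ('k, ('m, 'n) tree \<Rightarrow>\<^sub>0 'k) dgs" where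
  "circ M N = quotient (free_comp M N) (comp_rel M N)"

definition cls ::
    "('k::field, 'm::plus) dgs \<Rightarrow> ('k, 'n::plus) dgs \<Rightarrow> nat \<Rightarrow> int \<Rightarrow> ('m, 'n) tree \<Rightarrow>
     ('m, 'n) tree \<Rightarrow>\<^sub>0 'k" where
  "cls M N n d t = qproj psc (comp_rel M N n d) (Poly_Mapping.single t 1)"

text \<open>\<open>M \<circ> (N, N')\<close>, the part of \<open>M \<circ> (N \<oplus> N')\<close> that is linear in \<open>N'\<close>.\<close>

definition lin_tree :: "('m, 'n::zero \<times> 'n'::zero) tree \<Rightarrow> bool" where
  "lin_tree t \<longleftrightarrow> (case t of (r, xs) \<Rightarrow> \<exists>j<length xs. \<forall>i<length xs.
     case xs ! i of (s, e, (x, y)) \<Rightarrow> if i = j then x = 0 else y = 0)"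

definition circ_lin ::
    "('k::field, 'm::plus) dgs \<Rightarrow> ('k, 'n::monoid_add) dgs \<Rightarrow> ('k, 'n'::monoid_add) dgs \<Rightarrow>
     ('k, ('m, 'n \<times> 'n') tree \<Rightarrow>\<^sub>0 'k) dgs" where
  "circ_lin M N N' = (circ M (dsum N N'))\<lparr>grd := (\<lambda>n d.
     module.span psc (cls M (dsum N N') n d ` {t \<in> trees M (dsum N N') n d. lin_tree t}))\<rparr>"

text \<open>
  \<open>comp_map M' N' r f g : M \<circ> N \<rightarrow> M' \<circ> N'\<close> is \<open>f \<circ> g\<close>, for \<open>f\<close> of degree \<open>r\<close> and
  \<open>g\<close> of degree \<open>0\<close>.
\<close>

definition comp_map ::
    "('k::field, 'm'::plus) dgs \<Rightarrow> ('k, 'n'::plus) dgs \<Rightarrow> int \<Rightarrow> ('m, 'm') gmap \<Rightarrow> ('n, 'n') gmap \<Rightarrow>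
     (('m, 'n) tree \<Rightarrow>\<^sub>0 'k, ('m', 'n') tree \<Rightarrow>\<^sub>0 'k) gmap" where
  "comp_map M' N' r f g = (\<lambda>n d. lext (\<lambda>((p, m), xs).
     cls M' N' n (d + r)
       ((p + r, f (length xs) p m), map (\<lambda>(s, e, x). (s, e, g (length s) e x)) xs)))"

text \<open>
  \<open>lcomp_map M' L L' r f a q b : M \<circ> N \<rightarrow> M' \<circ> (L, L')\<close> is
  \<open>\<Sum>\<^sub>j f \<otimes> (a \<otimes> \<dots> \<otimes> b \<otimes> \<dots> \<otimes> a)\<close> with \<open>b\<close> in position \<open>j\<close>, for \<open>f\<close> of degree \<open>r\<close>,
  \<open>a : N \<rightarrow> L\<close> of degree \<open>0\<close> and \<open>b : N \<rightarrow> L'\<close> of degree \<open>q\<close>. Taking \<open>a = id\<close> one obtains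
  \<open>f \<circ>' b\<close>. On \<open>M \<circ> (N, N')\<close> one obtains \<open>f \<circ> (g, g')\<close> as the case \<open>a = g \<circ> fst\<close>,
  \<open>b = g' \<circ> snd\<close>: only the position of the factor in \<open>N'\<close> contributes to the sum.
\<close>

definition lcomp_map ::
    "('k::field, 'm'::plus) dgs \<Rightarrow> ('k, 'l::monoid_add) dgs \<Rightarrow> ('k, 'l'::monoid_add) dgs \<Rightarrow>
     int \<Rightarrow> ('m, 'm') gmap \<Rightarrow> ('n, 'l) gmap \<Rightarrow> int \<Rightarrow> ('n, 'l') gmap \<Rightarrow>
     (('m, 'n) tree \<Rightarrow>\<^sub>0 'k, ('m', 'l \<times> 'l') tree \<Rightarrow>\<^sub>0 'k) gmap" where
  "lcomp_map M' L L' r f a q b = (\<lambda>n d. lext (\<lambda>((p, m), xs).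
     \<Sum>j<length xs. psc ((-1) powi (q * (p + degs (take j xs))))
       (cls M' (dsum L L') n (d + r + q)
         ((p + r, f (length xs) p m),
          map (\<lambda>i. case xs ! i of (s, e, x) \<Rightarrow>
                 if i = j then (s, e + q, (0, b (length s) e x))
                 else (s, e, (a (length s) e x, 0)))
              [0..<length xs]))))"

text \<open>
  The associativity isomorphism \<open>M \<circ> (N \<circ> L) \<rightarrow> (M \<circ> N) \<circ> L\<close>. Each leaf \<open>u\<close> of a tree in
  \<open>M \<circ> (N \<circ> L)\<close> is a linear combination of trees; the product of these combinations is expanded,
  \<open>us\<close> running through the choices of one tree for every leaf. The sign comes from moving the
  roots of the trees \<open>us\<close> to the left of their leaves.
\<close>

definition assoc ::
    "('k::field, 'm::plus) dgs \<Rightarrow> ('k, 'n::plus) dgs \<Rightarrow> ('k, 'l::plus) dgs \<Rightarrow>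
     (('m, ('n, 'l) tree \<Rightarrow>\<^sub>0 'k) tree \<Rightarrow>\<^sub>0 'k, (('m, 'n) tree \<Rightarrow>\<^sub>0 'k, 'l) tree \<Rightarrow>\<^sub>0 'k) gmap" where
  "assoc M N L = (\<lambda>n d. lext (\<lambda>((p, m), xs).
     \<Sum>us\<in>listset (map (\<lambda>(t, e, u). Poly_Mapping.keys u) xs).
       let k = length xs;
           root = (\<lambda>j. fst (us ! j));
           leaves = (\<lambda>j. snd (us ! j));
           coef = (\<Prod>j<k. Poly_Mapping.lookup (snd (snd (xs ! j))) (us ! j));
           sign = (\<Prod>j<k. (-1) powi (fst (root j) * (\<Sum>i<j. degs (leaves i))));
           offset = (\<lambda>j. \<Sum>i<j. length (leaves i));
           deg = p + (\<Sum>j<k. fst (root j));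
           top = cls M N (offset k) deg
             ((p, m), map (\<lambda>j. ([offset j..<offset (Suc j)], root j)) [0..<k])
       in psc (coef * sign)
            (cls (circ M N) L n d
              ((deg, top),
               concat (map (\<lambda>j. map (\<lambda>(s, y). (map ((!) (fst (xs ! j))) s, y)) (leaves j)) [0..<k])))))"

text \<open>The unit \<open>I\<close>, and the isomorphisms \<open>V \<rightarrow> I \<circ> V\<close> and \<open>V \<rightarrow> V \<circ> I\<close>.\<close>

definition unit_smod :: "('k::field, 'k) dgs" where
  "unit_smod =
     \<lparr>scl = (*),
      grd = (\<lambda>n d. if n = 1 \<and> d = 0 then UNIV else {0}),
      dif = (\<lambda>n d x. 0),
      act = (\<lambda>n d \<sigma> x. x)\<rparr>"

definition lunit :: "('k::field, 'v::plus) dgs \<Rightarrow> ('v, ('k, 'v) tree \<Rightarrow>\<^sub>0 'k) gmap" where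
  "lunit V = (\<lambda>n d x. cls unit_smod V n d ((0, 1), [([0..<n], d, x)]))"

definition runit :: "('k::field, 'v::plus) dgs \<Rightarrow> ('v, ('v, 'k) tree \<Rightarrow>\<^sub>0 'k) gmap" where
  "runit V = (\<lambda>n d x. cls V unit_smod n d ((d, x), map (\<lambda>i. ([i], 0, 1)) [0..<n]))"

section \<open>Operads, cooperads and their algebras, modules and coalgebras\<close>

text \<open>The map \<open>V \<cong> I \<circ> V \<rightarrow> P \<circ> V\<close>.\<close>

definition iota ::
    "('k::field, 'p::plus) dgs \<Rightarrow> ('k, 'p) gmap \<Rightarrow> ('k, 'v::plus) dgs \<Rightarrow>
     ('v, ('p, 'v) tree \<Rightarrow>\<^sub>0 'k) gmap" where
  "iota P \<eta> V = comp_map P V 0 \<eta> idm \<bullet>[0] lunit V"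

definition operad ::
    "('k::field_char_0, 'p::ab_group_add) dgs \<Rightarrow> (('p, 'p) tree \<Rightarrow>\<^sub>0 'k, 'p) gmap \<Rightarrow> ('k, 'p) gmap \<Rightarrow> bool"
  where
  "operad P \<gamma> \<eta> \<longleftrightarrow>
     smodule P \<and> dg_hom (circ P P) P \<gamma> \<and> dg_hom unit_smod P \<eta> \<and>
     eq_on (circ P (circ P P))
       (\<gamma> \<bullet>[0] comp_map P P 0 idm \<gamma>)
       (\<gamma> \<bullet>[0] comp_map P P 0 \<gamma> idm \<bullet>[0] assoc P P P) \<and>
     eq_on P (\<gamma> \<bullet>[0] comp_map P P 0 \<eta> idm \<bullet>[0] lunit P) idm \<and>
     eq_on P (\<gamma> \<bullet>[0] comp_map P P 0 idm \<eta> \<bullet>[0] runit P) idm"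

text \<open>
  An augmentation is a morphism of operads to \<open>I\<close>; the composition of \<open>I\<close> is inverse to
  \<open>lunit unit_smod\<close>.
\<close>

definition augmented ::
    "('k::field_char_0, 'p::ab_group_add) dgs \<Rightarrow> (('p, 'p) tree \<Rightarrow>\<^sub>0 'k, 'p) gmap \<Rightarrow> ('k, 'p) gmap \<Rightarrow> bool"
  where
  "augmented P \<gamma> \<eta> \<longleftrightarrow> (\<exists>\<epsilon>. dg_hom P unit_smod \<epsilon> \<and>
     eq_on unit_smod (\<epsilon> \<bullet>[0] \<eta>) idm \<and>
     eq_on (circ P P) (lunit unit_smod \<bullet>[0] \<epsilon> \<bullet>[0] \<gamma>) (comp_map unit_smod unit_smod 0 \<epsilon> \<epsilon>))"

definition cooperad ::
    "('k::field_char_0, 'q::ab_group_add) dgs \<Rightarrow> ('q, ('q, 'q) tree \<Rightarrow>\<^sub>0 'k) gmap \<Rightarrow> ('q, 'k) gmap \<Rightarrow> bool"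
  where
  "cooperad Q \<Delta> \<epsilon> \<longleftrightarrow>
     smodule Q \<and> dg_hom Q (circ Q Q) \<Delta> \<and> dg_hom Q unit_smod \<epsilon> \<and>
     eq_on Q
       (assoc Q Q Q \<bullet>[0] comp_map Q (circ Q Q) 0 idm \<Delta> \<bullet>[0] \<Delta>)
       (comp_map (circ Q Q) Q 0 \<Delta> idm \<bullet>[0] \<Delta>) \<and>
     eq_on Q (comp_map unit_smod Q 0 \<epsilon> idm \<bullet>[0] \<Delta>) (lunit Q) \<and>
     eq_on Q (comp_map Q unit_smod 0 idm \<epsilon> \<bullet>[0] \<Delta>) (runit Q)"

definition coaugmented ::
    "('k::field_char_0, 'q::ab_group_add) dgs \<Rightarrow> ('q, ('q, 'q) tree \<Rightarrow>\<^sub>0 'k) gmap \<Rightarrow> ('q, 'k) gmap \<Rightarrow> bool"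
  where
  "coaugmented Q \<Delta> \<epsilon> \<longleftrightarrow> (\<exists>u. dg_hom unit_smod Q u \<and>
     eq_on unit_smod (\<epsilon> \<bullet>[0] u) idm \<and>
     eq_on unit_smod (\<Delta> \<bullet>[0] u) (comp_map Q Q 0 u u \<bullet>[0] lunit unit_smod))"

definition partial_comp ::
    "('k::field, 'p::ab_group_add) dgs \<Rightarrow> (('p, 'p) tree \<Rightarrow>\<^sub>0 'k, 'p) gmap \<Rightarrow> ('k, 'p) gmap \<Rightarrow>
     (('p, 'k \<times> 'p) tree \<Rightarrow>\<^sub>0 'k, 'p) gmap" where
  "partial_comp P \<gamma> \<eta> = \<gamma> \<bullet>[0] comp_map P P 0 idm (copair \<eta> idm)"

definition partial_decomp ::
    "('k::field, 'q::ab_group_add) dgs \<Rightarrow> ('q, ('q, 'q) tree \<Rightarrow>\<^sub>0 'k) gmap \<Rightarrow> ('q, 'k) gmap \<Rightarrow>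
     ('q, ('q, 'k \<times> 'q) tree \<Rightarrow>\<^sub>0 'k) gmap" where
  "partial_decomp Q \<Delta> \<epsilon> = lcomp_map Q unit_smod Q 0 idm \<epsilon> 0 idm \<bullet>[0] \<Delta>"

definition palgebra ::
    "('k::field_char_0, 'p::ab_group_add) dgs \<Rightarrow> (('p, 'p) tree \<Rightarrow>\<^sub>0 'k, 'p) gmap \<Rightarrow> ('k, 'p) gmap \<Rightarrow>
     ('k, 'a::ab_group_add) dgs \<Rightarrow> (('p, 'a) tree \<Rightarrow>\<^sub>0 'k, 'a) gmap \<Rightarrow> bool" where
  "palgebra P \<gamma> \<eta> A \<gamma>A \<longleftrightarrow>
     dg_module A \<and> dg_hom (circ P A) A \<gamma>A \<and>
     eq_on (circ P (circ P A))
       (\<gamma>A \<bullet>[0] comp_map P A 0 idm \<gamma>A)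
       (\<gamma>A \<bullet>[0] comp_map P A 0 \<gamma> idm \<bullet>[0] assoc P P A) \<and>
     eq_on A (\<gamma>A \<bullet>[0] iota P \<eta> A) idm"

definition qcoalgebra ::
    "('k::field_char_0, 'q::ab_group_add) dgs \<Rightarrow> ('q, ('q, 'q) tree \<Rightarrow>\<^sub>0 'k) gmap \<Rightarrow> ('q, 'k) gmap \<Rightarrow>
     ('k, 'c::ab_group_add) dgs \<Rightarrow> ('c, ('q, 'c) tree \<Rightarrow>\<^sub>0 'k) gmap \<Rightarrow> bool" where
  "qcoalgebra Q \<Delta> \<epsilon> C \<Delta>C \<longleftrightarrow>
     dg_module C \<and> dg_hom C (circ Q C) \<Delta>C \<and>
     eq_on C
       (assoc Q Q C \<bullet>[0] comp_map Q (circ Q C) 0 idm \<Delta>C \<bullet>[0] \<Delta>C)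
       (comp_map (circ Q Q) C 0 \<Delta> idm \<bullet>[0] \<Delta>C) \<and>
     eq_on C (comp_map unit_smod C 0 \<epsilon> idm \<bullet>[0] \<Delta>C) (lunit C)"

text \<open>
  \<open>P(P(A), P(A, N)) \<rightarrow> (P \<circ> P)(A, N)\<close>: both \<open>P(A)\<close> and \<open>P(A, N)\<close> are first mapped to
  \<open>P(A \<oplus> N)\<close>.
\<close>

definition lassoc ::
    "('k::field, 'p::ab_group_add) dgs \<Rightarrow> ('k, 'a::ab_group_add) dgs \<Rightarrow> ('k, 'n::ab_group_add) dgs \<Rightarrow>
     (('p, (('p, 'a) tree \<Rightarrow>\<^sub>0 'k) \<times> (('p, 'a \<times> 'n) tree \<Rightarrow>\<^sub>0 'k)) tree \<Rightarrow>\<^sub>0 'k,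
      (('p, 'p) tree \<Rightarrow>\<^sub>0 'k, 'a \<times> 'n) tree \<Rightarrow>\<^sub>0 'k) gmap" where
  "lassoc P A N = assoc P P (dsum A N) \<bullet>[0]
     comp_map P (circ P (dsum A N)) 0 idm (copair (comp_map P (dsum A N) 0 idm inlm) idm)"

text \<open>\<open>\<gamma> \<circ> (id, id)\<close> after \<open>lassoc\<close>, as a map \<open>P(P(A), P(A, N)) \<rightarrow> P(A, N)\<close>.\<close>

definition lmult ::
    "('k::field, 'p::ab_group_add) dgs \<Rightarrow> (('p, 'p) tree \<Rightarrow>\<^sub>0 'k, 'p) gmap \<Rightarrow>
     ('k, 'a::ab_group_add) dgs \<Rightarrow> ('k, 'n::ab_group_add) dgs \<Rightarrow>
     (('p, (('p, 'a) tree \<Rightarrow>\<^sub>0 'k) \<times> (('p, 'a \<times> 'n) tree \<Rightarrow>\<^sub>0 'k)) tree \<Rightarrow>\<^sub>0 'k,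
      ('p, 'a \<times> 'n) tree \<Rightarrow>\<^sub>0 'k) gmap" where
  "lmult P \<gamma> A N = comp_map P (dsum A N) 0 \<gamma> idm \<bullet>[0] lassoc P A N"

definition amodule ::
    "('k::field_char_0, 'p::ab_group_add) dgs \<Rightarrow> (('p, 'p) tree \<Rightarrow>\<^sub>0 'k, 'p) gmap \<Rightarrow> ('k, 'p) gmap \<Rightarrow>
     ('k, 'a::ab_group_add) dgs \<Rightarrow> (('p, 'a) tree \<Rightarrow>\<^sub>0 'k, 'a) gmap \<Rightarrow>
     ('k, 'm::ab_group_add) dgs \<Rightarrow> (('p, 'a \<times> 'm) tree \<Rightarrow>\<^sub>0 'k, 'm) gmap \<Rightarrow> bool" where
  "amodule P \<gamma> \<eta> A \<gamma>A M \<gamma>M \<longleftrightarrow>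
     dg_module M \<and> dg_hom (circ_lin P A M) M \<gamma>M \<and>
     eq_on (circ_lin P (circ P A) (circ_lin P A M))
       (\<gamma>M \<bullet>[0] lcomp_map P A M 0 idm (\<gamma>A \<bullet>[0] fstm) 0 (\<gamma>M \<bullet>[0] sndm))
       (\<gamma>M \<bullet>[0] lmult P \<gamma> A M) \<and>
     eq_on M (\<gamma>M \<bullet>[0] iota P \<eta> (dsum A M) \<bullet>[0] inrm) idm"

section \<open>The free A-module on a dg module\<close>

text \<open>
  \<open>A \<otimes>\<^sup>P N\<close> is the coequalizer of the maps \<open>P(P(A), N) \<rightarrow> P(A, N)\<close> given by \<open>\<gamma>\<close> (with
  \<open>N\<close> mapped to \<open>P(A, N)\<close> by the unit) and by \<open>\<gamma>A\<close>, that is, the quotient of \<open>P(A, N)\<close>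
  by \<open>tens_rel\<close>.
\<close>

definition tens_rel ::
    "('k::field, 'p::ab_group_add) dgs \<Rightarrow> (('p, 'p) tree \<Rightarrow>\<^sub>0 'k, 'p) gmap \<Rightarrow> ('k, 'p) gmap \<Rightarrow>
     ('k, 'a::ab_group_add) dgs \<Rightarrow> (('p, 'a) tree \<Rightarrow>\<^sub>0 'k, 'a) gmap \<Rightarrow> ('k, 'n::ab_group_add) dgs \<Rightarrow>
     nat \<Rightarrow> int \<Rightarrow> (('p, 'a \<times> 'n) tree \<Rightarrow>\<^sub>0 'k) set" where
  "tens_rel P \<gamma> \<eta> A \<gamma>A N n d = module.span psc
     ((\<lambda>x.
        (lmult P \<gamma> A N \<bullet>[0] lcomp_map P (circ P A) (circ_lin P A N) 0 idm fstm 0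
           (iota P \<eta> (dsum A N) \<bullet>[0] inrm \<bullet>[0] sndm)) n d x
        - lcomp_map P A N 0 idm (\<gamma>A \<bullet>[0] fstm) 0 sndm n d x)
      ` grd (circ_lin P (circ P A) N) n d)"

definition tens ::
    "('k::field, 'p::ab_group_add) dgs \<Rightarrow> (('p, 'p) tree \<Rightarrow>\<^sub>0 'k, 'p) gmap \<Rightarrow> ('k, 'p) gmap \<Rightarrow>
     ('k, 'a::ab_group_add) dgs \<Rightarrow> (('p, 'a) tree \<Rightarrow>\<^sub>0 'k, 'a) gmap \<Rightarrow> ('k, 'n::ab_group_add) dgs \<Rightarrow>
     ('k, ('p, 'a \<times> 'n) tree \<Rightarrow>\<^sub>0 'k) dgs" where
  "tens P \<gamma> \<eta> A \<gamma>A N = quotient (circ_lin P A N) (tens_rel P \<gamma> \<eta> A \<gamma>A N)"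

definition tens_proj ::
    "('k::field, 'p::ab_group_add) dgs \<Rightarrow> (('p, 'p) tree \<Rightarrow>\<^sub>0 'k, 'p) gmap \<Rightarrow> ('k, 'p) gmap \<Rightarrow>
     ('k, 'a::ab_group_add) dgs \<Rightarrow> (('p, 'a) tree \<Rightarrow>\<^sub>0 'k, 'a) gmap \<Rightarrow> ('k, 'n::ab_group_add) dgs \<Rightarrow>
     (('p, 'a \<times> 'n) tree \<Rightarrow>\<^sub>0 'k, ('p, 'a \<times> 'n) tree \<Rightarrow>\<^sub>0 'k) gmap" where
  "tens_proj P \<gamma> \<eta> A \<gamma>A N = (\<lambda>n d. qproj psc (tens_rel P \<gamma> \<eta> A \<gamma>A N n d))"

text \<open>
  The structure map \<open>P(A, A \<otimes>\<^sup>P N) \<rightarrow> A \<otimes>\<^sup>P N\<close> is induced by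
  \<open>P(A, P(A, N)) \<rightarrow> P(P(A), P(A, N)) \<rightarrow> P(A, N)\<close>. No lifting is needed, since the elements of
  \<open>A \<otimes>\<^sup>P N\<close> are representatives in \<open>P(A, N)\<close>.
\<close>

definition tens_act ::
    "('k::field, 'p::ab_group_add) dgs \<Rightarrow> (('p, 'p) tree \<Rightarrow>\<^sub>0 'k, 'p) gmap \<Rightarrow> ('k, 'p) gmap \<Rightarrow>
     ('k, 'a::ab_group_add) dgs \<Rightarrow> (('p, 'a) tree \<Rightarrow>\<^sub>0 'k, 'a) gmap \<Rightarrow> ('k, 'n::ab_group_add) dgs \<Rightarrow>
     (('p, 'a \<times> (('p, 'a \<times> 'n) tree \<Rightarrow>\<^sub>0 'k)) tree \<Rightarrow>\<^sub>0 'k, ('p, 'a \<times> 'n) tree \<Rightarrow>\<^sub>0 'k) gmap" where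
  "tens_act P \<gamma> \<eta> A \<gamma>A N =
     tens_proj P \<gamma> \<eta> A \<gamma>A N \<bullet>[0] lmult P \<gamma> A N \<bullet>[0]
     lcomp_map P (circ P A) (circ_lin P A N) 0 idm (iota P \<eta> A \<bullet>[0] fstm) 0 sndm"

text \<open>
  The map of graded A-modules \<open>A \<otimes>\<^sup>P N \<rightarrow> X\<close> whose restriction to \<open>N\<close> is the map \<open>g : N \<rightarrow> X\<close>
  of degree \<open>q\<close>, for an A-module \<open>X\<close> with structure map \<open>\<gamma>X\<close>.
\<close>

definition tens_ext ::
    "('k::field, 'p::ab_group_add) dgs \<Rightarrow> ('k, 'a::ab_group_add) dgs \<Rightarrow>
     ('k, 'x::ab_group_add) dgs \<Rightarrow> (('p, 'a \<times> 'x) tree \<Rightarrow>\<^sub>0 'k, 'x) gmap \<Rightarrow> int \<Rightarrow> ('n, 'x) gmap \<Rightarrow>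
     (('p, 'a \<times> 'n) tree \<Rightarrow>\<^sub>0 'k, 'x) gmap" where
  "tens_ext P A X \<gamma>X q g = \<gamma>X \<bullet>[q] lcomp_map P A X 0 idm fstm q (g \<bullet>[0] sndm)"

section \<open>Twisting morphisms and quasi-free resolutions\<close>

definition operadic_twisting ::
    "('k::field_char_0, 'q::ab_group_add) dgs \<Rightarrow> ('q, ('q, 'q) tree \<Rightarrow>\<^sub>0 'k) gmap \<Rightarrow> ('q, 'k) gmap \<Rightarrow>
     ('k, 'p::ab_group_add) dgs \<Rightarrow> (('p, 'p) tree \<Rightarrow>\<^sub>0 'k, 'p) gmap \<Rightarrow> ('k, 'p) gmap \<Rightarrow>
     ('q, 'p) gmap \<Rightarrow> bool" where
  "operadic_twisting Q \<Delta> \<epsilon> P \<gamma> \<eta> \<alpha> \<longleftrightarrow> ghom (-1) Q P \<alpha> \<and>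
     (\<forall>n d. \<forall>x\<in>grd Q n d.
        (dif P \<bullet>[-1] \<alpha>) n d x + (\<alpha> \<bullet>[-1] dif Q) n d x
        + (partial_comp P \<gamma> \<eta> \<bullet>[-2]
             lcomp_map P unit_smod P (-1) \<alpha> fstm (-1) (\<alpha> \<bullet>[0] sndm) \<bullet>[0]
             partial_decomp Q \<Delta> \<epsilon>) n d x = 0)"

definition algebraic_twisting ::
    "('k::field_char_0, 'p::ab_group_add) dgs \<Rightarrow> ('q, 'p) gmap \<Rightarrow>
     ('k, 'c::ab_group_add) dgs \<Rightarrow> ('c, ('q, 'c) tree \<Rightarrow>\<^sub>0 'k) gmap \<Rightarrow>
     ('k, 'a::ab_group_add) dgs \<Rightarrow> (('p, 'a) tree \<Rightarrow>\<^sub>0 'k, 'a) gmap \<Rightarrow> ('c, 'a) gmap \<Rightarrow> bool" where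
  "algebraic_twisting P \<alpha> C \<Delta>C A \<gamma>A \<phi> \<longleftrightarrow> ghom 0 C A \<phi> \<and>
     (\<forall>n d. \<forall>x\<in>grd C n d.
        (dif A \<bullet>[0] \<phi>) n d x - (\<phi> \<bullet>[-1] dif C) n d x
        + (\<gamma>A \<bullet>[-1] comp_map P A (-1) \<alpha> \<phi> \<bullet>[0] \<Delta>C) n d x = 0)"

definition delta_l ::
    "('k::field_char_0, 'p::ab_group_add) dgs \<Rightarrow> (('p, 'p) tree \<Rightarrow>\<^sub>0 'k, 'p) gmap \<Rightarrow> ('k, 'p) gmap \<Rightarrow>
     ('k, 'q::ab_group_add) dgs \<Rightarrow> ('q, 'p) gmap \<Rightarrow>
     ('k, 'c::ab_group_add) dgs \<Rightarrow> ('c, ('q, 'c) tree \<Rightarrow>\<^sub>0 'k) gmap \<Rightarrow>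
     (('p, 'c) tree \<Rightarrow>\<^sub>0 'k, ('p, 'c) tree \<Rightarrow>\<^sub>0 'k) gmap" where
  "delta_l P \<gamma> \<eta> Q \<alpha> C \<Delta>C =
     comp_map P C 0 \<gamma> idm \<bullet>[-1]
     assoc P P C \<bullet>[-1]
     comp_map P (circ P C) 0 idm (copair (iota P \<eta> C) idm) \<bullet>[-1]
     lcomp_map P C (circ P C) 0 idm fstm (-1) (comp_map P C (-1) \<alpha> idm \<bullet>[0] sndm) \<bullet>[0]
     lcomp_map P C (circ Q C) 0 idm idm 0 \<Delta>C"

definition quasi_free ::
    "('k::field_char_0, 'p::ab_group_add) dgs \<Rightarrow> (('p, 'p) tree \<Rightarrow>\<^sub>0 'k, 'p) gmap \<Rightarrow> ('k, 'p) gmap \<Rightarrow>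
     ('k, 'q::ab_group_add) dgs \<Rightarrow> ('q, 'p) gmap \<Rightarrow>
     ('k, 'c::ab_group_add) dgs \<Rightarrow> ('c, ('q, 'c) tree \<Rightarrow>\<^sub>0 'k) gmap \<Rightarrow> ('k, ('p, 'c) tree \<Rightarrow>\<^sub>0 'k) dgs" where
  "quasi_free P \<gamma> \<eta> Q \<alpha> C \<Delta>C = (circ P C)\<lparr>dif := (\<lambda>n d x.
     dif (circ P C) n d x - delta_l P \<gamma> \<eta> Q \<alpha> C \<Delta>C n d x)\<rparr>"

definition free_mult ::
    "('k::field_char_0, 'p::ab_group_add) dgs \<Rightarrow> (('p, 'p) tree \<Rightarrow>\<^sub>0 'k, 'p) gmap \<Rightarrow>
     ('k, 'c::ab_group_add) dgs \<Rightarrow>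
     (('p, ('p, 'c) tree \<Rightarrow>\<^sub>0 'k) tree \<Rightarrow>\<^sub>0 'k, ('p, 'c) tree \<Rightarrow>\<^sub>0 'k) gmap" where
  "free_mult P \<gamma> C = comp_map P C 0 \<gamma> idm \<bullet>[0] assoc P P C"

definition palgebra_hom ::
    "('k::field_char_0, 'p::ab_group_add) dgs \<Rightarrow> (('p, 'p) tree \<Rightarrow>\<^sub>0 'k, 'p) gmap \<Rightarrow> ('k, 'p) gmap \<Rightarrow>
     ('k, 'a::ab_group_add) dgs \<Rightarrow> (('p, 'a) tree \<Rightarrow>\<^sub>0 'k, 'a) gmap \<Rightarrow>
     ('k, 'b::ab_group_add) dgs \<Rightarrow> (('p, 'b) tree \<Rightarrow>\<^sub>0 'k, 'b) gmap \<Rightarrow> ('a, 'b) gmap \<Rightarrow> bool" where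
  "palgebra_hom P \<gamma> \<eta> A \<gamma>A B \<gamma>B f \<longleftrightarrow>
     palgebra P \<gamma> \<eta> A \<gamma>A \<and> palgebra P \<gamma> \<eta> B \<gamma>B \<and> dg_hom A B f \<and>
     eq_on (circ P A) (f \<bullet>[0] \<gamma>A) (\<gamma>B \<bullet>[0] comp_map P B 0 idm f)"

text \<open>
  The filtration is increasing and exhaustive; \<open>P(F\<^sub>p\<^sub>-\<^sub>1 C)\<close> is the span of the trees with leaves in
  \<open>F\<^sub>p\<^sub>-\<^sub>1 C\<close>.
\<close>

definition quasi_free_resolution ::
    "('k::field_char_0, 'p::ab_group_add) dgs \<Rightarrow> (('p, 'p) tree \<Rightarrow>\<^sub>0 'k, 'p) gmap \<Rightarrow> ('k, 'p) gmap \<Rightarrow>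
     ('k, 'q::ab_group_add) dgs \<Rightarrow> ('q, 'p) gmap \<Rightarrow>
     ('k, 'c::ab_group_add) dgs \<Rightarrow> ('c, ('q, 'c) tree \<Rightarrow>\<^sub>0 'k) gmap \<Rightarrow>
     ('k, 'a::ab_group_add) dgs \<Rightarrow> (('p, 'a) tree \<Rightarrow>\<^sub>0 'k, 'a) gmap \<Rightarrow>
     (('p, 'c) tree \<Rightarrow>\<^sub>0 'k, 'a) gmap \<Rightarrow> bool" where
  "quasi_free_resolution P \<gamma> \<eta> Q \<alpha> C \<Delta>C A \<gamma>A f \<longleftrightarrow>
     (\<exists>F :: int \<Rightarrow> nat \<Rightarrow> int \<Rightarrow> 'c set.
        (\<forall>p n d. module.subspace (scl C) (F p n d)) \<and>
        (\<forall>p q n d. p \<le> q \<longrightarrow> F p n d \<subseteq> F q n d) \<and>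
        (\<forall>n d. (\<Union>p. F p n d) = grd C n d) \<and>
        (\<forall>n d. F (-1) n d = {0}) \<and>
        (\<forall>p n d. \<forall>x\<in>F p n d.
           (delta_l P \<gamma> \<eta> Q \<alpha> C \<Delta>C \<bullet>[0] iota P \<eta> C) n d x
           \<in> module.span psc (cls P C n (d - 1) `
                {(r, xs). (r, xs) \<in> trees P C n (d - 1) \<and>
                          (\<forall>(s, e, y)\<in>set xs. y \<in> F (p - 1) (length s) e)}))) \<and>
     palgebra_hom P \<gamma> \<eta> (quasi_free P \<gamma> \<eta> Q \<alpha> C \<Delta>C) (free_mult P \<gamma> C) A \<gamma>A f \<and>
     quasi_iso (quasi_free P \<gamma> \<eta> Q \<alpha> C \<Delta>C) A f"

section \<open>The three complexes\<close>

text \<open>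
  Graded maps are compared on the components of their source only. So that equal maps are equal
  as functions, the elements of the complexes are required to vanish elsewhere.
\<close>

definition gmaps ::
    "int \<Rightarrow> ('k, 'v::ab_group_add) dgs \<Rightarrow> ('k, 'w::ab_group_add) dgs \<Rightarrow> ('v, 'w) gmap set" where
  "gmaps p V W = {f. ghom p V W f \<and> (\<forall>n d x. x \<notin> grd V n d \<longrightarrow> f n d x = 0)}"

definition map_complex ::
    "('k, 'v) dgs \<Rightarrow> ('k, 'w::ab_group_add) dgs \<Rightarrow> (int \<Rightarrow> ('v, 'w) gmap set) \<Rightarrow>
     (int \<Rightarrow> ('v, 'w) gmap \<Rightarrow> ('v, 'w) gmap) \<Rightarrow> ('k, ('v, 'w) gmap) dgs" where
  "map_complex V W S D =
     \<lparr>scl = (\<lambda>c f n d x. scl W c (f n d x)),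
      grd = (\<lambda>a p. if a = 0 then S p else {0}),
      dif = (\<lambda>a p f. if a = 0 then (\<lambda>n d x. if x \<in> grd V n d then D p f n d x else 0) else 0),
      act = (\<lambda>a p \<sigma> f. f)\<rparr>"

definition der_complex ::
    "('k::field_char_0, 'p::ab_group_add) dgs \<Rightarrow> ('k, 'a::ab_group_add) dgs \<Rightarrow>
     ('k, 'b::ab_group_add) dgs \<Rightarrow> (('p, 'b) tree \<Rightarrow>\<^sub>0 'k, 'b) gmap \<Rightarrow> ('b, 'a) gmap \<Rightarrow>
     ('k, 'm::ab_group_add) dgs \<Rightarrow> (('p, 'a \<times> 'm) tree \<Rightarrow>\<^sub>0 'k, 'm) gmap \<Rightarrow> ('k, ('b, 'm) gmap) dgs" where
  "der_complex P A B \<gamma>B f M \<gamma>M = map_complex B M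
     (\<lambda>p. {D \<in> gmaps p B M.
        eq_on (circ P B) (D \<bullet>[0] \<gamma>B)
          (\<gamma>M \<bullet>[p] lcomp_map P A M 0 idm (f \<bullet>[0] fstm) 0 sndm \<bullet>[p] lcomp_map P B M 0 idm idm p D)})
     (\<lambda>p D n d x. (dif M \<bullet>[p] D) n d x
        - scl M ((-1) powi p) ((D \<bullet>[-1] dif B) n d x))"

definition twisted_action ::
    "('k::field_char_0, 'p::ab_group_add) dgs \<Rightarrow> ('q, 'p) gmap \<Rightarrow> ('c, ('q, 'c) tree \<Rightarrow>\<^sub>0 'k) gmap \<Rightarrow>
     ('k, 'a::ab_group_add) dgs \<Rightarrow> ('c, 'a) gmap \<Rightarrow>
     ('k, 'm::ab_group_add) dgs \<Rightarrow> (('p, 'a \<times> 'm) tree \<Rightarrow>\<^sub>0 'k, 'm) gmap \<Rightarrow>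
     int \<Rightarrow> ('c, 'm) gmap \<Rightarrow> ('c, 'm) gmap" where
  "twisted_action P \<alpha> \<Delta>C A \<phi> M \<gamma>M p g =
     \<gamma>M \<bullet>[p - 1] lcomp_map P A M (-1) \<alpha> \<phi> p g \<bullet>[0] \<Delta>C"

definition hom_complex ::
    "('k::field_char_0, 'p::ab_group_add) dgs \<Rightarrow> ('q, 'p) gmap \<Rightarrow>
     ('k, 'c::ab_group_add) dgs \<Rightarrow> ('c, ('q, 'c) tree \<Rightarrow>\<^sub>0 'k) gmap \<Rightarrow>
     ('k, 'a::ab_group_add) dgs \<Rightarrow> ('c, 'a) gmap \<Rightarrow>
     ('k, 'm::ab_group_add) dgs \<Rightarrow> (('p, 'a \<times> 'm) tree \<Rightarrow>\<^sub>0 'k, 'm) gmap \<Rightarrow> ('k, ('c, 'm) gmap) dgs" where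
  "hom_complex P \<alpha> C \<Delta>C A \<phi> M \<gamma>M = map_complex C M
     (\<lambda>p. gmaps p C M)
     (\<lambda>p g n d x. (dif M \<bullet>[p] g) n d x - scl M ((-1) powi p) ((g \<bullet>[-1] dif C) n d x)
        + twisted_action P \<alpha> \<Delta>C A \<phi> M \<gamma>M p g n d x)"

definition delta_phi ::
    "('k::field_char_0, 'p::ab_group_add) dgs \<Rightarrow> (('p, 'p) tree \<Rightarrow>\<^sub>0 'k, 'p) gmap \<Rightarrow> ('k, 'p) gmap \<Rightarrow>
     ('q, 'p) gmap \<Rightarrow> ('k, 'c::ab_group_add) dgs \<Rightarrow> ('c, ('q, 'c) tree \<Rightarrow>\<^sub>0 'k) gmap \<Rightarrow>
     ('k, 'a::ab_group_add) dgs \<Rightarrow> (('p, 'a) tree \<Rightarrow>\<^sub>0 'k, 'a) gmap \<Rightarrow> ('c, 'a) gmap \<Rightarrow>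
     (('p, 'a \<times> 'c) tree \<Rightarrow>\<^sub>0 'k, ('p, 'a \<times> 'c) tree \<Rightarrow>\<^sub>0 'k) gmap" where
  "delta_phi P \<gamma> \<eta> \<alpha> C \<Delta>C A \<gamma>A \<phi> =
     tens_ext P A (tens P \<gamma> \<eta> A \<gamma>A C) (tens_act P \<gamma> \<eta> A \<gamma>A C) (-1)
       (tens_proj P \<gamma> \<eta> A \<gamma>A C \<bullet>[-1] lcomp_map P A C (-1) \<alpha> \<phi> 0 idm \<bullet>[0] \<Delta>C)"

definition module_hom_complex ::
    "('k::field_char_0, 'p::ab_group_add) dgs \<Rightarrow> (('p, 'p) tree \<Rightarrow>\<^sub>0 'k, 'p) gmap \<Rightarrow> ('k, 'p) gmap \<Rightarrow>
     ('q, 'p) gmap \<Rightarrow> ('k, 'c::ab_group_add) dgs \<Rightarrow> ('c, ('q, 'c) tree \<Rightarrow>\<^sub>0 'k) gmap \<Rightarrow>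
     ('k, 'a::ab_group_add) dgs \<Rightarrow> (('p, 'a) tree \<Rightarrow>\<^sub>0 'k, 'a) gmap \<Rightarrow> ('c, 'a) gmap \<Rightarrow>
     ('k, 'm::ab_group_add) dgs \<Rightarrow> (('p, 'a \<times> 'm) tree \<Rightarrow>\<^sub>0 'k, 'm) gmap \<Rightarrow>
     ('k, (('p, 'a \<times> 'c) tree \<Rightarrow>\<^sub>0 'k, 'm) gmap) dgs" where
  "module_hom_complex P \<gamma> \<eta> \<alpha> C \<Delta>C A \<gamma>A \<phi> M \<gamma>M =
     (let T = tens P \<gamma> \<eta> A \<gamma>A C in
      map_complex T M
        (\<lambda>p. {h \<in> gmaps p T M.
           eq_on (circ_lin P A T) (h \<bullet>[0] tens_act P \<gamma> \<eta> A \<gamma>A C)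
             (\<gamma>M \<bullet>[p] lcomp_map P A M 0 idm fstm p (h \<bullet>[0] sndm))})
        (\<lambda>p h n d x. (dif M \<bullet>[p] h) n d x
           - scl M ((-1) powi p)
               (h n (d - 1) (dif T n d x - delta_phi P \<gamma> \<eta> \<alpha> C \<Delta>C A \<gamma>A \<phi> n d x))))"

end

theory Submission
  imports Defs
begin

text \<open>
  A map \<open>g\<close> of degree \<open>p\<close> from \<open>C\<close> to \<open>M\<close> extends to the derivation \<open>\<gamma>M (id \<circ> (\<phi>, g))\<close> on \<open>P(C)\<close>
  and to the module map \<open>\<gamma>M (id \<circ> (id, g))\<close> on \<open>P(A, C)\<close>. That the first is a derivation, and that the
  second is linear and kills the relations of \<open>A \<otimes>\<^sup>P C\<close>, are instances of one identity: if a map \<open>T\<close> on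
  \<open>P(X)\<close> is built in this way from \<open>a : X \<rightarrow> A\<close> and \<open>b : X \<rightarrow> M\<close>, then \<open>T\<close> after the multiplication
  \<open>P(P(X)) \<rightarrow> P(X)\<close> is built from \<open>\<gamma>A P(a)\<close> and \<open>T\<close>. Conversely the unit axioms recover a derivation
  and, since the relations of \<open>A \<otimes>\<^sup>P C\<close> are stable under grafting, a module map from their
  values on \<open>C\<close>.
  Both differentials are compared on generators: the twisting terms \<open>\<delta>\<close> restrict to
  \<open>\<alpha> \<circ> id\<close> and \<open>\<alpha> \<circ> (\<phi>, id)\<close> after \<open>\<Delta>C\<close>, hence produce \<open>\<alpha>[\<phi>, g]\<close>. That \<open>\<partial>\<^sub>\<phi>\<close> squares to zero
  is inherited from the complex of derivations, where it follows from the differential of \<open>P \<circ>\<^sub>\<alpha> C\<close>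
  squaring to zero.
\<close>

text \<open>Elements of a composition product are representatives picked by \<open>qproj\<close>, of
  which only the class is known. A map given by \<open>lext\<close> therefore has a computable value
  only on classes of trees, and only once it is known to kill the relations. The hardest case is
  \<open>assoc\<close>: it expands the representatives that sit in the leaves, and its compatibility
  with permutations rests on Koszul signs of block permutations. Label lists of leaves become empty
  in arity zero, where algebras, modules and coalgebras live. Associativity of
  \<open>\<gamma>\<close> must nevertheless be used in every arity, because the upper levels of an
  arity-zero tree still have inputs. \<open>dg_iso\<close> requires both sides to be dg modules, and
  none of the three complexes is one by definition. This is proved for Hom(C, M) only; the other two
  receive subspaces, linearity and a square-zero differential through the bijections.\<close>

lemma lookup_psc [simp]: "Poly_Mapping.lookup (psc c u) g = c * Poly_Mapping.lookup u g"
  by (simp add: psc_def Poly_Mapping.map.rep_eq when_def)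

interpretation PM: vector_space "psc :: 'k::field \<Rightarrow> ('g \<Rightarrow>\<^sub>0 'k) \<Rightarrow> ('g \<Rightarrow>\<^sub>0 'k)"
  by unfold_locales (auto intro!: poly_mapping_eqI simp: lookup_add algebra_simps)

lemma psc_single [simp]: "psc c (Poly_Mapping.single g a) = Poly_Mapping.single g (c * a)"
  by (intro poly_mapping_eqI) (auto simp: lookup_single when_def)

lemma single_eq_psc: "Poly_Mapping.single g a = psc (a::'k::field) (Poly_Mapping.single g 1)"
  by simp

text \<open>Summing over a finite set that contains the support lets combinations with different
  supports be compared over one index set.\<close>

lemma lext_superset:
  fixes u :: "'g \<Rightarrow>\<^sub>0 'k::field"
  assumes "finite K" "Poly_Mapping.keys u \<subseteq> K"
  shows "lext F u = (\<Sum>g\<in>K. psc (Poly_Mapping.lookup u g) (F g))"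
  unfolding lext_def using assms
  by (intro sum.mono_neutral_left) (auto simp: in_keys_iff)

lemma lext_add: "lext F (u + v) = lext F u + lext F (v :: 'g \<Rightarrow>\<^sub>0 'k::field)"
proof -
  let ?K = "Poly_Mapping.keys u \<union> Poly_Mapping.keys v"
  have k: "Poly_Mapping.keys (u + v) \<subseteq> ?K" by (rule Poly_Mapping.keys_add)
  show ?thesis
    by (simp add: lext_superset[OF _ k] lext_superset[of ?K u] lext_superset[of ?K v] lookup_add
        PM.scale_left_distrib sum.distrib)
qed

lemma lext_psc: "lext F (psc c u) = psc c (lext F (u :: 'g \<Rightarrow>\<^sub>0 'k::field))"
proof -
  have k: "Poly_Mapping.keys (psc c u) \<subseteq> Poly_Mapping.keys u"
    by (auto simp: in_keys_iff)
  show ?thesis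
    by (simp add: lext_superset[OF _ k] lext_superset[of "Poly_Mapping.keys u" u] PM.scale_sum_right)
qed

lemma lext_single [simp]: "lext F (Poly_Mapping.single g c) = psc (c::'k::field) (F g)"
  by (subst lext_superset[of "{g}"]) auto

lemma lext_zero [simp]: "lext F (0 :: 'g \<Rightarrow>\<^sub>0 'k::field) = 0"
  by (simp add: lext_def)

lemma lext_uminus: "lext F (- u :: 'g \<Rightarrow>\<^sub>0 'k::field) = - lext F u"
  using lext_psc[of F "-1" u] by simp

lemma lext_diff: "lext F (u - v :: 'g \<Rightarrow>\<^sub>0 'k::field) = lext F u - lext F v"
  using lext_add[of F u "-v"] by (simp add: lext_uminus)

lemma lext_sum: "lext F (\<Sum>i\<in>I. u i :: 'g \<Rightarrow>\<^sub>0 'k::field) = (\<Sum>i\<in>I. lext F (u i))"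
  by (induction I rule: infinite_finite_induct) (auto simp: lext_add)

lemma lext_cong: "(\<And>g. g \<in> Poly_Mapping.keys u \<Longrightarrow> F g = G g) \<Longrightarrow> lext F u = lext G u"
  by (simp add: lext_def)

lemma lext_zero_fun [simp]: "lext (\<lambda>g. 0) (u :: 'g \<Rightarrow>\<^sub>0 'k::field) = 0"
  by (simp add: lext_def)

lemma poly_mapping_sum_single: "(u :: 'g \<Rightarrow>\<^sub>0 'k::field) = lext (\<lambda>g. Poly_Mapping.single g 1) u"
proof (rule poly_mapping_eqI)
  fix k
  have "(\<Sum>g\<in>Poly_Mapping.keys u. Poly_Mapping.lookup u g when g = k) = Poly_Mapping.lookup u k"
    by (simp add: when_def in_keys_iff sum.delta')
  thus "Poly_Mapping.lookup u k = Poly_Mapping.lookup (lext (\<lambda>g. Poly_Mapping.single g 1) u) k"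
    by (simp add: lext_def lookup_sum lookup_single)
qed

text \<open>Serves \<open>keys_circ\<close>: the associativity map runs over the support of each
  leaf, so the support has to consist of trees.\<close>

lemma keys_span_single:
  "(u :: 'g \<Rightarrow>\<^sub>0 'k::field) \<in> PM.span ((\<lambda>t. Poly_Mapping.single t 1) ` T) \<Longrightarrow> Poly_Mapping.keys u \<subseteq> T"
proof (induction rule: PM.span_induct_alt)
  case (step c x y)
  then obtain t where t: "t \<in> T" "x = Poly_Mapping.single t 1" by auto
  have "Poly_Mapping.keys (psc c x + y) \<subseteq> Poly_Mapping.keys (psc c x) \<union> Poly_Mapping.keys y"
    by (rule Poly_Mapping.keys_add)
  also have "\<dots> \<subseteq> T" using t step by (auto split: if_splits)
  finally show ?case .
qed simp

section \<open>Projections along subspaces, and graded modules\<close>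

lemma (in vector_space) qproj_props:
  assumes "subspace R"
  shows "Vector_Spaces.linear scale scale (qproj scale R)"
    and "x - qproj scale R x \<in> R"
    and "x \<in> R \<Longrightarrow> qproj scale R x = 0"
proof -
  interpret P: vector_space_pair scale scale ..
  obtain g where g: "range g \<subseteq> R" "Vector_Spaces.linear scale scale g" "\<forall>v\<in>R. g (id v) = v"
    using P.linear_exists_left_inverse_on[of id R] assms linear_id by auto
  \<comment> \<open>A left inverse \<open>g\<close> of the inclusion of \<open>R\<close> exists over
    a field, and \<open>x - g x\<close> is then a projection with kernel \<open>R\<close>; this
    justifies the choice made in \<open>qproj\<close>.\<close>
  have "\<exists>\<pi>. Vector_Spaces.linear scale scale \<pi> \<and> (\<forall>x. x - \<pi> x \<in> R) \<and> (\<forall>x\<in>R. \<pi> x = 0)"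
    using g by (intro exI[of _ "\<lambda>x. x - g x"] conjI P.linear_compose_sub)
      (auto simp: linear_ident)
  from someI_ex[OF this, folded qproj_def]
  show "Vector_Spaces.linear scale scale (qproj scale R)"
    and "x - qproj scale R x \<in> R"
    and "x \<in> R \<Longrightarrow> qproj scale R x = 0" by auto
qed

text \<open>The part of \<open>smodule\<close> without differential and action. For composition
  products it holds with no assumption on the factors, and it is enough for the calculus of
  classes.\<close>

definition gmod :: "('k::field, 'v::ab_group_add) dgs \<Rightarrow> bool" where
  "gmod V \<longleftrightarrow> vector_space (scl V) \<and> (\<forall>n d. module.subspace (scl V) (grd V n d))"

lemma gmodD:
  assumes "gmod V"
  shows "vector_space (scl V)" "module.subspace (scl V) (grd V n d)"
    "0 \<in> grd V n d" "x \<in> grd V n d \<Longrightarrow> y \<in> grd V n d \<Longrightarrow> x + y \<in> grd V n d"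
    "x \<in> grd V n d \<Longrightarrow> y \<in> grd V n d \<Longrightarrow> x - y \<in> grd V n d"
    "x \<in> grd V n d \<Longrightarrow> scl V c x \<in> grd V n d"
    "(\<And>i. i \<in> I \<Longrightarrow> h i \<in> grd V n d) \<Longrightarrow> sum h I \<in> grd V n d"
    "scl V 0 x = 0" "scl V c 0 = 0" "scl V 1 x = x"
    "scl V c (x + y) = scl V c x + scl V c y"
    "scl V c (x - y) = scl V c x - scl V c y"
    "scl V b (scl V c x) = scl V (b * c) x"
    "scl V (-1) x = - x" "scl V c (- x) = - scl V c x"
    "scl V c (sum h I) = (\<Sum>i\<in>I. scl V c (h i))"
proof -
  show v: "vector_space (scl V)" and s: "module.subspace (scl V) (grd V n d)" for n d
    using assms by (auto simp: gmod_def)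
  interpret vector_space "scl V" by fact
  note s = s[of n d]
  show "0 \<in> grd V n d" using s by (rule subspace_0)
  show "x \<in> grd V n d \<Longrightarrow> y \<in> grd V n d \<Longrightarrow> x + y \<in> grd V n d" using s by (rule subspace_add)
  show "x \<in> grd V n d \<Longrightarrow> y \<in> grd V n d \<Longrightarrow> x - y \<in> grd V n d" using s by (rule subspace_diff)
  show "x \<in> grd V n d \<Longrightarrow> scl V c x \<in> grd V n d" using s by (rule subspace_scale)
  show "(\<And>i. i \<in> I \<Longrightarrow> h i \<in> grd V n d) \<Longrightarrow> sum h I \<in> grd V n d" using s by (rule subspace_sum)
  show "scl V 0 x = 0" "scl V c 0 = 0" "scl V 1 x = x"
    "scl V c (x + y) = scl V c x + scl V c y" "scl V c (x - y) = scl V c x - scl V c y"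
    "scl V b (scl V c x) = scl V (b * c) x" "scl V (-1) x = - x" "scl V c (- x) = - scl V c x"
    "scl V c (sum h I) = (\<Sum>i\<in>I. scl V c (h i))"
    by (auto simp: scale_right_distrib scale_right_diff_distrib scale_sum_right)
qed

lemma glinearD:
  assumes "glinear p V W f" "x \<in> grd V n d"
  shows "f n d x \<in> grd W n (d + p)"
    "y \<in> grd V n d \<Longrightarrow> f n d (x + y) = f n d x + f n d y"
    "f n d (scl V c x) = scl W c (f n d x)"
  using assms by (auto simp: glinear_def)

lemma glinear_0:
  assumes "glinear p V W f" "gmod V"
  shows "f n d 0 = 0"
  using glinearD(2)[OF assms(1) gmodD(3)[OF assms(2)] gmodD(3)[OF assms(2)], of n d] by simp

lemma glinear_sum:
  assumes "glinear p V W f" "gmod V" "\<And>i. i \<in> I \<Longrightarrow> h i \<in> grd V n d"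
  shows "f n d (sum h I) = (\<Sum>i\<in>I. f n d (h i))"
  using assms(3)
proof (induction I rule: infinite_finite_induct)
  case (insert x F)
  then show ?case
    by (simp add: glinearD(2)[OF assms(1)] gmodD(7)[OF assms(2)])
qed (auto simp: glinear_0[OF assms(1,2)])

lemma glinear_diff:
  assumes "glinear p V W f" "gmod V" "gmod W" "x \<in> grd V n d" "y \<in> grd V n d"
  shows "f n d (x - y) = f n d x - f n d y"
proof -
  have "f n d (x + scl V (-1) y) = f n d x + scl W (-1) (f n d y)"
    using glinearD(2)[OF assms(1,4) gmodD(6)[OF assms(2,5)]] glinearD(3)[OF assms(1,5)] by simp
  thus ?thesis by (simp add: gmodD[OF assms(2)] gmodD[OF assms(3)])
qed

lemma glinear_gcomp:
  assumes "glinear p U V f" "glinear q V W g"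
  shows "glinear (p + q) U W (g \<bullet>[p] f)"
  using assms by (auto simp: glinear_def gcomp_def simp flip: add.assoc)

lemma glinear_idm: "glinear 0 V V idm"
  by (simp add: glinear_def idm_def)

lemma ghom_glinear: "ghom p V W f \<Longrightarrow> glinear p V W f"
  by (simp add: ghom_def)

lemma smodule_gmod: "smodule V \<Longrightarrow> gmod V"
  by (simp add: smodule_def gmod_def)

lemma scl_dsum [simp]: "scl (dsum V W) c = map_prod (scl V c) (scl W c)"
  and grd_dsum [simp]: "grd (dsum V W) n d = grd V n d \<times> grd W n d"
  and dif_dsum [simp]: "dif (dsum V W) n d = map_prod (dif V n d) (dif W n d)"
  and act_dsum [simp]: "act (dsum V W) n d \<sigma> = map_prod (act V n d \<sigma>) (act W n d \<sigma>)"
  by (simp_all add: dsum_def)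

lemma gmod_dsum:
  assumes "gmod V" "gmod W" shows "gmod (dsum V W)"
proof -
  interpret V: vector_space "scl V" using assms by (simp add: gmod_def)
  interpret W: vector_space "scl W" using assms by (simp add: gmod_def)
  have vs: "vector_space (scl (dsum V W))"
    by unfold_locales
      (auto simp: V.scale_right_distrib V.scale_left_distrib W.scale_right_distrib W.scale_left_distrib)
  then interpret vector_space "scl (dsum V W)" .
  show ?thesis unfolding gmod_def
  proof (intro conjI allI vs)
    fix n d
    show "subspace (grd (dsum V W) n d)"
      by (rule subspaceI) (auto simp: gmodD[OF assms(1)] gmodD[OF assms(2)] zero_prod_def)
  qed
qed

section \<open>Calculus of classes of trees\<close>

abbreviation edeg :: "nat list \<times> int \<times> 'x \<Rightarrow> int" where
  "edeg \<equiv> \<lambda>(s, e, x). e"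

abbreviation leaves0 :: "('k, 'n) dgs \<Rightarrow> (nat list \<times> int \<times> 'n) list \<Rightarrow> bool" where
  "leaves0 N xs \<equiv> \<forall>(s, e, x)\<in>set xs. s = [] \<and> x \<in> grd N 0 e"

lemma mem_trees:
  "((p, m), xs) \<in> trees M N n d \<longleftrightarrow> m \<in> grd M (length xs) p \<and>
     (\<forall>(s, e, x)\<in>set xs. x \<in> grd N (length s) e) \<and>
     distinct (concat (map fst xs)) \<and> set (concat (map fst xs)) = {..<n} \<and> p + degs xs = d"
  by (auto simp: trees_def)

lemma degs_simps [simp]:
  "degs [] = 0" "degs ((s, e, x) # xs) = e + degs xs" "degs (xs @ ys) = degs xs + degs ys"
  by (auto simp: degs_def)

lemma degs_map_fst: "degs xs = sum_list (map edeg xs)"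
  by (simp add: degs_def)

lemma degs_cong: "map edeg xs = map edeg ys \<Longrightarrow> degs xs = degs ys"
  by (simp add: degs_map_fst)

lemma degs_update:
  "l < length xs \<Longrightarrow> degs (xs[l := (s, e', x)]) = degs xs + e' - fst (snd (xs ! l))"
proof (induction xs arbitrary: l)
  case (Cons a xs)
  then show ?case by (cases l; cases a) auto
qed simp

lemma tree_update:
  assumes "((p, m), xs) \<in> trees M N n d" "l < length xs" "xs ! l = (s, e, y)"
    "x \<in> grd N (length s) e'"
  shows "((p, m), xs[l := (s, e', x)]) \<in> trees M N n (d + e' - e)"
proof -
  have "map fst (xs[l := (s, e', x)]) = map fst xs"
    using assms(2,3) by (metis fst_conv list_update_id map_update nth_map)
  moreover have "z \<in> grd N (length r) a" if "(r, a, z) \<in> set (xs[l := (s, e', x)])" for r a z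
  proof -
    have "(r, a, z) \<in> set xs \<or> (r, a, z) = (s, e', x)" using that set_update_subset_insert by fastforce
    thus ?thesis using assms by (auto simp: mem_trees)
  qed
  ultimately show ?thesis using assms by (auto simp: mem_trees degs_update)
qed

abbreviation sgl :: "'g \<Rightarrow> ('g \<Rightarrow>\<^sub>0 'k::field)" where
  "sgl t \<equiv> Poly_Mapping.single t 1"

lemma comp_rel_subspace: "PM.subspace (comp_rel M N n d)"
  by (simp add: comp_rel_def)

lemmas qproj_comp = PM.qproj_props[OF comp_rel_subspace]

lemma cls_rel:
  assumes "u \<in> comp_rels M N n d"
  shows "qproj psc (comp_rel M N n d) u = 0"
  using assms by (intro qproj_comp(3)) (simp add: comp_rel_def PM.span_base)

lemma qproj_comp_single:
  "qproj psc (comp_rel M N n d) (Poly_Mapping.single t c) = psc c (cls M N n d t)"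
proof -
  have "qproj psc (comp_rel M N n d) (psc c (sgl t)) = psc c (cls M N n d t)"
    unfolding cls_def by (rule module_hom.scale[OF Vector_Spaces.linear.axioms(3)[OF qproj_comp(1)]])
  thus ?thesis by simp
qed

lemma qproj_comp_diff:
  "qproj psc (comp_rel M N n d) (u - v) = qproj psc (comp_rel M N n d) u - qproj psc (comp_rel M N n d) v"
  by (rule module_hom.diff[OF Vector_Spaces.linear.axioms(3)[OF qproj_comp(1)]])

lemma qproj_comp_add:
  "qproj psc (comp_rel M N n d) (u + v) = qproj psc (comp_rel M N n d) u + qproj psc (comp_rel M N n d) v"
  by (rule module_hom.add[OF Vector_Spaces.linear.axioms(3)[OF qproj_comp(1)]])

lemmas qproj_cls = qproj_comp_add qproj_comp_diff qproj_comp_single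

text \<open>From here to \<open>cls_sym_leaf\<close> the six kinds of generating relations are
  turned into equations between classes, with a leaf addressed by its position in the list.\<close>

lemma cls_add_root:
  assumes "((p, m), xs) \<in> trees M N n d" "m' \<in> grd M (length xs) p"
  shows "cls M N n d ((p, m + m'), xs) = cls M N n d ((p, m), xs) + cls M N n d ((p, m'), xs)"
proof -
  have "((p, m'), xs) \<in> trees M N n d" using assms by (auto simp: mem_trees)
  from cls_rel[OF comp_rels.add_root[OF assms(1) this]] show ?thesis
    by (simp add: qproj_cls diff_diff_eq)
qed

lemma cls_scl_root:
  assumes "((p, m), xs) \<in> trees M N n d"
  shows "cls M N n d ((p, scl M c m), xs) = psc c (cls M N n d ((p, m), xs))"
  using cls_rel[OF comp_rels.scl_root[OF assms]] by (simp add: qproj_cls)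

lemma cls_add_leaf:
  assumes "((p, m), xs) \<in> trees M N n d" "l < length xs" "xs ! l = (s, e, y)"
    "x \<in> grd N (length s) e" "x' \<in> grd N (length s) e"
  shows "cls M N n d ((p, m), xs[l := (s, e, x + x')]) =
    cls M N n d ((p, m), xs[l := (s, e, x)]) + cls M N n d ((p, m), xs[l := (s, e, x')])"
proof -
  have e: "xs[l := v] = take l xs @ v # drop (Suc l) xs" for v
    using assms(2) by (rule upd_conv_take_nth_drop)
  have "((p, m), xs[l := (s, e, z)]) \<in> trees M N n d" if "z \<in> grd N (length s) e" for z
    using tree_update[OF assms(1-3) that] by simp
  note t = this[OF assms(4)] this[OF assms(5)]
  from cls_rel[OF comp_rels.add_leaf[OF t[unfolded e]]] show ?thesis
    by (simp add: e qproj_cls diff_diff_eq)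
qed

lemma cls_scl_leaf:
  assumes "((p, m), xs) \<in> trees M N n d" "l < length xs" "xs ! l = (s, e, y)"
    "x \<in> grd N (length s) e"
  shows "cls M N n d ((p, m), xs[l := (s, e, scl N c x)]) = psc c (cls M N n d ((p, m), xs[l := (s, e, x)]))"
proof -
  have e: "xs[l := v] = take l xs @ v # drop (Suc l) xs" for v
    using assms(2) by (rule upd_conv_take_nth_drop)
  have "((p, m), xs[l := (s, e, x)]) \<in> trees M N n d"
    using tree_update[OF assms(1-4)] by simp
  from cls_rel[OF comp_rels.scl_leaf[OF this[unfolded e]]] show ?thesis
    by (simp add: e qproj_cls)
qed

lemma cls_sym_root:
  assumes "((p, m), xs) \<in> trees M N n d" "\<sigma> permutes {..<length xs}"
  shows "cls M N n d ((p, act M (length xs) p \<sigma> m), permute_list \<sigma> xs) =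
    psc (koszul \<sigma> (map edeg xs)) (cls M N n d ((p, m), xs))"
  using cls_rel[OF comp_rels.sym_root[OF assms]] by (simp add: qproj_cls)

lemma cls_sym_leaf:
  assumes "((p, m), xs) \<in> trees M N n d" "l < length xs" "xs ! l = (s, e, x)"
    "\<sigma> permutes {..<length s}"
  shows "cls M N n d ((p, m), xs[l := (permute_list \<sigma> s, e, act N (length s) e \<sigma> x)]) =
    cls M N n d ((p, m), xs)"
proof -
  define us vs where "us = take l xs" and "vs = drop (Suc l) xs"
  have e: "xs[l := v] = us @ v # vs" for v
    unfolding us_def vs_def using assms(2) by (rule upd_conv_take_nth_drop)
  have x: "xs = us @ (s, e, x) # vs"
    unfolding us_def vs_def using assms(2,3) by (metis id_take_nth_drop)
  have "((p, m), us @ (s, e, x) # vs) \<in> trees M N n d" using assms(1) unfolding x .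
  from cls_rel[OF comp_rels.sym_leaf[OF this assms(4)]] show ?thesis
    unfolding e unfolding x by (simp add: qproj_cls)
qed

lemma cls_zero_leaf:
  assumes "((p, m), xs) \<in> trees M N n d" "l < length xs" "xs ! l = (s, e, y)" "gmod N"
  shows "cls M N n d ((p, m), xs[l := (s, e, 0)]) = 0"
  using cls_scl_leaf[OF assms(1-3), of 0 0] by (simp add: gmodD[OF assms(4)])

text \<open>The universal property of the composition product: a function on trees that respects the
  six kinds of relations descends to classes. Every map out of \<open>circ\<close> is shown to be
  well defined through it.\<close>

lemma lext_comp_rel:
  fixes F :: "('m::ab_group_add, 'n::ab_group_add) tree \<Rightarrow> ('h \<Rightarrow>\<^sub>0 'k::field)"
  assumes add_root: "\<And>p m m' xs. \<lbrakk>((p, m), xs) \<in> trees M N n d; ((p, m'), xs) \<in> trees M N n d\<rbrakk> \<Longrightarrow>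
      F ((p, m + m'), xs) = F ((p, m), xs) + F ((p, m'), xs)"
    and scl_root: "\<And>p m c xs. ((p, m), xs) \<in> trees M N n d \<Longrightarrow>
      F ((p, scl M c m), xs) = psc c (F ((p, m), xs))"
    and add_leaf: "\<And>p m xs l s e x x'. \<lbrakk>((p, m), xs) \<in> trees M N n d; l < length xs; xs ! l = (s, e, x);
      x \<in> grd N (length s) e; x' \<in> grd N (length s) e\<rbrakk> \<Longrightarrow>
      F ((p, m), xs[l := (s, e, x + x')]) = F ((p, m), xs) + F ((p, m), xs[l := (s, e, x')])"
    and scl_leaf: "\<And>p m xs l s e x c. \<lbrakk>((p, m), xs) \<in> trees M N n d; l < length xs; xs ! l = (s, e, x);
      x \<in> grd N (length s) e\<rbrakk> \<Longrightarrow>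
      F ((p, m), xs[l := (s, e, scl N c x)]) = psc c (F ((p, m), xs))"
    and sym_root: "\<And>p m xs \<sigma>. \<lbrakk>((p, m), xs) \<in> trees M N n d; \<sigma> permutes {..<length xs}\<rbrakk> \<Longrightarrow>
      F ((p, act M (length xs) p \<sigma> m), permute_list \<sigma> xs) =
      psc (koszul \<sigma> (map edeg xs)) (F ((p, m), xs))"
    and sym_leaf: "\<And>p m xs l s e x \<sigma>. \<lbrakk>((p, m), xs) \<in> trees M N n d; l < length xs; xs ! l = (s, e, x);
      x \<in> grd N (length s) e; \<sigma> permutes {..<length s}\<rbrakk> \<Longrightarrow>
      F ((p, m), xs[l := (permute_list \<sigma> s, e, act N (length s) e \<sigma> x)]) = F ((p, m), xs)"
  shows "u \<in> comp_rel M N n d \<Longrightarrow> lext F u = 0"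
proof -
  have *: "lext F u = 0" if "u \<in> comp_rels M N n d" for u
    using that
  proof cases
    case (add_root p m xs m')
    then show ?thesis using assms(1) by (simp add: lext_diff)
  next
    case (scl_root p m xs c)
    then show ?thesis using assms(2) by (simp add: lext_diff)
  next
    case (add_leaf r xs s e x ys x')
    obtain p m where r: "r = (p, m)" by (cases r)
    show ?thesis using add_leaf assms(3)[of p m "xs @ (s, e, x) # ys" "length xs" s e x x']
      by (auto simp add: lext_diff r mem_trees)
  next
    case (scl_leaf r xs s e x ys c)
    obtain p m where r: "r = (p, m)" by (cases r)
    show ?thesis using scl_leaf assms(4)[of p m "xs @ (s, e, x) # ys" "length xs" s e x c]
      by (auto simp add: lext_diff r mem_trees)
  next
    case (sym_root p m xs \<sigma>)
    then show ?thesis using assms(5)[of p m xs \<sigma>] by (simp add: lext_diff)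
  next
    case (sym_leaf r xs s e x ys \<sigma>)
    obtain p m where r: "r = (p, m)" by (cases r)
    show ?thesis using sym_leaf assms(6)[of p m "xs @ (s, e, x) # ys" "length xs" s e x \<sigma>]
      by (auto simp add: lext_diff r mem_trees)
  qed
  assume "u \<in> comp_rel M N n d"
  hence "u \<in> PM.span (comp_rels M N n d)" by (simp add: comp_rel_def)
  thus "lext F u = 0"
    by (induction rule: PM.span_induct_alt) (auto simp: lext_add lext_psc *)
qed

lemma lext_qproj:
  assumes "\<And>u. u \<in> comp_rel M N n d \<Longrightarrow> lext F u = 0"
  shows "lext F (qproj psc (comp_rel M N n d) v) = lext F v"
  using assms[OF qproj_comp(2)[of v]] by (simp add: lext_diff)

text \<open>The representative behind \<open>cls\<close> is unknown, but it differs from the tree by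
  a relation, which the map kills.\<close>

lemma lext_cls:
  assumes "\<And>u. u \<in> comp_rel M N n d \<Longrightarrow> lext F u = 0"
  shows "lext F (cls M N n d t) = F t"
proof -
  have "lext F (cls M N n d t) = lext F (sgl t)"
    unfolding cls_def by (rule lext_qproj) (rule assms)
  thus ?thesis by simp
qed

lemma grd_circ: "grd (circ M N) n d = PM.span (cls M N n d ` trees M N n d)"
proof -
  interpret L: Vector_Spaces.linear psc psc "qproj psc (comp_rel M N n d)" by (rule qproj_comp(1))
  have "grd (circ M N) n d = qproj psc (comp_rel M N n d) ` PM.span (sgl ` trees M N n d)"
    by (simp add: circ_def quotient_def free_comp_def)
  also have "\<dots> = PM.span (qproj psc (comp_rel M N n d) ` sgl ` trees M N n d)"
    by (simp add: L.span_image)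
  finally show ?thesis by (simp add: image_image cls_def)
qed

lemma scl_circ [simp]: "scl (circ M N) = psc"
  by (simp add: circ_def quotient_def free_comp_def)

lemma scl_circ_lin [simp]: "scl (circ_lin M N N') = psc"
  and dif_circ_lin [simp]: "dif (circ_lin M N N') = dif (circ M (dsum N N'))"
  and act_circ_lin [simp]: "act (circ_lin M N N') = act (circ M (dsum N N'))"
  and grd_circ_lin: "grd (circ_lin M N N') n d =
    PM.span (cls M (dsum N N') n d ` {t \<in> trees M (dsum N N') n d. lin_tree t})"
  by (simp_all add: circ_lin_def)

lemma gmod_circ: "gmod (circ M N)"
  by (simp add: gmod_def PM.vector_space_axioms grd_circ)

lemma gmod_circ_lin: "gmod (circ_lin M N N')"
  by (simp add: gmod_def PM.vector_space_axioms grd_circ_lin)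

lemma cls_in_circ: "t \<in> trees M N n d \<Longrightarrow> cls M N n d t \<in> grd (circ M N) n d"
  by (simp add: grd_circ PM.span_base)

lemma cls_in_circ_lin:
  "t \<in> trees M (dsum N N') n d \<Longrightarrow> lin_tree t \<Longrightarrow> cls M (dsum N N') n d t \<in> grd (circ_lin M N N') n d"
  by (simp add: grd_circ_lin PM.span_base)

lemma circ_lin_sub: "grd (circ_lin M N N') n d \<subseteq> grd (circ M (dsum N N')) n d"
  unfolding grd_circ_lin grd_circ by (rule PM.span_mono) auto

text \<open>Linearity is asked for on the span only, since graded maps such as
  \<open>\<gamma>M\<close> are linear on their components and arbitrary elsewhere. The same holds
  for \<open>span_map_eq\<close>.\<close>

lemma span_map_in:
  fixes f :: "('g \<Rightarrow>\<^sub>0 'k::field) \<Rightarrow> 'w::ab_group_add"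
  assumes "module.subspace s W" "vector_space s"
    and "\<And>x y. x \<in> PM.span G \<Longrightarrow> y \<in> PM.span G \<Longrightarrow> f (x + y) = f x + f y"
    and "\<And>c x. x \<in> PM.span G \<Longrightarrow> f (psc c x) = s c (f x)"
    and "\<And>x. x \<in> G \<Longrightarrow> f x \<in> W" "u \<in> PM.span G"
  shows "f u \<in> W"
proof -
  interpret vector_space s by fact
  have z: "f 0 = 0" using assms(3)[of 0 0] by (simp add: PM.span_zero)
  have "u \<in> PM.span G \<and> f u \<in> W"
    using assms(6)
  proof (induction rule: PM.span_induct_alt)
    case base thus ?case using subspace_0[OF assms(1)] by (simp add: z PM.span_zero)
  next
    case (step c x y)
    have "x \<in> PM.span G" using step by (simp add: PM.span_base)
    thus ?case using step assms
      by (auto simp: PM.span_add PM.span_scale subspace_add subspace_scale)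
  qed
  thus ?thesis ..
qed

lemma span_map_eq:
  fixes f g :: "('g \<Rightarrow>\<^sub>0 'k::field) \<Rightarrow> 'w::ab_group_add"
  assumes "\<And>x y. x \<in> PM.span G \<Longrightarrow> y \<in> PM.span G \<Longrightarrow> f (x + y) = f x + f y"
    and "\<And>c x. x \<in> PM.span G \<Longrightarrow> f (psc c x) = s c (f x)"
    and "\<And>x y. x \<in> PM.span G \<Longrightarrow> y \<in> PM.span G \<Longrightarrow> g (x + y) = g x + g y"
    and "\<And>c x. x \<in> PM.span G \<Longrightarrow> g (psc c x) = s c (g x)"
    and "\<And>x. x \<in> G \<Longrightarrow> f x = g x" "u \<in> PM.span G"
  shows "f u = g u"
proof -
  have z: "f 0 = 0" "g 0 = 0" using assms(1)[of 0 0] assms(3)[of 0 0] by (simp_all add: PM.span_zero)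
  have "u \<in> PM.span G \<and> f u = g u"
    using assms(6)
  proof (induction rule: PM.span_induct_alt)
    case base thus ?case by (simp add: z PM.span_zero)
  next
    case (step c x y)
    have "x \<in> PM.span G" using step by (simp add: PM.span_base)
    thus ?case using step assms by (auto simp: PM.span_add PM.span_scale)
  qed
  thus ?thesis ..
qed

lemma glinear_span_eq:
  assumes "glinear p V W f" "glinear p V W g" "scl V = psc" "grd V n d = PM.span G"
    and "\<And>x. x \<in> G \<Longrightarrow> f n d x = g n d x" "u \<in> grd V n d"
  shows "f n d u = g n d u"
proof (rule span_map_eq[where s = "scl W" and G = G])
  show "f n d (x + y) = f n d x + f n d y" "g n d (x + y) = g n d x + g n d y"
    if "x \<in> PM.span G" "y \<in> PM.span G" for x y
    using that assms(4) glinearD(2)[OF assms(1)] glinearD(2)[OF assms(2)] by auto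
  show "f n d (psc c x) = scl W c (f n d x)" "g n d (psc c x) = scl W c (g n d x)"
    if "x \<in> PM.span G" for x c
    using that assms(3,4) glinearD(3)[OF assms(1), of x n d c] glinearD(3)[OF assms(2), of x n d c] by auto
qed (use assms in auto)

lemma glinear_lextI:
  assumes "scl V = psc" "scl W = psc" "\<And>n d. grd V n d = PM.span (G n d)" "gmod W"
    "\<And>n d x. x \<in> G n d \<Longrightarrow> lext (F n d) x \<in> grd W n (d + p)"
  shows "glinear p V W (\<lambda>n d. lext (F n d))"
  unfolding glinear_def
proof (intro allI conjI ballI)
  fix n d x assume x: "x \<in> grd V n d"
  show "lext (F n d) x \<in> grd W n (d + p)"
    by (rule span_map_in[where s = psc and G = "G n d"])
      (use assms gmodD(1,2)[OF assms(4)] x in \<open>auto simp: lext_add lext_psc\<close>)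
qed (auto simp: assms lext_add lext_psc)

section \<open>Koszul signs\<close>

lemma powi_minus_one: "(-1 :: 'k::field) powi a = (if even a then 1 else -1)"
  by (simp add: power_int_minus_left)

lemma powi_m1_add: "(-1 :: 'k::field) powi (a + b) = (-1) powi a * (-1) powi b"
  by (simp add: powi_minus_one)

lemma powi_m1_sq: "(-1 :: 'k::field) powi a * (-1) powi a = 1"
  by (simp add: powi_minus_one)

lemma powi_m1_sum: "finite I \<Longrightarrow> (-1 :: 'k::field) powi (\<Sum>i\<in>I. h i) = (\<Prod>i\<in>I. (-1) powi (h i))"
  by (induction I rule: finite_induct) (auto simp: powi_m1_add)

text \<open>As a full double product, with factor 1 at pairs that are not inversions, the sign can
  be multiplied, transposed and reindexed factor by factor.\<close>

lemma koszul_alt: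
  "koszul \<sigma> ds = (\<Prod>i<length ds. \<Prod>j<length ds.
     if i < j \<and> \<sigma> j < \<sigma> i then (-1 :: 'k::field) powi (ds ! \<sigma> i * ds ! \<sigma> j) else 1)"
proof -
  let ?n = "length ds"
  have "koszul \<sigma> ds = (\<Prod>(i, j)\<in>{..<?n} \<times> {..<?n} \<inter> {(i, j). i < j \<and> \<sigma> j < \<sigma> i}.
      (-1 :: 'k) powi (ds ! \<sigma> i * ds ! \<sigma> j))"
    unfolding koszul_def by (rule prod.cong) auto
  also have "\<dots> = (\<Prod>z\<in>{..<?n} \<times> {..<?n}. if z \<in> {(i, j). i < j \<and> \<sigma> j < \<sigma> i} then
      (case z of (i, j) \<Rightarrow> (-1 :: 'k) powi (ds ! \<sigma> i * ds ! \<sigma> j)) else 1)"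
    by (rule prod.inter_restrict) auto
  also have "\<dots> = (\<Prod>(i, j)\<in>{..<?n} \<times> {..<?n}. if i < j \<and> \<sigma> j < \<sigma> i then
      (-1 :: 'k) powi (ds ! \<sigma> i * ds ! \<sigma> j) else 1)"
    by (intro prod.cong refl) (auto split: if_splits)
  finally show ?thesis by (simp add: prod.cartesian_product)
qed

text \<open>Raising one degree by \<open>q\<close> changes the Koszul sign by
  \<open>(-1) powi (q * e)\<close> for each entry of degree \<open>e\<close> that forms an inversion
  with it. These are exactly the entries lying to its left in one of the two orders but not in the
  other, which is the difference of the two prefix signs.\<close>

lemma koszul_shift:
  assumes \<sigma>: "\<sigma> permutes {..<length es}" and j: "j < length es"
  shows "(-1) powi (q * (\<Sum>i<j. es ! \<sigma> i)) * koszul \<sigma> (es[\<sigma> j := es ! \<sigma> j + q]) =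
    (-1) powi (q * (\<Sum>i<\<sigma> j. es ! i)) * (koszul \<sigma> es :: 'k::field)"
proof -
  let ?n = "length es"
  define t :: "nat \<Rightarrow> 'k" where "t = (\<lambda>i. (-1) powi (q * es ! \<sigma> i))"
  define c where "c = (\<lambda>i i'. i < i' \<and> \<sigma> i' < \<sigma> i)"
  have \<sigma>lt: "\<sigma> i < ?n" if "i < ?n" for i using permutes_in_image[OF \<sigma>] that by auto
  have inj: "\<sigma> i = \<sigma> i' \<longleftrightarrow> i = i'" for i i' using permutes_inj[OF \<sigma>] by (auto simp: inj_def)
  have tt: "t i * t i = 1" for i by (simp add: t_def powi_m1_sq)
  have "koszul \<sigma> (es[\<sigma> j := es ! \<sigma> j + q]) = (\<Prod>i<?n. \<Prod>i'<?n.
      if c i i' then (-1 :: 'k) powi (es ! \<sigma> i * es ! \<sigma> i')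
          * (if i = j then t i' else 1) * (if i' = j then t i else 1) else 1)"
    unfolding koszul_alt c_def length_list_update
    by (intro prod.cong refl)
      (auto simp: nth_list_update \<sigma>lt inj j t_def powi_m1_add[symmetric] algebra_simps)
  also have "\<dots> = (\<Prod>i<?n. \<Prod>i'<?n. (if c i i' then (-1 :: 'k) powi (es ! \<sigma> i * es ! \<sigma> i') else 1)
      * (if i = j then if c j i' then t i' else 1 else 1) * (if i' = j then if c i j then t i else 1 else 1))"
    by (intro prod.cong refl) auto
  also have "\<dots> = koszul \<sigma> es * (\<Prod>i<?n. if i = j then \<Prod>i'<?n. if c j i' then t i' else 1 else 1)
      * (\<Prod>i<?n. if c i j then t i else 1)"
  proof -
    have 1: "(\<Prod>i'<?n. if i = j then if c j i' then t i' else 1 else 1) =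
        (if i = j then \<Prod>i'<?n. if c j i' then t i' else 1 else 1)" for i by simp
    have 2: "(\<Prod>i'<?n. if i' = j then if c i j then t i else 1 else 1) = (if c i j then t i else 1)" for i
      using j by simp
    show ?thesis unfolding prod.distrib 1 2 by (simp add: koszul_alt c_def)
  qed
  also have "\<dots> = koszul \<sigma> es * (\<Prod>i<?n. (if c j i then t i else 1) * (if c i j then t i else 1))"
    using j by (simp add: prod.distrib mult.assoc)
  finally have k: "koszul \<sigma> (es[\<sigma> j := es ! \<sigma> j + q]) =
      koszul \<sigma> es * (\<Prod>i<?n. (if c j i then t i else 1) * (if c i j then t i else 1))" .
  have l: "(-1 :: 'k) powi (q * (\<Sum>i<j. es ! \<sigma> i)) = (\<Prod>i<?n. if i < j then t i else 1)"
  proof -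
    have "(\<Prod>i<?n. if i < j then t i else 1) = (\<Prod>i\<in>{..<?n} \<inter> {i. i < j}. t i)"
      by (subst prod.inter_restrict) auto
    also have "{..<?n} \<inter> {i. i < j} = {..<j}" using j by auto
    finally show ?thesis by (simp add: sum_distrib_left powi_m1_sum t_def)
  qed
  have r: "(-1 :: 'k) powi (q * (\<Sum>i<\<sigma> j. es ! i)) = (\<Prod>i<?n. if \<sigma> i < \<sigma> j then t i else 1)"
  proof -
    have "(\<Prod>i<?n. if \<sigma> i < \<sigma> j then t i else 1) =
        (\<Prod>i<?n. if i < \<sigma> j then (-1 :: 'k) powi (q * es ! i) else 1)"
      unfolding t_def
      by (rule prod.reindex_bij_betw[OF permutes_imp_bij[OF \<sigma>],
            of "\<lambda>i. if i < \<sigma> j then (-1 :: 'k) powi (q * es ! i) else 1"])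
    also have "\<dots> = (\<Prod>i\<in>{..<?n} \<inter> {i. i < \<sigma> j}. (-1 :: 'k) powi (q * es ! i))"
      by (subst prod.inter_restrict) auto
    also have "{..<?n} \<inter> {i. i < \<sigma> j} = {..<\<sigma> j}" using \<sigma>lt[OF j] by auto
    finally show ?thesis by (simp add: sum_distrib_left powi_m1_sum)
  qed
  have "(\<Prod>i<?n. if i < j then t i else 1) * (\<Prod>i<?n. (if c j i then t i else 1) * (if c i j then t i else 1))
      = (\<Prod>i<?n. if \<sigma> i < \<sigma> j then t i else 1)"
    unfolding prod.distrib[symmetric]
  proof (intro prod.cong refl)
    fix i
    have "\<sigma> i = \<sigma> j \<longleftrightarrow> i = j" by (rule inj)
    thus "(if i < j then t i else 1) * ((if c j i then t i else 1) * (if c i j then t i else 1)) =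
        (if \<sigma> i < \<sigma> j then t i else 1)"
      by (cases i j rule: linorder_cases) (auto simp: c_def tt)
  qed
  thus ?thesis unfolding k l r by (simp add: mult.left_commute)
qed

section \<open>Maps between composition products\<close>

text \<open>The leaf maps may depend on the position, so that \<open>comp_map\<close> (all equal)
  and the summands of \<open>lcomp_map\<close> (one exceptional position) are both instances. Signs
  are kept apart, in \<open>lsign\<close>.\<close>

definition gleaves :: "(nat \<Rightarrow> ('n, 'l) gmap) \<Rightarrow> (nat \<Rightarrow> int) \<Rightarrow>
    (nat list \<times> int \<times> 'n) list \<Rightarrow> (nat list \<times> int \<times> 'l) list" where
  "gleaves h \<delta> xs = map (\<lambda>i. case xs ! i of (s, e, x) \<Rightarrow> (s, e + \<delta> i, h i (length s) e x)) [0..<length xs]"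

definition gtree :: "int \<Rightarrow> ('m, 'p) gmap \<Rightarrow> (nat \<Rightarrow> ('n, 'l) gmap) \<Rightarrow> (nat \<Rightarrow> int) \<Rightarrow>
    ('m, 'n) tree \<Rightarrow> ('p, 'l) tree" where
  "gtree r f h \<delta> = (\<lambda>((p, m), xs). ((p + r, f (length xs) p m), gleaves h \<delta> xs))"

lemma length_gleaves [simp]: "length (gleaves h \<delta> xs) = length xs"
  by (simp add: gleaves_def)

lemma nth_gleaves:
  "i < length xs \<Longrightarrow> gleaves h \<delta> xs ! i = (case xs ! i of (s, e, x) \<Rightarrow> (s, e + \<delta> i, h i (length s) e x))"
  by (simp add: gleaves_def)

lemma fst_gleaves [simp]: "map fst (gleaves h \<delta> xs) = map fst xs"
  by (intro nth_equalityI) (auto simp: nth_gleaves split: prod.split)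

lemma degs_nth: "degs xs = (\<Sum>i<length xs. fst (snd (xs ! i)))"
proof -
  have "degs xs = sum_list (map (\<lambda>x. fst (snd x)) xs)"
    unfolding degs_def by (rule arg_cong[of _ _ sum_list]) auto
  thus ?thesis by (simp add: sum_list_sum_nth atLeast0LessThan)
qed

lemma degs_take: "j \<le> length xs \<Longrightarrow> degs (take j xs) = (\<Sum>i<j. fst (snd (xs ! i)))"
  by (simp add: degs_nth min_def)

lemma degs_gleaves: "degs (gleaves h \<delta> xs) = degs xs + (\<Sum>i<length xs. \<delta> i)"
  by (simp add: degs_nth nth_gleaves split_beta sum.distrib)

lemma gleaves_update:
  "l < length xs \<Longrightarrow> gleaves h \<delta> (xs[l := (s, e, x)]) = (gleaves h \<delta> xs)[l := (s, e + \<delta> l, h l (length s) e x)]"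
  by (intro nth_equalityI) (auto simp: nth_gleaves nth_list_update split: prod.split)

lemma gleaves_permute:
  assumes "\<sigma> permutes {..<length xs}"
    and "\<And>i. i < length xs \<Longrightarrow> h' (\<sigma> i) = h i \<and> \<delta>' (\<sigma> i) = \<delta> i"
  shows "gleaves h \<delta> (permute_list \<sigma> xs) = permute_list \<sigma> (gleaves h' \<delta>' xs)"
proof (rule nth_equalityI)
  fix i assume i: "i < length (gleaves h \<delta> (permute_list \<sigma> xs))"
  have "\<sigma> i < length xs" using i permutes_in_image[OF assms(1)] by auto
  thus "gleaves h \<delta> (permute_list \<sigma> xs) ! i = permute_list \<sigma> (gleaves h' \<delta>' xs) ! i"
    using i assms by (simp add: nth_gleaves permute_list_nth)
qed simp

lemma mem_trees_nth:
  "((p, m), xs) \<in> trees M N n d \<longleftrightarrow> m \<in> grd M (length xs) p \<and>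
     (\<forall>i<length xs. snd (snd (xs ! i)) \<in> grd N (length (fst (xs ! i))) (fst (snd (xs ! i)))) \<and>
     distinct (concat (map fst xs)) \<and> set (concat (map fst xs)) = {..<n} \<and> p + degs xs = d"
  unfolding mem_trees by (auto simp: all_set_conv_all_nth split_beta)

lemma gtree_trees:
  assumes "((p, m), xs) \<in> trees M N n d" "glinear r M M' f"
    "\<And>i. i < length xs \<Longrightarrow> glinear (\<delta> i) N N' (h i)"
  shows "gtree r f h \<delta> ((p, m), xs) \<in> trees M' N' n (d + r + (\<Sum>i<length xs. \<delta> i))"
  using assms by (auto simp: gtree_def mem_trees_nth nth_gleaves split_beta degs_gleaves glinear_def)

lemma gtree_update:
  assumes "((p, m), xs) \<in> trees M N n d" "glinear r M M' f" "l < length xs" "xs ! l = (s, e, x)"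
    "\<And>i. i < length xs \<Longrightarrow> glinear (\<delta> i) N N' (h i)"
    "d' = d + r + (\<Sum>i<length xs. \<delta> i)"
    "x' \<in> grd N (length s) e"
  shows "cls M' N' n d' (gtree r f h \<delta> ((p, m), xs[l := (s, e, x + x')])) =
      cls M' N' n d' (gtree r f h \<delta> ((p, m), xs)) + cls M' N' n d' (gtree r f h \<delta> ((p, m), xs[l := (s, e, x')]))" (is ?g1)
    "cls M' N' n d' (gtree r f h \<delta> ((p, m), xs[l := (s, e, scl N c x)])) =
      psc c (cls M' N' n d' (gtree r f h \<delta> ((p, m), xs)))" (is ?g2)
proof -
  have x: "x \<in> grd N (length s) e" using assms(1,3,4) by (auto simp: mem_trees_nth)
  note t = gtree_trees[where h = h and \<delta> = \<delta>, OF assms(1,2,5), folded assms(6), unfolded gtree_def, simplified]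
  have n: "gleaves h \<delta> xs ! l = (s, e + \<delta> l, h l (length s) e x)" using assms by (simp add: nth_gleaves)
  have h: "h l (length s) e z \<in> grd N' (length s) (e + \<delta> l)" if "z \<in> grd N (length s) e" for z
    using glinearD(1)[OF assms(5) that] assms(3) by simp
  have u: "(gleaves h \<delta> xs)[l := (s, e + \<delta> l, h l (length s) e x)] = gleaves h \<delta> xs"
    using n by (metis list_update_id)
  have a: "h l (length s) e (x + x') = h l (length s) e x + h l (length s) e x'"
    "h l (length s) e (scl N c x) = scl N' c (h l (length s) e x)"
    using glinearD[OF assms(5)] assms(3,7) x by auto
  show ?g1
    using cls_add_leaf[OF t, of l s "e + \<delta> l"] assms(3) n h[OF x] h[OF assms(7)]
    by (simp add: gtree_def gleaves_update a u)
  show ?g2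
    using cls_scl_leaf[OF t, of l s "e + \<delta> l"] assms(3) n h[OF x]
    by (simp add: gtree_def gleaves_update a u)
qed

lemma gtree_sym_leaf:
  assumes "((p, m), xs) \<in> trees M N n d" "glinear r M M' f" "l < length xs" "xs ! l = (s, e, x)"
    "\<And>i. i < length xs \<Longrightarrow> ghom (\<delta> i) N N' (h i)"
    "d' = d + r + (\<Sum>i<length xs. \<delta> i)" "\<sigma> permutes {..<length s}"
  shows "cls M' N' n d' (gtree r f h \<delta> ((p, m), xs[l := (permute_list \<sigma> s, e, act N (length s) e \<sigma> x)])) =
      cls M' N' n d' (gtree r f h \<delta> ((p, m), xs))"
proof -
  have x: "x \<in> grd N (length s) e" using assms(1,3,4) by (auto simp: mem_trees_nth)
  note t = gtree_trees[where h = h and \<delta> = \<delta>, OF assms(1,2) ghom_glinear[OF assms(5)], folded assms(6), unfolded gtree_def, simplified]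
  have n: "gleaves h \<delta> xs ! l = (s, e + \<delta> l, h l (length s) e x)" using assms by (simp add: nth_gleaves)
  have a: "h l (length s) e (act N (length s) e \<sigma> x) = act N' (length s) (e + \<delta> l) \<sigma> (h l (length s) e x)"
    using assms(5)[OF assms(3)] assms(7) x by (auto simp: ghom_def)
  show ?thesis
    using cls_sym_leaf[OF t, of l s "e + \<delta> l"] assms(3,7) n
    by (simp add: gtree_def gleaves_update a)
qed

lemma gtree_root:
  assumes "((p, m), xs) \<in> trees M N n d" "glinear r M M' f"
    "\<And>i. i < length xs \<Longrightarrow> glinear (\<delta> i) N N' (h i)"
    "d' = d + r + (\<Sum>i<length xs. \<delta> i)" "m' \<in> grd M (length xs) p"
  shows "cls M' N' n d' (gtree r f h \<delta> ((p, m + m'), xs)) =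
      cls M' N' n d' (gtree r f h \<delta> ((p, m), xs)) + cls M' N' n d' (gtree r f h \<delta> ((p, m'), xs))" (is ?g1)
    "cls M' N' n d' (gtree r f h \<delta> ((p, scl M c m), xs)) = psc c (cls M' N' n d' (gtree r f h \<delta> ((p, m), xs)))" (is ?g2)
proof -
  have m: "m \<in> grd M (length xs) p" using assms(1) by (auto simp: mem_trees)
  note t = gtree_trees[where h = h and \<delta> = \<delta>, OF assms(1,2,3), folded assms(4), unfolded gtree_def, simplified]
  show ?g1
    using cls_add_root[OF t, of "f (length xs) p m'"] glinearD[OF assms(2)] m assms(5)
    by (simp add: gtree_def)
  show ?g2
    using cls_scl_root[OF t] glinearD[OF assms(2)] m
    by (simp add: gtree_def)
qed

text \<open>The leaf maps travel with the leaves, and the sign that comes out is that of the shifted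
  degrees; \<open>lext_esum\<close> converts it to the sign of the original degrees.\<close>

lemma gtree_sym_root:
  assumes "((p, m), xs) \<in> trees M N n d" "ghom r M M' f"
    "\<And>i. i < length xs \<Longrightarrow> glinear (\<delta>' i) N N' (h' i)"
    "d' = d + r + (\<Sum>i<length xs. \<delta>' i)" "\<sigma> permutes {..<length xs}"
    "\<And>i. i < length xs \<Longrightarrow> h' (\<sigma> i) = h i \<and> \<delta>' (\<sigma> i) = \<delta> i"
  shows "cls M' N' n d' (gtree r f h \<delta> ((p, act M (length xs) p \<sigma> m), permute_list \<sigma> xs)) =
      psc (koszul \<sigma> (map edeg (gleaves h' \<delta>' xs))) (cls M' N' n d' (gtree r f h' \<delta>' ((p, m), xs)))"
proof -
  have m: "m \<in> grd M (length xs) p" using assms(1) by (auto simp: mem_trees)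
  note t = gtree_trees[where h = h' and \<delta> = \<delta>', OF assms(1) ghom_glinear[OF assms(2)] assms(3), folded assms(4), unfolded gtree_def, simplified]
  show ?thesis
    using cls_sym_root[OF t, of \<sigma>] assms(2,5) m
    by (simp add: gtree_def ghom_def gleaves_permute[where h' = h' and \<delta>' = \<delta>', OF assms(5) assms(6)])
qed

definition ctree :: "int \<Rightarrow> ('m, 'p) gmap \<Rightarrow> ('n, 'l) gmap \<Rightarrow> ('m, 'n) tree \<Rightarrow> ('p, 'l) tree" where
  "ctree r f g = gtree r f (\<lambda>i. g) (\<lambda>i. 0)"

lemma ctree_eq:
  "ctree r f g ((p, m), xs) = ((p + r, f (length xs) p m), map (\<lambda>(s, e, x). (s, e, g (length s) e x)) xs)"
proof -
  have "gleaves (\<lambda>i. g) (\<lambda>i. 0) xs = map (\<lambda>(s, e, x). (s, e, g (length s) e x)) xs"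
    by (intro nth_equalityI) (auto simp: nth_gleaves)
  thus ?thesis by (simp add: ctree_def gtree_def)
qed

lemma comp_map_alt: "comp_map M' N' r f g = (\<lambda>n d. lext (\<lambda>t. cls M' N' n (d + r) (ctree r f g t)))"
  unfolding comp_map_def by (intro ext arg_cong2[of _ _ _ _ lext] refl) (auto simp: ctree_eq)

lemma ctree_trees:
  assumes "t \<in> trees M N n d" "glinear r M M' f" "glinear 0 N N' g"
  shows "ctree r f g t \<in> trees M' N' n (d + r)"
proof -
  obtain p m xs where t: "t = ((p, m), xs)" by (cases t) auto
  show ?thesis using gtree_trees[OF assms(1)[unfolded t] assms(2), of "\<lambda>i. 0" N' "\<lambda>i. g"] assms(3)
    by (simp add: ctree_def t)
qed

lemma lext_ctree:
  assumes "ghom r M M' f" "ghom 0 N N' g" "u \<in> comp_rel M N n d"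
  shows "lext (\<lambda>t. cls M' N' n (d + r) (ctree r f g t)) u = 0"
proof (rule lext_comp_rel[OF _ _ _ _ _ _ assms(3)])
  note f = ghom_glinear[OF assms(1)] and g = ghom_glinear[OF assms(2)]
  have d: "d + r = d + r + (\<Sum>i<k. 0)" for k :: nat by simp
  show "cls M' N' n (d + r) (ctree r f g ((p, m + m'), xs)) = cls M' N' n (d + r) (ctree r f g ((p, m), xs))
      + cls M' N' n (d + r) (ctree r f g ((p, m'), xs))"
    if "((p, m), xs) \<in> trees M N n d" "((p, m'), xs) \<in> trees M N n d" for p m m' xs
    unfolding ctree_def using that gtree_root(1)[OF that(1) f _ d, where N' = N' and h = "\<lambda>i. g" and m' = m'] g
    by (auto simp: mem_trees)
  show "cls M' N' n (d + r) (ctree r f g ((p, scl M c m), xs)) = psc c (cls M' N' n (d + r) (ctree r f g ((p, m), xs)))"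
    if "((p, m), xs) \<in> trees M N n d" for p m c xs
    unfolding ctree_def using that gtree_root(2)[OF that(1) f _ d, where N' = N' and h = "\<lambda>i. g" and m' = m] g
    by (auto simp: mem_trees)
  show "cls M' N' n (d + r) (ctree r f g ((p, m), xs[l := (s, e, x + x')])) =
      cls M' N' n (d + r) (ctree r f g ((p, m), xs)) + cls M' N' n (d + r) (ctree r f g ((p, m), xs[l := (s, e, x')]))"
    if "((p, m), xs) \<in> trees M N n d" "l < length xs" "xs ! l = (s, e, x)" "x \<in> grd N (length s) e"
      "x' \<in> grd N (length s) e" for p m xs l s e x x'
    unfolding ctree_def using gtree_update(1)[OF that(1) f that(2,3) _ d that(5), where N' = N' and h = "\<lambda>i. g"] g by auto
  show "cls M' N' n (d + r) (ctree r f g ((p, m), xs[l := (s, e, scl N c x)])) =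
      psc c (cls M' N' n (d + r) (ctree r f g ((p, m), xs)))"
    if "((p, m), xs) \<in> trees M N n d" "l < length xs" "xs ! l = (s, e, x)" "x \<in> grd N (length s) e"
    for p m xs l s e x c
    unfolding ctree_def using gtree_update(2)[OF that(1) f that(2,3) _ d that(4), where N' = N' and h = "\<lambda>i. g"] g by auto
  show "cls M' N' n (d + r) (ctree r f g ((p, act M (length xs) p \<sigma> m), permute_list \<sigma> xs)) =
      psc (koszul \<sigma> (map edeg xs)) (cls M' N' n (d + r) (ctree r f g ((p, m), xs)))"
    if "((p, m), xs) \<in> trees M N n d" "\<sigma> permutes {..<length xs}" for p m xs \<sigma>
  proof -
    have "map edeg (gleaves (\<lambda>i. g) (\<lambda>i. 0) xs) = map edeg xs"
      by (intro nth_equalityI) (auto simp: nth_gleaves split_beta)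
    thus ?thesis
      unfolding ctree_def using gtree_sym_root[OF that(1) assms(1) _ d that(2), where N' = N' and h' = "\<lambda>i. g" and h = "\<lambda>i. g"] g by auto
  qed
  show "cls M' N' n (d + r) (ctree r f g ((p, m), xs[l := (permute_list \<sigma> s, e, act N (length s) e \<sigma> x)])) =
      cls M' N' n (d + r) (ctree r f g ((p, m), xs))"
    if "((p, m), xs) \<in> trees M N n d" "l < length xs" "xs ! l = (s, e, x)" "x \<in> grd N (length s) e"
      "\<sigma> permutes {..<length s}" for p m xs l s e x \<sigma>
    unfolding ctree_def using gtree_sym_leaf[OF that(1) f that(2,3) _ d that(5), where N' = N' and h = "\<lambda>i. g"] assms(2) by auto
qed

lemma comp_map_cls:
  assumes "ghom r M M' f" "ghom 0 N N' g"
  shows "comp_map M' N' r f g n d (cls M N n d t) = cls M' N' n (d + r) (ctree r f g t)"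
  unfolding comp_map_alt by (rule lext_cls, rule lext_ctree[OF assms])

lemma glinear_comp_map:
  assumes "ghom r M M' f" "ghom 0 N N' g"
  shows "glinear r (circ M N) (circ M' N') (comp_map M' N' r f g)"
proof -
  have "comp_map M' N' r f g n d x \<in> grd (circ M' N') n (d + r)" if "x \<in> cls M N n d ` trees M N n d" for n d x
    using that ctree_trees[OF _ ghom_glinear[OF assms(1)] ghom_glinear[OF assms(2)]]
    by (auto simp: comp_map_cls[OF assms] cls_in_circ)
  thus ?thesis unfolding comp_map_alt by (intro glinear_lextI[OF _ _ grd_circ gmod_circ]) auto
qed

text \<open>The sum over \<open>j\<close> of \<open>f \<otimes> (a \<otimes> \<dots> \<otimes> b \<otimes> \<dots> \<otimes> a)\<close>, with \<open>a\<close> and \<open>b\<close> having the same target;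
  both \<^const>\<open>lcomp_map\<close> and the differential of \<^const>\<open>circ\<close> are of this form.\<close>

definition etree :: "int \<Rightarrow> ('m, 'p) gmap \<Rightarrow> ('n, 'l) gmap \<Rightarrow> int \<Rightarrow> ('n, 'l) gmap \<Rightarrow> nat \<Rightarrow>
    ('m, 'n) tree \<Rightarrow> ('p, 'l) tree" where
  "etree r f a q b j = gtree r f (\<lambda>i. if i = j then b else a) (\<lambda>i. if i = j then q else 0)"

text \<open>The Koszul sign of moving a map of degree \<open>q\<close> past the root and the first
  \<open>j\<close> leaves.\<close>

definition lsign :: "int \<Rightarrow> nat \<Rightarrow> ('m, 'n) tree \<Rightarrow> 'k::field" where
  "lsign q j = (\<lambda>((p, m), xs). (-1) powi (q * (p + degs (take j xs))))"

definition esum :: "('k::field, 'm'::plus) dgs \<Rightarrow> ('k, 'l::plus) dgs \<Rightarrow>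
    int \<Rightarrow> ('m, 'm') gmap \<Rightarrow> ('n, 'l) gmap \<Rightarrow> int \<Rightarrow> ('n, 'l) gmap \<Rightarrow> nat \<Rightarrow> int \<Rightarrow>
    ('m, 'n) tree \<Rightarrow> ('m', 'l) tree \<Rightarrow>\<^sub>0 'k" where
  "esum M' L r f a q b n d t = (\<Sum>j<length (snd t). psc (lsign q j t)
     (cls M' L n (d + r + q) (etree r f a q b j t)))"

definition inl :: "('n, 'l) gmap \<Rightarrow> ('n, 'l \<times> 'l'::zero) gmap" where
  "inl a = (\<lambda>n e x. (a n e x, 0))"

definition inr :: "('n, 'l') gmap \<Rightarrow> ('n, 'l::zero \<times> 'l') gmap" where
  "inr b = (\<lambda>n e x. (0, b n e x))"

lemma lcomp_map_alt:
  "lcomp_map M' L L' r f a q b = (\<lambda>n d. lext (esum M' (dsum L L') r f (inl a) q (inr b) n d))"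
proof (intro ext)
  fix n d x
  have *: "gleaves (\<lambda>i. if i = j then inr b else inl a) (\<lambda>i. if i = j then q else 0) xs =
      map (\<lambda>i. case xs ! i of (s, e, x) \<Rightarrow> if i = j then (s, e + q, (0, b (length s) e x))
                 else (s, e, (a (length s) e x, 0))) [0..<length xs]" for xs j
    by (auto simp: gleaves_def inl_def inr_def split: prod.split)
  show "lcomp_map M' L L' r f a q b n d x = lext (esum M' (dsum L L') r f (inl a) q (inr b) n d) x"
    unfolding lcomp_map_def
    by (intro arg_cong2[of _ _ _ _ lext] refl ext)
      (auto simp: esum_def lsign_def etree_def gtree_def *)
qed

lemma sum_if_eq [simp]: "j < k \<Longrightarrow> (\<Sum>i<k. if i = j then q else 0) = (q :: int)" for j k :: nat
  by simp

lemma etree_trees: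
  assumes "t \<in> trees M N n d" "glinear r M M' f" "glinear 0 N N' a" "glinear q N N' b" "j < length (snd t)"
  shows "etree r f a q b j t \<in> trees M' N' n (d + r + q)"
proof -
  obtain p m xs where t: "t = ((p, m), xs)" by (cases t) auto
  show ?thesis using gtree_trees[OF assms(1)[unfolded t] assms(2),
        of "\<lambda>i. if i = j then q else 0" N' "\<lambda>i. if i = j then b else a"] assms(3,4,5)
    by (simp add: etree_def t)
qed

lemma take_degs_update:
  "l < length xs \<Longrightarrow> xs ! l = (s, e, x) \<Longrightarrow> degs (take j (xs[l := (s', e, x')])) = degs (take j xs)"
  by (rule degs_cong) (auto intro!: nth_equalityI simp: nth_list_update)

text \<open>All relations hold summand by summand except the symmetry at the root: permuting the
  leaves turns the summand \<open>j\<close> into the summand \<open>\<sigma> j\<close>, and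
  \<open>koszul_shift\<close> compares their signs.\<close>

lemma lext_esum:
  assumes "ghom r M M' f" "ghom 0 N N' a" "ghom q N N' b" "u \<in> comp_rel M N n d"
  shows "lext (esum M' N' r f a q b n d) u = 0"
proof (rule lext_comp_rel[OF _ _ _ _ _ _ assms(4)])
  note f = ghom_glinear[OF assms(1)] and a = ghom_glinear[OF assms(2)] and b = ghom_glinear[OF assms(3)]
  let ?E = "esum M' N' r f a q b n d"
  let ?h = "\<lambda>j i. if i = j then b else a"
  let ?\<delta> = "\<lambda>j i. if i = j then q else 0"
  have d: "d + r + q = d + r + (\<Sum>i<k. if i = j then q else 0)" if "j < k" for j k :: nat
    using that by simp
  have g: "glinear (?\<delta> j i) N N' (?h j i)" for i j :: nat using a b by simp
  have gh: "ghom (?\<delta> j i) N N' (?h j i)" for i j :: nat using assms(2,3) by simp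
  show "?E ((p, m + m'), xs) = ?E ((p, m), xs) + ?E ((p, m'), xs)"
    if "((p, m), xs) \<in> trees M N n d" "((p, m'), xs) \<in> trees M N n d" for p m m' xs
  proof -
    have "m' \<in> grd M (length xs) p" using that by (auto simp: mem_trees)
    note * = gtree_root(1)[OF that(1) f g d this]
    show ?thesis
      unfolding esum_def etree_def lsign_def by (simp add: * PM.scale_right_distrib sum.distrib)
  qed
  show "?E ((p, scl M c m), xs) = psc c (?E ((p, m), xs))"
    if "((p, m), xs) \<in> trees M N n d" for p m c xs
  proof -
    have "m \<in> grd M (length xs) p" using that by (auto simp: mem_trees)
    note * = gtree_root(2)[OF that(1) f g d this]
    show ?thesis
      unfolding esum_def etree_def lsign_def by (simp add: * PM.scale_sum_right mult.commute)
  qed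
  show "?E ((p, m), xs[l := (s, e, x + x')]) = ?E ((p, m), xs) + ?E ((p, m), xs[l := (s, e, x')])"
    if t: "((p, m), xs) \<in> trees M N n d" "l < length xs" "xs ! l = (s, e, x)" "x \<in> grd N (length s) e"
      "x' \<in> grd N (length s) e" for p m xs l s e x x'
  proof -
    note * = gtree_update(1)[OF t(1) f t(2,3) g d t(5)]
    show ?thesis
      unfolding esum_def etree_def lsign_def
      by (simp add: * PM.scale_right_distrib sum.distrib take_degs_update[OF t(2,3)])
  qed
  show "?E ((p, m), xs[l := (s, e, scl N c x)]) = psc c (?E ((p, m), xs))"
    if t: "((p, m), xs) \<in> trees M N n d" "l < length xs" "xs ! l = (s, e, x)" "x \<in> grd N (length s) e"
    for p m xs l s e x c
  proof -
    note * = gtree_update(2)[OF t(1) f t(2,3) g d t(4)]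
    show ?thesis
      unfolding esum_def etree_def lsign_def
      by (simp add: * PM.scale_sum_right take_degs_update[OF t(2,3)] mult.commute)
  qed
  show "?E ((p, m), xs[l := (permute_list \<sigma> s, e, act N (length s) e \<sigma> x)]) = ?E ((p, m), xs)"
    if t: "((p, m), xs) \<in> trees M N n d" "l < length xs" "xs ! l = (s, e, x)" "x \<in> grd N (length s) e"
      "\<sigma> permutes {..<length s}" for p m xs l s e x \<sigma>
  proof -
    note * = gtree_sym_leaf[OF t(1) f t(2,3) gh d t(5)]
    show ?thesis
      unfolding esum_def etree_def lsign_def by (simp add: * take_degs_update[OF t(2,3)])
  qed
  show "?E ((p, act M (length xs) p \<sigma> m), permute_list \<sigma> xs) =
      psc (koszul \<sigma> (map edeg xs)) (?E ((p, m), xs))"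
    if t: "((p, m), xs) \<in> trees M N n d" and \<sigma>: "\<sigma> permutes {..<length xs}" for p m xs \<sigma>
  proof -
    define es where "es = map edeg xs"
    have es: "es ! i = fst (snd (xs ! i))" if "i < length xs" for i
      using that by (simp add: es_def split_beta)
    have \<sigma>lt: "\<sigma> j < length xs" if "j < length xs" for j
      using permutes_in_image[OF \<sigma>] that by auto
    have inj: "\<sigma> i = \<sigma> j \<longleftrightarrow> i = j" for i j using permutes_inj[OF \<sigma>] by (auto simp: inj_def)
    have tm: "psc (lsign q j ((p, act M (length xs) p \<sigma> m), permute_list \<sigma> xs))
        (cls M' N' n (d + r + q) (etree r f a q b j ((p, act M (length xs) p \<sigma> m), permute_list \<sigma> xs))) =
      psc (koszul \<sigma> es) (psc (lsign q (\<sigma> j) ((p, m), xs)) (cls M' N' n (d + r + q) (etree r f a q b (\<sigma> j) ((p, m), xs))))"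
      if j: "j < length xs" for j
    proof -
      have e': "map edeg (gleaves (?h (\<sigma> j)) (?\<delta> (\<sigma> j)) xs) = es[\<sigma> j := es ! \<sigma> j + q]"
        by (intro nth_equalityI) (auto simp: nth_gleaves es_def nth_list_update split_beta \<sigma>lt j)
      have "cls M' N' n (d + r + q) (etree r f a q b j ((p, act M (length xs) p \<sigma> m), permute_list \<sigma> xs)) =
        psc (koszul \<sigma> (es[\<sigma> j := es ! \<sigma> j + q])) (cls M' N' n (d + r + q) (etree r f a q b (\<sigma> j) ((p, m), xs)))"
        unfolding etree_def e'[symmetric]
        by (rule gtree_sym_root[OF t assms(1) g d[OF \<sigma>lt[OF j]] \<sigma>]) (auto simp: inj)
      moreover have "lsign q j ((p, act M (length xs) p \<sigma> m), permute_list \<sigma> xs) * koszul \<sigma> (es[\<sigma> j := es ! \<sigma> j + q]) =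
          koszul \<sigma> es * (lsign q (\<sigma> j) ((p, m), xs) :: 'a)"
      proof -
        have "degs (take j (permute_list \<sigma> xs)) = (\<Sum>i<j. es ! \<sigma> i)"
          using j \<sigma>lt by (simp add: degs_take permute_list_nth[OF \<sigma>] es)
        moreover have "degs (take (\<sigma> j) xs) = (\<Sum>i<\<sigma> j. es ! i)"
          using \<sigma>lt[OF j] by (simp add: degs_take es)
        moreover have "length es = length xs" by (simp add: es_def)
        ultimately show ?thesis
          using koszul_shift[where 'k = 'a and \<sigma> = \<sigma> and es = es and j = j and q = q] \<sigma> j
          by (simp add: lsign_def distrib_left powi_m1_add)
      qed
      ultimately show ?thesis by simp
    qed
    have "?E ((p, act M (length xs) p \<sigma> m), permute_list \<sigma> xs) =
      (\<Sum>j<length xs. psc (koszul \<sigma> es) (psc (lsign q (\<sigma> j) ((p, m), xs)) (cls M' N' n (d + r + q) (etree r f a q b (\<sigma> j) ((p, m), xs)))))"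
      unfolding esum_def by (intro sum.cong) (auto simp: tm)
    also have "\<dots> = (\<Sum>j<length xs. psc (koszul \<sigma> es) (psc (lsign q j ((p, m), xs)) (cls M' N' n (d + r + q) (etree r f a q b j ((p, m), xs)))))"
      by (rule sum.reindex_bij_betw[OF permutes_imp_bij[OF \<sigma>], of "\<lambda>j. psc (koszul \<sigma> es) (psc (lsign q j ((p, m), xs)) (cls M' N' n (d + r + q) (etree r f a q b j ((p, m), xs))))"])
    finally show ?thesis by (simp add: esum_def es_def PM.scale_sum_right)
  qed
qed

section \<open>Modules concentrated in arity zero\<close>

text \<open>A consequence of \<open>dg_module\<close> that leaves out the differential. The two
  conditions on \<open>act\<close> make every linear map between such modules equivariant
  (\<open>flat_ghom\<close>), so that the action need not be followed in arity zero.\<close>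

definition flat :: "('k::field, 'v::ab_group_add) dgs \<Rightarrow> bool" where
  "flat V \<longleftrightarrow> gmod V \<and> (\<forall>n d. n > 0 \<longrightarrow> grd V n d = {0}) \<and>
     (\<forall>d. \<forall>x\<in>grd V 0 d. act V 0 d id x = x) \<and> (\<forall>n d \<sigma>. \<sigma> permutes {..<n} \<longrightarrow> act V n d \<sigma> 0 = 0)"

lemma flatD:
  assumes "flat V"
  shows "gmod V" "n > 0 \<Longrightarrow> grd V n d = {0}" "x \<in> grd V 0 d \<Longrightarrow> act V 0 d id x = x"
    "\<sigma> permutes {..<n} \<Longrightarrow> act V n d \<sigma> 0 = 0"
  using assms by (auto simp: flat_def)

lemma flat_act:
  assumes "flat V" "\<sigma> permutes {..<n}" "x \<in> grd V n d"
  shows "act V n d \<sigma> x = x"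
proof (cases "n = 0")
  case True
  hence "\<sigma> = id" using assms(2) by simp
  thus ?thesis using assms flatD(3)[OF assms(1)] True by simp
next
  case False
  thus ?thesis using assms flatD(2,4)[OF assms(1)] by auto
qed

lemma flat_ghom:
  assumes "flat V" "flat W" "glinear p V W f"
  shows "ghom p V W f"
  using assms(3) flat_act[OF assms(1)] flat_act[OF assms(2)]
  by (auto simp: ghom_def glinear_def)

lemma flat_glinearI:
  assumes "flat V" "flat W" "\<And>d x. x \<in> grd V 0 d \<Longrightarrow> f 0 d x \<in> grd W 0 (d + p)"
    "\<And>d x y. x \<in> grd V 0 d \<Longrightarrow> y \<in> grd V 0 d \<Longrightarrow> f 0 d (x + y) = f 0 d x + f 0 d y"
    "\<And>d c x. x \<in> grd V 0 d \<Longrightarrow> f 0 d (scl V c x) = scl W c (f 0 d x)"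
    "\<And>n d. f (Suc n) d 0 = 0"
  shows "glinear p V W f"
  unfolding glinear_def
proof (intro allI conjI ballI)
  fix n d x y c
  assume x: "x \<in> grd V n d"
  have z: "n \<noteq> 0 \<Longrightarrow> f n d 0 = 0" using assms(6) by (cases n) auto
  show "f n d x \<in> grd W n (d + p)"
    using x z assms(3) flatD(2)[OF assms(1), of n] gmodD(3)[OF flatD(1)[OF assms(2)]] by (cases "n = 0") auto
  show "f n d (scl V c x) = scl W c (f n d x)"
    using x z assms(5) flatD(2)[OF assms(1), of n] gmodD(9)[OF flatD(1)[OF assms(1)]]
      gmodD(9)[OF flatD(1)[OF assms(2)]] by (cases "n = 0") auto
  assume y: "y \<in> grd V n d"
  show "f n d (x + y) = f n d x + f n d y"
    using x y z assms(4) flatD(2)[OF assms(1), of n] by (cases "n = 0") auto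
qed

lemma flat_dsum:
  assumes "flat V" "flat W" shows "flat (dsum V W)"
  using assms gmod_dsum by (auto simp: flat_def zero_prod_def)

lemma dg_module_flat:
  assumes "dg_module V" shows "flat V"
proof -
  have V: "gmod V" and s: "smodule V" using assms by (auto simp: dg_module_def smodule_gmod)
  have a: "act V n d \<sigma> (scl V c x) = scl V c (act V n d \<sigma> x)"
    if "\<sigma> permutes {..<n}" "x \<in> grd V n d" for n d \<sigma> c x
    using s that by (simp add: smodule_def)
  have "act V n d \<sigma> 0 = 0" if "\<sigma> permutes {..<n}" for n d \<sigma>
    using a[OF that gmodD(3)[OF V], of d 0] by (simp add: gmodD[OF V])
  thus ?thesis using assms V by (auto simp: flat_def dg_module_def smodule_def)
qed

lemma glinear_inl: "glinear 0 N L a \<Longrightarrow> gmod L' \<Longrightarrow> glinear 0 N (dsum L L') (inl a)"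
  by (auto simp: glinear_def inl_def gmodD)

lemma glinear_inr: "glinear q N L' b \<Longrightarrow> gmod L \<Longrightarrow> glinear q N (dsum L L') (inr b)"
  by (auto simp: glinear_def inr_def gmodD)

lemma flat_trees:
  assumes "t \<in> trees M N 0 d"
  shows "\<forall>(s, e, x)\<in>set (snd t). s = []"
proof -
  obtain p m xs where t: "t = ((p, m), xs)" by (cases t) auto
  have "\<Union> (set ` fst ` set xs) = {}" using assms by (simp add: t mem_trees)
  thus ?thesis by (force simp: t)
qed

text \<open>A tree with at least one label has a leaf of positive arity; the element at that leaf is
  0, hence so is the class.\<close>

lemma flat_circ_zero:
  assumes "flat N" "n > 0"
  shows "grd (circ M N) n d = {0}"
proof -
  have "cls M N n d t = 0" if t: "t \<in> trees M N n d" for t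
  proof -
    obtain p m xs where t': "t = ((p, m), xs)" by (cases t) auto
    have "(\<Union>x\<in>set xs. set (fst x)) = {..<n}" using t by (simp add: t' mem_trees)
    hence "0 \<in> (\<Union>x\<in>set xs. set (fst x))" using assms(2) by simp
    hence "\<exists>x\<in>set xs. fst x \<noteq> []" by force
    then obtain l where l: "l < length xs" "fst (xs ! l) \<noteq> []" by (metis in_set_conv_nth)
    obtain s e x where x: "xs ! l = (s, e, x)" by (cases "xs ! l") auto
    have "x \<in> grd N (length s) e" using t l x by (auto simp: t' mem_trees_nth)
    hence "x = 0" using flatD(2)[OF assms(1), of "length s" e] l x by auto
    hence "xs = xs[l := (s, e, 0)]" using x by (metis list_update_id)
    thus ?thesis using cls_zero_leaf[OF t[unfolded t'] l(1) x flatD(1)[OF assms(1)]] by (simp add: t')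
  qed
  hence "cls M N n d ` trees M N n d \<subseteq> {0}" by auto
  hence "grd (circ M N) n d \<subseteq> {0}" unfolding grd_circ
    by (metis PM.span_mono PM.span_insert_0 PM.span_empty insert_absorb2)
  thus ?thesis using gmodD(3)[OF gmod_circ[of M N]] by blast
qed

lemma qproj_0 [simp]: "qproj psc (comp_rel M N n d) 0 = 0"
  by (rule module_hom.zero[OF Vector_Spaces.linear.axioms(3)[OF qproj_comp(1)]])

lemma qproj_idem:
  assumes "x \<in> grd (circ M N) n d"
  shows "qproj psc (comp_rel M N n d) x = x"
proof -
  interpret L: Vector_Spaces.linear psc psc "qproj psc (comp_rel M N n d)" by (rule qproj_comp(1))
  have "qproj psc (comp_rel M N n d) (qproj psc (comp_rel M N n d) y) = qproj psc (comp_rel M N n d) y"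
    for y
  proof -
    have "y - qproj psc (comp_rel M N n d) y \<in> comp_rel M N n d" by (rule qproj_comp(2))
    hence "qproj psc (comp_rel M N n d) (y - qproj psc (comp_rel M N n d) y) = 0" by (rule qproj_comp(3))
    thus ?thesis by (simp add: L.diff)
  qed
  thus ?thesis using assms by (auto simp: circ_def quotient_def free_comp_def)
qed

lemma act_circ:
  "act (circ M N) n d \<sigma> x = qproj psc (comp_rel M N n d)
    (lext (\<lambda>(r, xs). sgl (r, map (\<lambda>(s, y). (map (inv \<sigma>) s, y)) xs)) x)"
  by (simp add: circ_def quotient_def free_comp_def)

lemma flat_circ:
  assumes "flat N" shows "flat (circ M N)"
proof -
  have "(\<lambda>(r, xs). sgl (r, map (\<lambda>(s, y). (map (inv id) s, y)) xs)) = (\<lambda>t. sgl t)"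
    by (auto simp: fun_eq_iff)
  hence "act (circ M N) n d id x = qproj psc (comp_rel M N n d) (lext sgl x)" for n d x
    unfolding act_circ by (rule arg_cong)
  hence "act (circ M N) n d id x = x" if "x \<in> grd (circ M N) n d" for n d x
    using qproj_idem[OF that] poly_mapping_sum_single[of x] by simp
  moreover have "act (circ M N) n d \<sigma> 0 = 0" for n d \<sigma> by (simp add: act_circ)
  ultimately show ?thesis unfolding flat_def using gmod_circ flat_circ_zero[OF assms] by blast
qed

lemma flat_circ_lin:
  assumes "flat N" "flat N'" shows "flat (circ_lin M N N')"
  unfolding flat_def
proof (intro conjI gmod_circ_lin allI impI ballI)
  note F = flat_circ[OF flat_dsum[OF assms], of M]
  show "grd (circ_lin M N N') n d = {0}" if "n > 0" for n d
    using circ_lin_sub[of M N N' n d] flatD(2)[OF F that] gmodD(3)[OF gmod_circ_lin[of M N N']] by blast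
  show "act (circ_lin M N N') 0 d id x = x" if "x \<in> grd (circ_lin M N N') 0 d" for d x
    using that circ_lin_sub[of M N N' 0 d] flatD(3)[OF F] by (simp add: subset_eq)
  show "act (circ_lin M N N') n d \<sigma> 0 = 0" if "\<sigma> permutes {..<n}" for n d \<sigma>
    using flatD(4)[OF F that] by simp
qed

section \<open>Evaluation on classes\<close>

lemma etree_lin: "j < length (snd t) \<Longrightarrow> lin_tree (etree r f (inl a) q (inr b) j t)"
  by (cases t) (force simp: lin_tree_def etree_def gtree_def nth_gleaves inl_def inr_def split: prod.split)

lemma lcomp_map_cls:
  assumes "ghom r M M' f" "glinear 0 N L a" "glinear q N L' b" "flat N" "flat L" "flat L'"
  shows "lcomp_map M' L L' r f a q b n d (cls M N n d t) = esum M' (dsum L L') r f (inl a) q (inr b) n d t"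
  unfolding lcomp_map_alt
  by (rule lext_cls, rule lext_esum[OF assms(1)])
    (auto intro!: flat_ghom flat_dsum glinear_inl glinear_inr assms flatD(1))

lemma esum_lin_in:
  assumes "glinear r M M' f" "glinear 0 N L a" "glinear q N L' b" "gmod L" "gmod L'" "t \<in> trees M N n d"
  shows "esum M' (dsum L L') r f (inl a) q (inr b) n d t \<in> grd (circ_lin M' L L') n (d + r + q)"
  unfolding esum_def
  by (intro gmodD(7)[OF gmod_circ_lin] gmodD(6)[OF gmod_circ_lin, simplified] cls_in_circ_lin
      etree_trees[OF assms(6,1)] etree_lin glinear_inl glinear_inr assms) auto

lemma glinear_lcomp_map:
  assumes "ghom r M M' f" "glinear 0 N L a" "glinear q N L' b" "flat N" "flat L" "flat L'"
  shows "glinear (r + q) (circ M N) (circ_lin M' L L') (lcomp_map M' L L' r f a q b)"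
proof -
  have "lcomp_map M' L L' r f a q b n d x \<in> grd (circ_lin M' L L') n (d + (r + q))"
    if "x \<in> cls M N n d ` trees M N n d" for n d x
    using that esum_lin_in[OF ghom_glinear[OF assms(1)] assms(2,3)] assms(4-6)
    by (auto simp: lcomp_map_cls[OF assms] flatD simp flip: add.assoc)
  thus ?thesis unfolding lcomp_map_alt by (intro glinear_lextI[OF _ _ grd_circ gmod_circ_lin]) auto
qed

lemma glinear_sub:
  assumes "glinear p V W f" "scl V' = scl V" "\<And>n d. grd V' n d \<subseteq> grd V n d"
  shows "glinear p V' W f"
  using assms by (auto simp: glinear_def subset_eq)

lemma glinear_super:
  assumes "glinear p V W f" "scl W' = scl W" "\<And>n d. grd W n d \<subseteq> grd W' n d"
  shows "glinear p V W' f"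
  using assms by (auto simp: glinear_def subset_eq)

text \<open>The differential is defined on representatives. Written as \<open>ctree\<close> of the
  root differential plus \<open>esum\<close> of the leaf differential, it kills the relations by
  \<open>lext_ctree\<close> and \<open>lext_esum\<close>, and can be evaluated on a tree.\<close>

lemma dif_circ_cls:
  assumes "ghom (-1) M M (dif M)" "ghom (-1) N N (dif N)"
  shows "dif (circ M N) n d (cls M N n d t) =
    cls M N n (d - 1) (ctree (-1) (dif M) idm t) + esum M N 0 idm idm (-1) (dif N) n d t"
proof -
  let ?q = "qproj psc (comp_rel M N n (d - 1))"
  interpret L: Vector_Spaces.linear psc psc ?q by (rule qproj_comp(1))
  let ?D = "\<lambda>((p, m), xs).
        sgl ((p - 1, dif M (length xs) p m), xs) +
        (\<Sum>j<length xs. case xs ! j of (s, e, x) \<Rightarrow>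
           Poly_Mapping.single ((p, m), xs[j := (s, e - 1, dif N (length s) e x)])
             ((-1) powi (p + degs (take j xs))))"
  let ?E = "\<lambda>t. cls M N n (d - 1) (ctree (-1) (dif M) idm t) + esum M N 0 idm idm (-1) (dif N) n d t"
  have idm: "ghom 0 V V idm" for V :: "('x, 'y::ab_group_add) dgs"
    by (simp add: ghom_def glinear_idm) (simp add: idm_def)
  have D: "?q (?D t) = ?E t" for t
  proof -
    obtain p m xs where t: "t = ((p, m), xs)" by (cases t) auto
    have c: "ctree (-1) (dif M) idm t = ((p - 1, dif M (length xs) p m), xs)"
      by (simp add: t ctree_eq idm_def)
    have e: "etree 0 idm idm (-1) (dif N) j t =
        ((p, m), xs[j := (case xs ! j of (s, e, x) \<Rightarrow> (s, e - 1, dif N (length s) e x))])"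
      if "j < length xs" for j
      using that unfolding t etree_def gtree_def
      by (auto intro!: nth_equalityI simp: nth_gleaves idm_def nth_list_update split: prod.split)
    have s: "(-1 :: 'a) powi (p + degs (take j xs)) = lsign (-1) j t" for j
      by (simp add: t lsign_def powi_minus_one)
    have "?q (?D t) = cls M N n (d - 1) ((p - 1, dif M (length xs) p m), xs) +
        (\<Sum>j<length xs. psc (lsign (-1) j t) (cls M N n (d - 1)
          ((p, m), xs[j := (case xs ! j of (s, e, x) \<Rightarrow> (s, e - 1, dif N (length s) e x))])))"
      by (simp add: t L.add L.sum qproj_comp_single split_beta s[unfolded t] cls_def[symmetric])
    thus ?thesis unfolding esum_def c by (simp add: e[unfolded t] t)
  qed
  have "lext ?E u = 0" if "u \<in> comp_rel M N n d" for u
  proof -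
    have "lext ?E u = lext (\<lambda>t. cls M N n (d + -1) (ctree (-1) (dif M) idm t)) u
        + lext (esum M N 0 idm idm (-1) (dif N) n d) u"
      by (simp add: lext_def PM.scale_right_distrib sum.distrib)
    also have "lext (\<lambda>t. cls M N n (d + -1) (ctree (-1) (dif M) idm t)) u = 0"
      using that by (rule lext_ctree[OF assms(1) idm])
    finally show ?thesis using lext_esum[OF idm idm assms(2) that] by simp
  qed
  hence "lext ?E (cls M N n d t) = ?E t" by (rule lext_cls)
  moreover have "?q (lext ?D x) = lext ?E x" for x
    unfolding lext_def L.sum L.scale D ..
  ultimately show ?thesis by (simp add: circ_def quotient_def free_comp_def)
qed

section \<open>Koszul signs of block permutations\<close>

text \<open>\<open>kosl ds J\<close> is the sign of the rearrangement in which the \<open>i\<close>-th entry comes from position \<open>J ! i\<close>.\<close>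

definition kpair :: "int list \<Rightarrow> nat \<Rightarrow> nat \<Rightarrow> 'k::field" where
  "kpair ds x y = (if y < x then (-1) powi (ds ! x * ds ! y) else 1)"

definition kcross :: "int list \<Rightarrow> nat list \<Rightarrow> nat list \<Rightarrow> 'k::field" where
  "kcross ds xs ys = (\<Prod>x\<leftarrow>xs. \<Prod>y\<leftarrow>ys. kpair ds x y)"

primrec kosl :: "int list \<Rightarrow> nat list \<Rightarrow> 'k::field" where
  "kosl ds [] = 1"
| "kosl ds (x # xs) = (\<Prod>y\<leftarrow>xs. kpair ds x y) * kosl ds xs"

lemma prod_list_mult: "(\<Prod>x\<leftarrow>xs. f x * g x) = (\<Prod>x\<leftarrow>xs. f x) * (\<Prod>x\<leftarrow>xs. g x :: 'k::comm_monoid_mult)"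
  by (induction xs) (auto simp: mult_ac)

lemma kcross_simps [simp]:
  "kcross ds [] ys = 1" "kcross ds xs [] = 1"
  "kcross ds (x # xs) ys = (\<Prod>y\<leftarrow>ys. kpair ds x y) * kcross ds xs ys"
  "kcross ds (xs @ xs') ys = kcross ds xs ys * kcross ds xs' ys"
  "kcross ds xs (ys @ ys') = kcross ds xs ys * kcross ds xs ys'"
proof -
  show "kcross ds xs [] = 1" by (induction xs) (auto simp: kcross_def)
qed (auto simp: kcross_def prod_list_mult)

lemma kosl_append: "kosl ds (xs @ ys) = kosl ds xs * kosl ds ys * kcross ds xs ys"
  by (induction xs) (auto simp: mult_ac)

lemma prod_list_one: "(\<And>x. x \<in> set xs \<Longrightarrow> f x = 1) \<Longrightarrow> (\<Prod>x\<leftarrow>xs. f x) = (1 :: 'k::comm_monoid_mult)"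
  by (induction xs) auto

lemma kcross_less:
  assumes "\<And>x y. x \<in> set xs \<Longrightarrow> y \<in> set ys \<Longrightarrow> x < y"
  shows "kcross ds xs ys = 1"
  unfolding kcross_def using assms by (intro prod_list_one) (force simp: kpair_def)

lemma prod_list_powi: "(\<Prod>x\<leftarrow>xs. (-1 :: 'k::field) powi (f x)) = (-1) powi (\<Sum>x\<leftarrow>xs. f x)"
  by (induction xs) (auto simp: powi_m1_add)

lemma kcross_greater:
  assumes "\<And>x y. x \<in> set xs \<Longrightarrow> y \<in> set ys \<Longrightarrow> y < x"
  shows "kcross ds xs ys = (-1 :: 'k::field) powi ((\<Sum>x\<leftarrow>xs. ds ! x) * (\<Sum>y\<leftarrow>ys. ds ! y))"
  using assms
proof (induction xs)
  case (Cons x xs)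
  have "(\<Prod>y\<leftarrow>ys. kpair ds x y :: 'k) = (\<Prod>y\<leftarrow>ys. (-1) powi (ds ! x * ds ! y))"
    using Cons.prems by (intro arg_cong[of _ _ prod_list] map_cong refl) (simp add: kpair_def)
  also have "\<dots> = (-1) powi (ds ! x * (\<Sum>y\<leftarrow>ys. ds ! y))"
    by (simp add: prod_list_powi sum_list_const_mult)
  finally show ?case using Cons by (simp add: powi_m1_add distrib_right)
qed simp

lemma kosl_sorted: "sorted xs \<Longrightarrow> kosl ds xs = 1"
  by (induction xs) (auto intro!: prod_list_one simp: kpair_def)

lemma kosl_prod: "(kosl ds J :: 'k::field) = (\<Prod>i<length J. \<Prod>j<length J. if i < j then kpair ds (J ! i) (J ! j) else 1)"
proof (induction J)
  case (Cons x J)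
  have "(\<Prod>y\<leftarrow>J. kpair ds x y) = (\<Prod>j<length J. kpair ds x (J ! j) :: 'k)"
    by (induction J) (auto simp: prod.lessThan_Suc_shift simp del: prod.lessThan_Suc)
  thus ?case by (simp add: Cons prod.lessThan_Suc_shift del: prod.lessThan_Suc cong: if_cong)
qed simp

lemma koszul_kosl:
  assumes "\<sigma> permutes {..<length ds}"
  shows "koszul \<sigma> ds = kosl ds (map \<sigma> [0..<length ds])"
  unfolding koszul_alt kosl_prod by (intro prod.cong) (auto simp: kpair_def)

lemma kosl_shift:
  "(\<And>x. x \<in> set J \<Longrightarrow> x < length ds) \<Longrightarrow> kosl (as @ ds @ bs) (map (\<lambda>x. length as + x) J) = (kosl ds J :: 'k::field)"
proof (induction J)
  case (Cons x J)
  have "map (kpair (as @ ds @ bs) (length as + x)) (map (\<lambda>x. length as + x) J) = map (kpair ds x :: nat \<Rightarrow> 'k) J"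
    using Cons.prems by (auto simp: kpair_def nth_append)
  moreover have "kosl (as @ ds @ bs) (map (\<lambda>x. length as + x) J) = (kosl ds J :: 'k)" using Cons by auto
  ultimately show ?case by (simp only: list.map kosl.simps)
qed simp

text \<open>Nothing moves inside a block, and two blocks whose order is reversed contribute the sign
  of the product of their total degrees. So permuting blocks costs the same as permuting single
  entries of these total degrees.\<close>

lemma kosl_concat:
  assumes "\<And>j. j \<in> set J \<Longrightarrow> j < length bds \<and> bds ! j = (\<Sum>x\<leftarrow>B j. ds ! x) \<and> kosl ds (B j) = (1 :: 'k::field)"
    and "\<And>i j x y. i \<in> set J \<Longrightarrow> j \<in> set J \<Longrightarrow> i < j \<Longrightarrow> x \<in> set (B i) \<Longrightarrow> y \<in> set (B j) \<Longrightarrow> x < y"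
    and "distinct J"
  shows "kosl ds (concat (map B J)) = (kosl bds J :: 'k)"
  using assms
proof (induction J)
  case (Cons j J)
  have c: "kcross ds (B j) (B i) = (kpair bds j i :: 'k)" if "i \<in> set J" for i
  proof (cases "i < j")
    case True
    thus ?thesis using Cons.prems(1)[of i] Cons.prems(1)[of j] Cons.prems(2)[of i j] that
      by (subst kcross_greater) (auto simp: kpair_def)
  next
    case False
    hence "j < i" using Cons.prems(3) that by (cases i j rule: linorder_cases) auto
    thus ?thesis using Cons.prems(2)[of j i] that by (subst kcross_less) (auto simp: kpair_def)
  qed
  have "kcross ds (B j) (concat (map B I)) = (\<Prod>i\<leftarrow>I. kcross ds (B j) (B i) :: 'k)" for I
    by (induction I) auto
  hence "kcross ds (B j) (concat (map B J)) = (\<Prod>i\<leftarrow>J. kpair bds j i :: 'k)"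
    using c by (simp cong: map_cong)
  moreover have "kosl ds (concat (map B J)) = (kosl bds J :: 'k)"
  proof (rule Cons.IH)
    show "x < y" if "i \<in> set J" "i' \<in> set J" "i < i'" "x \<in> set (B i)" "y \<in> set (B i')" for i i' x y
      by (rule Cons.prems(2)[OF _ _ that(3-5)]) (use that in auto)
  qed (use Cons.prems in auto)
  ultimately show ?case using Cons.prems(1)[of j] by (simp add: kosl_append mult.commute)
qed simp

text \<open>Consider a row of trees with root degrees \<open>r\<close> and leaf degrees
  \<open>l\<close>. Permuting the trees and then moving the roots to the left agrees with moving the
  roots first and then permuting roots and leaves separately. All signs are products over pairs; for
  an inverted pair the mixed terms of \<open>(r + l) * (r' + l')\<close> account for the difference
  of the two separation signs.\<close>

lemma koszul_interchange:
  assumes \<sigma>: "\<sigma> permutes {..<k}" and "length r = k" "length l = k"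
  shows "(-1) powi (\<Sum>j<k. r ! \<sigma> j * (\<Sum>i<j. l ! \<sigma> i)) * koszul \<sigma> r * koszul \<sigma> l =
    koszul \<sigma> (map (\<lambda>i. r ! i + l ! i) [0..<k]) * ((-1) powi (\<Sum>j<k. r ! j * (\<Sum>i<j. l ! i)) :: 'k::field)"
proof -
  define g where "g = (\<lambda>i j. (-1 :: 'k) powi (r ! j * l ! i))"
  define PP where "PP = (\<lambda>F. \<Prod>i<k. \<Prod>j<k. (F i j :: 'k))"
  have mult: "PP (\<lambda>i j. F i j * G i j) = PP F * PP G" for F G by (simp add: PP_def prod.distrib)
  have swap: "PP F = PP (\<lambda>i j. F j i)" for F unfolding PP_def by (rule prod.swap)
  have perm: "PP F = PP (\<lambda>i j. F (\<sigma> i) (\<sigma> j))" for F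
  proof -
    have b: "bij_betw \<sigma> {..<k} {..<k}" using \<sigma> by (rule permutes_imp_bij)
    show ?thesis unfolding PP_def
      by (subst prod.reindex_bij_betw[OF b, symmetric], subst prod.reindex_bij_betw[OF b, symmetric]) simp
  qed
  have ex: "(-1) powi (\<Sum>j<k. r ! \<tau> j * (\<Sum>i<j. l ! \<tau> i)) = PP (\<lambda>i j. if i < j then g (\<tau> i) (\<tau> j) else 1)" for \<tau>
  proof -
    have "(-1 :: 'k) powi (r ! \<tau> j * (\<Sum>i<j. l ! \<tau> i)) = (\<Prod>i<k. if i < j then g (\<tau> i) (\<tau> j) else 1)" if "j < k" for j
    proof -
      have "(\<Prod>i<k. if i < j then g (\<tau> i) (\<tau> j) else 1) = (\<Prod>i\<in>{..<k} \<inter> {i. i < j}. g (\<tau> i) (\<tau> j))"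
        by (subst prod.inter_restrict) auto
      also have "{..<k} \<inter> {i. i < j} = {..<j}" using that by auto
      finally show ?thesis by (simp add: sum_distrib_left powi_m1_sum g_def)
    qed
    hence "(-1) powi (\<Sum>j<k. r ! \<tau> j * (\<Sum>i<j. l ! \<tau> i)) = (\<Prod>j<k. \<Prod>i<k. if i < j then g (\<tau> i) (\<tau> j) else 1)"
      by (simp add: powi_m1_sum)
    thus ?thesis by (subst swap) (simp add: PP_def)
  qed
  have inj: "\<sigma> i = \<sigma> j \<longleftrightarrow> i = j" for i j using permutes_inj[OF \<sigma>] by (auto simp: inj_def)
  have lt: "\<sigma> i < k" if "i < k" for i using permutes_in_image[OF \<sigma>] that by auto
  have kos: "koszul \<sigma> ds = PP (\<lambda>i j. if i < j \<and> \<sigma> j < \<sigma> i then (-1) powi (ds ! \<sigma> i * ds ! \<sigma> j) else 1)"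
    if "length ds = k" for ds using that by (simp add: koszul_alt PP_def)
  have "(-1) powi (\<Sum>j<k. r ! j * (\<Sum>i<j. l ! i)) = PP (\<lambda>i j. if i < j then g i j else 1)"
    using ex[of "\<lambda>x. x"] .
  also have "\<dots> = PP (\<lambda>i j. if \<sigma> i < \<sigma> j then g (\<sigma> i) (\<sigma> j) else 1)" by (rule perm)
  \<comment> \<open>Split by the order of \<open>i\<close> and \<open>j\<close> and fold the second
    half back by transposition, so that all products run over the pairs
    \<open>i < j\<close>.\<close>
  also have "\<dots> = PP (\<lambda>i j. (if i < j \<and> \<sigma> i < \<sigma> j then g (\<sigma> i) (\<sigma> j) else 1) *
      (if j < i \<and> \<sigma> i < \<sigma> j then g (\<sigma> i) (\<sigma> j) else 1))"
    unfolding PP_def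
  proof (intro prod.cong refl)
    fix i j
    show "(if \<sigma> i < \<sigma> j then g (\<sigma> i) (\<sigma> j) else 1) = (if i < j \<and> \<sigma> i < \<sigma> j then g (\<sigma> i) (\<sigma> j) else 1) *
      (if j < i \<and> \<sigma> i < \<sigma> j then g (\<sigma> i) (\<sigma> j) else 1)"
      by (cases i j rule: linorder_cases) auto
  qed
  also have "\<dots> = PP (\<lambda>i j. if i < j \<and> \<sigma> i < \<sigma> j then g (\<sigma> i) (\<sigma> j) else 1) *
      PP (\<lambda>i j. if i < j \<and> \<sigma> j < \<sigma> i then g (\<sigma> j) (\<sigma> i) else 1)"
    unfolding mult by (subst (2) swap) simp
  finally have e: "(-1) powi (\<Sum>j<k. r ! j * (\<Sum>i<j. l ! i)) = \<dots>" .
  show ?thesis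
    unfolding e ex kos[OF assms(2)] kos[OF assms(3)] kos[of "map _ [0..<k]", simplified] mult[symmetric]
    unfolding PP_def
  proof (intro prod.cong refl)
    fix i j assume "i \<in> {..<k}" "j \<in> {..<k}"
    hence ij: "\<sigma> i < k" "\<sigma> j < k" using lt by auto
    show "(if i < j then g (\<sigma> i) (\<sigma> j) else 1) * (if i < j \<and> \<sigma> j < \<sigma> i then (-1) powi (r ! \<sigma> i * r ! \<sigma> j) else 1) *
        (if i < j \<and> \<sigma> j < \<sigma> i then (-1) powi (l ! \<sigma> i * l ! \<sigma> j) else 1) =
      (if i < j \<and> \<sigma> j < \<sigma> i then (-1) powi (map (\<lambda>i. r ! i + l ! i) [0..<k] ! \<sigma> i * map (\<lambda>i. r ! i + l ! i) [0..<k] ! \<sigma> j) else 1) *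
      ((if i < j \<and> \<sigma> i < \<sigma> j then g (\<sigma> i) (\<sigma> j) else 1) * (if i < j \<and> \<sigma> j < \<sigma> i then g (\<sigma> j) (\<sigma> i) else 1))"
      using ij inj[of i j] by (cases "\<sigma> i" "\<sigma> j" rule: linorder_cases) (auto simp: g_def powi_minus_one)
  qed
qed

section \<open>Multilinear extension\<close>

text \<open>The sum over \<open>listset\<close> in \<open>assoc\<close>, by recursion over the
  leaves: one slot can be treated as a linear combination while the others are fixed.
  \<open>mext_listset\<close> gives the comparison.\<close>

primrec mext :: "('g list \<Rightarrow> ('h \<Rightarrow>\<^sub>0 'k::field)) \<Rightarrow> ('g \<Rightarrow>\<^sub>0 'k) list \<Rightarrow> ('h \<Rightarrow>\<^sub>0 'k)" where
  "mext A [] = A []"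
| "mext A (y # ys) = lext (\<lambda>u. mext (\<lambda>us. A (u # us)) ys) y"

lemma mext_listset:
  "mext A ys = (\<Sum>us\<in>listset (map Poly_Mapping.keys ys).
     psc (\<Prod>j<length ys. Poly_Mapping.lookup (ys ! j) (us ! j)) (A us))"
proof (induction ys arbitrary: A)
  case (Cons y ys)
  let ?L = "listset (map Poly_Mapping.keys ys)"
  let ?c = "\<lambda>ys us. \<Prod>j<length ys. Poly_Mapping.lookup (ys ! j) (us ! j)"
  have L: "listset (map Poly_Mapping.keys (y # ys)) = (\<lambda>(u, us). u # us) ` (Poly_Mapping.keys y \<times> ?L)"
    by (auto simp: set_Cons_def)
  have "(\<Sum>us\<in>listset (map Poly_Mapping.keys (y # ys)). psc (?c (y # ys) us) (A us)) =
      (\<Sum>(u, us)\<in>Poly_Mapping.keys y \<times> ?L. psc (?c (y # ys) (u # us)) (A (u # us)))"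
    unfolding L by (subst sum.reindex) (auto simp: inj_on_def split_beta)
  also have "\<dots> = (\<Sum>u\<in>Poly_Mapping.keys y. \<Sum>us\<in>?L. psc (?c (y # ys) (u # us)) (A (u # us)))"
    by (simp add: sum.cartesian_product)
  also have "\<dots> = (\<Sum>u\<in>Poly_Mapping.keys y. psc (Poly_Mapping.lookup y u) (\<Sum>us\<in>?L. psc (?c ys us) (A (u # us))))"
    by (simp add: PM.scale_sum_right prod.lessThan_Suc_shift del: prod.lessThan_Suc)
  finally show ?case by (simp add: Cons lext_def)
qed simp

lemma mext_cong:
  "(\<And>us. list_all2 (\<lambda>u y. u \<in> Poly_Mapping.keys y) us ys \<Longrightarrow> A us = B us) \<Longrightarrow> mext A ys = mext B ys"
proof (induction ys arbitrary: A B)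
  case (Cons y ys)
  show ?case by (simp, intro lext_cong Cons.IH Cons.prems) simp
qed simp

lemma mext_zero [simp]: "mext (\<lambda>us. 0) ys = 0"
  by (induction ys) auto

lemma mext_add: "mext (\<lambda>us. A us + B us) ys = mext A ys + mext B ys"
  by (induction ys arbitrary: A B) (auto simp: lext_def PM.scale_right_distrib sum.distrib)

lemma mext_psc: "mext (\<lambda>us. psc c (A us)) ys = psc c (mext A ys)"
  by (induction ys arbitrary: A) (auto simp: lext_def PM.scale_sum_right mult.commute)

lemma mext_sum: "mext (\<lambda>us. \<Sum>i\<in>I. A i us) ys = (\<Sum>i\<in>I. mext (A i) ys)"
  by (induction I rule: infinite_finite_induct) (auto simp: mext_add)

lemma mext_lext: "mext (\<lambda>us. lext (\<lambda>u. A u us) r) ys = lext (\<lambda>u. mext (A u) ys) r"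
  by (simp add: lext_def mext_sum mext_psc)

lemma mext_append: "mext A (ys @ zs) = mext (\<lambda>us. mext (\<lambda>vs. A (us @ vs)) zs) ys"
  by (induction ys arbitrary: A) auto

lemma mext_slot: "mext A (ys @ r # zs) = lext (\<lambda>t. mext (\<lambda>us. mext (\<lambda>vs. A (us @ t # vs)) zs) ys) r"
  by (simp add: mext_append mext_lext)

lemma mext_single: "mext A (map sgl us) = A us"
  by (induction us arbitrary: A) auto

text \<open>Reduces a relation placed in one leaf to the case where all other leaves are single
  trees.\<close>

lemma mext_kill:
  assumes "\<And>us vs. list_all2 (\<lambda>u y. u \<in> Poly_Mapping.keys y) us ys \<Longrightarrow>
    list_all2 (\<lambda>u y. u \<in> Poly_Mapping.keys y) vs zs \<Longrightarrow> lext (\<lambda>t. A (us @ t # vs)) r = 0"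
  shows "mext A (ys @ r # zs) = 0"
proof -
  have "mext A (ys @ r # zs) = mext (\<lambda>us. mext (\<lambda>vs. lext (\<lambda>t. A (us @ t # vs)) r) zs) ys"
    by (simp add: mext_append mext_lext)
  also have "\<dots> = mext (\<lambda>us. mext (\<lambda>vs. 0) zs) ys"
    by (intro mext_cong assms)
  finally show ?thesis by simp
qed

lemma mext_permute:
  assumes \<sigma>: "\<sigma> permutes {..<length ys}"
  shows "mext A (permute_list \<sigma> ys) = mext (\<lambda>us. A (permute_list \<sigma> us)) ys"
proof -
  let ?k = "length ys"
  have ls: "us \<in> listset (map Poly_Mapping.keys zs) \<longleftrightarrow>
      length us = length zs \<and> (\<forall>i<length zs. us ! i \<in> Poly_Mapping.keys (zs ! i))" for us zs
    by (induction zs arbitrary: us) (auto simp: set_Cons_def length_Suc_conv All_less_Suc2)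
  have inv: "inv \<sigma> permutes {..<?k}" using \<sigma> by (rule permutes_inv)
  have lt: "\<sigma> i < ?k" "inv \<sigma> i < ?k" if "i < ?k" for i
    using permutes_in_image[OF \<sigma>] permutes_in_image[OF inv] that by auto
  have b: "bij_betw (permute_list \<sigma>) (listset (map Poly_Mapping.keys ys))
      (listset (map Poly_Mapping.keys (permute_list \<sigma> ys)))"
  proof (rule bij_betw_byWitness[where f' = "permute_list (inv \<sigma>)"])
    show "\<forall>us\<in>listset (map Poly_Mapping.keys ys). permute_list (inv \<sigma>) (permute_list \<sigma> us) = us"
      using \<sigma> inv lt by (auto simp: ls intro!: nth_equalityI simp: permute_list_nth permutes_inverses)
    show "\<forall>us\<in>listset (map Poly_Mapping.keys (permute_list \<sigma> ys)). permute_list \<sigma> (permute_list (inv \<sigma>) us) = us"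
      using \<sigma> inv lt by (auto simp: ls intro!: nth_equalityI simp: permute_list_nth permutes_inverses)
    show "permute_list \<sigma> ` listset (map Poly_Mapping.keys ys) \<subseteq> listset (map Poly_Mapping.keys (permute_list \<sigma> ys))"
      using \<sigma> lt by (auto simp: ls permute_list_nth)
    show "permute_list (inv \<sigma>) ` listset (map Poly_Mapping.keys (permute_list \<sigma> ys)) \<subseteq> listset (map Poly_Mapping.keys ys)"
    proof
      fix us assume "us \<in> permute_list (inv \<sigma>) ` listset (map Poly_Mapping.keys (permute_list \<sigma> ys))"
      then obtain vs where vs: "us = permute_list (inv \<sigma>) vs" "length vs = ?k"
        "\<And>i. i < ?k \<Longrightarrow> vs ! i \<in> Poly_Mapping.keys (permute_list \<sigma> ys ! i)" by (auto simp: ls)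
      have "us ! i \<in> Poly_Mapping.keys (ys ! i)" if "i < ?k" for i
        using vs(3)[OF lt(2)[OF that]] lt(2)[OF that] vs(1,2) that inv \<sigma>
        by (simp add: permute_list_nth permutes_inverses)
      thus "us \<in> listset (map Poly_Mapping.keys ys)" using vs by (simp add: ls)
    qed
  qed
  have c: "(\<Prod>j<?k. Poly_Mapping.lookup (permute_list \<sigma> ys ! j) (permute_list \<sigma> us ! j)) =
      (\<Prod>j<?k. Poly_Mapping.lookup (ys ! j) (us ! j))" if "length us = ?k" for us
  proof -
    have "(\<Prod>j<?k. Poly_Mapping.lookup (permute_list \<sigma> ys ! j) (permute_list \<sigma> us ! j)) =
      (\<Prod>j<?k. Poly_Mapping.lookup (ys ! \<sigma> j) (us ! \<sigma> j))"
      using that \<sigma> by (intro prod.cong) (auto simp: permute_list_nth)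
    also have "\<dots> = (\<Prod>j<?k. Poly_Mapping.lookup (ys ! j) (us ! j))"
      by (rule prod.reindex_bij_betw[OF permutes_imp_bij[OF \<sigma>]])
    finally show ?thesis .
  qed
  show ?thesis unfolding mext_listset
    by (subst sum.reindex_bij_betw[OF b, symmetric], rule sum.cong) (auto simp: c ls)
qed

section \<open>The associativity isomorphism\<close>

text \<open>Together with \<open>gmod\<close> this closure keeps the symmetry relations inside the
  span of the trees (\<open>comp_rels_span\<close>).\<close>

definition acl :: "('k, 'v) dgs \<Rightarrow> bool" where
  "acl V \<longleftrightarrow> (\<forall>n d \<sigma>. \<sigma> permutes {..<n} \<longrightarrow> (\<forall>x\<in>grd V n d. act V n d \<sigma> x \<in> grd V n d))"

lemma smodule_acl: "smodule V \<Longrightarrow> acl V"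
  by (simp add: smodule_def acl_def)

lemma flat_acl: "flat V \<Longrightarrow> acl V"
  by (simp add: acl_def flat_act)

text \<open>As a multiset equation, the labelling condition passes through concatenation,
  permutation and substitution of label lists by rewriting alone.\<close>

lemma mset_labels: "distinct xs \<and> set xs = {..<n} \<longleftrightarrow> mset xs = mset [0..<n]"
proof
  assume "distinct xs \<and> set xs = {..<n}"
  hence "distinct xs" "set xs = set [0..<n]" by (auto simp: atLeast0LessThan)
  thus "mset xs = mset [0..<n]" using set_eq_iff_mset_eq_distinct[OF _ distinct_upt] by blast
next
  assume m: "mset xs = mset [0..<n]"
  have "set xs = set [0..<n]" using m by (rule mset_eq_setD)
  moreover have "distinct xs" using mset_eq_imp_distinct_iff[OF m] distinct_upt by blast
  ultimately show "distinct xs \<and> set xs = {..<n}" by (simp add: atLeast0LessThan)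
qed

lemma mem_trees_mset:
  "((p, m), xs) \<in> trees M N n d \<longleftrightarrow> m \<in> grd M (length xs) p \<and>
     (\<forall>(s, e, x)\<in>set xs. x \<in> grd N (length s) e) \<and>
     mset (concat (map fst xs)) = mset [0..<n] \<and> p + degs xs = d"
  by (simp only: mem_trees mset_labels[symmetric] conj_assoc)

lemma mset_concat_sum: "mset (concat xss) = \<Sum>\<^sub># (image_mset mset (mset xss))"
  by (induction xss) auto

lemma mset_concat_permute: "mset xs = mset ys \<Longrightarrow> mset (concat (map g xs)) = mset (concat (map g ys))"
  by (simp add: mset_concat_sum)

lemma degs_permute: "mset xs = mset ys \<Longrightarrow> degs xs = degs ys"
  unfolding degs_def by (metis mset_map sum_mset_sum_list)

lemma trees_permute:
  assumes "((p, m), xs) \<in> trees M N n d" "mset ys = mset xs" "m' \<in> grd M (length xs) p"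
  shows "((p, m'), ys) \<in> trees M N n d"
  using assms mset_concat_permute[OF assms(2), of fst] degs_permute[OF assms(2)]
    mset_eq_setD[OF assms(2)] mset_eq_length[OF assms(2)]
  unfolding mem_trees_mset by auto

lemma comp_rels_span:
  assumes M: "gmod M" "acl M" and N: "gmod N" "acl N" and u: "u \<in> comp_rels M N n d"
  shows "u \<in> PM.span (sgl ` trees M N n d)"
proof -
  have s: "Poly_Mapping.single t c \<in> PM.span (sgl ` trees M N n d)" if "t \<in> trees M N n d" for t c
    using that by (subst single_eq_psc) (intro PM.span_scale PM.span_base imageI)
  note sp = PM.span_diff s
  from u show ?thesis
  proof cases
    case (add_root p m xs m')
    have "((p, m + m'), xs) \<in> trees M N n d" using add_root gmodD(4)[OF M(1)] by (auto simp: mem_trees)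
    thus ?thesis using add_root by (auto intro!: sp)
  next
    case (scl_root p m xs c)
    have "((p, scl M c m), xs) \<in> trees M N n d" using scl_root gmodD(6)[OF M(1)] by (auto simp: mem_trees)
    thus ?thesis using scl_root by (auto intro!: sp)
  next
    case (add_leaf r xs s e x ys x')
    have "(r, xs @ (s, e, x + x') # ys) \<in> trees M N n d"
      using add_leaf gmodD(4)[OF N(1)] by (cases r) (auto simp: mem_trees)
    thus ?thesis using add_leaf by (auto intro!: sp)
  next
    case (scl_leaf r xs s e x ys c)
    have "(r, xs @ (s, e, scl N c x) # ys) \<in> trees M N n d"
      using scl_leaf gmodD(6)[OF N(1)] by (cases r) (auto simp: mem_trees)
    thus ?thesis using scl_leaf by (auto intro!: sp)
  next
    case (sym_root p m xs \<sigma>)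
    have "act M (length xs) p \<sigma> m \<in> grd M (length xs) p"
      using sym_root M(2) by (auto simp: acl_def mem_trees)
    hence "((p, act M (length xs) p \<sigma> m), permute_list \<sigma> xs) \<in> trees M N n d"
      using trees_permute[OF sym_root(2) mset_permute_list[OF sym_root(3)]] by blast
    thus ?thesis using sym_root by (auto intro!: sp)
  next
    case (sym_leaf r xs s e x ys \<sigma>)
    have "act N (length s) e \<sigma> x \<in> grd N (length s) e"
      using sym_leaf N(2) by (cases r) (auto simp: acl_def mem_trees)
    hence "(r, xs @ (permute_list \<sigma> s, e, act N (length s) e \<sigma> x) # ys) \<in> trees M N n d"
      using sym_leaf by (cases r) (simp add: mem_trees_mset)
    thus ?thesis using sym_leaf by (auto intro!: sp)
  qed
qed

text \<open>The chosen representative differs from a combination of trees by an element of the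
  relations, and these are combinations of trees themselves. This is what makes the expansion of
  leaves in \<open>assoc\<close> meaningful.\<close>

lemma keys_circ:
  assumes "gmod M" "acl M" "gmod N" "acl N" "u \<in> grd (circ M N) n d"
  shows "Poly_Mapping.keys u \<subseteq> trees M N n d"
proof -
  let ?S = "PM.span (sgl ` trees M N n d)"
  have "comp_rels M N n d \<subseteq> ?S" using comp_rels_span[OF assms(1-4)] by blast
  hence R: "comp_rel M N n d \<subseteq> ?S" unfolding comp_rel_def by (metis PM.span_minimal PM.subspace_span)
  obtain v where v: "v \<in> ?S" "u = qproj psc (comp_rel M N n d) v"
    using assms(5) by (auto simp: circ_def quotient_def free_comp_def)
  have "v - u \<in> comp_rel M N n d" using qproj_comp(2)[of v M N n d] v(2) by simp
  hence "v - (v - u) \<in> ?S" using R by (rule PM.span_diff[OF v(1) subsetD, rotated])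
  thus ?thesis using keys_span_single[of u] by simp
qed

lemma cls_add_leaf_app:
  assumes "((p, m), xs @ (s, e, x) # ys) \<in> trees M N n d" "x' \<in> grd N (length s) e"
  shows "cls M N n d ((p, m), xs @ (s, e, x + x') # ys) =
    cls M N n d ((p, m), xs @ (s, e, x) # ys) + cls M N n d ((p, m), xs @ (s, e, x') # ys)"
  using cls_add_leaf[OF assms(1), of "length xs" s e x x x'] assms by (auto simp: mem_trees)

lemma cls_scl_leaf_app:
  assumes "((p, m), xs @ (s, e, x) # ys) \<in> trees M N n d"
  shows "cls M N n d ((p, m), xs @ (s, e, scl N c x) # ys) = psc c (cls M N n d ((p, m), xs @ (s, e, x) # ys))"
  using cls_scl_leaf[OF assms, of "length xs" s e x x c] assms by (auto simp: mem_trees)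

lemma cls_sym_leaf_app:
  assumes "((p, m), xs @ (s, e, x) # ys) \<in> trees M N n d" "\<sigma> permutes {..<length s}"
  shows "cls M N n d ((p, m), xs @ (permute_list \<sigma> s, e, act N (length s) e \<sigma> x) # ys) =
    cls M N n d ((p, m), xs @ (s, e, x) # ys)"
  using cls_sym_leaf[OF assms(1), of "length xs" s e x \<sigma>] assms by auto

text \<open>Used with \<open>inv \<sigma>\<close> for the action of a permutation, and with
  \<open>(!) s\<close> for substituting the label list \<open>s\<close> of a leaf into the tree
  sitting there.\<close>

definition rl :: "(nat \<Rightarrow> nat) \<Rightarrow> (nat list \<times> 'y) list \<Rightarrow> (nat list \<times> 'y) list" where
  "rl g = map (\<lambda>(s, y). (map g s, y))"

lemma rl_simps [simp]:
  "rl g [] = []" "rl g ((s, y) # xs) = (map g s, y) # rl g xs" "rl g (xs @ ys) = rl g xs @ rl g ys"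
  "length (rl g xs) = length xs" "rl g (xs[l := (s, y)]) = (rl g xs)[l := (map g s, y)]"
  "i < length xs \<Longrightarrow> rl g xs ! i = (map g (fst (xs ! i)), snd (xs ! i))"
  "map fst (rl g xs) = map (map g) (map fst xs)"
  "map snd (rl g xs) = map snd xs"
  by (auto simp: rl_def map_update split_beta)

lemma degs_rl [simp]: "degs (rl g xs) = degs xs"
  by (induction xs) auto

lemma rl_permute: "\<sigma> permutes {..<length xs} \<Longrightarrow> rl g (permute_list \<sigma> xs) = permute_list \<sigma> (rl g xs)"
  by (simp add: rl_def permute_list_map)

lemma rl_degrees [simp]: "map edeg (rl g xs) = map edeg xs"
  by (simp add: rl_def split_beta)

lemma rl_trees:
  assumes "((p, m), xs) \<in> trees M N n d" "g permutes {..<n}"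
  shows "((p, m), rl g xs) \<in> trees M N n d"
proof -
  have "mset (concat (map fst (rl g xs))) = image_mset g (mset (concat (map fst xs)))"
    unfolding rl_simps(7) map_concat[symmetric] by simp
  also have "\<dots> = image_mset g (mset_set {..<n})"
    using assms(1) by (simp add: mem_trees_mset atLeast0LessThan)
  also have "\<dots> = mset_set {..<n}" by (rule permutes_image_mset[OF assms(2)])
  finally have "mset (concat (map fst (rl g xs))) = mset [0..<n]" by (simp add: atLeast0LessThan)
  moreover have "\<forall>(s, e, x)\<in>set (rl g xs). x \<in> grd N (length s) e"
    using assms(1) by (auto simp: mem_trees rl_def)
  ultimately show ?thesis using assms(1) by (simp add: mem_trees_mset)
qed

lemma act_circ_cls:
  fixes M :: "('k::field, 'm::ab_group_add) dgs" and N :: "('k, 'n::ab_group_add) dgs"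
  assumes \<sigma>: "\<sigma> permutes {..<n}"
  shows "act (circ M N) n d \<sigma> (cls M N n d (r, xs)) = cls M N n d (r, rl (inv \<sigma>) xs)"
proof -
  let ?q = "qproj psc (comp_rel M N n d)"
  interpret L: Vector_Spaces.linear psc psc ?q by (rule qproj_comp(1))
  let ?g = "inv \<sigma>"
  let ?F = "\<lambda>(r, xs). cls M N n d (r, rl ?g xs)"
  have inv: "?g permutes {..<n}" using \<sigma> by (rule permutes_inv)
  note T = rl_trees[OF _ inv]
  have "lext ?F u = 0" if "u \<in> comp_rel M N n d" for u
  proof (rule lext_comp_rel[OF _ _ _ _ _ _ that])
    fix p m m' xs assume "((p, m), xs) \<in> trees M N n d" "((p, m'), xs) \<in> trees M N n d"
    thus "?F ((p, m + m'), xs) = ?F ((p, m), xs) + ?F ((p, m'), xs)"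
      using cls_add_root[OF T, of p m xs M N d m'] by (auto simp: mem_trees)
  next
    fix p m c xs assume "((p, m), xs) \<in> trees M N n d"
    thus "?F ((p, scl M c m), xs) = psc c (?F ((p, m), xs))"
      using cls_scl_root[OF T] by auto
  next
    fix p m xs l s e x x' assume *: "((p, m), xs) \<in> trees M N n d" "l < length xs" "xs ! l = (s, e, x)"
      "x \<in> grd N (length s) e" "x' \<in> grd N (length s) e"
    have "rl ?g xs ! l = (map ?g s, e, x)" using * by simp
    thus "?F ((p, m), xs[l := (s, e, x + x')]) = ?F ((p, m), xs) + ?F ((p, m), xs[l := (s, e, x')])"
      using cls_add_leaf[OF T[OF *(1)], of l "map ?g s" e x x x'] * list_update_id[of "rl ?g xs" l] by simp
  next
    fix p m xs l s e x c assume *: "((p, m), xs) \<in> trees M N n d" "l < length xs" "xs ! l = (s, e, x)"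
      "x \<in> grd N (length s) e"
    have "rl ?g xs ! l = (map ?g s, e, x)" using * by simp
    thus "?F ((p, m), xs[l := (s, e, scl N c x)]) = psc c (?F ((p, m), xs))"
      using cls_scl_leaf[OF T[OF *(1)], of l "map ?g s" e x x c] * list_update_id[of "rl ?g xs" l] by simp
  next
    fix p m xs \<tau> assume *: "((p, m), xs) \<in> trees M N n d" "\<tau> permutes {..<length xs}"
    thus "?F ((p, act M (length xs) p \<tau> m), permute_list \<tau> xs) =
        psc (koszul \<tau> (map edeg xs)) (?F ((p, m), xs))"
      using cls_sym_root[OF T[OF *(1)], of \<tau>] by (simp add: rl_permute)
  next
    fix p m xs l s e x \<tau> assume *: "((p, m), xs) \<in> trees M N n d" "l < length xs" "xs ! l = (s, e, x)"
      "x \<in> grd N (length s) e" "\<tau> permutes {..<length s}"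
    have "rl ?g xs ! l = (map ?g s, e, x)" using * by simp
    thus "?F ((p, m), xs[l := (permute_list \<tau> s, e, act N (length s) e \<tau> x)]) = ?F ((p, m), xs)"
      using cls_sym_leaf[OF T[OF *(1)], of l "map ?g s" e x \<tau>] * by (simp add: permute_list_map)
  qed
  hence "lext ?F (cls M N n d (r, xs)) = ?F (r, xs)" by (rule lext_cls)
  moreover have "?q (lext (\<lambda>(r, xs). sgl (r, rl ?g xs)) x) = lext ?F x" for x
    unfolding lext_def L.sum L.scale by (simp add: cls_def split_beta)
  ultimately show ?thesis unfolding act_circ rl_def[symmetric] by simp
qed

section \<open>Grafting a row of trees\<close>

definition rdeg :: "('n, 'l) tree list \<Rightarrow> int" where
  "rdeg us = (\<Sum>u\<leftarrow>us. fst (fst u))"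

definition ldeg :: "('n, 'l) tree list \<Rightarrow> int" where
  "ldeg us = (\<Sum>u\<leftarrow>us. degs (snd u))"

definition lcnt :: "('n, 'l) tree list \<Rightarrow> nat" where
  "lcnt us = (\<Sum>u\<leftarrow>us. length (snd u))"

text \<open>The parity of \<open>aexp us\<close> gives the sign of moving the roots of \<open>us\<close> to the left of their leaves.\<close>

primrec aexp :: "('n, 'l) tree list \<Rightarrow> int" where
  "aexp [] = 0"
| "aexp (u # us) = degs (snd u) * rdeg us + aexp us"

text \<open>The first label \<open>c\<close> is a parameter because a tree in the middle of the row
  shifts the label blocks of all trees to its right.\<close>

primrec topl :: "nat \<Rightarrow> ('n, 'l) tree list \<Rightarrow> (nat list \<times> int \<times> 'n) list" where
  "topl c [] = []"
| "topl c (u # us) = ([c..<c + length (snd u)], fst u) # topl (c + length (snd u)) us"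

text \<open>The leaves of the grafted tree: labels inside an inner tree index into the label list of
  the outer leaf that carries it.\<close>

definition alv :: "nat list list \<Rightarrow> ('n, 'l) tree list \<Rightarrow> (nat list \<times> int \<times> 'l) list" where
  "alv ss us = concat (map2 (\<lambda>s u. rl ((!) s) (snd u)) ss us)"

lemma udeg_simps [simp]:
  "rdeg [] = 0" "rdeg (u # us) = fst (fst u) + rdeg us" "rdeg (us @ vs) = rdeg us + rdeg vs"
  "ldeg [] = 0" "ldeg (u # us) = degs (snd u) + ldeg us" "ldeg (us @ vs) = ldeg us + ldeg vs"
  "lcnt [] = 0" "lcnt (u # us) = length (snd u) + lcnt us" "lcnt (us @ vs) = lcnt us + lcnt vs"
  by (auto simp: rdeg_def ldeg_def lcnt_def)

lemma aexp_append [simp]: "aexp (us @ vs) = aexp us + aexp vs + ldeg us * rdeg vs"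
  by (induction us) (auto simp: algebra_simps)

lemma topl_append [simp]: "topl c (us @ vs) = topl c us @ topl (c + lcnt us) vs"
  by (induction us arbitrary: c) (auto simp: add.assoc)

lemma length_topl [simp]: "length (topl c us) = length us"
  by (induction us arbitrary: c) auto

lemma alv_simps [simp]:
  "alv [] us = []" "alv ss [] = []" "alv (s # ss) (u # us) = rl ((!) s) (snd u) @ alv ss us"
  "length ss = length us \<Longrightarrow> alv (ss @ ss') (us @ us') = alv ss us @ alv ss' us'"
  by (auto simp: alv_def)

lemma length_alv: "length ss = length us \<Longrightarrow> length (alv ss us) = lcnt us"
  by (induction ss us rule: list_induct2) auto

lemma degs_alv: "length ss = length us \<Longrightarrow> degs (alv ss us) = ldeg us"
  by (induction ss us rule: list_induct2) auto

lemma degs_topl: "degs (topl c us) = rdeg us"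
  by (induction us arbitrary: c) (auto simp: degs_def)

lemma labels_topl: "concat (map fst (topl c us)) = [c..<c + lcnt us]"
proof (induction us arbitrary: c)
  case (Cons u us)
  thus ?case using upt_add_eq_append[of c "c + length (snd u)" "lcnt us"] by (simp add: add.assoc)
qed simp

lemma lcnt_take: "j \<le> length us \<Longrightarrow> lcnt (take j us) = (\<Sum>i<j. length (snd (us ! i)))"
  by (simp add: lcnt_def sum_list_sum_nth atLeast0LessThan min_def)

lemma lcnt_eq: "lcnt us = (\<Sum>i<length us. length (snd (us ! i)))"
  by (simp add: lcnt_def sum_list_sum_nth atLeast0LessThan)

lemma rdeg_eq: "rdeg us = (\<Sum>i<length us. fst (fst (us ! i)))"
  by (simp add: rdeg_def sum_list_sum_nth atLeast0LessThan)

lemma aexp_eq: "aexp us = (\<Sum>j<length us. fst (fst (us ! j)) * (\<Sum>i<j. degs (snd (us ! i))))"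
proof (induction us)
  case (Cons u us)
  show ?case
    by (simp add: Cons sum.lessThan_Suc_shift rdeg_eq sum_distrib_left distrib_left sum.distrib
        mult.commute del: sum.lessThan_Suc)
qed simp

text \<open>The positions occupied by the leaves of the \<open>i\<close>-th tree in the concatenated
  row of leaves.\<close>

definition bl :: "('n, 'l) tree list \<Rightarrow> nat \<Rightarrow> nat list" where
  "bl us i = [lcnt (take i us)..<lcnt (take (Suc i) us)]"

lemma topl_nth: "j < length us \<Longrightarrow>
  topl c us ! j = ([c + lcnt (take j us)..<c + lcnt (take (Suc j) us)], fst (us ! j))"
proof (induction us arbitrary: c j)
  case (Cons u us)
  thus ?case by (cases j) (auto simp: add.assoc)
qed simp

lemma topl_bl: "topl 0 us = map (\<lambda>j. (bl us j, fst (us ! j))) [0..<length us]"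
  by (intro nth_equalityI) (auto simp: topl_nth bl_def)

definition atop :: "('k::field, 'm::plus) dgs \<Rightarrow> ('k, 'n::plus) dgs \<Rightarrow> int \<times> 'm \<Rightarrow> ('n, 'l) tree list \<Rightarrow>
    ('m, 'n) tree \<Rightarrow>\<^sub>0 'k" where
  "atop M N r us = cls M N (lcnt us) (fst r + rdeg us) (r, topl 0 us)"

text \<open>The value of the associativity isomorphism when every leaf is a single tree, with the
  sign of moving all their roots to the left.\<close>

definition agraft :: "('k::field, 'm::plus) dgs \<Rightarrow> ('k, 'n::plus) dgs \<Rightarrow> ('k, 'l::plus) dgs \<Rightarrow> nat \<Rightarrow> int \<Rightarrow>
    int \<times> 'm \<Rightarrow> nat list list \<Rightarrow> ('n, 'l) tree list \<Rightarrow> (('m, 'n) tree \<Rightarrow>\<^sub>0 'k, 'l) tree \<Rightarrow>\<^sub>0 'k" where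
  "agraft M N L n d r ss us = psc ((-1) powi aexp us)
     (cls (circ M N) L n d ((fst r + rdeg us, atop M N r us), alv ss us))"

definition aext :: "('k::field, 'm::plus) dgs \<Rightarrow> ('k, 'n::plus) dgs \<Rightarrow> ('k, 'l::plus) dgs \<Rightarrow> nat \<Rightarrow> int \<Rightarrow>
    ('m, ('n, 'l) tree \<Rightarrow>\<^sub>0 'k) tree \<Rightarrow> (('m, 'n) tree \<Rightarrow>\<^sub>0 'k, 'l) tree \<Rightarrow>\<^sub>0 'k" where
  "aext M N L n d = (\<lambda>(r, xs). mext (agraft M N L n d r (map fst xs)) (map (\<lambda>(s, e, u). u) xs))"

lemma alv_concat: "length ss = length us \<Longrightarrow>
  alv ss us = concat (map (\<lambda>j. rl ((!) (ss ! j)) (snd (us ! j))) [0..<length us])"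
  unfolding alv_def by (intro arg_cong[of _ _ concat] nth_equalityI) auto

lemma assoc_alt:
  fixes M :: "('k::field, 'm::plus) dgs" and N :: "('k, 'n::plus) dgs" and L :: "('k, 'l::plus) dgs"
  shows "assoc M N L = (\<lambda>n d. lext (aext M N L n d))"
proof (intro ext)
  fix n d x
  define T where "T = (\<lambda>p (m :: 'm) (xs :: (nat list \<times> int \<times> (('n, 'l) tree \<Rightarrow>\<^sub>0 'k)) list) (us :: ('n, 'l) tree list).
       (let k = length xs; root = (\<lambda>j. fst (us ! j)); leaves = (\<lambda>j. snd (us ! j));
           coef = (\<Prod>j<k. Poly_Mapping.lookup (snd (snd (xs ! j))) (us ! j));
           sign = (\<Prod>j<k. (-1) powi (fst (root j) * (\<Sum>i<j. degs (leaves i))));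
           offset = (\<lambda>j. \<Sum>i<j. length (leaves i));
           deg = p + (\<Sum>j<k. fst (root j));
           top = cls M N (offset k) deg
             ((p, m), map (\<lambda>j. ([offset j..<offset (Suc j)], root j)) [0..<k])
       in psc (coef * sign)
            (cls (circ M N) L n d
              ((deg, top),
               concat (map (\<lambda>j. map (\<lambda>(s, y). (map ((!) (fst (xs ! j))) s, y)) (leaves j)) [0..<k])))))"
  have T: "T p m xs us
     = psc (\<Prod>j<length xs. Poly_Mapping.lookup (snd (snd (xs ! j))) (us ! j)) (agraft M N L n d (p, m) (map fst xs) us)"
    if "length us = length xs" for xs p m us
  proof -
    have t: "map (\<lambda>j. ([\<Sum>i<j. length (snd (us ! i))..<\<Sum>i<Suc j. length (snd (us ! i))], fst (us ! j))) [0..<length xs]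
        = topl 0 us"
      unfolding topl_bl bl_def that[symmetric]
      by (intro map_cong refl) (simp del: sum.lessThan_Suc add: lcnt_take)
    have c: "concat (map (\<lambda>j. map (\<lambda>(s, y). (map ((!) (fst (xs ! j))) s, y)) (snd (us ! j))) [0..<length xs]) =
        alv (map fst xs) us"
      using that by (subst alv_concat) (auto simp: rl_def intro!: arg_cong[of _ _ concat])
    have n: "(\<Sum>j<length xs. length (snd (us ! j))) = lcnt us" "(\<Sum>j<length xs. fst (fst (us ! j))) = rdeg us"
      by (simp_all only: that[symmetric] lcnt_eq rdeg_eq)
    have "(\<Prod>j<length xs. (-1) powi (fst (fst (us ! j)) * (\<Sum>i<j. degs (snd (us ! i))))) = ((-1) powi aexp us :: 'k)"
      by (simp add: aexp_eq powi_m1_sum that)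
    thus ?thesis
      unfolding T_def Let_def t c n agraft_def atop_def by simp
  qed
  have main: "(\<Sum>us\<in>listset (map (\<lambda>(t, e, u). Poly_Mapping.keys u) xs). T p m xs us) =
      mext (agraft M N L n d (p, m) (map fst xs)) (map (\<lambda>(s, e, u). u) xs)" for p m xs
  proof -
    have l: "length us = length xs" if "us \<in> listset (map (\<lambda>(t, e, u). Poly_Mapping.keys u) xs)"
      for us and xs :: "(nat list \<times> int \<times> (('n, 'l) tree \<Rightarrow>\<^sub>0 'k)) list"
      using that by (induction xs arbitrary: us) (auto simp: set_Cons_def)
    have k: "map Poly_Mapping.keys (map (\<lambda>(s, e, u). u) xs) = map (\<lambda>(t, e, u). Poly_Mapping.keys u) xs"
      by auto
    show ?thesis
      unfolding mext_listset k
      by (rule sum.cong[OF refl], subst T[OF l]) (auto simp: split_beta intro!: arg_cong2[of _ _ _ _ psc] prod.cong)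
  qed
  have "assoc M N L n d x = lext (\<lambda>((p, m), xs).
      \<Sum>us\<in>listset (map (\<lambda>(t, e, u). Poly_Mapping.keys u) xs). T p m xs us) x"
    by (simp only: assoc_def T_def)
  also have "\<dots> = lext (aext M N L n d) x"
    unfolding aext_def main by (rule arg_cong2[of _ _ _ _ lext]) auto
  finally show "assoc M N L n d x = lext (aext M N L n d) x" .
qed

definition uok :: "('k, 'n) dgs \<Rightarrow> ('k, 'l) dgs \<Rightarrow> nat list \<times> int \<Rightarrow> ('n, 'l) tree \<Rightarrow> bool" where
  "uok N L = (\<lambda>(s, e) u. u \<in> trees N L (length s) e)"

lemma rl_nth_labels:
  assumes "mset (concat (map fst xs)) = mset [0..<length s]"
  shows "mset (concat (map fst (rl ((!) s) xs))) = mset s"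
proof -
  have "mset (concat (map fst (rl ((!) s) xs))) = image_mset ((!) s) (mset [0..<length s])"
    unfolding rl_simps(7) map_concat[symmetric] mset_map assms ..
  also have "\<dots> = mset s" by (metis map_nth mset_map)
  finally show ?thesis .
qed

lemma rl_id: "(\<And>i. i \<in> set (concat (map fst xs)) \<Longrightarrow> g i = i) \<Longrightarrow> rl g xs = xs"
  by (induction xs) (auto intro!: map_idI)

lemma uok_simps [simp]: "uok N L (s, e) u \<longleftrightarrow> u \<in> trees N L (length s) e"
  by (simp add: uok_def)

lemma uok_facts:
  assumes "list_all2 (uok N L) se us"
  shows "mset (concat (map fst (alv (map fst se) us))) = mset (concat (map fst se))" (is ?g1)
    "rdeg us + ldeg us = sum_list (map snd se)"
    "\<forall>(s, e, x)\<in>set (topl c us). x \<in> grd N (length s) e" (is ?g3)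
    "\<forall>(s, e, x)\<in>set (alv (map fst se) us). x \<in> grd L (length s) e" (is ?g4)
proof -
  show ?g1
    using assms
  proof (induction rule: list_all2_induct)
    case (Cons x xs y ys)
    obtain s e q \<mu> zs where "x = (s, e)" "y = ((q, \<mu>), zs)" by (cases x; cases y) auto
    thus ?case using Cons rl_nth_labels[of zs s] by (simp add: mem_trees_mset)
  qed simp
  show "rdeg us + ldeg us = sum_list (map snd se)"
    using assms
  proof (induction rule: list_all2_induct)
    case (Cons x xs y ys)
    obtain s e q \<mu> zs where "x = (s, e)" "y = ((q, \<mu>), zs)" by (cases x; cases y) auto
    thus ?case using Cons by (simp add: mem_trees)
  qed simp
  show ?g3
    using assms
  proof (induction arbitrary: c rule: list_all2_induct)
    case (Cons x xs y ys)
    obtain s e q \<mu> zs where "x = (s, e)" "y = ((q, \<mu>), zs)" by (cases x; cases y) auto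
    thus ?case using Cons by (simp add: mem_trees)
  qed simp
  show ?g4
    using assms
  proof (induction rule: list_all2_induct)
    case (Cons x xs y ys)
    obtain s e q \<mu> zs where *: "x = (s, e)" "y = ((q, \<mu>), zs)" by (cases x; cases y) auto
    have "\<forall>(s, e, x)\<in>set (rl ((!) s) zs). x \<in> grd L (length s) e"
      using Cons(1) * by (auto simp: mem_trees rl_def)
    thus ?case using Cons * by (auto simp: ball_Un)
  qed simp
qed

lemma atop_trees:
  assumes "m \<in> grd M (length us) p" "list_all2 (uok N L) se us"
  shows "((p, m), topl 0 us) \<in> trees M N (lcnt us) (p + rdeg us)"
  using assms uok_facts(3)[OF assms(2)] by (simp add: mem_trees_mset labels_topl degs_topl)

lemma agraft_trees:
  fixes M :: "('k::field, 'm::plus) dgs" and N :: "('k, 'n::plus) dgs"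
  assumes "m \<in> grd M (length us) p" "list_all2 (uok N L) se us"
    "mset (concat (map fst se)) = mset [0..<n]" "p + sum_list (map snd se) = d"
  shows "((p + rdeg us, atop M N (p, m) us), alv (map fst se) us) \<in> trees (circ M N) L n d"
proof -
  have l: "length (map fst se) = length us" using assms(2) by (simp add: list_all2_lengthD)
  show ?thesis
    using cls_in_circ[OF atop_trees[OF assms(1,2)]] uok_facts[OF assms(2)] assms(3,4) l
    by (auto simp: mem_trees_mset length_alv degs_alv atop_def)
qed

text \<open>The permutation \<open>\<rho>\<close> extends a permutation \<open>\<tau>\<close> of the
  leaves of one inner tree by the identity to all leaves of the grafted tree, hence has the Koszul
  sign of \<open>\<tau>\<close>. The statements on \<open>inv \<rho>\<close> describe its effect on
  the consecutive label blocks of the top.\<close>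

lemma permute_block:
  fixes as xs bs :: "'x list"
  assumes \<tau>: "\<tau> permutes {..<length xs}"
  defines "\<rho> \<equiv> \<lambda>x. if length as \<le> x \<and> x < length as + length xs then length as + \<tau> (x - length as) else x"
  shows "\<rho> permutes {..<length as + length xs + length bs}"
    and "permute_list \<rho> (as @ xs @ bs) = as @ permute_list \<tau> xs @ bs" (is ?g2)
    and "permute_list \<tau> (map (inv \<rho>) [length as..<length as + length xs]) = [length as..<length as + length xs]"
    and "map (inv \<rho>) [0..<length as] = [0..<length as]"
    and "map (inv \<rho>) [length as + length xs..<n] = [length as + length xs..<n]"
    and "length ds = length as \<Longrightarrow> length es = length xs \<Longrightarrow> length fs = length bs \<Longrightarrow>
      koszul \<rho> (ds @ es @ fs) = (koszul \<tau> es :: 'k::field)"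
proof -
  let ?a = "length as" and ?c = "length xs" and ?b = "length bs"
  have lt: "\<tau> i < ?c" if "i < ?c" for i using permutes_in_image[OF \<tau>] that by auto
  have inj: "\<tau> i = \<tau> j \<longleftrightarrow> i = j" for i j using permutes_inj[OF \<tau>] by (auto simp: inj_def)
  have \<rho>in: "\<rho> (?a + i) = ?a + \<tau> i" if "i < ?c" for i using that by (simp add: \<rho>_def)
  show p: "\<rho> permutes {..<?a + ?c + ?b}"
  proof (rule inj_imp_permutes)
    show "inj_on \<rho> {..<?a + ?c + ?b}"
    proof (rule inj_onI)
      fix x y assume e: "\<rho> x = \<rho> y"
      show "x = y"
      proof (cases "?a \<le> x \<and> x < ?a + ?c")
        case True
        hence "\<tau> (x - ?a) < ?c" by (intro lt) auto
        hence y: "?a \<le> y \<and> y < ?a + ?c" using True e by (auto simp: \<rho>_def split: if_splits)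
        hence "\<tau> (x - ?a) = \<tau> (y - ?a)" using True e by (simp add: \<rho>_def)
        hence "x - ?a = y - ?a" using inj by simp
        thus ?thesis using True y by linarith
      next
        case False
        show ?thesis
        proof (cases "?a \<le> y \<and> y < ?a + ?c")
          case True
          hence "\<tau> (y - ?a) < ?c" by (intro lt) auto
          thus ?thesis using True False e by (auto simp: \<rho>_def split: if_splits)
        qed (use False e in \<open>auto simp: \<rho>_def split: if_splits\<close>)
      qed
    qed
    show "\<rho> x \<in> {..<?a + ?c + ?b}" if "x \<in> {..<?a + ?c + ?b}" for x
    proof (cases "?a \<le> x \<and> x < ?a + ?c")
      case True
      hence "\<tau> (x - ?a) < ?c" by (intro lt) auto
      thus ?thesis using True by (simp add: \<rho>_def)
    qed (use that in \<open>auto simp: \<rho>_def\<close>)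
    show "\<rho> x = x" if "x \<notin> {..<?a + ?c + ?b}" for x using that by (auto simp: \<rho>_def)
  qed simp
  show ?g2
  proof (rule nth_equalityI)
    fix i assume i: "i < length (permute_list \<rho> (as @ xs @ bs))"
    have "permute_list \<rho> (as @ xs @ bs) ! i = (as @ xs @ bs) ! \<rho> i"
      using i p by (intro permute_list_nth) (auto simp: add.assoc)
    also have "\<dots> = (as @ permute_list \<tau> xs @ bs) ! i"
      using i lt[of "i - ?a"] by (auto simp: \<rho>_def nth_append permute_list_nth[OF \<tau>])
    finally show "permute_list \<rho> (as @ xs @ bs) ! i = (as @ permute_list \<tau> xs @ bs) ! i" .
  qed simp
  have inv\<rho>: "inv \<rho> (\<rho> x) = x" for x by (rule permutes_inverses(2)[OF p])
  show "permute_list \<tau> (map (inv \<rho>) [?a..<?a + ?c]) = [?a..<?a + ?c]"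
  proof (rule nth_equalityI)
    fix i assume i: "i < length (permute_list \<tau> (map (inv \<rho>) [?a..<?a + ?c]))"
    have "permute_list \<tau> (map (inv \<rho>) [?a..<?a + ?c]) ! i = inv \<rho> (?a + \<tau> i)"
      using i lt[of i] \<tau> by (subst permute_list_nth) auto
    also have "\<dots> = ?a + i" using \<rho>in[of i] inv\<rho>[of "?a + i"] i by simp
    finally show "permute_list \<tau> (map (inv \<rho>) [?a..<?a + ?c]) ! i = [?a..<?a + ?c] ! i" using i by simp
  qed simp
  have out: "inv \<rho> x = x" if "x < ?a \<or> ?a + ?c \<le> x" for x
    using inv\<rho>[of x] that by (auto simp: \<rho>_def)
  show "map (inv \<rho>) [0..<?a] = [0..<?a]"
    by (rule map_idI) (simp add: out)
  show "map (inv \<rho>) [?a + ?c..<n] = [?a + ?c..<n]"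
    by (rule map_idI) (simp add: out)
  assume l: "length ds = ?a" "length es = ?c" "length fs = ?b"
  have k1: "map \<rho> [0..<?a + ?c + ?b] = [0..<?a] @ map (\<lambda>x. ?a + x) (map \<tau> [0..<?c]) @ [?a + ?c..<?a + ?c + ?b]"
    by (intro nth_equalityI) (auto simp: nth_append \<rho>_def)
  have k2: "koszul \<rho> (ds @ es @ fs) = kosl (ds @ es @ fs) (map \<rho> [0..<?a + ?c + ?b])"
    using koszul_kosl[of \<rho> "ds @ es @ fs"] p l by (simp add: add.assoc)
  have k3: "kosl (ds @ es @ fs) (map (\<lambda>x. ?a + x) (map \<tau> [0..<?c])) = (kosl es (map \<tau> [0..<?c]) :: 'k)"
  proof -
    have "x < length es" if "x \<in> set (map \<tau> [0..<?c])" for x using that lt l by auto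
    from kosl_shift[OF this, where as = ds and bs = fs] show ?thesis unfolding l .
  qed
  have k4: "kcross (ds @ es @ fs) [0..<?a] (map (\<lambda>x. ?a + x) (map \<tau> [0..<?c]) @ [?a + ?c..<?a + ?c + ?b]) = (1 :: 'k)"
    "kcross (ds @ es @ fs) (map (\<lambda>x. ?a + x) (map \<tau> [0..<?c])) [?a + ?c..<?a + ?c + ?b] = (1 :: 'k)"
  proof -
    show "kcross (ds @ es @ fs) [0..<?a] (map (\<lambda>x. ?a + x) (map \<tau> [0..<?c]) @ [?a + ?c..<?a + ?c + ?b]) = (1 :: 'k)"
      by (rule kcross_less) auto
    show "kcross (ds @ es @ fs) (map (\<lambda>x. ?a + x) (map \<tau> [0..<?c])) [?a + ?c..<?a + ?c + ?b] = (1 :: 'k)"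
    proof (rule kcross_less)
      fix x y assume x: "x \<in> set (map (\<lambda>x. ?a + x) (map \<tau> [0..<?c]))" and y: "y \<in> set [?a + ?c..<?a + ?c + ?b]"
      obtain i where "i < ?c" "x = ?a + \<tau> i" using x by auto
      thus "x < y" using lt[of i] y by simp
    qed
  qed
  have k6: "koszul \<tau> es = (kosl es (map \<tau> [0..<?c]) :: 'k)"
    using koszul_kosl[of \<tau> es] \<tau> l by simp
  show "koszul \<rho> (ds @ es @ fs) = (koszul \<tau> es :: 'k)"
    unfolding k2 k1 kosl_append k3 k4 k6 by (simp add: kosl_sorted)
qed

text \<open>A relation in one inner tree becomes a relation of the grafted tree. At the inner root,
  sums and multiples are leaf relations of the top and then root relations of the whole; at inner
  leaves they remain leaf relations. A permutation of the inner leaves extends to a block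
  permutation acting on the top, absorbed by the symmetry relation at the new root.\<close>

lemma lext_agraft_slot:
  fixes M :: "('k::field, 'm::ab_group_add) dgs" and N :: "('k, 'n::ab_group_add) dgs"
    and L :: "('k, 'l::ab_group_add) dgs"
  assumes m: "m \<in> grd M (Suc (length us + length vs)) p"
    and us: "list_all2 (uok N L) se us" and vs: "list_all2 (uok N L) se' vs"
    and lab: "mset (concat (map fst (se @ (s, e) # se'))) = mset [0..<n]"
    and deg: "p + sum_list (map snd (se @ (s, e) # se')) = d"
    and r: "r \<in> comp_rel N L (length s) e"
  shows "lext (\<lambda>t. agraft M N L n d (p, m) (map fst (se @ (s, e) # se')) (us @ t # vs)) r = 0"
proof (rule lext_comp_rel[OF _ _ _ _ _ _ r])
  let ?G = "\<lambda>t. agraft M N L n d (p, m) (map fst (se @ (s, e) # se')) (us @ t # vs)"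
  define F where "F = ?G"
  define A1 A2 where "A1 = alv (map fst se) us" and "A2 = alv (map fst se') vs"
  define D where "D = (\<lambda>q. p + (rdeg us + (q + rdeg vs)))"
  define c where "c = lcnt us"
  define K where "K = (\<lambda>l. c + (l + lcnt vs))"
  define TL where "TL = (\<lambda>q \<mu> l. topl 0 us @ ([c..<c + l], q :: int, \<mu> :: 'n) # topl (c + l) vs)"
  define T where "T = (\<lambda>q \<mu> l. cls M N (K l) (D q) ((p, m), TL q \<mu> l))"
  define sg where "sg = (\<lambda>q b. (-1 :: 'k) powi (aexp us + ldeg us * (q + rdeg vs) + b * rdeg vs + aexp vs))"
  define C where "C = cls (circ M N) L n d"
  have l1: "length se = length us" "length se' = length vs" using us vs by (auto dest: list_all2_lengthD)
  have lA1: "length A1 = c" unfolding A1_def c_def using l1 by (simp add: length_alv)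
  have Fe: "F ((q, \<mu>), xs) = psc (sg q (degs xs)) (C ((D q, T q \<mu> (length xs)), A1 @ rl ((!) s) xs @ A2))" for q \<mu> xs
    using l1 by (simp add: F_def agraft_def atop_def sg_def C_def D_def T_def K_def TL_def A1_def A2_def c_def
        algebra_simps)
  have all: "list_all2 (uok N L) (se @ (s, e) # se') (us @ t # vs)" if "t \<in> trees N L (length s) e" for t
    using us vs that by (auto intro!: list_all2_appendI)
  have TLt: "((p, m), TL q \<mu> (length xs)) \<in> trees M N (K (length xs)) (D q)"
    if "((q, \<mu>), xs) \<in> trees N L (length s) e" for q \<mu> xs
    using atop_trees[OF _ all[OF that], of m M p] m
    by (simp add: TL_def K_def D_def c_def add.assoc)
  have Ct: "((D q, T q \<mu> (length xs)), A1 @ rl ((!) s) xs @ A2) \<in> trees (circ M N) L n d"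
    if "((q, \<mu>), xs) \<in> trees N L (length s) e" for q \<mu> xs
    using agraft_trees[OF _ all[OF that] lab deg, of m M] m l1
    by (simp add: atop_def D_def T_def K_def TL_def A1_def A2_def c_def algebra_simps)
  have Tg: "T q \<mu> (length xs) \<in> grd (circ M N) (length (A1 @ rl ((!) s) xs @ A2)) (D q)"
    if "((q, \<mu>), xs) \<in> trees N L (length s) e" for q \<mu> xs
    using Ct[OF that] by (auto simp: mem_trees)
  have f: "(\<lambda>t. agraft M N L n d (p, m) (map fst (se @ (s, e) # se')) (us @ t # vs)) = F" by (simp add: F_def)
  note F' = f[THEN fun_cong]
  {
    fix q \<mu> \<mu>' xs assume t: "((q, \<mu>), xs) \<in> trees N L (length s) e" "((q, \<mu>'), xs) \<in> trees N L (length s) e"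
    have "T q (\<mu> + \<mu>') (length xs) = T q \<mu> (length xs) + T q \<mu>' (length xs)"
      unfolding T_def TL_def using TLt[OF t(1)] t(2)
      by (intro cls_add_leaf_app) (auto simp: TL_def mem_trees)
    thus "?G ((q, \<mu> + \<mu>'), xs) =
      ?G ((q, \<mu>), xs) +
      ?G ((q, \<mu>'), xs)"
      unfolding F' Fe C_def using cls_add_root[OF Ct[OF t(1)] Tg[OF t(2)]]
      by (simp add: PM.scale_right_distrib)
  next
    fix q \<mu> a xs assume t: "((q, \<mu>), xs) \<in> trees N L (length s) e"
    have "T q (scl N a \<mu>) (length xs) = psc a (T q \<mu> (length xs))"
      unfolding T_def TL_def using TLt[OF t(1)]
      by (intro cls_scl_leaf_app) (auto simp: TL_def)
    thus "?G ((q, scl N a \<mu>), xs) =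
      psc a (?G ((q, \<mu>), xs))"
      unfolding F' Fe C_def using cls_scl_root[OF Ct[OF t(1)], of a]
      by (simp add: mult.commute)
  next
    fix q \<mu> xs l s' e' x x' assume t: "((q, \<mu>), xs) \<in> trees N L (length s) e" "l < length xs"
      "xs ! l = (s', e', x)" "x \<in> grd L (length s') e'" "x' \<in> grd L (length s') e'"
    have d: "degs (xs[l := (s', e', y)]) = degs xs" for y using t by (simp add: degs_update)
    have e: "A1 @ rl ((!) s) (xs[l := (s', e', y)]) @ A2 = (A1 @ rl ((!) s) xs @ A2)[length A1 + l := (map ((!) s) s', e', y)]" for y
      using t(2) by (simp add: list_update_append)
    have n: "(A1 @ rl ((!) s) xs @ A2) ! (length A1 + l) = (map ((!) s) s', e', x)"
      using t(2,3) by (simp add: nth_append)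
    have i: "(A1 @ rl ((!) s) xs @ A2)[length A1 + l := (map ((!) s) s', e', x)] = A1 @ rl ((!) s) xs @ A2"
      using n by (metis list_update_id)
    show "?G ((q, \<mu>), xs[l := (s', e', x + x')]) =
      ?G ((q, \<mu>), xs) +
      ?G ((q, \<mu>), xs[l := (s', e', x')])"
      unfolding F' Fe C_def d e length_list_update
      using cls_add_leaf[OF Ct[OF t(1)] _ n, of x x'] t(2,4,5) i by (simp add: PM.scale_right_distrib)
  next
    fix q \<mu> xs l s' e' x a assume t: "((q, \<mu>), xs) \<in> trees N L (length s) e" "l < length xs"
      "xs ! l = (s', e', x)" "x \<in> grd L (length s') e'"
    have d: "degs (xs[l := (s', e', y)]) = degs xs" for y using t by (simp add: degs_update)
    have e: "A1 @ rl ((!) s) (xs[l := (s', e', y)]) @ A2 = (A1 @ rl ((!) s) xs @ A2)[length A1 + l := (map ((!) s) s', e', y)]" for y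
      using t(2) by (simp add: list_update_append)
    have n: "(A1 @ rl ((!) s) xs @ A2) ! (length A1 + l) = (map ((!) s) s', e', x)"
      using t(2,3) by (simp add: nth_append)
    have i: "(A1 @ rl ((!) s) xs @ A2)[length A1 + l := (map ((!) s) s', e', x)] = A1 @ rl ((!) s) xs @ A2"
      using n by (metis list_update_id)
    show "?G ((q, \<mu>), xs[l := (s', e', scl L a x)]) =
      psc a (?G ((q, \<mu>), xs))"
      unfolding F' Fe C_def d e length_list_update
      using cls_scl_leaf[OF Ct[OF t(1)] _ n, of x a] t(2,4) i by (simp add: mult.commute)
  next
    fix q \<mu> xs l s' e' x \<tau> assume t: "((q, \<mu>), xs) \<in> trees N L (length s) e" "l < length xs"
      "xs ! l = (s', e', x)" "x \<in> grd L (length s') e'" "\<tau> permutes {..<length s'}"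
    have d: "degs (xs[l := (s'', e', y)]) = degs xs" for s'' y using t by (simp add: degs_update)
    have e: "A1 @ rl ((!) s) (xs[l := (permute_list \<tau> s', e', y)]) @ A2 =
        (A1 @ rl ((!) s) xs @ A2)[length A1 + l := (permute_list \<tau> (map ((!) s) s'), e', y)]" for y
      using t(2,5) by (simp add: list_update_append permute_list_map)
    have n: "(A1 @ rl ((!) s) xs @ A2) ! (length A1 + l) = (map ((!) s) s', e', x)"
      using t(2,3) by (simp add: nth_append)
    show "?G ((q, \<mu>), xs[l := (permute_list \<tau> s', e', act L (length s') e' \<tau> x)]) =
      ?G ((q, \<mu>), xs)"
      unfolding F' Fe C_def d e length_list_update
      using cls_sym_leaf[OF Ct[OF t(1)] _ n, of \<tau>] t(2,5) by simp
  next
    fix q \<mu> xs \<tau> assume t: "((q, \<mu>), xs) \<in> trees N L (length s) e" and \<tau>: "\<tau> permutes {..<length xs}"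
    let ?l = "length xs"
    define \<rho> where "\<rho> = (\<lambda>x. if length A1 \<le> x \<and> x < length A1 + length (rl ((!) s) xs)
      then length A1 + \<tau> (x - length A1) else x)"
    have \<tau>': "\<tau> permutes {..<length (rl ((!) s) xs)}" using \<tau> by simp
    note pb1 = permute_block(1,2,6)[OF \<tau>', where as = A1 and bs = A2, folded \<rho>_def, unfolded lA1 rl_simps(4)]
    note pb2 = permute_block(3-5)[OF \<tau>', where as = A1, folded \<rho>_def, unfolded lA1 rl_simps(4)]
    have lA2: "length A2 = lcnt vs" unfolding A2_def using l1 by (simp add: length_alv)
    have Kl: "K ?l = c + ?l + length A2" by (simp add: K_def lA2)
    have \<rho>: "\<rho> permutes {..<K ?l}" unfolding Kl by (rule pb1(1))
    have dx: "degs (permute_list \<tau> xs) = degs xs" using \<tau> by (intro degs_permute) simp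
    have "inv \<rho> i = i" if "i < c" for i
      using arg_cong[OF pb2(2), of "\<lambda>l. l ! i"] that by simp
    hence rt: "rl (inv \<rho>) (topl 0 us) = topl 0 us"
      by (intro rl_id) (simp add: labels_topl c_def)
    have "inv \<rho> i = i" if "c + ?l \<le> i" for i
      using arg_cong[OF pb2(3)[of "Suc i"], of last] that by simp
    hence rt2: "rl (inv \<rho>) (topl (c + ?l) vs) = topl (c + ?l) vs"
      by (intro rl_id) (simp add: labels_topl)
    \<comment> \<open>Acting by \<open>\<rho>\<close> on the whole top only relabels the block of
      \<open>\<mu>\<close>, and the symmetry relation at that leaf trades the relabelling for the
      action of \<open>\<tau>\<close> on \<open>\<mu>\<close>.\<close>
    have "T q (act N ?l q \<tau> \<mu>) ?l = act (circ M N) (K ?l) (D q) \<rho> (T q \<mu> ?l)"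
    proof -
      have rTL: "rl (inv \<rho>) (TL q \<mu> ?l) = topl 0 us @ (map (inv \<rho>) [c..<c + ?l], q, \<mu>) # topl (c + ?l) vs"
        using rt rt2 by (simp add: TL_def)
      have tr: "((p, m), topl 0 us @ (map (inv \<rho>) [c..<c + ?l], q, \<mu>) # topl (c + ?l) vs) \<in> trees M N (K ?l) (D q)"
        using rl_trees[OF TLt[OF t] permutes_inv[OF \<rho>]] unfolding rTL .
      have "act (circ M N) (K ?l) (D q) \<rho> (T q \<mu> ?l) =
          cls M N (K ?l) (D q) ((p, m), topl 0 us @ (map (inv \<rho>) [c..<c + ?l], q, \<mu>) # topl (c + ?l) vs)"
        unfolding T_def act_circ_cls[OF \<rho>] rTL ..
      also have "\<dots> = cls M N (K ?l) (D q) ((p, m), TL q (act N ?l q \<tau> \<mu>) ?l)"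
        using cls_sym_leaf_app[OF tr, of \<tau>] \<tau> pb2(1) by (simp add: TL_def)
      finally show ?thesis by (simp add: T_def)
    qed
    moreover have "A1 @ rl ((!) s) (permute_list \<tau> xs) @ A2 = permute_list \<rho> (A1 @ rl ((!) s) xs @ A2)"
      using pb1(2) by (simp add: rl_permute[OF \<tau>])
    moreover have "length (A1 @ rl ((!) s) xs @ A2) = K ?l" using lA1 by (simp add: Kl)
    moreover have "koszul \<rho> (map edeg (A1 @ rl ((!) s) xs @ A2)) = (koszul \<tau> (map edeg xs) :: 'k)"
      using lA1 by (simp add: pb1(3))
    ultimately show "?G ((q, act N (length xs) q \<tau> \<mu>), permute_list \<tau> xs) =
      psc (koszul \<tau> (map edeg xs))
       (?G ((q, \<mu>), xs))"
      unfolding F' Fe C_def dx length_permute_list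
      using cls_sym_root[OF Ct[OF t], of \<rho>] \<rho> by (simp add: mult.commute)
  }
qed

lemma sum_list_permute:
  "mset xs = mset ys \<Longrightarrow> sum_list (map f xs) = (sum_list (map f ys) :: 'x::comm_monoid_add)"
  by (metis mset_map sum_mset_sum_list)

lemma block_slice:
  assumes "length xss = length us" "\<And>j. j < length us \<Longrightarrow> length (xss ! j) = length (snd (us ! j))"
    "i < length us"
  shows "map ((!) (concat xss)) (bl us i) = xss ! i"
proof -
  have l: "length (concat (take j xss)) = lcnt (take j us)" if "j \<le> length us" for j
    using that
  proof (induction j)
    case (Suc j)
    thus ?case using assms by (simp add: take_Suc_conv_app_nth)
  qed simp
  have "concat xss = concat (take i xss) @ xss ! i @ concat (drop (Suc i) xss)"
    using assms by (metis concat.simps(2) concat_append id_take_nth_drop)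
  moreover have "bl us i = [length (concat (take i xss))..<length (concat (take i xss)) + length (xss ! i)]"
    using l[of i] assms by (simp add: bl_def take_Suc_conv_app_nth)
  ultimately show ?thesis by (auto intro!: nth_equalityI simp: nth_append)
qed

lemma bl_concat: "concat (map (bl us) [0..<length us]) = [0..<lcnt us]"
proof -
  have "concat (map (bl us) [0..<j]) = [0..<lcnt (take j us)]" if "j \<le> length us" for j
    using that
  proof (induction j)
    case (Suc j)
    thus ?case
      using upt_add_eq_append[of 0 "lcnt (take j us)" "length (snd (us ! j))"]
      by (simp add: bl_def take_Suc_conv_app_nth)
  qed simp
  from this[of "length us"] show ?thesis by simp
qed

lemma bl_less:
  assumes "i < j" "x \<in> set (bl us i)" "y \<in> set (bl us j)"
  shows "x < y"
proof -
  have "lcnt (take i us) \<le> lcnt (take (Suc i) us)" for i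
    by (cases "i < length us") (simp_all add: take_Suc_conv_app_nth)
  hence "lcnt (take (Suc i) us) \<le> lcnt (take j us)"
    using lift_Suc_mono_le[of "\<lambda>i. lcnt (take i us)" "Suc i" j] assms(1) by simp
  thus ?thesis using assms(2,3) by (simp add: bl_def)
qed

lemma topl_degrees: "map edeg (topl c us) = map (\<lambda>u. fst (fst u)) us"
  by (induction us arbitrary: c) (auto simp: split_beta)

text \<open>Permuting the outer leaves by \<open>\<sigma>\<close> permutes the roots in the top by
  \<open>\<sigma>\<close> and the leaves blockwise. The two resulting signs, for root degrees and
  for leaf degrees, combine with the separation sign by \<open>koszul_interchange\<close>.\<close>

lemma agraft_permute:
  fixes M :: "('k::field, 'm::ab_group_add) dgs" and N :: "('k, 'n::ab_group_add) dgs"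
    and L :: "('k, 'l::ab_group_add) dgs"
  assumes m: "m \<in> grd M (length us) p" and us: "list_all2 (uok N L) se us"
    and lab: "mset (concat (map fst se)) = mset [0..<n]"
    and deg: "p + sum_list (map snd se) = d" and \<sigma>: "\<sigma> permutes {..<length us}"
  shows "agraft M N L n d (p, act M (length us) p \<sigma> m) (permute_list \<sigma> (map fst se)) (permute_list \<sigma> us) =
    psc (koszul \<sigma> (map snd se)) (agraft M N L n d (p, m) (map fst se) us)"
proof -
  define k where "k = length us"
  define ss where "ss = map fst se"
  define us' where "us' = permute_list \<sigma> us"
  define K where "K = lcnt us"
  define D where "D = p + rdeg us"
  define lv where "lv = alv ss us"
  define J where "J = map \<sigma> [0..<k]"
  \<comment> \<open>\<open>R\<close> lists the old positions of the leaves in their new order, block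
    after block; \<open>\<rho>\<close> is this list read as a permutation.\<close>
  define R where "R = concat (map (bl us) J)"
  define \<rho> where "\<rho> = (\<lambda>i. if i < K then R ! i else i)"
  define Ls where "Ls = map (\<lambda>j. rl ((!) (ss ! j)) (snd (us ! j))) [0..<k]"
  have lse: "length se = k" using us by (simp add: k_def list_all2_lengthD)
  have lt: "\<sigma> i < k" if "i < k" for i using permutes_in_image[OF \<sigma>] that by (auto simp: k_def)
  have ms: "mset us' = mset us" unfolding us'_def by (rule mset_permute_list[OF \<sigma>])
  have K': "lcnt us' = K" and D': "p + rdeg us' = D"
    using sum_list_permute[OF ms] by (simp_all add: lcnt_def K_def rdeg_def D_def)
  have lus': "length us' = k" by (simp add: us'_def k_def)
  have us'n: "us' ! j = us ! \<sigma> j" if "j < k" for j using that by (simp add: us'_def permute_list_nth[OF \<sigma>] k_def)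
  have llv: "length lv = K" using lse by (simp add: lv_def ss_def K_def length_alv k_def)
  have mJ: "mset J = mset [0..<k]"
    using permutes_image_mset[OF \<sigma>] by (simp add: J_def k_def atLeast0LessThan)
  have mR: "mset R = mset [0..<K]"
    using mset_concat_permute[OF mJ, of "bl us"] bl_concat[of us] by (simp add: R_def K_def k_def)
  hence dR: "distinct R" "set R = {..<K}" using mset_labels[of R K] by auto
  have lR: "length R = K" using mset_eq_length[OF mR] by simp
  have \<rho>: "\<rho> permutes {..<K}"
  proof (rule bij_imp_permutes)
    have "bij_betw ((!) R) {..<K} {..<K}" using dR lR by (intro bij_betw_nth) auto
    thus "bij_betw \<rho> {..<K} {..<K}" by (rule bij_betw_cong[THEN iffD1, rotated]) (simp add: \<rho>_def)
  qed (simp add: \<rho>_def)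
  have m\<rho>: "map \<rho> [0..<K] = R" using lR by (auto intro!: nth_equalityI simp: \<rho>_def)
  have lLs: "length (Ls ! j) = length (snd (us ! j))" if "j < k" for j using that by (simp add: Ls_def)
  have lvLs: "lv = concat Ls" unfolding lv_def Ls_def using lse by (simp add: alv_concat ss_def k_def)
  have sl: "map ((!) lv) (bl us i) = Ls ! i" if "i < k" for i
    unfolding lvLs using that lLs by (intro block_slice) (auto simp: k_def Ls_def)
  have "alv (permute_list \<sigma> ss) us' = concat (map (\<lambda>i. Ls ! i) J)"
  proof -
    have p: "permute_list \<sigma> ss ! j = ss ! \<sigma> j" if "j < k" for j
      using that \<sigma> lse by (intro permute_list_nth) (auto simp: ss_def k_def)
    have "alv (permute_list \<sigma> ss) us' = concat (map (\<lambda>j. rl ((!) (permute_list \<sigma> ss ! j)) (snd (us' ! j))) [0..<k])"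
      using lse lus' by (subst alv_concat) (auto simp: ss_def)
    also have "\<dots> = concat (map (\<lambda>j. Ls ! \<sigma> j) [0..<k])"
      using lt by (intro arg_cong[of _ _ concat] map_cong refl) (simp add: p us'n Ls_def)
    finally show ?thesis by (simp add: J_def o_def)
  qed
  also have "\<dots> = map ((!) lv) R"
    unfolding R_def map_concat map_map using sl lt
    by (intro arg_cong[of _ _ concat] map_cong refl) (auto simp: J_def)
  also have "\<dots> = permute_list \<rho> lv"
    unfolding permute_list_def llv m\<rho>[symmetric] by simp
  finally have alv': "alv (permute_list \<sigma> ss) us' = permute_list \<rho> lv" .
  have blK: "x < K" if "x \<in> set (bl us' j)" "j < k" for x j
  proof -
    have "x \<in> set (concat (map (bl us') [0..<length us']))" using that lus' by auto
    thus ?thesis unfolding bl_concat K' by simp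
  qed
  have "map ((!) R) (bl us' j) = bl us (\<sigma> j)" if "j < k" for j
  proof -
    have "length (bl us (\<sigma> j)) = length (snd (us ! \<sigma> j))" if "j < k" for j
      using lt[OF that] by (simp add: bl_def k_def take_Suc_conv_app_nth)
    hence "map ((!) R) (bl us' j) = map (bl us) J ! j"
      unfolding R_def using that by (intro block_slice) (auto simp: lus' J_def us'n)
    thus ?thesis using that by (simp add: J_def)
  qed
  hence "map \<rho> (bl us' j) = bl us (\<sigma> j)" if "j < k" for j
    using that blK[OF _ that] by (simp add: \<rho>_def cong: map_cong)
  hence inv: "map (inv \<rho>) (bl us (\<sigma> j)) = bl us' j" if "j < k" for j
    using that permutes_inverses(2)[OF \<rho>] by (metis (no_types, lifting) map_idI map_map o_apply)
  define ys where "ys = rl (inv \<rho>) (topl 0 us)"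
  have lys: "length ys = k" by (simp add: ys_def k_def)
  have tys: "topl 0 us' = permute_list \<sigma> ys"
  proof (rule nth_equalityI)
    fix j assume "j < length (topl 0 us')"
    hence j: "j < k" by (simp add: lus')
    have "permute_list \<sigma> ys ! j = ys ! \<sigma> j" using j \<sigma> lys by (intro permute_list_nth) (auto simp: k_def)
    also have "\<dots> = (map (inv \<rho>) (bl us (\<sigma> j)), fst (us ! \<sigma> j))"
      using lt[OF j] by (simp add: ys_def topl_bl k_def)
    also have "\<dots> = topl 0 us' ! j" using j by (simp add: inv topl_bl lus' us'n)
    finally show "topl 0 us' ! j = permute_list \<sigma> ys ! j" ..
  qed (simp add: lus' lys)
  have yst: "((p, m), ys) \<in> trees M N K D"
    unfolding ys_def K_def D_def
    by (rule rl_trees[OF atop_trees[OF m us] permutes_inv[OF \<rho>[unfolded K_def]]])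
  define top where "top = atop M N (p, m) us"
  have act: "act (circ M N) K D \<rho> top = cls M N K D ((p, m), ys)"
    unfolding top_def atop_def ys_def K_def D_def fst_conv using \<rho>[unfolded K_def] by (rule act_circ_cls)
  have dys: "map edeg ys = map (\<lambda>u. fst (fst u)) us"
    by (simp add: ys_def topl_degrees)
  have "atop M N (p, act M (length us) p \<sigma> m) us' = cls M N K D ((p, act M (length ys) p \<sigma> m), permute_list \<sigma> ys)"
    using D' by (simp add: atop_def K' tys lys k_def)
  also have "\<dots> = psc (koszul \<sigma> (map edeg ys)) (cls M N K D ((p, m), ys))"
    using yst \<sigma> by (intro cls_sym_root) (auto simp: lys k_def)
  finally have top': "atop M N (p, act M (length us) p \<sigma> m) us' =
      psc (koszul \<sigma> (map (\<lambda>u. fst (fst u)) us)) (act (circ M N) K D \<rho> top)"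
    unfolding dys act .
  have tr: "((D, top), lv) \<in> trees (circ M N) L n d"
    using agraft_trees[OF m us lab deg] by (simp add: D_def top_def lv_def ss_def)
  have "act (circ M N) K D \<rho> top \<in> grd (circ M N) K D" unfolding act by (rule cls_in_circ[OF yst])
  hence tr': "((D, act (circ M N) K D \<rho> top), permute_list \<rho> lv) \<in> trees (circ M N) L n d"
    using trees_permute[OF tr, of "permute_list \<rho> lv"] \<rho> llv by simp
  define bds where "bds = map (\<lambda>u. degs (snd u)) us"
  define rds where "rds = map (\<lambda>u. fst (fst u)) us"
  define ld where "ld = map edeg lv"
  have k\<rho>: "koszul \<rho> ld = (koszul \<sigma> bds :: 'k)"
  proof -
    have "koszul \<rho> ld = (kosl ld R :: 'k)"
      using koszul_kosl[of \<rho> ld] \<rho> llv by (simp add: ld_def m\<rho>)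
    also have "\<dots> = kosl bds J"
      unfolding R_def
    proof (rule kosl_concat)
      show "distinct J" using mset_eq_imp_distinct_iff[OF mJ] by simp
      fix j assume "j \<in> set J"
      hence j: "j < k" using lt by (auto simp: J_def)
      have "map ((!) (concat (map (map edeg) Ls))) (bl us j) = map (map edeg) Ls ! j"
        using j lLs by (intro block_slice) (auto simp: k_def Ls_def)
      hence "map ((!) ld) (bl us j) = map edeg (Ls ! j)"
        using j by (simp add: ld_def lvLs map_concat Ls_def)
      hence "sum_list (map ((!) ld) (bl us j)) = degs (snd (us ! j))"
        using j by (simp add: degs_map_fst[symmetric] Ls_def)
      thus "j < length bds \<and> bds ! j = sum_list (map ((!) ld) (bl us j)) \<and> kosl ld (bl us j) = (1 :: 'k)"
        using j by (auto simp: bds_def k_def bl_def kosl_sorted)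
    qed (rule bl_less)
    also have "\<dots> = koszul \<sigma> bds" using koszul_kosl[where 'a = 'k and \<sigma> = \<sigma> and ds = bds] \<sigma> by (simp add: bds_def J_def k_def)
    finally show ?thesis .
  qed
  \<comment> \<open>The degree of an outer leaf is the root degree plus the leaf degrees of the tree
    in it, which is the shape that \<open>koszul_interchange\<close> expects.\<close>
  have sg: "(-1) powi aexp us' * koszul \<sigma> rds * koszul \<sigma> bds = koszul \<sigma> (map snd se) * ((-1) powi aexp us :: 'k)"
  proof -
    have e: "map snd se = map (\<lambda>i. rds ! i + bds ! i) [0..<k]"
    proof (rule nth_equalityI)
      fix i assume "i < length (map snd se)"
      hence i: "i < k" by (simp add: lse)
      have "uok N L (se ! i) (us ! i)" using us i lse by (simp add: list_all2_conv_all_nth)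
      thus "map snd se ! i = map (\<lambda>i. rds ! i + bds ! i) [0..<k] ! i"
        using i lse by (cases "se ! i"; cases "us ! i") (auto simp: rds_def bds_def k_def mem_trees)
    qed (simp add: lse)
    have "aexp us = (\<Sum>j<k. rds ! j * (\<Sum>i<j. bds ! i))"
      unfolding aexp_eq by (intro sum.cong) (auto simp: k_def rds_def bds_def)
    moreover have "aexp us' = (\<Sum>j<k. rds ! \<sigma> j * (\<Sum>i<j. bds ! \<sigma> i))"
      unfolding aexp_eq using lt lus' by (intro sum.cong) (auto simp: k_def rds_def bds_def us'n[unfolded k_def])
    ultimately show ?thesis
      unfolding e using koszul_interchange[of \<sigma> k rds bds, where 'k = 'k] \<sigma> by (simp add: k_def rds_def bds_def)
  qed
  have "agraft M N L n d (p, act M (length us) p \<sigma> m) (permute_list \<sigma> ss) us' =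
    psc ((-1) powi aexp us') (cls (circ M N) L n d ((D, scl (circ M N) (koszul \<sigma> rds) (act (circ M N) K D \<rho> top)), permute_list \<rho> lv))"
    using D' by (simp add: agraft_def top' alv' rds_def)
  also have "\<dots> = psc ((-1) powi aexp us' * koszul \<sigma> rds * koszul \<rho> ld) (cls (circ M N) L n d ((D, top), lv))"
    using cls_sym_root[OF tr, of \<rho>] \<rho> llv by (simp add: cls_scl_root[OF tr', simplified] ld_def mult.assoc)
  also have "\<dots> = psc (koszul \<sigma> (map snd se)) (agraft M N L n d (p, m) ss us)"
    unfolding k\<rho> sg by (simp add: agraft_def D_def top_def lv_def)
  finally show ?thesis by (simp add: ss_def us'_def)
qed

lemma uok_keys:
  assumes "\<forall>(s, e, x)\<in>set xs. Poly_Mapping.keys x \<subseteq> trees N L (length s) e"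
    and "list_all2 (\<lambda>u y. u \<in> Poly_Mapping.keys y) us (map (\<lambda>(s, e, u). u) xs)"
  shows "list_all2 (uok N L) (map (\<lambda>(s, e, u). (s, e)) xs) us"
  using assms
proof (induction xs arbitrary: us)
  case (Cons z xs)
  obtain s e y where z: "z = (s, e, y)" by (cases z)
  then obtain u us' where us: "us = u # us'" "u \<in> Poly_Mapping.keys y"
    "list_all2 (\<lambda>u y. u \<in> Poly_Mapping.keys y) us' (map (\<lambda>(s, e, u). u) xs)"
    using Cons.prems by (auto simp: list_all2_Cons2)
  have "u \<in> trees N L (length s) e" using Cons.prems(1) z us by auto
  thus ?case using Cons.IH[OF _ us(3)] Cons.prems(1) z us by simp
qed simp

lemma circ_keys_leaves:
  assumes "gmod N" "acl N" "gmod L" "acl L" "((p, m), xs) \<in> trees M (circ N L) n d"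
  shows "\<forall>(s, e, x)\<in>set xs. Poly_Mapping.keys x \<subseteq> trees N L (length s) e"
  using assms(5) keys_circ[OF assms(1-4)] by (fastforce simp: mem_trees)

text \<open>Makes the associativity map independent of the representative in a leaf: expanding all
  other leaves reduces the claim to \<open>lext_agraft_slot\<close>.\<close>

lemma aext_kill:
  fixes M :: "('k::field, 'm::ab_group_add) dgs" and N :: "('k, 'n::ab_group_add) dgs"
    and L :: "('k, 'l::ab_group_add) dgs"
  assumes m: "m \<in> grd M (length (xs @ (s, e, y) # ys)) p"
    and g: "\<forall>(s, e, x)\<in>set xs \<union> set ys. Poly_Mapping.keys x \<subseteq> trees N L (length s) e"
    and lab: "mset (concat (map fst (xs @ (s, e, y) # ys))) = mset [0..<n]" and deg: "p + degs (xs @ (s, e, y) # ys) = d"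
    and r: "r \<in> comp_rel N L (length s) e"
  shows "aext M N L n d ((p, m), xs @ (s, e, r) # ys) = 0"
proof -
  let ?se = "map (\<lambda>(s, e, u). (s, e :: int))"
  have se: "map fst (?se xs) = map fst xs" "map snd (?se xs) = map edeg xs" for xs :: "(nat list \<times> int \<times> 'z) list"
    by (auto simp: split_beta)
  have "lext (\<lambda>t. agraft M N L n d (p, m) (map fst (?se xs @ (s, e) # ?se ys)) (us @ t # vs)) r = 0"
    if u: "list_all2 (\<lambda>u y. u \<in> Poly_Mapping.keys y) us (map (\<lambda>(s, e, u). u) xs)"
      and v: "list_all2 (\<lambda>u y. u \<in> Poly_Mapping.keys y) vs (map (\<lambda>(s, e, u). u) ys)" for us vs
  proof (rule lext_agraft_slot[OF _ _ _ _ _ r])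
    show "list_all2 (uok N L) (?se xs) us" "list_all2 (uok N L) (?se ys) vs"
      by (rule uok_keys[OF _ u], use g in blast, rule uok_keys[OF _ v], use g in blast)
    show "m \<in> grd M (Suc (length us + length vs)) p"
      using m list_all2_lengthD[OF u] list_all2_lengthD[OF v] by simp
    show "mset (concat (map fst (?se xs @ (s, e) # ?se ys))) = mset [0..<n]" using lab by (simp only: map_append list.map se fst_conv)
    show "p + sum_list (map snd (?se xs @ (s, e) # ?se ys)) = d" using deg by (simp only: map_append list.map se snd_conv degs_map_fst prod.case)
  qed
  hence "mext (agraft M N L n d (p, m) (map fst (?se xs @ (s, e) # ?se ys)))
      (map (\<lambda>(s, e, u). u) xs @ r # map (\<lambda>(s, e, u). u) ys) = 0"
    by (intro mext_kill)
  moreover have e: "map fst (?se xs @ (s, e) # ?se ys) = map fst (xs @ (s, e, r) # ys)"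
    by (simp only: map_append list.map se fst_conv)
  ultimately show ?thesis unfolding e by (simp add: aext_def)
qed

lemma aext_slot:
  "aext M N L n d (r, xs @ (s, e, y) # ys) = lext (\<lambda>t. aext M N L n d (r, xs @ (s, e, sgl t) # ys)) y"
  by (simp add: aext_def mext_slot)

lemma aext_slot_lin:
  "aext M N L n d (r, xs @ (s, e, x + y) # ys) = aext M N L n d (r, xs @ (s, e, x) # ys) + aext M N L n d (r, xs @ (s, e, y) # ys)"
  "aext M N L n d (r, xs @ (s, e, x - y) # ys) = aext M N L n d (r, xs @ (s, e, x) # ys) - aext M N L n d (r, xs @ (s, e, y) # ys)"
  "aext M N L n d (r, xs @ (s, e, psc c x) # ys) = psc c (aext M N L n d (r, xs @ (s, e, x) # ys))"
  by (simp_all add: aext_slot[where y = "x + y"] aext_slot[where y = "x - y"] aext_slot[where y = "psc c x"]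
      aext_slot[where y = x] aext_slot[where y = y] lext_add lext_diff lext_psc)

text \<open>Sums and multiples at a leaf hold because each slot is linear; relations at the root are
  inherited from the grafts of single trees. The delicate case is a permutation at a leaf, because
  its action on a class is defined through the projection.\<close>

lemma lext_aext:
  fixes M :: "('k::field, 'm::ab_group_add) dgs" and N :: "('k, 'n::ab_group_add) dgs"
    and L :: "('k, 'l::ab_group_add) dgs"
  assumes N: "gmod N" "acl N" and L: "gmod L" "acl L" and u: "u \<in> comp_rel M (circ N L) n d"
  shows "lext (aext M N L n d) u = 0"
proof (rule lext_comp_rel[OF _ _ _ _ _ _ u])
  let ?se = "map (\<lambda>(s, e, u). (s, e :: int))"
  let ?us = "map (\<lambda>(s, e, u). u)"
  let ?A = "aext M N L n d"
  have se: "map fst (?se xs) = map fst xs" "map snd (?se xs) = map edeg xs" for xs :: "(nat list \<times> int \<times> 'z) list"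
    by (auto simp: split_beta)
  have sp: "xs = take l xs @ (s, e, x) # drop (Suc l) xs" if "l < length xs" "xs ! l = (s, e, x)"
    for xs :: "(nat list \<times> int \<times> 'z) list" and l s e x
    using that by (metis id_take_nth_drop)
  {
    fix p m m' xs assume t: "((p, m), xs) \<in> trees M (circ N L) n d" "((p, m'), xs) \<in> trees M (circ N L) n d"
    have "agraft M N L n d (p, m + m') (map fst xs) us =
        agraft M N L n d (p, m) (map fst xs) us + agraft M N L n d (p, m') (map fst xs) us"
      if "list_all2 (\<lambda>u y. u \<in> Poly_Mapping.keys y) us (?us xs)" for us
    proof -
      have ok: "list_all2 (uok N L) (?se xs) us" by (rule uok_keys[OF circ_keys_leaves[OF N L] that]) (use t in blast)
      have l: "length us = length xs" using that by (simp add: list_all2_lengthD)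
      have m: "m \<in> grd M (length us) p" "m' \<in> grd M (length us) p" using t l by (auto simp: mem_trees)
      have a: "atop M N (p, m + m') us = atop M N (p, m) us + atop M N (p, m') us"
        unfolding atop_def fst_conv using m atop_trees[OF _ ok] by (intro cls_add_root) auto
      have ag: "((p + rdeg us, atop M N (p, m) us), alv (map fst xs) us) \<in> trees (circ M N) L n d"
        if t: "((p, m), xs) \<in> trees M (circ N L) n d" for m
      proof -
        have c: "mset (concat (map fst xs)) = mset [0..<n]" "p + sum_list (map edeg xs) = d"
          "m \<in> grd M (length us) p"
          using t l by (simp_all add: mem_trees_mset degs_map_fst)
        show ?thesis by (rule agraft_trees[OF c(3) ok, unfolded se, OF c(1,2)])
      qed
      have "cls (circ M N) L n d ((p + rdeg us, atop M N (p, m) us + atop M N (p, m') us), alv (map fst xs) us) =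
         cls (circ M N) L n d ((p + rdeg us, atop M N (p, m) us), alv (map fst xs) us) +
         cls (circ M N) L n d ((p + rdeg us, atop M N (p, m') us), alv (map fst xs) us)"
        using ag[OF t(2)] by (intro cls_add_root ag t) (simp add: mem_trees)
      thus ?thesis by (simp add: agraft_def a PM.scale_right_distrib)
    qed
    thus "?A ((p, m + m'), xs) = ?A ((p, m), xs) + ?A ((p, m'), xs)"
      unfolding aext_def by (simp add: mext_add[symmetric] cong: mext_cong)
  next
    fix p m c xs assume t: "((p, m), xs) \<in> trees M (circ N L) n d"
    have "agraft M N L n d (p, scl M c m) (map fst xs) us = psc c (agraft M N L n d (p, m) (map fst xs) us)"
      if "list_all2 (\<lambda>u y. u \<in> Poly_Mapping.keys y) us (?us xs)" for us
    proof -
      have ok: "list_all2 (uok N L) (?se xs) us" by (rule uok_keys[OF circ_keys_leaves[OF N L] that]) (use t in blast)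
      have l: "length us = length xs" using that by (simp add: list_all2_lengthD)
      have m: "m \<in> grd M (length us) p" using t l by (auto simp: mem_trees)
      have a: "atop M N (p, scl M c m) us = psc c (atop M N (p, m) us)"
        unfolding atop_def fst_conv using atop_trees[OF m ok] by (rule cls_scl_root)
      have c: "mset (concat (map fst xs)) = mset [0..<n]" "p + sum_list (map edeg xs) = d"
        using t by (simp_all add: mem_trees_mset degs_map_fst)
      have "((p + rdeg us, atop M N (p, m) us), alv (map fst xs) us) \<in> trees (circ M N) L n d"
        by (rule agraft_trees[OF m ok, unfolded se, OF c])
      from cls_scl_root[OF this, of c] show ?thesis by (simp add: agraft_def a mult.commute)
    qed
    thus "?A ((p, scl M c m), xs) = psc c (?A ((p, m), xs))"
      unfolding aext_def by (simp add: mext_psc[symmetric] cong: mext_cong)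
  next
    fix p m xs l s e x x'
    assume t: "((p, m), xs) \<in> trees M (circ N L) n d" "l < length xs" "xs ! l = (s, e, x)"
    show "?A ((p, m), xs[l := (s, e, x + x')]) = ?A ((p, m), xs) + ?A ((p, m), xs[l := (s, e, x')])"
      using aext_slot_lin(1)[of M N L n d "(p, m)" "take l xs" s e x x' "drop (Suc l) xs"] t sp[OF t(2,3)]
      by (simp add: upd_conv_take_nth_drop)
  next
    fix p m xs l s e x c
    assume t: "((p, m), xs) \<in> trees M (circ N L) n d" "l < length xs" "xs ! l = (s, e, x)"
    show "?A ((p, m), xs[l := (s, e, scl (circ N L) c x)]) = psc c (?A ((p, m), xs))"
      using aext_slot_lin(3)[of M N L n d "(p, m)" "take l xs" s e c x "drop (Suc l) xs"] t sp[OF t(2,3)]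
      by (simp add: upd_conv_take_nth_drop)
  next
    fix p m xs \<sigma> assume t: "((p, m), xs) \<in> trees M (circ N L) n d" and \<sigma>: "\<sigma> permutes {..<length xs}"
    have ag: "agraft M N L n d (p, act M (length xs) p \<sigma> m) (permute_list \<sigma> (map fst xs)) (permute_list \<sigma> us) =
        psc (koszul \<sigma> (map edeg xs)) (agraft M N L n d (p, m) (map fst xs) us)"
      if "list_all2 (\<lambda>u y. u \<in> Poly_Mapping.keys y) us (?us xs)" for us
    proof -
      have ok: "list_all2 (uok N L) (?se xs) us" by (rule uok_keys[OF circ_keys_leaves[OF N L] that]) (use t in blast)
      have l: "length us = length xs" using that by (simp add: list_all2_lengthD)
      have c: "mset (concat (map fst xs)) = mset [0..<n]" "p + sum_list (map edeg xs) = d"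
        "m \<in> grd M (length us) p" "\<sigma> permutes {..<length us}"
        using t l \<sigma> by (simp_all add: mem_trees_mset degs_map_fst)
      show ?thesis by (rule agraft_permute[OF c(3) ok, unfolded se l, OF c(1,2) c(4)[unfolded l]])
    qed
    show "?A ((p, act M (length xs) p \<sigma> m), permute_list \<sigma> xs) = psc (koszul \<sigma> (map edeg xs)) (?A ((p, m), xs))"
    proof -
      have pl: "?us (permute_list \<sigma> xs) = permute_list \<sigma> (?us xs)" "map fst (permute_list \<sigma> xs) = permute_list \<sigma> (map fst xs)"
        by (rule permute_list_map[OF \<sigma>, symmetric])+
      have "mext (agraft M N L n d (p, act M (length xs) p \<sigma> m) (permute_list \<sigma> (map fst xs))) (permute_list \<sigma> (?us xs)) =
        mext (\<lambda>us. psc (koszul \<sigma> (map edeg xs)) (agraft M N L n d (p, m) (map fst xs) us)) (?us xs)"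
        using \<sigma> by (subst mext_permute) (auto intro!: mext_cong ag)
      thus ?thesis by (simp add: aext_def pl mext_psc)
    qed
  next
    fix p m xs l s e x \<sigma>
    assume t: "((p, m), xs) \<in> trees M (circ N L) n d" "l < length xs" "xs ! l = (s, e, x)"
      "x \<in> grd (circ N L) (length s) e" "\<sigma> permutes {..<length s}"
    define as bs where "as = take l xs" and "bs = drop (Suc l) xs"
    have xs: "xs = as @ (s, e, x) # bs" unfolding as_def bs_def by (rule sp[OF t(2,3)])
    have upd: "xs[l := v] = as @ v # bs" for v
      using t(2) by (simp add: as_def bs_def upd_conv_take_nth_drop)
    \<comment> \<open>The relabelled representative before projection. The action on the class is
      its projection, so the two differ by an inner relation, which \<open>aext_kill\<close>
      discards.\<close>
    define y where "y = lext (\<lambda>(r, xs). sgl (r, rl (inv \<sigma>) xs)) x"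
    have ax: "act (circ N L) (length s) e \<sigma> x = qproj psc (comp_rel N L (length s) e) y"
      by (simp add: act_circ y_def rl_def)
    have "y - act (circ N L) (length s) e \<sigma> x \<in> comp_rel N L (length s) e"
      unfolding ax by (rule qproj_comp(2))
    hence "?A ((p, m), as @ (permute_list \<sigma> s, e, y - act (circ N L) (length s) e \<sigma> x) # bs) = 0"
      using t(1,5) circ_keys_leaves[OF N L t(1)] unfolding xs
      by (intro aext_kill[where y = x]) (auto simp: mem_trees_mset)
    hence "?A ((p, m), as @ (permute_list \<sigma> s, e, act (circ N L) (length s) e \<sigma> x) # bs) =
        ?A ((p, m), as @ (permute_list \<sigma> s, e, y) # bs)" by (simp add: aext_slot_lin(2))
    also have "\<dots> = lext (\<lambda>t. ?A ((p, m), as @ (permute_list \<sigma> s, e, case t of (r, xs) \<Rightarrow> sgl (r, rl (inv \<sigma>) xs)) # bs)) x"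
      unfolding y_def lext_def[of "\<lambda>(r, xs). sgl (r, rl (inv \<sigma>) xs)"]
    proof (subst aext_slot)
      show "lext (\<lambda>t. ?A ((p, m), as @ (permute_list \<sigma> s, e, sgl t) # bs))
          (\<Sum>g\<in>Poly_Mapping.keys x. psc (Poly_Mapping.lookup x g) (case g of (r, xs) \<Rightarrow> sgl (r, rl (inv \<sigma>) xs))) =
        lext (\<lambda>t. ?A ((p, m), as @ (permute_list \<sigma> s, e, case t of (r, xs) \<Rightarrow> sgl (r, rl (inv \<sigma>) xs)) # bs)) x"
        by (simp add: lext_sum lext_psc lext_def[of _ x] split_beta del: psc_single)
    qed
    also have "\<dots> = lext (\<lambda>t. ?A ((p, m), as @ (s, e, sgl t) # bs)) x"
    proof (rule lext_cong)
      fix t' assume "t' \<in> Poly_Mapping.keys x"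
      hence t': "t' \<in> trees N L (length s) e" using keys_circ[OF N L t(4)] by auto
      obtain q \<mu> zs where t'': "t' = ((q, \<mu>), zs)" by (cases t') auto
      \<comment> \<open>Permuting the outer label list by \<open>\<sigma>\<close> cancels the
        relabelling of the inner tree by \<open>inv \<sigma>\<close>.\<close>
      have r: "rl ((!) (permute_list \<sigma> s)) (rl (inv \<sigma>) zs) = rl ((!) s) zs"
      proof -
        have "map ((!) (permute_list \<sigma> s)) (map (inv \<sigma>) w) = map ((!) s) w" if "(w, z) \<in> set zs" for w z
        proof -
          have "set w \<subseteq> set (concat (map fst zs))" using that by force
          hence w: "i < length s" if "i \<in> set w" for i using t' that by (auto simp: t'' mem_trees)
          have "inv \<sigma> i < length s" if "i < length s" for i
            using that permutes_in_image[OF permutes_inv[OF t(5)]] by auto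
          thus ?thesis using w t(5) by (auto simp: permute_list_nth permutes_inverses)
        qed
        thus ?thesis by (auto simp: rl_def)
      qed
      have len: "length us = length as" if "list_all2 (\<lambda>u y. u \<in> Poly_Mapping.keys y) us (?us as)" for us
        using that by (simp add: list_all2_lengthD)
      have "agraft M N L n d (p, m) (map fst as @ permute_list \<sigma> s # map fst bs) (us @ ((q, \<mu>), rl (inv \<sigma>) zs) # vs) =
          agraft M N L n d (p, m) (map fst as @ s # map fst bs) (us @ ((q, \<mu>), zs) # vs)"
        if "length us = length as" for us vs
        using that by (simp add: agraft_def atop_def r)
      hence "mext (\<lambda>us. mext (\<lambda>vs. agraft M N L n d (p, m) (map fst as @ permute_list \<sigma> s # map fst bs) (us @ ((q, \<mu>), rl (inv \<sigma>) zs) # vs)) (?us bs)) (?us as)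
         = mext (\<lambda>us. mext (\<lambda>vs. agraft M N L n d (p, m) (map fst as @ s # map fst bs) (us @ ((q, \<mu>), zs) # vs)) (?us bs)) (?us as)"
        using len by (intro mext_cong) simp
      thus "?A ((p, m), as @ (permute_list \<sigma> s, e, case t' of (r, xs) \<Rightarrow> sgl (r, rl (inv \<sigma>) xs)) # bs) =
          ?A ((p, m), as @ (s, e, sgl t') # bs)"
        by (simp add: aext_def mext_slot t'')
    qed
    also have "\<dots> = ?A ((p, m), as @ (s, e, x) # bs)" by (rule aext_slot[symmetric])
    finally show "?A ((p, m), xs[l := (permute_list \<sigma> s, e, act (circ N L) (length s) e \<sigma> x)]) = ?A ((p, m), xs)"
      unfolding upd unfolding xs .
  }
qed

text \<open>The leaves are classes with unknown representatives. They are exchanged for the trees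
  themselves one at a time from the left, each exchange changing the leaf by a relation; once all
  leaves are single trees, no expansion is left.\<close>

lemma assoc_cls:
  fixes M :: "('k::field, 'm::ab_group_add) dgs" and N :: "('k, 'n::ab_group_add) dgs"
    and L :: "('k, 'l::ab_group_add) dgs"
  assumes N: "gmod N" "acl N" and L: "gmod L" "acl L"
    and m: "m \<in> grd M (length us) p" and us: "list_all2 (uok N L) se us"
    and lab: "mset (concat (map fst se)) = mset [0..<n]" and deg: "p + sum_list (map snd se) = d"
  shows "assoc M N L n d (cls M (circ N L) n d ((p, m), map2 (\<lambda>(s, e) u. (s, e, cls N L (length s) e u)) se us)) =
    agraft M N L n d (p, m) (map fst se) us"
proof -
  let ?A = "aext M N L n d"
  let ?c = "map2 (\<lambda>(s, e) u. (s, e, cls N L (length s) e u))"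
  let ?s = "map2 (\<lambda>(s, e) u. (s, e, sgl u))"
  have "?A ((p, m), ?s se1 us1 @ ?c se2 us2) = ?A ((p, m), ?s (se1 @ se2) (us1 @ us2))"
    if "list_all2 (uok N L) se1 us1" "list_all2 (uok N L) se2 us2" "se1 @ se2 = se" "us1 @ us2 = us" for se1 se2 us1 us2
    using that(2,1,3,4)
  proof (induction arbitrary: se1 us1 rule: list_all2_induct)
    case (Cons z zs u vs)
    obtain s e where z: "z = (s, e)" by (cases z)
    have l: "length se1 = length us1" "length zs = length vs" using Cons by (auto dest: list_all2_lengthD)
    have "?A ((p, m), ?s se1 us1 @ (s, e, sgl u - cls N L (length s) e u) # ?c zs vs) = 0"
    proof (rule aext_kill[where y = 0])
      have c: "cls N L (length s) e u \<in> grd (circ N L) (length s) e" if "u \<in> trees N L (length s) e" for s e u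
        using that by (rule cls_in_circ)
      show "\<forall>(s, e, x)\<in>set (?s se1 us1) \<union> set (?c zs vs). Poly_Mapping.keys x \<subseteq> trees N L (length s) e"
      proof safe
        fix s e x u assume "(s, e, x) \<in> set (?s se1 us1)" "u \<in> Poly_Mapping.keys x"
        thus "u \<in> trees N L (length s) e" using Cons.prems(1)
          by (auto simp: list_all2_iff in_set_zip uok_def split: if_splits)
      next
        fix s e x u assume *: "(s, e, x) \<in> set (?c zs vs)" "u \<in> Poly_Mapping.keys x"
        then obtain w where "x = cls N L (length s) e w" "w \<in> trees N L (length s) e"
          using Cons.hyps by (auto simp: list_all2_iff uok_def)
        thus "u \<in> trees N L (length s) e" using * keys_circ[OF N L c] by blast
      qed
      have "map fst (?s se1 us1 @ (s, e, 0) # ?c zs vs) = map fst se"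
        "map edeg (?s se1 us1 @ (s, e, 0) # ?c zs vs) = map snd se"
        using l Cons.prems(2) z by (auto intro!: nth_equalityI simp: split_beta nth_append nth_Cons')
      thus "mset (concat (map fst (?s se1 us1 @ (s, e, 0) # ?c zs vs))) = mset [0..<n]"
        "p + degs (?s se1 us1 @ (s, e, 0) # ?c zs vs) = d"
        using lab deg by (simp_all only: degs_map_fst)
      show "m \<in> grd M (length (?s se1 us1 @ (s, e, 0) # ?c zs vs)) p"
        using m l Cons.prems(3) by auto
      have "cls N L (length s) e u = qproj psc (comp_rel N L (length s) e) (sgl u)" by (simp add: cls_def)
      thus "sgl u - cls N L (length s) e u \<in> comp_rel N L (length s) e" using qproj_comp(2) by metis
    qed
    hence "?A ((p, m), ?s se1 us1 @ ?c (z # zs) (u # vs)) = ?A ((p, m), ?s (se1 @ [z]) (us1 @ [u]) @ ?c zs vs)"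
      using l by (simp add: aext_slot_lin(2) z)
    also have "\<dots> = ?A ((p, m), ?s ((se1 @ [z]) @ zs) ((us1 @ [u]) @ vs))"
      using Cons.hyps Cons.prems by (intro Cons.IH) (auto intro: list_all2_appendI)
    finally show ?case by simp
  qed (auto dest: list_all2_lengthD)
  from this[of "[]" "[]" se us] have "?A ((p, m), ?c se us) = ?A ((p, m), ?s se us)" using us by simp
  also have "\<dots> = agraft M N L n d (p, m) (map fst se) us"
  proof -
    have l: "length se = length us" using us by (rule list_all2_lengthD)
    have z: "map fst (?s se us) = map fst se" "map (\<lambda>(s, e, u). u) (?s se us) = map sgl us"
      using l by (auto intro!: nth_equalityI simp: split_beta)
    have A: "?A ((p, m), zs) = mext (agraft M N L n d (p, m) (map fst zs)) (map (\<lambda>(s, e, u). u) zs)" for zs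
      by (simp add: aext_def)
    show ?thesis unfolding A z by (rule mext_single)
  qed
  finally show ?thesis unfolding assoc_alt by (subst lext_cls[OF lext_aext[OF N L]])
qed

section \<open>Free algebras\<close>

text \<open>Maps made from \<open>lext\<close> are linear on all formal combinations, not merely on
  graded components. Recording this spares the membership conditions when such maps are compared on
  generators.\<close>

definition plin :: "(('g \<Rightarrow>\<^sub>0 'k::field) \<Rightarrow> ('h \<Rightarrow>\<^sub>0 'k)) \<Rightarrow> bool" where
  "plin f \<longleftrightarrow> (\<forall>x y. f (x + y) = f x + f y) \<and> (\<forall>c x. f (psc c x) = psc c (f x))"

lemma plin_lext: "plin (lext F :: ('g \<Rightarrow>\<^sub>0 'k::field) \<Rightarrow> ('h \<Rightarrow>\<^sub>0 'k))"
  by (simp add: plin_def lext_add lext_psc)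

lemma plin_gcomp: "plin (f n d) \<Longrightarrow> plin (g n (d + p)) \<Longrightarrow> plin ((g \<bullet>[p] f) n d)"
  by (simp add: plin_def gcomp_def)

lemma plin_comp_map: "plin (comp_map M N r f g n d)"
  by (simp add: comp_map_alt plin_lext)

lemma plin_lcomp_map: "plin (lcomp_map M L L' r f a q b n d)"
  by (simp add: lcomp_map_alt plin_lext)

lemma plin_assoc: "plin (assoc M N L n d)"
  by (simp add: assoc_alt plin_lext)

lemma plin_free_mult: "plin (free_mult P \<gamma> X n d)"
  unfolding free_mult_def by (intro plin_gcomp plin_comp_map plin_assoc)

lemma plinD:
  assumes "plin f"
  shows "f (x + y) = f x + f y" "f (psc c x) = psc c (f x)" "f 0 = 0"
    "f (x - y) = f x - f y" "f (sum h I) = (\<Sum>i\<in>I. f (h i))"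
proof -
  show a: "f (x + y) = f x + f y" "f (psc c x) = psc c (f x)" for x y c
    using assms by (auto simp: plin_def)
  show z: "f 0 = 0" using a(2)[of 0 0] by simp
  show "f (x - y) = f x - f y" using a(1)[of x "psc (-1) y"] a(2)[of "-1" y] by simp
  show "f (sum h I) = (\<Sum>i\<in>I. f (h i))"
    by (induction I rule: infinite_finite_induct) (auto simp: a z)
qed

lemma plin_eq:
  assumes "plin f" "plin g" "\<And>x. x \<in> G \<Longrightarrow> f x = g x" "u \<in> PM.span G"
  shows "f u = g u"
  by (rule span_map_eq[where s = psc and G = G]) (use assms in \<open>auto simp: plinD\<close>)

lemma plin_in:
  assumes "plin f" "\<And>x. x \<in> G \<Longrightarrow> f x \<in> W" "PM.subspace W" "u \<in> PM.span G"
  shows "f u \<in> W"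
  by (rule span_map_in[where s = psc and G = G]) (use assms in \<open>auto simp: plinD PM.vector_space_axioms\<close>)

text \<open>Induction on the number \<open>k\<close> of leaves that are still only in the span; the
  later ones are already generators, and each step is linearity in a single leaf.\<close>

lemma cls_span:
  fixes M :: "('k::field, 'm::ab_group_add) dgs" and N :: "('k, 'n::ab_group_add) dgs"
  assumes N: "gmod N" and t: "((p, m), xs) \<in> trees M N n d"
    and G: "\<And>i. i < length xs \<Longrightarrow> G i \<subseteq> grd N (length (fst (xs ! i))) (fst (snd (xs ! i)))"
    and v: "\<And>i. i < length xs \<Longrightarrow> snd (snd (xs ! i)) \<in> module.span (scl N) (G i)"
  shows "cls M N n d ((p, m), xs) \<in> PM.span (cls M N n d ` {((p, m), ys) | ys. length ys = length xs \<and>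
    (\<forall>i<length xs. fst (ys ! i) = fst (xs ! i) \<and> fst (snd (ys ! i)) = fst (snd (xs ! i)) \<and> snd (snd (ys ! i)) \<in> G i)})"
    (is "_ \<in> PM.span (_ ` ?T)")
proof -
  interpret V: vector_space "scl N" by (rule gmodD(1)[OF N])
  have "cls M N n d ((p, m), ys) \<in> PM.span (cls M N n d ` ?T)"
    if "((p, m), ys) \<in> trees M N n d" "length ys = length xs" "k \<le> length xs"
      "\<And>i. i < length xs \<Longrightarrow> fst (ys ! i) = fst (xs ! i) \<and> fst (snd (ys ! i)) = fst (snd (xs ! i))"
      "\<And>i. i < k \<Longrightarrow> snd (snd (ys ! i)) \<in> V.span (G i)"
      "\<And>i. k \<le> i \<Longrightarrow> i < length xs \<Longrightarrow> snd (snd (ys ! i)) \<in> G i" for k ys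
    using that
  proof (induction k arbitrary: ys)
    case 0
    have "((p, m), ys) \<in> ?T" using 0 by auto
    thus ?case by (intro PM.span_base imageI)
  next
    case (Suc k)
    have k: "k < length ys" using Suc.prems by simp
    obtain s e y where y: "ys ! k = (s, e, y)" by (cases "ys ! k") auto
    have se: "fst (xs ! k) = s" "fst (snd (xs ! k)) = e" using Suc.prems(4)[of k] Suc.prems(2) k y by auto
    have Gk: "G k \<subseteq> grd N (length s) e" using G[of k] Suc.prems(4)[of k] k y Suc.prems(2) by simp
    have "cls M N n d ((p, m), ys[k := (s, e, z)]) \<in> PM.span (cls M N n d ` ?T) \<and> z \<in> grd N (length s) e"
      if "z \<in> V.span (G k)" for z
      using that
    proof (induction rule: V.span_induct_alt)
      case base
      show ?case using cls_zero_leaf[OF Suc.prems(1) k y N] by (simp add: PM.span_zero gmodD(3)[OF N])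
    next
      case (step c g z)
      have g: "g \<in> grd N (length s) e" using step(1) Gk by auto
      have "((p, m), ys[k := (s, e, g)]) \<in> trees M N n d"
        using tree_update[OF Suc.prems(1) k y g] by simp
      hence "cls M N n d ((p, m), ys[k := (s, e, g)]) \<in> PM.span (cls M N n d ` ?T)"
        using Suc.prems(2-) step(1) y k se
        by (intro Suc.IH) (auto simp: nth_list_update)
      thus ?case
        using step(2) g
        by (simp add: cls_add_leaf[OF Suc.prems(1) k y] cls_scl_leaf[OF Suc.prems(1) k y]
            gmodD(4,6)[OF N] PM.span_add PM.span_scale)
    qed
    from this[of y] Suc.prems(5)[of k] y have "cls M N n d ((p, m), ys[k := (s, e, y)]) \<in> PM.span (cls M N n d ` ?T)"
      by simp
    thus ?case by (metis list_update_id y)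
  qed
  from this[of xs "length xs"] t v show ?thesis by simp
qed

lemma circ_gen:
  fixes M :: "('k::field, 'm::ab_group_add) dgs" and N :: "('k, 'n::ab_group_add) dgs"
  assumes N: "gmod N" and G: "\<And>e. G e \<subseteq> grd N 0 e" "\<And>e. grd N 0 e \<subseteq> module.span (scl N) (G e)"
  shows "grd (circ M N) 0 d \<subseteq> PM.span (cls M N 0 d ` {(r, xs) \<in> trees M N 0 d. \<forall>(s, e, x)\<in>set xs. x \<in> G e})"
    (is "_ \<subseteq> PM.span (_ ` ?T)")
proof -
  have "cls M N 0 d t \<in> PM.span (cls M N 0 d ` ?T)" if t: "t \<in> trees M N 0 d" for t
  proof -
    obtain p m xs where t': "t = ((p, m), xs)" by (cases t) auto
    have s: "fst (xs ! i) = []" if "i < length xs" for i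
      using flat_trees[OF t] that by (auto simp: t' all_set_conv_all_nth split_beta)
    have g: "snd (snd (xs ! i)) \<in> grd N 0 (fst (snd (xs ! i)))" if "i < length xs" for i
      using t that s[OF that] by (auto simp: t' mem_trees_nth)
    have "cls M N 0 d t \<in> PM.span (cls M N 0 d ` {((p, m), ys) | ys. length ys = length xs \<and>
      (\<forall>i<length xs. fst (ys ! i) = fst (xs ! i) \<and> fst (snd (ys ! i)) = fst (snd (xs ! i)) \<and> snd (snd (ys ! i)) \<in> G (fst (snd (xs ! i))))})"
      unfolding t' using G(1) s subsetD[OF G(2) g] by (intro cls_span[OF N t[unfolded t']]) auto
    also have "\<dots> \<subseteq> PM.span (cls M N 0 d ` ?T)"
    proof (intro PM.span_mono image_mono subsetI)
      fix z assume "z \<in> {((p, m), ys) | ys. length ys = length xs \<and>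
        (\<forall>i<length xs. fst (ys ! i) = fst (xs ! i) \<and> fst (snd (ys ! i)) = fst (snd (xs ! i)) \<and> snd (snd (ys ! i)) \<in> G (fst (snd (xs ! i))))}"
      then obtain ys where ys: "z = ((p, m), ys)" "length ys = length xs"
        "\<And>i. i < length xs \<Longrightarrow> fst (ys ! i) = fst (xs ! i) \<and> fst (snd (ys ! i)) = fst (snd (xs ! i)) \<and> snd (snd (ys ! i)) \<in> G (fst (snd (xs ! i)))"
        by auto
      have e: "map fst ys = map fst xs" "degs ys = degs xs"
        using ys by (auto simp: degs_nth intro!: nth_equalityI)
      have "\<forall>i<length ys. snd (snd (ys ! i)) \<in> grd N (length (fst (ys ! i))) (fst (snd (ys ! i)))"
      proof (intro allI impI)
        fix i assume "i < length ys"
        hence i: "i < length xs" using ys(2) by simp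
        show "snd (snd (ys ! i)) \<in> grd N (length (fst (ys ! i))) (fst (snd (ys ! i)))"
          using ys(3)[OF i] s[OF i] subsetD[OF G(1)] by simp
      qed
      hence "z \<in> trees M N 0 d" using t unfolding ys(1) t' mem_trees_nth e ys(2) by simp
      moreover have "\<forall>(s, e, x)\<in>set ys. x \<in> G e"
        unfolding all_set_conv_all_nth ys(2)
      proof (intro allI impI)
        fix i assume "i < length xs"
        from ys(3)[OF this] show "case ys ! i of (s, e, x) \<Rightarrow> x \<in> G e" by (simp add: split_beta)
      qed
      ultimately show "z \<in> ?T" unfolding ys(1) by blast
    qed
    finally show ?thesis .
  qed
  hence "cls M N 0 d ` trees M N 0 d \<subseteq> PM.span (cls M N 0 d ` ?T)" by auto
  thus ?thesis unfolding grd_circ by (rule PM.span_minimal[OF _ PM.subspace_span])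
qed

definition tdeg :: "('n, 'l) tree \<Rightarrow> int" where
  "tdeg u = fst (fst u) + degs (snd u)"

text \<open>Rows whose leaves are classes of single arity-zero trees. By
  \<open>circ_circ_gen\<close> such rows generate an iterated product, so that maps on it can be
  compared on them.\<close>

definition uleaves :: "('k::field, 'n::plus) dgs \<Rightarrow> ('k, 'l::plus) dgs \<Rightarrow> ('n, 'l) tree list \<Rightarrow>
    (nat list \<times> int \<times> (('n, 'l) tree \<Rightarrow>\<^sub>0 'k)) list" where
  "uleaves N L us = map (\<lambda>u. ([], tdeg u, cls N L 0 (tdeg u) u)) us"

definition utrees :: "('k, 'n) dgs \<Rightarrow> ('k, 'l) dgs \<Rightarrow> ('n, 'l) tree set" where
  "utrees N L = {u. u \<in> trees N L 0 (tdeg u)}"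

lemma trees_tdeg: "u \<in> trees N L n e \<Longrightarrow> tdeg u = e"
  by (cases u) (auto simp: tdeg_def mem_trees)

lemma utrees_iff: "u \<in> trees N L 0 e \<longleftrightarrow> u \<in> utrees N L \<and> tdeg u = e"
  by (auto simp: utrees_def dest: trees_tdeg)

lemma trees_0_iff:
  "((p, m), xs) \<in> trees M N 0 d \<longleftrightarrow> m \<in> grd M (length xs) p \<and>
     (leaves0 N xs) \<and> p + degs xs = d"
proof (cases "\<forall>(s, e, x)\<in>set xs. s = []")
  case True
  hence c: "concat (map fst xs) = []" by (auto simp: concat_eq_Nil_conv)
  have "(\<forall>(s, e, x)\<in>set xs. x \<in> grd N (length s) e) \<longleftrightarrow> (leaves0 N xs)"
    using True by (intro ball_cong) auto
  thus ?thesis unfolding mem_trees c by simp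
next
  case False
  hence "set (concat (map fst xs)) \<noteq> {..<0}" by (auto simp: split_beta)
  thus ?thesis using False unfolding mem_trees by (auto simp: split_beta)
qed

lemma utrees_eq:
  "((p, m), xs) \<in> utrees M N \<longleftrightarrow> m \<in> grd M (length xs) p \<and> (leaves0 N xs)"
  by (auto simp: utrees_def trees_0_iff tdeg_def)

lemma degs_uleaves: "degs (uleaves N L us) = rdeg us + ldeg us"
  by (induction us) (auto simp: uleaves_def tdeg_def)

lemma uleaves_simps [simp]:
  "uleaves N L [] = []" "uleaves N L (u # us) = ([], tdeg u, cls N L 0 (tdeg u) u) # uleaves N L us"
  "uleaves N L (us @ vs) = uleaves N L us @ uleaves N L vs" "length (uleaves N L us) = length us"
  by (auto simp: uleaves_def)

lemma uleaves_trees: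
  assumes "m \<in> grd M (length us) p" "set us \<subseteq> utrees N L" "d = p + (rdeg us + ldeg us)"
  shows "((p, m), uleaves N L us) \<in> trees M (circ N L) 0 d"
proof -
  have "leaves0 (circ N L) (uleaves N L us)"
    using assms(2) by (auto simp: uleaves_def utrees_def intro!: cls_in_circ)
  thus ?thesis using assms(1,3) by (auto simp: trees_0_iff degs_uleaves)
qed

lemma uleaves_ex:
  assumes "\<forall>(s, e, x)\<in>set xs. s = [] \<and> x \<in> cls N L 0 e ` {u \<in> trees N L 0 e. Q u}"
  shows "\<exists>us. xs = uleaves N L us \<and> set us \<subseteq> utrees N L \<and> (\<forall>u\<in>set us. Q u)"
  using assms
proof (induction xs)
  case (Cons z xs)
  obtain s e x where z: "z = (s, e, x)" by (cases z)
  then obtain u us where "s = []" "u \<in> trees N L 0 e" "x = cls N L 0 e u" "Q u"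
    "xs = uleaves N L us" "set us \<subseteq> utrees N L" "\<forall>u\<in>set us. Q u" using Cons by auto
  thus ?case using z by (intro exI[of _ "u # us"]) (auto simp: utrees_iff)
qed (auto intro: exI[of _ "[]"])

lemma circ_circ_gen:
  fixes M :: "('k::field, 'm::ab_group_add) dgs" and N :: "('k, 'n::ab_group_add) dgs" and L :: "('k, 'l::ab_group_add) dgs"
  assumes "\<And>e. grd (circ N L) 0 e \<subseteq> PM.span (cls N L 0 e ` {u \<in> trees N L 0 e. Q u})"
  shows "grd (circ M (circ N L)) 0 d \<subseteq> PM.span (cls M (circ N L) 0 d `
    {((p, m), uleaves N L us) | p m us. m \<in> grd M (length us) p \<and> set us \<subseteq> utrees N L \<and> (\<forall>u\<in>set us. Q u) \<and> d = p + (rdeg us + ldeg us)})"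
    (is "_ \<subseteq> PM.span (_ ` ?T)")
proof -
  let ?G = "\<lambda>e. cls N L 0 e ` {u \<in> trees N L 0 e. Q u}"
  have "grd (circ M (circ N L)) 0 d \<subseteq> PM.span (cls M (circ N L) 0 d ` {(r, xs) \<in> trees M (circ N L) 0 d. \<forall>(s, e, x)\<in>set xs. x \<in> ?G e})"
    by (rule circ_gen[OF gmod_circ]) (use assms in \<open>auto simp: cls_in_circ\<close>)
  also have "\<dots> \<subseteq> PM.span (cls M (circ N L) 0 d ` ?T)"
  proof (intro PM.span_mono image_mono subsetI)
    fix t assume "t \<in> {(r, xs) \<in> trees M (circ N L) 0 d. \<forall>(s, e, x)\<in>set xs. x \<in> ?G e}"
    then obtain p m xs where t: "t = ((p, m), xs)" "((p, m), xs) \<in> trees M (circ N L) 0 d" "\<forall>(s, e, x)\<in>set xs. x \<in> ?G e"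
      by auto
    hence "\<forall>(s, e, x)\<in>set xs. s = [] \<and> x \<in> ?G e" by (auto simp: trees_0_iff)
    from uleaves_ex[OF this] obtain us where us: "xs = uleaves N L us" "set us \<subseteq> utrees N L" "\<forall>u\<in>set us. Q u" by blast
    thus "t \<in> ?T" using t by (auto simp: trees_0_iff degs_uleaves)
  qed
  finally show ?thesis .
qed

lemma circ_circ_gen_all:
  "grd (circ M (circ N L)) 0 d \<subseteq> PM.span (cls M (circ N L) 0 d `
    {((p, m), uleaves N L us) | p m us. m \<in> grd M (length us) p \<and> set us \<subseteq> utrees N L \<and> d = p + (rdeg us + ldeg us)})"
  for M :: "('k::field, 'm::ab_group_add) dgs" and N :: "('k, 'n::ab_group_add) dgs" and L :: "('k, 'l::ab_group_add) dgs"
  using circ_circ_gen[of N L "\<lambda>u. True" M d] by (simp add: grd_circ)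

text \<open>In arity zero all label lists of the leaves are empty and the relabelling is trivial;
  labels survive only inside the top.\<close>

lemma assoc_uleaves:
  fixes M :: "('k::field, 'm::ab_group_add) dgs" and N :: "('k, 'n::ab_group_add) dgs" and L :: "('k, 'l::ab_group_add) dgs"
  assumes N: "gmod N" "acl N" and L: "gmod L" "acl L"
    and m: "m \<in> grd M (length us) p" and us: "set us \<subseteq> utrees N L" and d: "d = p + (rdeg us + ldeg us)"
  shows "assoc M N L 0 d (cls M (circ N L) 0 d ((p, m), uleaves N L us)) =
    psc ((-1) powi aexp us) (cls (circ M N) L 0 d ((p + rdeg us, atop M N (p, m) us), concat (map snd us)))"
proof -
  let ?se = "map (\<lambda>u. ([] :: nat list, tdeg u)) us"
  have "uleaves N L us = map2 (\<lambda>(s, e) u. (s, e, cls N L (length s) e u)) ?se us"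
    by (induction us) auto
  moreover have "list_all2 (uok N L) ?se us"
    using us by (induction us) (auto simp: utrees_def)
  moreover have "sum_list (map snd ?se) = rdeg us + ldeg us"
    by (induction us) (auto simp: tdeg_def)
  moreover have "concat (map fst ?se) = []" by simp
  moreover have "alv (map fst ?se) us = concat (map snd us)"
  proof -
    have "rl ((!) []) (snd u) = snd u" if "u \<in> utrees N L" for u
      using that by (intro rl_id) (cases u, force simp: utrees_eq)
    thus ?thesis using us by (induction us) auto
  qed
  ultimately show ?thesis
    using assoc_cls[OF N L m, of ?se 0 d] d by (simp add: agraft_def)
qed

text \<open>The operadic composite of \<open>r\<close> with the roots of \<open>us\<close>; the
  leaves of \<open>us\<close> enter through their number alone.\<close>

definition gam :: "('k::field, 'p::plus) dgs \<Rightarrow> (('p, 'p) tree \<Rightarrow>\<^sub>0 'k, 'p) gmap \<Rightarrow> int \<times> 'p \<Rightarrow> ('p, 'l) tree list \<Rightarrow> 'p" where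
  "gam P \<gamma> r us = \<gamma> (lcnt us) (fst r + rdeg us) (atop P P r us)"

lemma ghom_idm: "ghom 0 V V idm"
  by (simp add: ghom_def glinear_idm) (simp add: idm_def)

lemma ctree_idm:
  "ctree r f idm ((p, m), xs) = ((p + r, f (length xs) p m), xs)"
  by (simp add: ctree_eq idm_def split_beta)

lemma dg_hom_ghom: "dg_hom V W f \<Longrightarrow> ghom 0 V W f"
  by (simp add: dg_hom_def)

lemma iota_eq:
  fixes P :: "('k::field, 'p::ab_group_add) dgs" and V :: "('k, 'v::ab_group_add) dgs"
  assumes "ghom 0 unit_smod P \<eta>"
  shows "iota P \<eta> V n d x = cls P V n d ((0, \<eta> (Suc 0) 0 1), [([0..<n], d, x)])"
  by (simp add: iota_def gcomp_def lunit_def comp_map_cls[OF assms ghom_idm] ctree_idm)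

section \<open>Multiplication in free algebras over an operad\<close>

locale opd =
  fixes P :: "('k::field_char_0, 'p::ab_group_add) dgs" and \<gamma> and \<eta>
  assumes opd: "operad P \<gamma> \<eta>"
begin

lemma P_smodule: "smodule P" and \<gamma>_dg: "dg_hom (circ P P) P \<gamma>" and \<eta>_dg: "dg_hom unit_smod P \<eta>"
  using opd by (auto simp: operad_def)

lemmas P_gmod = smodule_gmod[OF P_smodule] and P_acl = smodule_acl[OF P_smodule]
lemmas \<gamma>_ghom = dg_hom_ghom[OF \<gamma>_dg] and \<eta>_ghom = dg_hom_ghom[OF \<eta>_dg]
lemmas iota = iota_eq[OF \<eta>_ghom]

abbreviation "\<eta>1 \<equiv> \<eta> (Suc 0) 0 1"

lemma \<eta>1_in: "\<eta>1 \<in> grd P (Suc 0) 0"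
proof -
  have "(1 :: 'k) \<in> grd unit_smod (Suc 0) 0" by (simp add: unit_smod_def)
  thus ?thesis using glinearD(1)[OF ghom_glinear[OF \<eta>_ghom], of 1 "Suc 0" 0] by simp
qed

lemma \<eta>_left:
  assumes "\<mu> \<in> grd P n q"
  shows "\<gamma> n q (cls P P n q ((0, \<eta>1), [([0..<n], q, \<mu>)])) = \<mu>"
proof -
  have "(\<gamma> \<bullet>[0] comp_map P P 0 \<eta> idm \<bullet>[0] lunit P) n q \<mu> = idm n q \<mu>"
    using opd assms unfolding operad_def eq_on_def by blast
  hence "\<gamma> n q (iota P \<eta> P n q \<mu>) = \<mu>" by (simp add: gcomp_def iota_def idm_def)
  thus ?thesis by (simp add: iota)
qed

lemma \<eta>_right:
  assumes "m \<in> grd P n p"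
  shows "\<gamma> n p (cls P P n p ((p, m), map (\<lambda>i. ([i], 0, \<eta>1)) [0..<n])) = m"
proof -
  have "(\<gamma> \<bullet>[0] comp_map P P 0 idm \<eta> \<bullet>[0] runit P) n p m = idm n p m"
    using opd assms unfolding operad_def eq_on_def by blast
  hence "\<gamma> n p (comp_map P P 0 idm \<eta> n p (runit P n p m)) = m"
    by (simp add: gcomp_def idm_def)
  thus ?thesis unfolding runit_def comp_map_cls[OF ghom_idm \<eta>_ghom]
    by (simp add: ctree_eq o_def) (simp add: idm_def)
qed

lemma iota_in:
  fixes V :: "('k, 'v::ab_group_add) dgs"
  assumes "x \<in> grd V n d" shows "iota P \<eta> V n d x \<in> grd (circ P V) n d"
  unfolding iota by (rule cls_in_circ) (use assms \<eta>1_in in \<open>auto simp: mem_trees atLeast0LessThan\<close>)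

lemma glinear_iota:
  assumes "gmod V" shows "glinear 0 V (circ P V) (iota P \<eta> V)"
proof -
  have t: "((0, \<eta>1), [([0..<n], d, x)]) \<in> trees P V n d" if "x \<in> grd V n d" for n d x
    using that \<eta>1_in by (auto simp: mem_trees atLeast0LessThan)
  show ?thesis unfolding glinear_def
  proof (intro allI conjI ballI)
    fix n d x assume x: "x \<in> grd V n d"
    show "iota P \<eta> V n d x \<in> grd (circ P V) n (d + 0)" using iota_in[OF x] by simp
    show "iota P \<eta> V n d (scl V c x) = scl (circ P V) c (iota P \<eta> V n d x)" for c
      using cls_scl_leaf_app[of 0 \<eta>1 "[]" "[0..<n]" d x "[]" P V n d c] t[OF x] by (simp add: iota)
    fix y assume "y \<in> grd V n d"
    thus "iota P \<eta> V n d (x + y) = iota P \<eta> V n d x + iota P \<eta> V n d y"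
      using cls_add_leaf_app[of 0 \<eta>1 "[]" "[0..<n]" d x "[]" P V n d y] t[OF x] by (simp add: iota)
  qed
qed

lemma gam_in:
  assumes "m \<in> grd P (length us) p" "set us \<subseteq> utrees P L"
  shows "gam P \<gamma> (p, m) us \<in> grd P (lcnt us) (p + rdeg us)"
proof -
  have "list_all2 (uok P L) (map (\<lambda>u. ([] :: nat list, tdeg u)) us) us"
    using assms(2) by (induction us) (auto simp: utrees_def)
  from atop_trees[OF assms(1) this] have "atop P P (p, m) us \<in> grd (circ P P) (lcnt us) (p + rdeg us)"
    by (simp add: atop_def cls_in_circ)
  thus ?thesis using glinearD(1)[OF ghom_glinear[OF \<gamma>_ghom]] by (simp add: gam_def)
qed

lemma length_concat_snd: "length (concat (map snd us)) = lcnt us"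
  by (induction us) auto

lemma degs_concat_snd: "degs (concat (map snd us)) = ldeg us"
  by (induction us) auto

lemma graft_trees:
  assumes "m \<in> grd P (length us) p" "set us \<subseteq> utrees P X" "d = p + (rdeg us + ldeg us)"
  shows "((p + rdeg us, gam P \<gamma> (p, m) us), concat (map snd us)) \<in> trees P X 0 d"
proof -
  have "leaves0 X (concat (map snd us))"
    using assms(2)
  proof (induction us)
    case (Cons u us)
    thus ?case by (cases u) (auto simp: utrees_eq)
  qed simp
  thus ?thesis using gam_in[OF assms(1,2)] assms(3)
    by (simp add: trees_0_iff length_concat_snd degs_concat_snd)
qed

lemma free_mult_uleaves:
  assumes X: "flat X"
    and m: "m \<in> grd P (length us) p" and us: "set us \<subseteq> utrees P X" and d: "d = p + (rdeg us + ldeg us)"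
  shows "free_mult P \<gamma> X 0 d (cls P (circ P X) 0 d ((p, m), uleaves P X us)) =
    psc ((-1) powi aexp us) (cls P X 0 d ((p + rdeg us, gam P \<gamma> (p, m) us), concat (map snd us)))"
  unfolding free_mult_def gcomp_def
    assoc_uleaves[OF P_gmod P_acl flatD(1)[OF X] flat_acl[OF X] m us d]
  by (simp add: plinD(2)[OF plin_comp_map] comp_map_cls[OF \<gamma>_ghom ghom_idm] ctree_idm length_concat_snd gam_def)

lemma free_mult_in:
  assumes X: "flat X" and x: "x \<in> grd (circ P (circ P X)) 0 d"
  shows "free_mult P \<gamma> X 0 d x \<in> grd (circ P X) 0 d"
  by (rule plin_in[OF plin_free_mult _ _ subsetD[OF circ_circ_gen_all x]])
    (use gmodD(2)[OF gmod_circ[of P X]] in \<open>auto simp: free_mult_uleaves[OF X] intro!: PM.subspace_scale cls_in_circ graft_trees\<close>)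

lemma glinear_free_mult:
  assumes X: "flat X"
  shows "glinear 0 (circ P (circ P X)) (circ P X) (free_mult P \<gamma> X)"
  by (rule flat_glinearI[OF flat_circ[OF flat_circ[OF X]] flat_circ[OF X]])
    (auto simp: free_mult_in[OF X] plinD[OF plin_free_mult])

text \<open>Left unit law of the free algebra: on a single tree grafted on the unit it is
  \<open>\<eta>_left\<close>, applied to the root.\<close>

lemma free_mult_iota:
  assumes X: "flat X" and x: "x \<in> grd (circ P X) 0 d"
  shows "free_mult P \<gamma> X 0 d (iota P \<eta> (circ P X) 0 d x) = x"
proof (rule glinear_span_eq[where f = "free_mult P \<gamma> X \<bullet>[0] iota P \<eta> (circ P X)" and g = idm and d = d and n = 0,
      unfolded gcomp_def idm_def, simplified])
  show "glinear 0 (circ P X) (circ P X) (\<lambda>n d x. free_mult P \<gamma> X n d (iota P \<eta> (circ P X) n d x))"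
    using glinear_gcomp[OF glinear_iota[OF gmod_circ] glinear_free_mult[OF X]] by (simp add: gcomp_def)
  show "glinear 0 (circ P X) (circ P X) (\<lambda>n d x. x)" using glinear_idm by (simp add: idm_def)
  fix z assume "z \<in> cls P X 0 d ` trees P X 0 d"
  then obtain u where u: "u \<in> trees P X 0 d" "z = cls P X 0 d u" by auto
  obtain q \<mu> xs where u': "u = ((q, \<mu>), xs)" by (cases u) auto
  have d: "tdeg u = d" "u \<in> utrees P X" using u(1) by (auto simp: utrees_iff)
  have \<mu>: "\<mu> \<in> grd P (length xs) q" using u(1) by (simp add: u' mem_trees)
  have g: "gam P \<gamma> (0, \<eta>1) [u] = \<mu>" using \<eta>_left[OF \<mu>] by (simp add: gam_def atop_def u')
  have "iota P \<eta> (circ P X) 0 d z = cls P (circ P X) 0 d ((0, \<eta>1), uleaves P X [u])"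
    unfolding iota by (simp add: d u(2))
  also have "free_mult P \<gamma> X 0 d \<dots> = z"
    using d \<eta>1_in by (subst free_mult_uleaves[OF X]) (auto simp: tdeg_def u(2) g, simp add: u')
  finally show "free_mult P \<gamma> X 0 d (iota P \<eta> (circ P X) 0 d z) = z" .
qed (auto simp: grd_circ x[unfolded grd_circ])

text \<open>Right unit law: every leaf becomes a one-leaf tree on the unit, and
  \<open>\<eta>_right\<close> removes these units. It writes an element of P(X) as a product of
  generators, which is how maps out of P(X) are later recovered from their values on X.\<close>

lemma free_mult_iotas:
  assumes X: "flat X" and x: "x \<in> grd (circ P X) 0 d"
  shows "free_mult P \<gamma> X 0 d (comp_map P (circ P X) 0 idm (iota P \<eta> X) 0 d x) = x"
proof -
  have gi: "ghom 0 X (circ P X) (iota P \<eta> X)"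
    by (rule flat_ghom[OF X flat_circ[OF X] glinear_iota[OF flatD(1)[OF X]]])
  have p1: "plin (\<lambda>x. x)" by (simp add: plin_def)
  have p2: "plin (\<lambda>x. free_mult P \<gamma> X 0 d (comp_map P (circ P X) 0 idm (iota P \<eta> X) 0 d x))"
    using plin_free_mult[of P \<gamma> X 0 d] plin_comp_map[of P "circ P X" 0 idm "iota P \<eta> X" 0 d] by (simp add: plin_def)
  have main: "free_mult P \<gamma> X 0 d (comp_map P (circ P X) 0 idm (iota P \<eta> X) 0 d z) = z"
    if z: "z \<in> cls P X 0 d ` trees P X 0 d" for z
  proof -
    from z obtain p m xs where u: "((p, m), xs) \<in> trees P X 0 d" "z = cls P X 0 d ((p, m), xs)" by auto
    hence m: "m \<in> grd P (length xs) p" and leaf: "leaves0 X xs"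
      and d: "d = p + degs xs" by (auto simp: trees_0_iff)
    let ?us = "map (\<lambda>y. ((0 :: int, \<eta>1), [y])) xs"
    have ul: "map (\<lambda>(s, e, x). (s, e, iota P \<eta> X (length s) e x)) xs = uleaves P X ?us"
      using leaf by (induction xs) (auto simp: iota tdeg_def)
    have ut: "set ?us \<subseteq> utrees P X" using leaf \<eta>1_in by (auto simp: utrees_eq)
    have r: "rdeg ?us = 0" "ldeg ?us = degs xs" "aexp ?us = 0" "lcnt ?us = length xs" "concat (map snd ?us) = xs"
      by (induction xs) auto
    have "topl c ?us = map (\<lambda>i. ([i], 0, \<eta>1)) [c..<c + length xs]" for c
      by (induction xs arbitrary: c) (auto simp: upt_conv_Cons simp del: upt_Suc)
    hence "gam P \<gamma> (p, m) ?us = m"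
      using \<eta>_right[OF m] by (simp add: gam_def atop_def r)
    thus ?thesis
      unfolding u(2) comp_map_cls[OF ghom_idm gi] ctree_eq
      using free_mult_uleaves[OF X _ ut, of m p d, unfolded r] m d
      by (simp add: ul r idm_def)
  qed
  show ?thesis by (rule plin_eq[OF p2 p1 main x[unfolded grd_circ]])
qed

end

lemma rl_cong: "(\<And>i. i \<in> set (concat (map fst xs)) \<Longrightarrow> g i = h i) \<Longrightarrow> rl g xs = rl h xs"
  by (induction xs) auto

lemma rl_topl_shift: "rl (\<lambda>i. c + i) (topl c' us) = topl (c + c') us"
proof -
  have "map (\<lambda>i. c + i) [a..<b] = [c + a..<c + b]" for a b by (intro nth_equalityI) auto
  thus ?thesis by (induction us arbitrary: c') (auto simp: add.assoc)
qed

lemma rl_topl_nth: "rl ((!) [c..<c + lcnt us]) (topl 0 us) = topl c us"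
proof -
  have "rl ((!) [c..<c + lcnt us]) (topl 0 us) = rl (\<lambda>i. c + i) (topl 0 us)"
    by (rule rl_cong) (auto simp: labels_topl)
  thus ?thesis by (simp add: rl_topl_shift)
qed

lemma cleaves_trees:
  fixes M :: "('k::field, 'm::plus) dgs" and N :: "('k, 'n::plus) dgs" and L :: "('k, 'l::plus) dgs"
  assumes "m \<in> grd M (length us) p" "list_all2 (uok N L) se us"
    "mset (concat (map fst se)) = mset [0..<n]" "p + sum_list (map snd se) = d"
  shows "((p, m), map2 (\<lambda>(s, e) u. (s, e, cls N L (length s) e u)) se us) \<in> trees M (circ N L) n d"
proof -
  let ?xs = "map2 (\<lambda>(s, e) u. (s, e, cls N L (length s) e u)) se us"
  have l: "length se = length us" using assms(2) by (rule list_all2_lengthD)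
  have "map fst ?xs = map fst se" using l by (auto intro!: nth_equalityI simp: split_beta)
  moreover have "map edeg ?xs = map snd se" using l by (auto intro!: nth_equalityI simp: split_beta)
  hence "degs ?xs = sum_list (map snd se)" by (simp only: degs_map_fst)
  moreover have "\<forall>(s, e, x)\<in>set ?xs. x \<in> grd (circ N L) (length s) e"
    using assms(2) by (auto simp: list_all2_iff uok_def intro!: cls_in_circ)
  ultimately show ?thesis using assms l by (simp add: mem_trees_mset)
qed

text \<open>Collects scalars from many leaves at once; \<open>free_mult_assoc\<close> needs it for
  the signs produced inside the leaves.\<close>

lemma cls_scl_all:
  fixes M :: "('k::field, 'm::ab_group_add) dgs" and N :: "('k, 'n::ab_group_add) dgs"
  assumes N: "gmod N"
    and "((p, m), pre @ map (\<lambda>v. ([], e v, y v)) vs) \<in> trees M N 0 d"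
  shows "cls M N 0 d ((p, m), pre @ map (\<lambda>v. ([], e v, scl N (c v) (y v))) vs) =
    psc (\<Prod>v\<leftarrow>vs. c v) (cls M N 0 d ((p, m), pre @ map (\<lambda>v. ([], e v, y v)) vs))"
  using assms(2)
proof (induction vs arbitrary: pre)
  case (Cons v vs)
  have t: "((p, m), pre @ ([], e v, y v) # map (\<lambda>v. ([], e v, scl N (c v) (y v))) vs) \<in> trees M N 0 d"
    using Cons.prems gmodD(6)[OF N] by (auto simp: trees_0_iff degs_def comp_def ball_Un)
  have "cls M N 0 d ((p, m), pre @ map (\<lambda>v. ([], e v, scl N (c v) (y v))) (v # vs)) =
    psc (c v) (cls M N 0 d ((p, m), (pre @ [([], e v, y v)]) @ map (\<lambda>v. ([], e v, scl N (c v) (y v))) vs))"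
    using cls_scl_leaf_app[OF t, of "c v"] by simp
  also have "\<dots> = psc (c v) (psc (\<Prod>v\<leftarrow>vs. c v) (cls M N 0 d ((p, m), (pre @ [([], e v, y v)]) @ map (\<lambda>v. ([], e v, y v)) vs)))"
    using Cons.prems by (subst Cons.IH) auto
  finally show ?case by simp
qed simp

context opd
begin

text \<open>\<open>V\<close> lists the roots of the middle level with, for each of them, the trees grafted on it.\<close>

lemma gam_gam:
  assumes m: "m \<in> grd P (length V) p"
    and V: "\<forall>(r, w)\<in>set V. snd r \<in> grd P (length w) (fst r) \<and> set w \<subseteq> utrees P X"
  defines "W \<equiv> \<lambda>(r, w). ((fst r + rdeg w, gam P \<gamma> r w), concat (map snd w))"
  defines "Tf \<equiv> \<lambda>(r, w). (r, topl 0 w)"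
  defines "cw \<equiv> concat (map snd V)"
  shows "gam P \<gamma> (p, m) (map W V) = scl P ((-1) powi aexp (map Tf V))
    (gam P \<gamma> (p + rdeg (map Tf V), gam P \<gamma> (p, m) (map Tf V)) cw)"
proof -
  define N where "N = lcnt (map W V)"
  define D where "D = p + rdeg (map W V)"
  define se where "se = (\<lambda>c. map (\<lambda>(s, e, x). (s, e)) (topl c (map W V)))"
  let ?x = "\<lambda>c. map2 (\<lambda>(s, e) u. (s, e, cls P P (length s) e u)) (se c) (map Tf V)"
  have Tt: "Tf (r, w) \<in> trees P P (lcnt w) (fst r + rdeg w)"
    if "snd r \<in> grd P (length w) (fst r)" "set w \<subseteq> utrees P X" for r w
  proof -
    have "list_all2 (uok P X) (map (\<lambda>u. ([] :: nat list, tdeg u)) w) w"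
      using that(2) by (induction w) (auto simp: utrees_def)
    from atop_trees[OF that(1) this] show ?thesis by (cases r) (simp add: Tf_def)
  qed
  have ok: "list_all2 (uok P P) (se c) (map Tf V)" for c
    unfolding se_def using V
  proof (induction V arbitrary: c)
    case (Cons v V)
    obtain r w where v: "v = (r, w)" by (cases v)
    have "Tf (r, w) \<in> trees P P (lcnt w) (fst r + rdeg w)" using Cons.prems v by (intro Tt) auto
    thus ?case using Cons by (simp add: v W_def length_concat_snd)
  qed simp
  have lab: "mset (concat (map fst (se 0))) = mset [0..<N]"
  proof -
    have "map fst (se 0) = map fst (topl 0 (map W V))" by (simp add: se_def split_beta)
    thus ?thesis by (simp add: labels_topl N_def)
  qed
  have dg: "p + sum_list (map snd (se 0)) = D"
  proof -
    have "map snd (se 0) = map edeg (topl 0 (map W V))" by (simp add: se_def split_beta)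
    thus ?thesis by (simp add: topl_degrees D_def rdeg_def o_def)
  qed
  have m': "m \<in> grd P (length (map Tf V)) p" using m by simp
  \<comment> \<open>The associativity axiom of the operad is applied to this element, with root
    \<open>m\<close> and the tops of \<open>V\<close> in its leaves. One side multiplies inside the
    leaves, the other moves all roots of \<open>V\<close> up first and thereby produces the
    sign.\<close>
  have x: "cls P (circ P P) N D ((p, m), ?x 0) \<in> grd (circ P (circ P P)) N D"
    by (rule cls_in_circ, rule cleaves_trees[OF m' ok lab dg])
  have "map (\<lambda>(s, e, y). (s, e, \<gamma> (length s) e y)) (?x c) = topl c (map W V)" for c
    unfolding se_def
  proof (induction V arbitrary: c)
    case (Cons v V)
    obtain p' m' w where v: "v = ((p', m'), w)" by (cases v) auto
    show ?case using Cons[of "c + lcnt w"] by (simp add: v W_def Tf_def length_concat_snd gam_def atop_def)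
  qed simp
  hence l: "\<gamma> N D (comp_map P P 0 idm \<gamma> N D (cls P (circ P P) N D ((p, m), ?x 0))) = gam P \<gamma> (p, m) (map W V)"
    unfolding comp_map_cls[OF ghom_idm \<gamma>_ghom] ctree_eq
    by (simp add: gam_def atop_def N_def D_def idm_def)
  have al: "alv (map fst (topl c (map W V))) (map Tf V) = topl c cw" for c
    unfolding cw_def
  proof (induction V arbitrary: c)
    case (Cons v V)
    obtain r w where v: "v = (r, w)" by (cases v) auto
    show ?case using Cons[of "c + lcnt w"] by (simp add: v W_def Tf_def length_concat_snd rl_topl_nth)
  qed simp
  have cw: "lcnt cw = N" "rdeg (map W V) = rdeg (map Tf V) + rdeg cw"
    unfolding cw_def N_def by (induction V) (auto simp: W_def Tf_def length_concat_snd)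
  have sf: "map fst (se 0) = map fst (topl 0 (map W V))" by (simp add: se_def split_beta)
  have a: "assoc P P P N D (cls P (circ P P) N D ((p, m), ?x 0)) =
    psc ((-1) powi aexp (map Tf V)) (cls (circ P P) P N D ((p + rdeg (map Tf V), atop P P (p, m) (map Tf V)), topl 0 cw))"
    unfolding assoc_cls[OF P_gmod P_acl P_gmod P_acl m' ok lab dg] sf by (simp add: agraft_def al)
  have lt: "length cw = lcnt (map Tf V)" unfolding cw_def by (induction V) (auto simp: Tf_def)
  have cwt: "((p + rdeg (map Tf V), gam P \<gamma> (p, m) (map Tf V)), topl 0 cw) \<in> trees P P N D"
  proof -
    have "((p + rdeg (map Tf V), atop P P (p, m) (map Tf V)), topl 0 cw) \<in> trees (circ P P) P N D"
      using agraft_trees[OF m' ok lab dg] unfolding sf al .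
    from ctree_trees[OF this ghom_glinear[OF \<gamma>_ghom] glinear_idm] show ?thesis
      by (simp add: ctree_idm lt gam_def)
  qed
  have "\<gamma> N D (comp_map P P 0 \<gamma> idm N D (assoc P P P N D (cls P (circ P P) N D ((p, m), ?x 0)))) =
     \<gamma> N D (psc ((-1) powi aexp (map Tf V)) (cls P P N D ((p + rdeg (map Tf V), gam P \<gamma> (p, m) (map Tf V)), topl 0 cw)))"
    unfolding a plinD(2)[OF plin_comp_map] comp_map_cls[OF \<gamma>_ghom ghom_idm] ctree_idm
    by (simp add: lt gam_def)
  also have "\<dots> = scl P ((-1) powi aexp (map Tf V)) (\<gamma> N D (cls P P N D ((p + rdeg (map Tf V), gam P \<gamma> (p, m) (map Tf V)), topl 0 cw)))"
    using glinearD(3)[OF ghom_glinear[OF \<gamma>_ghom] cls_in_circ[OF cwt]] by simp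
  also have "\<dots> = scl P ((-1) powi aexp (map Tf V)) (gam P \<gamma> (p + rdeg (map Tf V), gam P \<gamma> (p, m) (map Tf V)) cw)"
    by (simp add: gam_def[of _ _ _ cw] atop_def[of _ _ _ cw] cw D_def add.assoc)
  finally have r: "\<gamma> N D (comp_map P P 0 \<gamma> idm N D (assoc P P P N D (cls P (circ P P) N D ((p, m), ?x 0)))) = \<dots>" .
  have "(\<gamma> \<bullet>[0] comp_map P P 0 idm \<gamma>) N D (cls P (circ P P) N D ((p, m), ?x 0)) =
      (\<gamma> \<bullet>[0] comp_map P P 0 \<gamma> idm \<bullet>[0] assoc P P P) N D (cls P (circ P P) N D ((p, m), ?x 0))"
    using opd x unfolding operad_def eq_on_def by blast
  thus ?thesis using l r by (simp add: gcomp_def)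
qed

text \<open>On generators all levels consist of single trees. Both sides end with the same row of
  leaves; the roots agree by \<open>gam_gam\<close>, and the remaining signs by a count of
  exponents.\<close>

lemma free_mult_assoc:
  fixes X :: "('k, 'x::ab_group_add) dgs"
  assumes X: "flat X" and x: "x \<in> grd (circ P (circ P (circ P X))) 0 d"
  shows "free_mult P \<gamma> X 0 d (comp_map P (circ P X) 0 idm (free_mult P \<gamma> X) 0 d x) =
    free_mult P \<gamma> X 0 d (free_mult P \<gamma> (circ P X) 0 d x)"
proof -
  let ?F = "circ P X"
  have F: "flat ?F" by (rule flat_circ[OF X])
  \<comment> \<open>Selects the trees over P(X) whose leaves are themselves classes of single trees;
    they already generate P(P(X)).\<close>
  define Q where "Q = (\<lambda>U :: ('p, ('p, 'x) tree \<Rightarrow>\<^sub>0 'k) tree. \<exists>w. snd U = uleaves P X w \<and> set w \<subseteq> utrees P X)"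
  have "grd (circ P ?F) 0 e \<subseteq> PM.span (cls P ?F 0 e ` {U \<in> trees P ?F 0 e. Q U})" for e
  proof (rule order.trans[OF circ_circ_gen_all PM.span_mono], intro image_mono subsetI)
    fix z assume "z \<in> {((p, m), uleaves P X us) | p m us. m \<in> grd P (length us) p \<and> set us \<subseteq> utrees P X \<and> e = p + (rdeg us + ldeg us)}"
    thus "z \<in> {U \<in> trees P ?F 0 e. Q U}" by (auto simp: Q_def intro!: uleaves_trees)
  qed
  note gen = subsetD[OF circ_circ_gen[OF this] x]
  have p1: "plin (\<lambda>x. free_mult P \<gamma> X 0 d (comp_map P ?F 0 idm (free_mult P \<gamma> X) 0 d x))"
    using plin_free_mult[of P \<gamma> X 0 d] plin_comp_map[of P ?F 0 idm "free_mult P \<gamma> X" 0 d] by (simp add: plin_def)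
  have p2: "plin (\<lambda>x. free_mult P \<gamma> X 0 d (free_mult P \<gamma> ?F 0 d x))"
    using plin_free_mult[of P \<gamma> X 0 d] plin_free_mult[of P \<gamma> ?F 0 d] by (simp add: plin_def)
  have gf: "ghom 0 (circ P ?F) ?F (free_mult P \<gamma> X)"
    by (rule flat_ghom[OF flat_circ[OF F] F glinear_free_mult[OF X]])
  show ?thesis
  proof (rule plin_eq[OF p1 p2 _ gen])
    fix z assume "z \<in> cls P (circ P ?F) 0 d `
      {((p, m), uleaves P ?F us) | p m us. m \<in> grd P (length us) p \<and> set us \<subseteq> utrees P ?F \<and> (\<forall>u\<in>set us. Q u) \<and> d = p + (rdeg us + ldeg us)}"
    then obtain p m Us where z: "z = cls P (circ P ?F) 0 d ((p, m), uleaves P ?F Us)"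
      and m: "m \<in> grd P (length Us) p" and Us: "set Us \<subseteq> utrees P ?F" "\<forall>u\<in>set Us. Q u" and d: "d = p + (rdeg Us + ldeg Us)"
      by auto
    define Uf where "Uf = (\<lambda>(r :: int \<times> 'p, w). (r, uleaves P X w))"
    have "\<exists>V. Us = map Uf V \<and> (\<forall>(r, w)\<in>set V. snd r \<in> grd P (length w) (fst r) \<and> set w \<subseteq> utrees P X)"
      using Us
    proof (induction Us)
      case (Cons u Us)
      then obtain V where V: "Us = map Uf V" "\<forall>(r, w)\<in>set V. snd r \<in> grd P (length w) (fst r) \<and> set w \<subseteq> utrees P X" by auto
      obtain r xs where u: "u = (r, xs)" by (cases u)
      obtain w where w: "xs = uleaves P X w" "set w \<subseteq> utrees P X" using Cons.prems(2) u by (auto simp: Q_def)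
      have "snd r \<in> grd P (length w) (fst r)" using Cons.prems(1) u w by (cases r) (auto simp: utrees_eq)
      thus ?case using V w u by (intro exI[of _ "(r, w) # V"]) (auto simp: Uf_def)
    qed simp
    then obtain V where V: "Us = map Uf V" "\<forall>(r, w)\<in>set V. snd r \<in> grd P (length w) (fst r) \<and> set w \<subseteq> utrees P X" by blast
    define W where "W = (\<lambda>(r, w :: ('p, 'x) tree list). ((fst r + rdeg w, gam P \<gamma> r w), concat (map snd w)))"
    define Tf where "Tf = (\<lambda>(r :: int \<times> 'p, w :: ('p, 'x) tree list). (r, topl 0 w))"
    define cw where "cw = concat (map snd V)"
    have lV: "length Us = length V" by (simp add: V)
    have cw: "set cw \<subseteq> utrees P X" using V(2) by (fastforce simp: cw_def)
    have tops: "topl c (map Tf V) = topl c Us" "lcnt (map Tf V) = lcnt Us" "rdeg (map Tf V) = rdeg Us" for c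
      unfolding V(1) by (induction V arbitrary: c) (auto simp: Tf_def Uf_def)
    have gT: "gam P \<gamma> (p, m) (map Tf V) = gam P \<gamma> (p, m) Us"
      by (simp add: gam_def atop_def tops)
    have dW: "rdeg (map W V) = rdeg Us + rdeg cw" "ldeg (map W V) = ldeg cw" "ldeg Us = rdeg cw + ldeg cw" "ldeg (map Tf V) = rdeg cw"
      unfolding V(1) cw_def by (induction V) (auto simp: W_def Uf_def Tf_def degs_uleaves degs_concat_snd degs_topl)
    have leaves: "concat (map snd (map W V)) = concat (map snd cw)" "concat (map snd Us) = uleaves P X cw"
      unfolding V(1) cw_def by (induction V) (auto simp: W_def Uf_def)
    \<comment> \<open>The exponents agree as integers, not only modulo 2: both orders of flattening
      move the same roots past the same leaves.\<close>
    have sg: "(\<Sum>v\<leftarrow>V. aexp (snd v)) + aexp (map W V) + aexp (map Tf V) = aexp Us + aexp cw"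
    proof -
      have "rdeg (map W V) = rdeg (map Uf V) + rdeg (concat (map snd V))" "rdeg (map Tf V) = rdeg (map Uf V)" for V
        by (induction V) (auto simp: W_def Uf_def Tf_def)
      thus ?thesis unfolding V(1) cw_def
        by (induction V) (auto simp: W_def Uf_def Tf_def degs_uleaves degs_concat_snd degs_topl algebra_simps)
    qed
    have Wu: "set (map W V) \<subseteq> utrees P X"
    proof -
      have "W (r, w) \<in> utrees P X" if "snd r \<in> grd P (length w) (fst r)" "set w \<subseteq> utrees P X" for r w
        using graft_trees[of "snd r" w "fst r" X, OF that refl] by (auto simp: utrees_iff W_def)
      thus ?thesis using V(2) by auto
    qed
    have root: "gam P \<gamma> (p, m) (map W V) = scl P ((-1) powi aexp (map Tf V)) (gam P \<gamma> (p + rdeg Us, gam P \<gamma> (p, m) Us) cw)"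
      using gam_gam[OF _ V(2), of m p] m unfolding W_def[symmetric] Tf_def[symmetric] cw_def[symmetric] gT tops(3) lV .
    have lcw: "length cw = lcnt Us" unfolding cw_def V(1) by (induction V) (auto simp: Uf_def)
    have gcw: "gam P \<gamma> (p, m) Us \<in> grd P (length cw) (p + rdeg Us)"
      unfolding lcw by (rule gam_in[OF m Us(1)])
    have tr: "((p + rdeg Us + rdeg cw, gam P \<gamma> (p + rdeg Us, gam P \<gamma> (p, m) Us) cw), concat (map snd cw)) \<in> trees P X 0 d"
      by (rule graft_trees[OF gcw cw]) (simp add: d dW)
    have leaf: "map (\<lambda>(s, e, x). (s, e, free_mult P \<gamma> X (length s) e x)) (uleaves P ?F Us) =
      map (\<lambda>v. ([], tdeg (W v), psc ((-1) powi aexp (snd v)) (cls P X 0 (tdeg (W v)) (W v)))) V"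
      unfolding V(1) using V(2)
    proof (induction V)
      case (Cons v V)
      obtain p' m' w where v: "v = ((p', m'), w)" by (cases v) auto
      have "tdeg (Uf v) = p' + (rdeg w + ldeg w)" "tdeg (W v) = p' + (rdeg w + ldeg w)"
        by (simp_all add: v Uf_def W_def tdeg_def degs_uleaves degs_concat_snd)
      moreover have "free_mult P \<gamma> X 0 (tdeg (W v)) (cls P ?F 0 (tdeg (W v)) (Uf v)) = psc ((-1) powi aexp w) (cls P X 0 (tdeg (W v)) (W v))"
        using Cons.prems v calculation unfolding Uf_def W_def by (simp add: free_mult_uleaves[OF X])
      ultimately show ?case using Cons by (simp add: v)
    qed simp
    have ul: "map (\<lambda>v. ([], tdeg (W v), cls P X 0 (tdeg (W v)) (W v))) V = uleaves P X (map W V)"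
      by (simp add: uleaves_def)
    have "free_mult P \<gamma> X 0 d (comp_map P ?F 0 idm (free_mult P \<gamma> X) 0 d z) =
      free_mult P \<gamma> X 0 d (cls P ?F 0 d ((p, m), [] @ map (\<lambda>v. ([], tdeg (W v), scl ?F ((-1) powi aexp (snd v)) (cls P X 0 (tdeg (W v)) (W v)))) V))"
      unfolding z comp_map_cls[OF ghom_idm gf] ctree_eq leaf by (simp add: idm_def)
    also have "\<dots> = psc (\<Prod>v\<leftarrow>V. (-1) powi aexp (snd v)) (free_mult P \<gamma> X 0 d (cls P ?F 0 d ((p, m), uleaves P X (map W V))))"
      using m lV Wu by (subst cls_scl_all[OF gmod_circ]) (auto simp: ul plinD(2)[OF plin_free_mult] d dW intro!: uleaves_trees)
    also have "\<dots> = psc (\<Prod>v\<leftarrow>V. (-1) powi aexp (snd v)) (psc ((-1) powi aexp (map W V))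
        (cls P X 0 d ((p + rdeg Us + rdeg cw, gam P \<gamma> (p, m) (map W V)), concat (map snd cw))))"
      using m lV Wu by (subst free_mult_uleaves[OF X]) (auto simp: d dW leaves(1)[simplified] add.assoc)
    also have "\<dots> = psc ((-1) powi (aexp Us + aexp cw))
        (cls P X 0 d ((p + rdeg Us + rdeg cw, gam P \<gamma> (p + rdeg Us, gam P \<gamma> (p, m) Us) cw), concat (map snd cw)))"
      unfolding root cls_scl_root[OF tr] sg[symmetric] by (simp add: prod_list_powi powi_m1_add mult.assoc)
    also have "\<dots> = free_mult P \<gamma> X 0 d (free_mult P \<gamma> ?F 0 d z)"
      unfolding z free_mult_uleaves[OF F m Us(1) d] leaves(2) plinD(2)[OF plin_free_mult]
      using free_mult_uleaves[OF X gcw cw, of d] d dW by (simp add: powi_m1_add)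
    finally show "free_mult P \<gamma> X 0 d (comp_map P ?F 0 idm (free_mult P \<gamma> X) 0 d z) = free_mult P \<gamma> X 0 d (free_mult P \<gamma> ?F 0 d z)" .
  qed
qed

text \<open>Associativity read on one row of trees over P(X): multiplying inside the leaves first,
  or composing the roots first. It is the form used in \<open>root_graft\<close>.\<close>

lemma free_mult_graft:
  assumes X: "flat X" and m: "m \<in> grd P (length Us) p" and Us: "set Us \<subseteq> utrees P (circ P X)"
    and d: "d = p + (rdeg Us + ldeg Us)"
  shows "free_mult P \<gamma> X 0 d (cls P (circ P X) 0 d ((p, m), map (\<lambda>U. ([], tdeg U, free_mult P \<gamma> X 0 (tdeg U) (cls P (circ P X) 0 (tdeg U) U))) Us)) =
    psc ((-1) powi aexp Us) (free_mult P \<gamma> X 0 d (cls P (circ P X) 0 d ((p + rdeg Us, gam P \<gamma> (p, m) Us), concat (map snd Us))))"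
proof -
  let ?F = "circ P X"
  have F: "flat ?F" by (rule flat_circ[OF X])
  have gf: "ghom 0 (circ P ?F) ?F (free_mult P \<gamma> X)"
    by (rule flat_ghom[OF flat_circ[OF F] F glinear_free_mult[OF X]])
  have "cls P (circ P ?F) 0 d ((p, m), uleaves P ?F Us) \<in> grd (circ P (circ P ?F)) 0 d"
    by (intro cls_in_circ uleaves_trees m Us d)
  from free_mult_assoc[OF X this] show ?thesis
    unfolding comp_map_cls[OF ghom_idm gf] ctree_eq free_mult_uleaves[OF F m Us d] plinD(2)[OF plin_free_mult]
    by (simp add: uleaves_def idm_def o_def)
qed

end

section \<open>Trees that are linear in the second variable\<close>

definition aleaf :: "('n, 'l) gmap \<Rightarrow> (nat list \<times> int \<times> 'n) list \<Rightarrow> (nat list \<times> int \<times> 'l) list" where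
  "aleaf a xs = map (\<lambda>(s, e, x). (s, e, a (length s) e x)) xs"

definition injl :: "(nat list \<times> int \<times> 'n) list \<Rightarrow> (nat list \<times> int \<times> 'n \<times> 'l::zero) list" where
  "injl xs = map (\<lambda>(s, e, x). (s, e, (x, 0))) xs"

text \<open>Normal form of an arity-zero tree that is linear in the second variable: one
  distinguished leaf \<open>y\<close>, all leaves to its left and right in the first
  variable.\<close>

definition linl :: "(nat list \<times> int \<times> 'n::zero) list \<Rightarrow> int \<Rightarrow> 'l::zero \<Rightarrow> (nat list \<times> int \<times> 'n) list \<Rightarrow>
    (nat list \<times> int \<times> 'n \<times> 'l) list" where
  "linl xs e y ys = injl xs @ ([], e, (0, y)) # injl ys"

lemma degs_injl [simp]: "degs (injl xs) = degs xs"
  by (induction xs) (auto simp: injl_def)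

lemma degs_aleaf [simp]: "degs (aleaf a xs) = degs xs"
  by (induction xs) (auto simp: aleaf_def)

lemma aleaf_simps [simp]:
  "length (aleaf a xs) = length xs" "aleaf a (xs @ ys) = aleaf a xs @ aleaf a ys" "aleaf a [] = []"
  "aleaf a ((s, e, x) # xs) = (s, e, a (length s) e x) # aleaf a xs"
  by (auto simp: aleaf_def)

lemma injl_simps [simp]:
  "length (injl xs) = length xs" "injl (xs @ ys) = injl xs @ injl ys" "injl [] = []"
  "injl ((s, e, x) # xs) = (s, e, (x, 0)) # injl xs"
  by (auto simp: injl_def)

lemma length_linl [simp]: "length (linl xs e y ys) = Suc (length xs + length ys)"
  by (simp add: linl_def)

lemma aleaf_idm [simp]: "aleaf idm xs = xs"
  by (auto simp: aleaf_def idm_def)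

lemma degs_linl [simp]: "degs (linl xs e y ys) = degs xs + e + degs ys"
  by (simp add: linl_def)

lemma aleaf_injl [simp]: "aleaf (a \<bullet>[0] fstm) (injl xs) = aleaf a xs"
  by (induction xs) (auto simp: gcomp_def fstm_def)

lemma lin_tree_linl: "lin_tree (r, linl xs e y ys)"
proof -
  have "case linl xs e y ys ! i of (s, e, x, y) \<Rightarrow> if i = length xs then x = 0 else y = 0"
    if "i < length (linl xs e y ys)" for i
    using that by (auto simp: linl_def injl_def nth_append nth_Cons' split_beta)
  moreover have "length xs < length (linl xs e y ys)" by simp
  ultimately show ?thesis unfolding lin_tree_def prod.case by blast
qed

lemma linl_trees:
  assumes "gmod N" "gmod N'"
  shows "((p, m), linl xs e y ys) \<in> trees M (dsum N N') 0 d \<longleftrightarrow>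
    m \<in> grd M (Suc (length xs + length ys)) p \<and>
    (\<forall>(s, e, x)\<in>set xs \<union> set ys. s = [] \<and> x \<in> grd N 0 e) \<and> y \<in> grd N' 0 e \<and> p + degs xs + e + degs ys = d"
  using gmodD(3)[OF assms(1)] gmodD(3)[OF assms(2)]
  unfolding trees_0_iff linl_def by (auto simp: injl_def ball_Un degs_injl[unfolded injl_def])

lemma linl_ex:
  assumes "j < length zs" "zs ! j = ([], e, (0, y))" "\<And>i. i < length zs \<Longrightarrow> i \<noteq> j \<Longrightarrow> snd (snd (snd (zs ! i))) = 0"
  obtains xs ys where "zs = linl xs e y ys" "length xs = j"
proof -
  let ?f = "map (\<lambda>(s, e, z). (s, e, fst z))"
  have inj: "injl (?f ws) = ws" if "\<forall>(s, e, z)\<in>set ws. snd z = 0" for ws :: "(nat list \<times> int \<times> 'a \<times> 'b) list"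
    using that by (induction ws) (auto simp: injl_def)
  have "\<forall>(s, e, z)\<in>set (take j zs). snd z = 0" "\<forall>(s, e, z)\<in>set (drop (Suc j) zs). snd z = 0"
    using assms(1,3) unfolding all_set_conv_all_nth by (auto simp: split_beta)
  from inj[OF this(1)] inj[OF this(2)] have "zs = linl (?f (take j zs)) e y (?f (drop (Suc j) zs))"
    using id_take_nth_drop[OF assms(1)] assms(2) by (simp add: linl_def)
  thus ?thesis using assms(1) by (intro that) auto
qed

lemma lin_tree_ex:
  fixes N :: "('k, 'n::zero) dgs" and N' :: "('k, 'l::zero) dgs"
  assumes t: "((p, m), zs) \<in> trees M (dsum N N') 0 d" and l: "lin_tree ((p, m), zs)"
  shows "\<exists>xs e y ys. zs = linl xs e y ys"
proof -
  obtain j where j: "j < length zs"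
    "\<And>i. i < length zs \<Longrightarrow> case zs ! i of (s, e, (x, y)) \<Rightarrow> if i = j then x = 0 else y = 0"
    using l by (auto simp: lin_tree_def)
  obtain s e x y where z: "zs ! j = (s, e, (x, y))" by (cases "zs ! j") auto
  have "s = []" using t j(1) z by (auto simp: trees_0_iff dest!: nth_mem)
  moreover have "x = 0" using j z by force
  moreover have "snd (snd (snd (zs ! i))) = 0" if "i < length zs" "i \<noteq> j" for i
    using j(2)[OF that(1)] that(2) by (simp add: split_beta)
  ultimately show ?thesis using z linl_ex[OF j(1)] by metis
qed

lemma circ_lin_gen:
  assumes "gmod N" "gmod N'"
  shows "grd (circ_lin M N N') 0 d = PM.span (cls M (dsum N N') 0 d `
    {((p, m), linl xs e y ys) | p m xs e y ys. ((p, m), linl xs e y ys) \<in> trees M (dsum N N') 0 d})"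
proof -
  have "{t \<in> trees M (dsum N N') 0 d. lin_tree t} =
    {((p, m), linl xs e y ys) | p m xs e y ys. ((p, m), linl xs e y ys) \<in> trees M (dsum N N') 0 d}"
    using lin_tree_linl lin_tree_ex[of _ _ _ M N N' d] by fastforce
  thus ?thesis by (simp add: grd_circ_lin)
qed

lemma linl_add:
  fixes M :: "('k::field, 'm::ab_group_add) dgs" and N :: "('k, 'n::ab_group_add) dgs" and N' :: "('k, 'l::ab_group_add) dgs"
  assumes "gmod N" "gmod N'" "((p, m), linl xs e y ys) \<in> trees M (dsum N N') 0 d" "z \<in> grd N' 0 e"
  shows "cls M (dsum N N') 0 d ((p, m), linl xs e (y + z) ys) =
    cls M (dsum N N') 0 d ((p, m), linl xs e y ys) + cls M (dsum N N') 0 d ((p, m), linl xs e z ys)"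
  using cls_add_leaf_app[OF assms(3)[unfolded linl_def], of "(0, z)"] assms gmodD(3)[OF assms(1)]
  by (simp add: linl_def)

lemma linl_scl:
  fixes M :: "('k::field, 'm::ab_group_add) dgs" and N :: "('k, 'n::ab_group_add) dgs" and N' :: "('k, 'l::ab_group_add) dgs"
  assumes "gmod N" "gmod N'" "((p, m), linl xs e y ys) \<in> trees M (dsum N N') 0 d"
  shows "cls M (dsum N N') 0 d ((p, m), linl xs e (scl N' c y) ys) = psc c (cls M (dsum N N') 0 d ((p, m), linl xs e y ys))"
  using cls_scl_leaf_app[OF assms(3)[unfolded linl_def], of c] gmodD(9)[OF assms(1)]
  by (simp add: linl_def)

lemma linl_sum:
  fixes M :: "('k::field, 'm::ab_group_add) dgs" and N :: "('k, 'n::ab_group_add) dgs" and N' :: "('k, 'l::ab_group_add) dgs"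
  assumes "gmod N" "gmod N'" "((p, m), linl xs e 0 ys) \<in> trees M (dsum N N') 0 d" "finite I"
    "\<And>i. i \<in> I \<Longrightarrow> y i \<in> grd N' 0 e"
  shows "cls M (dsum N N') 0 d ((p, m), linl xs e (\<Sum>i\<in>I. scl N' (c i) (y i)) ys) =
    (\<Sum>i\<in>I. psc (c i) (cls M (dsum N N') 0 d ((p, m), linl xs e (y i) ys)))"
proof -
  have t: "((p, m), linl xs e z ys) \<in> trees M (dsum N N') 0 d" if "z \<in> grd N' 0 e" for z
    using assms(3) that by (simp add: linl_trees assms(1,2))
  show ?thesis using assms(4,5)
  proof (induction I rule: finite_induct)
    case empty
    show ?case using linl_scl[OF assms(1-3), of 0] gmodD(8)[OF assms(2)] by simp
  next
    case (insert i I)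
    have s: "(\<Sum>i\<in>I. scl N' (c i) (y i)) \<in> grd N' 0 e"
      using insert.prems by (intro gmodD(7)[OF assms(2)] gmodD(6)[OF assms(2)]) auto
    have yi: "y i \<in> grd N' 0 e" using insert.prems by auto
    show ?case
      using insert by (simp add: linl_add[OF assms(1,2) t[OF gmodD(6)[OF assms(2) yi]] s] linl_scl[OF assms(1,2) t[OF yi]])
  qed
qed

text \<open>Displays the summand at a given position in normal form, so that sums over positions can
  be compared through the distinguished leaf.\<close>

lemma etree_split:
  "etree r f (inl a) q (inr b) (length xs) ((p, m), xs @ ([], e, x) # ys) =
    ((p + r, f (Suc (length xs + length ys)) p m), linl (aleaf a xs) (e + q) (b 0 e x) (aleaf a ys))"
  unfolding etree_def gtree_def
  by (auto simp: linl_def aleaf_def injl_def inl_def inr_def nth_gleaves nth_append nth_Cons' split_beta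
      intro!: nth_equalityI)

lemma cls_zero_at:
  assumes "((p, m), xs) \<in> trees M N n d" "l < length xs" "snd (snd (xs ! l)) = 0" "gmod N"
  shows "cls M N n d ((p, m), xs) = 0"
proof -
  have x: "xs ! l = (fst (xs ! l), fst (snd (xs ! l)), 0)" using assms(3) by (simp add: prod_eq_iff)
  from cls_zero_leaf[OF assms(1,2) x assms(4)] show ?thesis using x by (metis list_update_id)
qed

lemma glinear_fstm: "glinear 0 (dsum V W) V fstm" and glinear_sndm: "glinear 0 (dsum V W) W sndm"
  by (auto simp: glinear_def fstm_def sndm_def)

lemma idm_gcomp [simp]: "idm \<bullet>[p] f = f" and gcomp_idm [simp]: "f \<bullet>[0] idm = f"
  by (auto simp: gcomp_def idm_def fun_eq_iff)

text \<open>Of the sum over positions only the distinguished leaf survives: elsewhere the second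
  component is 0, \<open>b\<close> sends it to 0, and a tree with a zero leaf has class 0.\<close>

lemma lcomp_lin:
  fixes M :: "('k::field, 'm::ab_group_add) dgs" and N :: "('k, 'n::ab_group_add) dgs" and N' :: "('k, 'n'::ab_group_add) dgs"
    and M' :: "('k, 'p::ab_group_add) dgs" and L :: "('k, 'l::ab_group_add) dgs" and L' :: "('k, 'l'::ab_group_add) dgs"
  assumes f: "ghom r M M' f" and a: "glinear 0 N L a" and b: "glinear q N' L' b"
    and fl: "flat N" "flat N'" "flat L" "flat L'"
    and t: "((p, m), linl xs e y ys) \<in> trees M (dsum N N') 0 d"
  shows "lcomp_map M' L L' r f (a \<bullet>[0] fstm) q (b \<bullet>[0] sndm) 0 d (cls M (dsum N N') 0 d ((p, m), linl xs e y ys)) =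
    psc ((-1) powi (q * (p + degs xs))) (cls M' (dsum L L') 0 (d + r + q)
      ((p + r, f (Suc (length xs + length ys)) p m), linl (aleaf a xs) (e + q) (b 0 e y) (aleaf a ys)))"
proof -
  let ?t = "((p, m), linl xs e y ys)"
  let ?a = "a \<bullet>[0] fstm" and ?b = "b \<bullet>[0] sndm"
  have a': "glinear 0 (dsum N N') L ?a" using glinear_gcomp[OF glinear_fstm a] by simp
  have b': "glinear q (dsum N N') L' ?b" using glinear_gcomp[OF glinear_sndm b] by simp
  have b0: "b n e 0 = 0" for n e by (rule glinear_0[OF b flatD(1)[OF fl(2)]])
  have z: "cls M' (dsum L L') 0 (d + r + q) (etree r f (inl ?a) q (inr ?b) j ?t) = 0"
    if j: "j < length (linl xs e y ys)" "j \<noteq> length xs" for j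
  proof -
    have tr: "etree r f (inl ?a) q (inr ?b) j ?t \<in> trees M' (dsum L L') 0 (d + r + q)"
      using j(1) by (intro etree_trees[OF t ghom_glinear[OF f]] glinear_inl glinear_inr a' b' flatD(1) fl) auto
    have "snd (snd (snd (linl xs e y ys ! j))) = 0"
      using j by (auto simp: linl_def injl_def nth_append nth_Cons' split_beta)
    hence "snd (snd (snd (etree r f (inl ?a) q (inr ?b) j ?t) ! j)) = 0"
      using j(1) unfolding etree_def gtree_def
      by (auto simp: nth_gleaves inr_def gcomp_def sndm_def b0 zero_prod_def split_beta)
    moreover obtain r' zs where e: "etree r f (inl ?a) q (inr ?b) j ?t = (r', zs)" by (cases "etree r f (inl ?a) q (inr ?b) j ?t")
    moreover have "length zs = length (linl xs e y ys)" using e by (auto simp: etree_def gtree_def)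
    ultimately show ?thesis
      using tr j(1) cls_zero_at[of "fst r'" "snd r'" zs M' "dsum L L'" 0 "d + r + q" j] gmod_dsum[OF flatD(1)[OF fl(3)] flatD(1)[OF fl(4)]]
      by simp
  qed
  have "etree r f (inl ?a) q (inr ?b) (length xs) ?t =
      etree r f (inl ?a) q (inr ?b) (length (injl xs :: (nat list \<times> int \<times> 'n \<times> 'n') list)) ((p, m), injl xs @ ([], e, (0, y)) # injl ys)"
    by (simp add: linl_def)
  also have "\<dots> = ((p + r, f (Suc (length xs + length ys)) p m), linl (aleaf a xs) (e + q) (b 0 e y) (aleaf a ys))"
    unfolding etree_split aleaf_injl by (simp add: gcomp_def sndm_def)
  finally have e: "etree r f (inl ?a) q (inr ?b) (length xs) ?t = \<dots>" .
  have s: "lsign q (length xs) ?t = ((-1) powi (q * (p + degs xs)) :: 'k)"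
    by (simp add: lsign_def linl_def)
  have "lcomp_map M' L L' r f ?a q ?b 0 d (cls M (dsum N N') 0 d ?t) =
    (\<Sum>j<length (linl xs e y ys). psc (lsign q j ?t) (cls M' (dsum L L') 0 (d + r + q) (etree r f (inl ?a) q (inr ?b) j ?t)))"
    unfolding lcomp_map_cls[OF f a' b' flat_dsum[OF fl(1,2)] fl(3,4)] esum_def by simp
  also have "\<dots> = (\<Sum>j\<in>{length xs}. psc (lsign q j ?t) (cls M' (dsum L L') 0 (d + r + q) (etree r f (inl ?a) q (inr ?b) j ?t)))"
    using z by (intro sum.mono_neutral_right) auto
  finally show ?thesis by (simp add: e s)
qed

section \<open>Modules\<close>

lemma glinear_gen_eq:
  assumes "glinear p V W f" "glinear p V W g" "scl V = psc" "gmod V" "grd V n d \<subseteq> PM.span G" "G \<subseteq> grd V n d"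
    and "\<And>x. x \<in> G \<Longrightarrow> f n d x = g n d x" "u \<in> grd V n d"
  shows "f n d u = g n d u"
proof (rule glinear_span_eq[OF assms(1-3) _ assms(7,8)])
  have "PM.subspace (grd V n d)" using gmodD(2)[OF assms(4)] assms(3) by simp
  thus "grd V n d = PM.span G" using assms(5,6) PM.span_minimal by blast
qed

text \<open>Allows the leaves of the grafted trees to be replaced by their images in
  \<open>A\<close> or \<open>M\<close> without changing the composite of the roots.\<close>

lemma gam_cong:
  "map (\<lambda>u. (fst u, length (snd u))) us = map (\<lambda>u. (fst u, length (snd u))) vs \<Longrightarrow>
    gam P \<gamma> r us = gam P \<gamma> r vs \<and> rdeg us = rdeg vs \<and> lcnt us = lcnt vs"
proof -
  assume a: "map (\<lambda>u. (fst u, length (snd u))) us = map (\<lambda>u. (fst u, length (snd u))) vs"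
  have "length us = length vs" using map_eq_imp_length_eq[OF a] .
  hence "topl c us = topl c vs \<and> rdeg us = rdeg vs \<and> lcnt us = lcnt vs" for c
    using a by (induction us vs arbitrary: c rule: list_induct2) auto
  thus ?thesis by (simp add: gam_def atop_def)
qed

definition ctl :: "('p, 'a) tree \<Rightarrow> ('p, 'a \<times> 'n::zero) tree" where
  "ctl u = (fst u, injl (snd u))"

lemma ctree_inlm: "ctree 0 idm inlm u = ctl u"
  by (cases u) (auto simp: ctree_eq ctl_def injl_def inlm_def idm_def)

lemma tdeg_simp [simp]: "tdeg ((p, m), xs) = p + degs xs"
  by (simp add: tdeg_def)

lemma ctl_facts:
  "tdeg (ctl u) = tdeg u" "fst (ctl u) = fst u" "length (snd (ctl u)) = length (snd u)"
  "degs (snd (ctl u)) = degs (snd u)"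
  by (simp_all add: ctl_def tdeg_def)

lemma ctl_utrees: "gmod N \<Longrightarrow> u \<in> utrees P A \<Longrightarrow> ctl u \<in> utrees P (dsum A N)"
  by (cases u) (auto simp: ctl_def utrees_eq injl_def gmodD(3))

lemma ctl_lists:
  "rdeg (map ctl us) = rdeg us" "ldeg (map ctl us) = ldeg us" "lcnt (map ctl us) = lcnt us"
  "concat (map snd (map ctl us)) = injl (concat (map snd us))"
  by (induction us) (auto simp: ctl_facts, auto simp: ctl_def)

section \<open>Maps P(X) -> M built from a : X -> A and b : X -> M\<close>

locale amd = opd P \<gamma> \<eta> for P :: "('k::field_char_0, 'p::ab_group_add) dgs" and \<gamma> and \<eta> +
  fixes A :: "('k, 'a::ab_group_add) dgs" and \<gamma>A and M :: "('k, 'm::ab_group_add) dgs" and \<gamma>M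
  assumes A: "palgebra P \<gamma> \<eta> A \<gamma>A" and M: "amodule P \<gamma> \<eta> A \<gamma>A M \<gamma>M"
begin

lemma A_flat: "flat A" and M_flat: "flat M"
  using A M by (auto simp: palgebra_def amodule_def dg_module_flat)

lemmas A_gmod = flatD(1)[OF A_flat] and M_gmod = flatD(1)[OF M_flat]
lemmas AM_flat = flat_dsum[OF A_flat M_flat]
lemma \<gamma>A_lin: "glinear 0 (circ P A) A \<gamma>A" and \<gamma>M_lin: "glinear 0 (circ_lin P A M) M \<gamma>M"
  using A M by (auto simp: palgebra_def amodule_def dg_hom_def ghom_def)

lemma \<gamma>M_psc: "x \<in> grd (circ_lin P A M) n d \<Longrightarrow> \<gamma>M n d (psc c x) = scl M c (\<gamma>M n d x)"
  using glinearD(3)[OF \<gamma>M_lin] by simp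

lemma \<gamma>M_sum:
  assumes "\<And>i. i \<in> I \<Longrightarrow> h i \<in> grd (circ_lin P A M) n d"
  shows "\<gamma>M n d (\<Sum>i\<in>I. psc (c i) (h i)) = (\<Sum>i\<in>I. scl M (c i) (\<gamma>M n d (h i)))"
proof -
  have "psc (c i) (h i) \<in> grd (circ_lin P A M) n d" if "i \<in> I" for i
    using gmodD(6)[OF gmod_circ_lin assms[OF that]] by simp
  hence "\<gamma>M n d (\<Sum>i\<in>I. psc (c i) (h i)) = (\<Sum>i\<in>I. \<gamma>M n d (psc (c i) (h i)))"
    by (rule glinear_sum[OF \<gamma>M_lin gmod_circ_lin])
  also have "\<dots> = (\<Sum>i\<in>I. scl M (c i) (\<gamma>M n d (h i)))"
    by (intro sum.cong refl \<gamma>M_psc assms)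
  finally show ?thesis .
qed

definition ual :: "('p, 'a) tree list \<Rightarrow> (nat list \<times> int \<times> 'a) list" where
  "ual us = map (\<lambda>u. ([], tdeg u, \<gamma>A 0 (tdeg u) (cls P A 0 (tdeg u) u))) us"

lemma kap_lin:
  assumes N: "flat N"
  shows "ghom 0 (dsum (circ P A) (circ_lin P A N)) (circ P (dsum A N)) (copair (comp_map P (dsum A N) 0 idm inlm) idm)"
proof (rule flat_ghom)
  show "flat (dsum (circ P A) (circ_lin P A N))" "flat (circ P (dsum A N))"
    by (intro flat_dsum flat_circ flat_circ_lin A_flat N)+
  have "glinear 0 A (dsum A N) inlm"
    using gmodD(3)[OF flatD(1)[OF N]] gmodD(9)[OF flatD(1)[OF N]] by (auto simp: glinear_def inlm_def)
  hence "ghom 0 A (dsum A N) inlm" by (rule flat_ghom[OF A_flat flat_dsum[OF A_flat N]])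
  note c = glinear_comp_map[OF ghom_idm[of P] this]
  show "glinear 0 (dsum (circ P A) (circ_lin P A N)) (circ P (dsum A N)) (copair (comp_map P (dsum A N) 0 idm inlm) idm)"
    using glinearD[OF c] circ_lin_sub[of P A N]
    by (auto simp: glinear_def copair_def idm_def PM.scale_right_distrib gmodD(4)[OF gmod_circ] subset_eq algebra_simps)
qed

text \<open>Reduces the multiplication on P(P(A), P(A, N)) to that of the free algebra on the sum of
  \<open>A\<close> and \<open>N\<close>, preceded by the inclusions, so that the results on
  \<open>free_mult\<close> apply.\<close>

lemma lmult_eq:
  "lmult P \<gamma> A N n d x = free_mult P \<gamma> (dsum A N) n d
    (comp_map P (circ P (dsum A N)) 0 idm (copair (comp_map P (dsum A N) 0 idm inlm) idm) n d x)"
  by (simp add: lmult_def lassoc_def free_mult_def gcomp_def)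

lemma inlm_ghom:
  assumes N: "flat N"
  shows "ghom 0 A (dsum A N) inlm"
  by (rule flat_ghom[OF A_flat flat_dsum[OF A_flat N]])
    (use gmodD(3)[OF flatD(1)[OF N]] gmodD(9)[OF flatD(1)[OF N]] in \<open>auto simp: glinear_def inlm_def\<close>)

lemma degs_ual [simp]: "degs (ual us) = rdeg us + ldeg us" and length_ual [simp]: "length (ual us) = length us"
  by (induction us) (auto simp: ual_def tdeg_def)

lemma lmult_linl:
  assumes N: "flat N"
  shows "lmult P \<gamma> A N 0 d (cls P (dsum (circ P A) (circ_lin P A N)) 0 d ((p, m), linl xs e y ys)) =
    free_mult P \<gamma> (dsum A N) 0 d (cls P (circ P (dsum A N)) 0 d ((p, m),
      aleaf (comp_map P (dsum A N) 0 idm inlm) xs @ ([], e, y) # aleaf (comp_map P (dsum A N) 0 idm inlm) ys))"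
proof -
  have z: "comp_map P (dsum A N) 0 idm inlm n e 0 = 0" for n e by (simp add: comp_map_alt)
  have kx: "copair (comp_map P (dsum A N) 0 idm inlm) idm n e (x, y) = comp_map P (dsum A N) 0 idm inlm n e x + y" for n e x y
    by (simp add: copair_def) (simp add: idm_def)
  have kl: "map (\<lambda>(s, e, x). (s, e, copair (comp_map P (dsum A N) 0 idm inlm) idm (length s) e x)) (injl us) =
      aleaf (comp_map P (dsum A N) 0 idm inlm) us" for us
    by (induction us) (auto simp: kx)
  show ?thesis
    unfolding lmult_eq comp_map_cls[OF ghom_idm kap_lin[OF N]] ctree_eq linl_def
    by (simp add: kl kx z) (simp add: idm_def)
qed

lemma aleaf_inlm_uleaves:
  assumes N: "flat N"
  shows "aleaf (comp_map P (dsum A N) 0 idm inlm) (uleaves P A us) = uleaves P (dsum A N) (map ctl us)"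
  by (induction us) (auto simp: ctl_facts comp_map_cls[OF ghom_idm inlm_ghom[OF N]] ctree_inlm simp del: tdeg_simp)

lemma lmult_uleaves:
  assumes N: "flat N" and m: "m \<in> grd P (Suc (length us1 + length us2)) p"
    and us: "set us1 \<subseteq> utrees P A" "set us2 \<subseteq> utrees P A"
    and v: "v = (r, linl xs e y ys)" "v \<in> utrees P (dsum A N)"
  defines "ws \<equiv> map ctl us1 @ v # map ctl us2"
  assumes D: "D = p + (rdeg ws + ldeg ws)"
  shows "lmult P \<gamma> A N 0 D (cls P (dsum (circ P A) (circ_lin P A N)) 0 D
      ((p, m), linl (uleaves P A us1) (tdeg v) (cls P (dsum A N) 0 (tdeg v) v) (uleaves P A us2))) =
    psc ((-1) powi aexp ws) (cls P (dsum A N) 0 D ((p + rdeg ws, gam P \<gamma> (p, m) ws),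
      linl (concat (map snd us1) @ xs) e y (ys @ concat (map snd us2))))" (is ?g1)
    and "((p + rdeg ws, gam P \<gamma> (p, m) ws), linl (concat (map snd us1) @ xs) e y (ys @ concat (map snd us2))) \<in> trees P (dsum A N) 0 D" (is ?g2)
proof -
  have "ctl ` utrees P A \<subseteq> utrees P (dsum A N)"
    by (rule image_subsetI) (rule ctl_utrees[OF flatD(1)[OF N]])
  hence wst: "set ws \<subseteq> utrees P (dsum A N)" using us v(2) unfolding ws_def by simp blast
  have m': "m \<in> grd P (length ws) p" using m by (simp add: ws_def)
  have le: "concat (map snd ws) = linl (concat (map snd us1) @ xs) e y (ys @ concat (map snd us2))"
    by (simp add: ctl_lists(4)[simplified] ws_def v(1) linl_def)
  have k: "aleaf (comp_map P (dsum A N) 0 idm inlm) (uleaves P A us1) @ ([], tdeg v, cls P (dsum A N) 0 (tdeg v) v) #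
      aleaf (comp_map P (dsum A N) 0 idm inlm) (uleaves P A us2) = uleaves P (dsum A N) ws"
    by (simp add: aleaf_inlm_uleaves[OF N] ws_def)
  show ?g2
    using graft_trees[OF m' wst D] unfolding le .
  show ?g1
    unfolding lmult_linl[OF N] k free_mult_uleaves[OF flat_dsum[OF A_flat N] m' wst D] le ..
qed

text \<open>The associativity axiom of the module on generators: trees over \<open>A\<close> are
  evaluated by \<open>\<gamma>A\<close>, the one tree containing an element of \<open>M\<close> by
  \<open>\<gamma>M\<close>; on the other side all of them are grafted first.\<close>

lemma module_graft:
  assumes m: "m \<in> grd P (Suc (length us1 + length us2)) p"
    and us: "set us1 \<subseteq> utrees P A" "set us2 \<subseteq> utrees P A"
    and v: "v = (r, linl xs e y ys)" "v \<in> utrees P (dsum A M)"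
  defines "ws \<equiv> map ctl us1 @ v # map ctl us2"
  assumes D: "D = p + (rdeg ws + ldeg ws)"
  shows "\<gamma>M 0 D (cls P (dsum A M) 0 D ((p, m), linl (ual us1) (tdeg v) (\<gamma>M 0 (tdeg v) (cls P (dsum A M) 0 (tdeg v) v)) (ual us2))) =
    scl M ((-1) powi aexp ws) (\<gamma>M 0 D (cls P (dsum A M) 0 D ((p + rdeg ws, gam P \<gamma> (p, m) ws),
      linl (concat (map snd us1) @ xs) e y (ys @ concat (map snd us2)))))"
proof -
  define ul where "ul = (\<lambda>us :: ('p, 'a) tree list. uleaves P A us)"
  let ?c = "cls P (dsum A M) 0 (tdeg v) v"
  let ?t = "((p, m), linl (ul us1) (tdeg v) ?c (ul us2))"
  let ?x = "cls P (dsum (circ P A) (circ_lin P A M)) 0 D ?t"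
  have fA: "flat (circ P A)" and fM: "flat (circ_lin P A M)"
    by (intro flat_circ flat_circ_lin A_flat M_flat)+
  have vt: "v \<in> trees P (dsum A M) 0 (tdeg v)" using v(2) by (simp add: utrees_def)
  have c: "?c \<in> grd (circ_lin P A M) 0 (tdeg v)"
    by (rule cls_in_circ_lin[OF vt]) (simp add: v(1) lin_tree_linl)
  have tr: "?t \<in> trees P (dsum (circ P A) (circ_lin P A M)) 0 D"
  proof -
    have "leaves0 (circ P A) (ul us)" if "set us \<subseteq> utrees P A" for us
      using that by (auto simp: ul_def uleaves_def utrees_def intro!: cls_in_circ)
    from this[OF us(1)] this[OF us(2)] have "\<forall>(s, e, x)\<in>set (ul us1) \<union> set (ul us2). s = [] \<and> x \<in> grd (circ P A) 0 e"
      by blast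
    moreover have "p + degs (ul us1) + tdeg v + degs (ul us2) = D"
      by (simp add: D ws_def ctl_lists ul_def degs_uleaves) (simp add: tdeg_def)
    ultimately show ?thesis
      using m c unfolding linl_trees[OF gmod_circ gmod_circ_lin] by (simp add: ul_def)
  qed
  have x: "?x \<in> grd (circ_lin P (circ P A) (circ_lin P A M)) 0 D"
    by (rule cls_in_circ_lin[OF tr lin_tree_linl])
  have ax: "(\<gamma>M \<bullet>[0] lcomp_map P A M 0 idm (\<gamma>A \<bullet>[0] fstm) 0 (\<gamma>M \<bullet>[0] sndm)) 0 D ?x = (\<gamma>M \<bullet>[0] lmult P \<gamma> A M) 0 D ?x"
    using M x unfolding amodule_def eq_on_def by blast
  have al: "aleaf \<gamma>A (ul us) = ual us" for us by (induction us) (auto simp: ul_def ual_def)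
  have l: "lcomp_map P A M 0 idm (\<gamma>A \<bullet>[0] fstm) 0 (\<gamma>M \<bullet>[0] sndm) 0 D ?x =
     cls P (dsum A M) 0 D ((p, m), linl (ual us1) (tdeg v) (\<gamma>M 0 (tdeg v) ?c) (ual us2))"
    unfolding lcomp_lin[OF ghom_idm \<gamma>A_lin \<gamma>M_lin fA fM A_flat M_flat tr] by (simp add: al) (simp add: idm_def)
  note lm = lmult_uleaves[OF M_flat m us v, folded ws_def, OF D]
  have tr2: "((p + rdeg ws, gam P \<gamma> (p, m) ws), linl (concat (map snd us1) @ xs) e y (ys @ concat (map snd us2))) \<in> trees P (dsum A M) 0 D"
    by (rule lm(2))
  have r: "lmult P \<gamma> A M 0 D ?x = psc ((-1) powi aexp ws) (cls P (dsum A M) 0 D ((p + rdeg ws, gam P \<gamma> (p, m) ws),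
      linl (concat (map snd us1) @ xs) e y (ys @ concat (map snd us2))))"
    using lm(1) by (simp add: ul_def)
  have g: "(\<gamma>M \<bullet>[0] G) 0 D z = \<gamma>M 0 D (G 0 D z)" for G :: "('z, ('p, 'a \<times> 'm) tree \<Rightarrow>\<^sub>0 'k) gmap" and z
    by (simp add: gcomp_def)
  show ?thesis using ax unfolding g l r \<gamma>M_psc[OF cls_in_circ_lin[OF tr2 lin_tree_linl]] .
qed

lemma twist_lin:
  assumes "flat X" "glinear 0 X A a" "glinear q X M b"
  shows "glinear q (circ P X) M (\<gamma>M \<bullet>[q] lcomp_map P A M 0 idm a q b)"
  using glinear_gcomp[OF glinear_lcomp_map[OF ghom_idm assms(2,3,1) A_flat M_flat] \<gamma>M_lin] by simp

lemma alg_lin: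
  assumes "flat X" "glinear 0 X A a"
  shows "glinear 0 (circ P X) A (\<gamma>A \<bullet>[0] comp_map P A 0 idm a)"
  using glinear_gcomp[OF glinear_comp_map[OF ghom_idm flat_ghom[OF assms(1) A_flat assms(2)]] \<gamma>A_lin] by simp

lemma twist_cls:
  assumes X: "flat X" and a: "glinear 0 X A a" and b: "glinear q X M b" and t: "t \<in> trees P X 0 d"
  shows "\<gamma>M 0 (d + q) (lcomp_map P A M 0 idm a q b 0 d (cls P X 0 d t)) =
    (\<Sum>j<length (snd t). scl M (lsign q j t) (\<gamma>M 0 (d + q) (cls P (dsum A M) 0 (d + q) (etree 0 idm (inl a) q (inr b) j t))))"
proof -
  have e: "cls P (dsum A M) 0 (d + q) (etree 0 idm (inl a) q (inr b) j t) \<in> grd (circ_lin P A M) 0 (d + q)"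
    if "j < length (snd t)" for j
    using etree_trees[OF t glinear_idm glinear_inl[OF a M_gmod] glinear_inr[OF b A_gmod] that] etree_lin[OF that]
    by (intro cls_in_circ_lin) auto
  show ?thesis
    unfolding lcomp_map_cls[OF ghom_idm a b X A_flat M_flat] esum_def
    using e by (simp only: add_0_right) (rule \<gamma>M_sum, simp)
qed

lemma sum_lcnt:
  "(\<Sum>c<lcnt us. F c) = (\<Sum>j<length us. \<Sum>l<length (snd (us ! j)). (F (lcnt (take j us) + l) :: 'z::comm_monoid_add))"
proof -
  have "(\<Sum>c<lcnt (take k us). F c) = (\<Sum>j<k. \<Sum>l<length (snd (us ! j)). F (lcnt (take j us) + l))" if "k \<le> length us" for k
    using that
  proof (induction k)
    case (Suc k)
    have "(\<Sum>c<x + y. F c) = (\<Sum>c<x. F c) + (\<Sum>l<y. F (x + l))" for x y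
      by (induction y) (auto simp: add.assoc)
    thus ?case using Suc by (simp add: take_Suc_conv_app_nth)
  qed simp
  from this[of "length us"] show ?thesis by simp
qed

text \<open>The contribution of one leaf: the \<open>l\<close>-th leaf of the \<open>j\<close>-th tree corresponds to
  the leaf in position \<open>lcnt us1 + length lv1\<close> of the grafted tree.\<close>

lemma twist_mult_term:
  fixes X :: "('k, 'x::ab_group_add) dgs"
  assumes X: "flat X" and a: "glinear 0 X A a" and b: "glinear q X M b"
    and u: "u = (r, lv1 @ ([], e, x) # lv2)" and us: "us = us1 @ u # us2"
    and ust: "set us \<subseteq> utrees P X" and m: "m \<in> grd P (length us) p" and d: "d = p + (rdeg us + ldeg us)"
  defines "T \<equiv> ((p + rdeg us, gam P \<gamma> (p, m) us), concat (map snd us))"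
    and "S \<equiv> \<gamma>A \<bullet>[0] comp_map P A 0 idm a"
  shows "scl M (lsign q (length us1) ((p, m), uleaves P X us) * lsign q (length lv1) u)
      (\<gamma>M 0 (d + q) (cls P (dsum A M) 0 (d + q) ((p, m), linl (aleaf S (uleaves P X us1)) (tdeg u + q)
        (\<gamma>M 0 (tdeg u + q) (cls P (dsum A M) 0 (tdeg u + q) (etree 0 idm (inl a) q (inr b) (length lv1) u)))
        (aleaf S (uleaves P X us2))))) =
    scl M ((-1) powi aexp us * lsign q (lcnt us1 + length lv1) T)
      (\<gamma>M 0 (d + q) (cls P (dsum A M) 0 (d + q) (etree 0 idm (inl a) q (inr b) (lcnt us1 + length lv1) T)))"
proof -
  define v where "v = (r, linl (aleaf a lv1) (e + q) (b 0 e x) (aleaf a lv2))"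
  define ca where "ca = (\<lambda>u :: ('p, 'x) tree. (fst u, aleaf a (snd u)))"
  define ws where "ws = map ctl (map ca us1) @ v # map ctl (map ca us2)"
  have cae: "ca u = ctree 0 idm a u" for u by (cases u, cases "fst u") (auto simp: ca_def ctree_eq aleaf_def idm_def)
  have ev: "etree 0 idm (inl a) q (inr b) (length lv1) u = v"
    unfolding u v_def using etree_split[of 0 idm a q b lv1 "fst r" "snd r" e x lv2] by (simp add: idm_def)
  have ga: "ghom 0 X A a" by (rule flat_ghom[OF X A_flat a])
  have Su: "aleaf S (uleaves P X us) = ual (map ca us)" for us
  proof (induction us)
    case (Cons u us)
    have "tdeg (ca u) = tdeg u" by (simp add: ca_def tdeg_def)
    moreover have "S 0 e (cls P X 0 e u) = \<gamma>A 0 e (cls P A 0 e (ca u))" for e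
      by (simp add: S_def gcomp_def comp_map_cls[OF ghom_idm ga] cae)
    ultimately show ?case using Cons by (simp add: ual_def)
  qed (simp add: ual_def)
  have cat: "set (map ca us') \<subseteq> utrees P A" if "set us' \<subseteq> utrees P X" for us'
  proof -
    have "ca u \<in> utrees P A" if "u \<in> utrees P X" for u
    proof -
      have "u \<in> trees P X 0 (tdeg u)" using that by (simp add: utrees_def)
      from ctree_trees[OF this glinear_idm a] have "ca u \<in> trees P A 0 (tdeg u)" by (simp add: cae)
      thus ?thesis by (simp add: utrees_iff)
    qed
    thus ?thesis using that by auto
  qed
  have u12: "set us1 \<subseteq> utrees P X" "set us2 \<subseteq> utrees P X" "u \<in> utrees P X" using ust us by auto
  have dv: "tdeg v = tdeg u + q" by (simp add: v_def u tdeg_def)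
  have vt: "v \<in> utrees P (dsum A M)"
  proof -
    have "u \<in> trees P X 0 (tdeg u)" using u12(3) by (simp add: utrees_def)
    from etree_trees[OF this glinear_idm glinear_inl[OF a M_gmod] glinear_inr[OF b A_gmod], of "length lv1"]
    show ?thesis unfolding ev by (simp add: u utrees_iff)
  qed
  have same: "gam P \<gamma> (p, m) ws = gam P \<gamma> (p, m) us" "rdeg ws = rdeg us"
  proof -
    have "map (\<lambda>u. (fst u, length (snd u))) ws = map (\<lambda>u. (fst u, length (snd u))) us"
      by (simp add: ws_def us ctl_def ca_def v_def u)
    from gam_cong[OF this] show "gam P \<gamma> (p, m) ws = gam P \<gamma> (p, m) us" "rdeg ws = rdeg us" by auto
  qed
  have lists: "rdeg (map ca us') = rdeg us'" "ldeg (map ca us') = ldeg us'" "aexp (map ctl (map ca us')) = aexp us'"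
    "concat (map snd (map ca us')) = aleaf a (concat (map snd us'))" for us'
    by (induction us') (auto simp: ca_def ctl_facts ctl_lists simp del: map_map)
  have lw: "ldeg ws = ldeg us + q"
    by (simp add: ws_def us ctl_lists lists del: map_map) (simp add: v_def u)
  have D: "d + q = p + (rdeg ws + ldeg ws)" by (simp add: same lw d)
  have m': "m \<in> grd P (Suc (length (map ca us1) + length (map ca us2))) p" using m by (simp add: us)
  note MG = module_graft[OF m' cat[OF u12(1)] cat[OF u12(2)] v_def vt D[unfolded ws_def]]
  have eT: "etree 0 idm (inl a) q (inr b) (lcnt us1 + length lv1) T =
    ((p + rdeg us, gam P \<gamma> (p, m) us), linl (aleaf a (concat (map snd us1) @ lv1)) (e + q) (b 0 e x) (aleaf a (lv2 @ concat (map snd us2))))"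
  proof -
    have "lcnt us1 + length lv1 = length (concat (map snd us1) @ lv1)" by (simp add: length_concat_snd)
    moreover have "T = ((p + rdeg us, gam P \<gamma> (p, m) us), (concat (map snd us1) @ lv1) @ ([], e, x) # (lv2 @ concat (map snd us2)))"
      by (simp add: T_def us u)
    ultimately show ?thesis by (simp only: etree_split) (simp add: idm_def)
  qed
  \<comment> \<open>On the left \<open>b\<close> first passes what precedes the tree
    \<open>u\<close>, then what precedes its leaf inside \<open>u\<close>. As it raises the degree
    of that leaf by \<open>q\<close>, separating roots from leaves costs an extra
    \<open>q * rdeg us2\<close>. Together this is what \<open>b\<close> passes in the grafted
    tree.\<close>
  have sg: "lsign q (length us1) ((p, m), uleaves P X us) * lsign q (length lv1) u * (-1) powi aexp ws =
      ((-1) powi aexp us * lsign q (lcnt us1 + length lv1) T :: 'k)"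
  proof -
    have "take (lcnt us1 + length lv1) (concat (map snd us)) = concat (map snd us1) @ lv1"
      by (simp add: us u length_concat_snd)
    moreover have "q * (p + (rdeg us1 + ldeg us1)) + q * (fst r + degs lv1) + aexp ws = aexp us + q * (p + rdeg us + (ldeg us1 + degs lv1))"
      unfolding ws_def us by (simp add: lists ctl_lists del: map_map) (simp add: v_def u algebra_simps)
    ultimately show ?thesis
      by (simp add: lsign_def T_def us u degs_uleaves degs_concat_snd split_beta flip: powi_m1_add)
  qed
  show ?thesis
    unfolding ev eT Su dv[symmetric] MG[folded ws_def] lists same
    using sg by (simp add: gmodD(13)[OF M_gmod])
qed

text \<open>The leaves of a grafted tree are the leaves of the inner trees, so the sum over
  positions splits into a sum over the trees and a sum over the leaves of each
  (\<open>sum_lcnt\<close>). The terms match by \<open>twist_mult_term\<close>, that is, by the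
  module axiom.\<close>

lemma twist_mult:
  assumes X: "flat X" and a: "glinear 0 X A a" and b: "glinear q X M b" and x: "x \<in> grd (circ P (circ P X)) 0 d"
  shows "\<gamma>M 0 (d + q) (lcomp_map P A M 0 idm a q b 0 d (free_mult P \<gamma> X 0 d x)) =
    \<gamma>M 0 (d + q) (lcomp_map P A M 0 idm (\<gamma>A \<bullet>[0] comp_map P A 0 idm a) q (\<gamma>M \<bullet>[q] lcomp_map P A M 0 idm a q b) 0 d x)"
proof -
  let ?F = "circ P X"
  let ?S = "\<gamma>A \<bullet>[0] comp_map P A 0 idm a" and ?T = "\<gamma>M \<bullet>[q] lcomp_map P A M 0 idm a q b"
  have F: "flat ?F" by (rule flat_circ[OF X])
  have S: "glinear 0 ?F A ?S" by (rule alg_lin[OF X a])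
  have T: "glinear q ?F M ?T" by (rule twist_lin[OF X a b])
  let ?G = "cls P ?F 0 d ` {((p, m), uleaves P X us) | p m us. m \<in> grd P (length us) p \<and> set us \<subseteq> utrees P X \<and> d = p + (rdeg us + ldeg us)}"
  have "(?T \<bullet>[0] free_mult P \<gamma> X) 0 d x = (\<gamma>M \<bullet>[q] lcomp_map P A M 0 idm ?S q ?T) 0 d x"
  proof (rule glinear_gen_eq[of q "circ P ?F" M _ _ 0 d ?G])
    show "glinear q (circ P ?F) M (?T \<bullet>[0] free_mult P \<gamma> X)"
      using glinear_gcomp[OF glinear_free_mult[OF X] T] by simp
    show "glinear q (circ P ?F) M (\<gamma>M \<bullet>[q] lcomp_map P A M 0 idm ?S q ?T)" by (rule twist_lin[OF F S T])
    show "grd (circ P ?F) 0 d \<subseteq> PM.span ?G" by (rule circ_circ_gen_all)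
    show "?G \<subseteq> grd (circ P ?F) 0 d" by (auto intro!: cls_in_circ uleaves_trees)
    fix z assume "z \<in> ?G"
    then obtain p m us where z: "z = cls P ?F 0 d ((p, m), uleaves P X us)"
      and m: "m \<in> grd P (length us) p" and us: "set us \<subseteq> utrees P X" and d: "d = p + (rdeg us + ldeg us)" by auto
    let ?t = "((p, m), uleaves P X us)"
    define U where "U = ((p + rdeg us, gam P \<gamma> (p, m) us), concat (map snd us))"
    have t: "?t \<in> trees P ?F 0 d" by (rule uleaves_trees[OF m us d])
    have Ut: "U \<in> trees P X 0 d" unfolding U_def by (rule graft_trees[OF m us d])
    define h where "h = (\<lambda>c. scl M ((-1) powi aexp us * lsign q c U)
        (\<gamma>M 0 (d + q) (cls P (dsum A M) 0 (d + q) (etree 0 idm (inl a) q (inr b) c U))))"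
    have "(?T \<bullet>[0] free_mult P \<gamma> X) 0 d z = ?T 0 d (psc ((-1) powi aexp us) (cls P X 0 d U))"
      by (simp add: gcomp_def z free_mult_uleaves[OF X m us d] U_def)
    also have "\<dots> = scl M ((-1) powi aexp us) (?T 0 d (cls P X 0 d U))"
      using glinearD(3)[OF T cls_in_circ[OF Ut]] by simp
    also have "\<dots> = (\<Sum>c<lcnt us. h c)"
      using twist_cls[OF X a b Ut]
      by (simp add: gcomp_def gmodD(13,16)[OF M_gmod] h_def U_def length_concat_snd)
    also have "\<dots> = (\<Sum>j<length us. \<Sum>l<length (snd (us ! j)). h (lcnt (take j us) + l))"
      by (rule sum_lcnt)
    also have "\<dots> = (\<Sum>j<length us. scl M (lsign q j ?t) (\<gamma>M 0 (d + q) (cls P (dsum A M) 0 (d + q) (etree 0 idm (inl ?S) q (inr ?T) j ?t))))"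
    proof (intro sum.cong refl)
      fix j assume "j \<in> {..<length us}"
      hence j: "j < length us" by simp
      define us1 us2 u where "us1 = take j us" and "us2 = drop (Suc j) us" and "u = us ! j"
      have usd: "us = us1 @ u # us2" unfolding us1_def us2_def u_def by (rule id_take_nth_drop[OF j])
      have lj: "length us1 = j" using j by (simp add: us1_def)
      have ut: "u \<in> trees P X 0 (tdeg u)" using us usd by (auto simp: utrees_def)
      let ?L = "\<lambda>y. ((p, m), linl (aleaf ?S (uleaves P X us1)) (tdeg u + q) y (aleaf ?S (uleaves P X us2)))"
      let ?y = "\<lambda>l. \<gamma>M 0 (tdeg u + q) (cls P (dsum A M) 0 (tdeg u + q) (etree 0 idm (inl a) q (inr b) l u))"
      have y: "?y l \<in> grd M 0 (tdeg u + q)" if "l < length (snd u)" for l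
      proof -
        have "etree 0 idm (inl a) q (inr b) l u \<in> trees P (dsum A M) 0 (tdeg u + q)"
          using etree_trees[OF ut glinear_idm glinear_inl[OF a M_gmod] glinear_inr[OF b A_gmod] that] by simp
        from glinearD(1)[OF \<gamma>M_lin cls_in_circ_lin[OF this etree_lin[OF that]]] show ?thesis by simp
      qed
      have et: "etree 0 idm (inl ?S) q (inr ?T) j ?t = ?L (?T 0 (tdeg u) (cls P X 0 (tdeg u) u))"
        using etree_split[of 0 idm ?S q ?T "uleaves P X us1" p m "tdeg u" "cls P X 0 (tdeg u) u" "uleaves P X us2"] lj
        by (simp add: usd idm_def)
      have Tu: "?T 0 (tdeg u) (cls P X 0 (tdeg u) u) = (\<Sum>l<length (snd u). scl M (lsign q l u) (?y l))"
        using twist_cls[OF X a b ut] by (simp add: gcomp_def)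
      have etr: "etree 0 idm (inl ?S) q (inr ?T) j ?t \<in> trees P (dsum A M) 0 (d + q)"
        using etree_trees[OF t glinear_idm glinear_inl[OF S M_gmod] glinear_inr[OF T A_gmod], of j] j by simp
      have Lt: "?L z \<in> trees P (dsum A M) 0 (d + q)" if "z \<in> grd M 0 (tdeg u + q)" for z
        using etr that unfolding et linl_trees[OF A_gmod M_gmod] by simp
      have L0: "?L 0 \<in> trees P (dsum A M) 0 (d + q)" by (rule Lt[OF gmodD(3)[OF M_gmod]])
      have Lin: "cls P (dsum A M) 0 (d + q) (?L (?y l)) \<in> grd (circ_lin P A M) 0 (d + q)" if "l < length (snd u)" for l
        by (rule cls_in_circ_lin[OF Lt[OF y[OF that]] lin_tree_linl])
      have "scl M (lsign q j ?t) (\<gamma>M 0 (d + q) (cls P (dsum A M) 0 (d + q) (etree 0 idm (inl ?S) q (inr ?T) j ?t))) =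
        scl M (lsign q j ?t) (\<gamma>M 0 (d + q) (\<Sum>l<length (snd u). psc (lsign q l u) (cls P (dsum A M) 0 (d + q) (?L (?y l)))))"
        unfolding et Tu using y by (subst linl_sum[OF A_gmod M_gmod L0]) auto
      also have "\<dots> = (\<Sum>l<length (snd u). scl M (lsign q j ?t * lsign q l u) (\<gamma>M 0 (d + q) (cls P (dsum A M) 0 (d + q) (?L (?y l)))))"
        using Lin by (subst \<gamma>M_sum) (auto simp: gmodD(13,16)[OF M_gmod])
      also have "\<dots> = (\<Sum>l<length (snd u). h (lcnt us1 + l))"
      proof (intro sum.cong refl)
        fix l assume "l \<in> {..<length (snd u)}"
        hence l: "l < length (snd u)" by simp
        obtain s e w where w: "snd u ! l = (s, e, w)" by (cases "snd u ! l")
        have "(s, e, w) \<in> set (snd u)" using nth_mem[OF l] w by simp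
        hence s: "s = []" using flat_trees[OF ut] by auto
        define lv1 lv2 where "lv1 = take l (snd u)" and "lv2 = drop (Suc l) (snd u)"
        have ud: "u = (fst u, lv1 @ ([], e, w) # lv2)"
          using id_take_nth_drop[OF l] w s by (simp add: lv1_def lv2_def prod_eq_iff)
        have ll: "length lv1 = l" using l by (simp add: lv1_def)
        from twist_mult_term[OF X a b ud usd us m d]
        show "scl M (lsign q j ?t * lsign q l u) (\<gamma>M 0 (d + q) (cls P (dsum A M) 0 (d + q) (?L (?y l)))) = h (lcnt us1 + l)"
          unfolding lj ll h_def U_def .
      qed
      finally show "(\<Sum>l<length (snd (us ! j)). h (lcnt (take j us) + l)) =
          scl M (lsign q j ?t) (\<gamma>M 0 (d + q) (cls P (dsum A M) 0 (d + q) (etree 0 idm (inl ?S) q (inr ?T) j ?t)))"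
        by (simp add: u_def us1_def)
    qed
    also have "\<dots> = (\<gamma>M \<bullet>[q] lcomp_map P A M 0 idm ?S q ?T) 0 d z"
      using twist_cls[OF F S T t] by (simp add: gcomp_def z)
    finally show "(?T \<bullet>[0] free_mult P \<gamma> X) 0 d z = (\<gamma>M \<bullet>[q] lcomp_map P A M 0 idm ?S q ?T) 0 d z" .
  qed (auto simp: x gmod_circ)
  thus ?thesis by (simp add: gcomp_def)
qed

end

section \<open>Composites of the structure maps\<close>

lemma aleaf_aleaf:
  assumes "leaves0 N xs" "\<And>e x. x \<in> grd N 0 e \<Longrightarrow> a3 0 e x = a2 0 e (a1 0 e x)"
  shows "aleaf a2 (aleaf a1 xs) = aleaf a3 xs"
  using assms(1) by (induction xs) (auto simp: assms(2))

lemma ctree_aleaf: "ctree r f g ((p, m), xs) = ((p + r, f (length xs) p m), aleaf g xs)"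
  by (simp add: ctree_eq aleaf_def)

lemma leaf_split:
  assumes "((p, m), xs) \<in> trees M N 0 d" "j < length xs"
  obtains xs1 e x xs2 where "xs = xs1 @ ([], e, x) # xs2" "length xs1 = j" "x \<in> grd N 0 e"
    "leaves0 N xs1" "leaves0 N xs2"
proof -
  obtain s e x where x: "xs ! j = (s, e, x)" by (cases "xs ! j")
  define ys zs where "ys = take j xs" and "zs = drop (Suc j) xs"
  have xs: "xs = ys @ (s, e, x) # zs" unfolding ys_def zs_def using id_take_nth_drop[OF assms(2)] x by simp
  have "leaves0 N xs" using assms(1) by (simp add: trees_0_iff)
  hence "s = []" "x \<in> grd N 0 e" "leaves0 N ys" "leaves0 N zs"
    by (auto simp: xs)
  moreover have "length ys = j" using assms(2) by (simp add: ys_def)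
  ultimately show ?thesis using that[of ys e x zs] xs by simp
qed

lemma comp_comp:
  assumes "ghom 0 M M2 f" "glinear 0 N N1 g1" "glinear 0 N1 N2 g2" "glinear 0 N N2 g3" "flat N" "flat N1" "flat N2"
    and g: "\<And>e x. x \<in> grd N 0 e \<Longrightarrow> g3 0 e x = g2 0 e (g1 0 e x)" and x: "x \<in> grd (circ M N) 0 d"
  shows "comp_map M2 N2 0 idm g2 0 d (comp_map M2 N1 0 f g1 0 d x) = comp_map M2 N2 0 f g3 0 d x"
proof (rule plin_eq[OF _ plin_comp_map _ x[unfolded grd_circ]])
  show "plin (\<lambda>x. comp_map M2 N2 0 idm g2 0 d (comp_map M2 N1 0 f g1 0 d x))"
    using plin_comp_map[of M2 N2 0 idm g2 0 d] plin_comp_map[of M2 N1 0 f g1 0 d] by (simp add: plin_def)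
  fix z assume "z \<in> cls M N 0 d ` trees M N 0 d"
  then obtain p m xs where t: "((p, m), xs) \<in> trees M N 0 d" "z = cls M N 0 d ((p, m), xs)" by auto
  have "aleaf g2 (aleaf g1 xs) = aleaf g3 xs"
    using t(1) by (intro aleaf_aleaf[of _ N] g) (auto simp: trees_0_iff)
  thus "comp_map M2 N2 0 idm g2 0 d (comp_map M2 N1 0 f g1 0 d z) = comp_map M2 N2 0 f g3 0 d z"
    unfolding t(2) comp_map_cls[OF assms(1) flat_ghom[OF assms(5,6,2)]] comp_map_cls[OF assms(1) flat_ghom[OF assms(5,7,4)]]
      ctree_aleaf add_0_right comp_map_cls[OF ghom_idm flat_ghom[OF assms(6,7,3)]]
    by (simp add: idm_def)
qed

text \<open>The sign arises because \<open>b2\<close> is applied after the root has been shifted by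
  the degree \<open>r\<close> of \<open>f\<close>. The composites \<open>a3\<close> and
  \<open>b3\<close> are given separately, as they need to agree with the actual composites in arity
  zero only.\<close>

lemma lcomp_lcomp:
  fixes M :: "('k::field, 'm::ab_group_add) dgs" and N :: "('k, 'n::ab_group_add) dgs"
  assumes f: "ghom r M M2 f" and a1: "glinear 0 N L1 a1" and b1: "glinear q1 N L1' b1"
    and a2: "glinear 0 L1 L2 a2" and b2: "glinear q2 L1' L2' b2"
    and a3: "glinear 0 N L2 a3" and b3: "glinear (q1 + q2) N L2' b3"
    and fl: "flat N" "flat L1" "flat L1'" "flat L2" "flat L2'"
    and a: "\<And>e x. x \<in> grd N 0 e \<Longrightarrow> a3 0 e x = a2 0 e (a1 0 e x)"
    and b: "\<And>e x. x \<in> grd N 0 e \<Longrightarrow> b3 0 e x = b2 0 (e + q1) (b1 0 e x)"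
    and x: "x \<in> grd (circ M N) 0 d"
  shows "lcomp_map M2 L2 L2' 0 idm (a2 \<bullet>[0] fstm) q2 (b2 \<bullet>[0] sndm) 0 (d + r + q1) (lcomp_map M2 L1 L1' r f a1 q1 b1 0 d x) =
    psc ((-1) powi (q2 * r)) (lcomp_map M2 L2 L2' r f a3 (q1 + q2) b3 0 d x)"
proof (rule plin_eq[OF _ _ _ x[unfolded grd_circ]])
  let ?o = "lcomp_map M2 L2 L2' 0 idm (a2 \<bullet>[0] fstm) q2 (b2 \<bullet>[0] sndm) 0 (d + r + q1)"
  show "plin (\<lambda>x. ?o (lcomp_map M2 L1 L1' r f a1 q1 b1 0 d x))"
    using plin_lcomp_map[of M2 L2 L2' 0 idm "a2 \<bullet>[0] fstm" q2 "b2 \<bullet>[0] sndm" 0 "d + r + q1"]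
      plin_lcomp_map[of M2 L1 L1' r f a1 q1 b1 0 d] by (simp add: plin_def)
  show "plin (\<lambda>x. psc ((-1) powi (q2 * r)) (lcomp_map M2 L2 L2' r f a3 (q1 + q2) b3 0 d x))"
    using plin_lcomp_map[of M2 L2 L2' r f a3 "q1 + q2" b3 0 d] by (simp add: plin_def PM.scale_right_distrib mult.commute)
  fix z assume "z \<in> cls M N 0 d ` trees M N 0 d"
  then obtain p m xs where t: "((p, m), xs) \<in> trees M N 0 d" "z = cls M N 0 d ((p, m), xs)" by auto
  have tm: "?o (psc (lsign q1 j ((p, m), xs)) (cls M2 (dsum L1 L1') 0 (d + r + q1) (etree r f (inl a1) q1 (inr b1) j ((p, m), xs)))) =
      psc ((-1) powi (q2 * r)) (psc (lsign (q1 + q2) j ((p, m), xs)) (cls M2 (dsum L2 L2') 0 (d + r + (q1 + q2)) (etree r f (inl a3) (q1 + q2) (inr b3) j ((p, m), xs))))"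
    if j: "j < length xs" for j
  proof -
    obtain xs1 e y xs2 where s: "xs = xs1 @ ([], e, y) # xs2" "length xs1 = j" "y \<in> grd N 0 e"
      "leaves0 N xs1" "leaves0 N xs2"
      by (rule leaf_split[OF t(1) j])
    have al: "aleaf a2 (aleaf a1 xs1) = aleaf a3 xs1" "aleaf a2 (aleaf a1 xs2) = aleaf a3 xs2"
      using s(4,5) a by (auto intro!: aleaf_aleaf[of _ N])
    have e1: "etree r f (inl a1) q1 (inr b1) j ((p, m), xs) =
        ((p + r, f (length xs) p m), linl (aleaf a1 xs1) (e + q1) (b1 0 e y) (aleaf a1 xs2))"
      using etree_split[of r f a1 q1 b1 xs1 p m e y xs2] by (simp add: s(1) s(2)[symmetric])
    have e3: "etree r f (inl a3) (q1 + q2) (inr b3) j ((p, m), xs) =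
        ((p + r, f (length xs) p m), linl (aleaf a3 xs1) (e + (q1 + q2)) (b2 0 (e + q1) (b1 0 e y)) (aleaf a3 xs2))"
      using etree_split[of r f a3 "q1 + q2" b3 xs1 p m e y xs2] by (simp add: s(1) s(2)[symmetric] b[OF s(3)])
    have et: "etree r f (inl a1) q1 (inr b1) j ((p, m), xs) \<in> trees M2 (dsum L1 L1') 0 (d + r + q1)"
      using etree_trees[OF t(1) ghom_glinear[OF f] glinear_inl[OF a1 flatD(1)[OF fl(3)]] glinear_inr[OF b1 flatD(1)[OF fl(2)]]] j by simp
    note ll = lcomp_lin[OF ghom_idm a2 b2 fl(2-5) et[unfolded e1]]
    have sg: "lsign q1 j ((p, m), xs) * (-1) powi (q2 * (p + r + degs xs1)) = ((-1) powi (q2 * r) * lsign (q1 + q2) j ((p, m), xs) :: 'k)"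
      by (simp add: lsign_def s(1) s(2)[symmetric] flip: powi_m1_add) (simp add: algebra_simps)
    show ?thesis
      unfolding plinD(2)[OF plin_lcomp_map] e1 e3 ll al degs_aleaf aleaf_simps PM.scale_scale sg by (simp add: add.assoc idm_def s(1))
  qed
  show "?o (lcomp_map M2 L1 L1' r f a1 q1 b1 0 d z) = psc ((-1) powi (q2 * r)) (lcomp_map M2 L2 L2' r f a3 (q1 + q2) b3 0 d z)"
    unfolding t(2) lcomp_map_cls[OF f a1 b1 fl(1-3)] lcomp_map_cls[OF f a3 b3 fl(1,4,5)] esum_def plinD(5)[OF plin_lcomp_map] PM.scale_sum_right
    by (intro sum.cong refl tm) simp
qed

lemma lcomp_comp:
  fixes M :: "('k::field, 'm::ab_group_add) dgs" and N :: "('k, 'n::ab_group_add) dgs"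
  assumes f: "ghom r M M2 f" and g: "glinear 0 N N1 g" and a: "glinear 0 N1 L a" and b: "glinear q N1 L' b"
    and a3: "glinear 0 N L a3" and b3: "glinear q N L' b3"
    and fl: "flat N" "flat N1" "flat L" "flat L'"
    and ag: "\<And>e x. x \<in> grd N 0 e \<Longrightarrow> a3 0 e x = a 0 e (g 0 e x)"
    and bg: "\<And>e x. x \<in> grd N 0 e \<Longrightarrow> b3 0 e x = b 0 e (g 0 e x)"
    and x: "x \<in> grd (circ M N) 0 d"
  shows "lcomp_map M2 L L' 0 idm a q b 0 (d + r) (comp_map M2 N1 r f g 0 d x) =
    psc ((-1) powi (q * r)) (lcomp_map M2 L L' r f a3 q b3 0 d x)"
proof (rule plin_eq[OF _ _ _ x[unfolded grd_circ]])
  let ?o = "lcomp_map M2 L L' 0 idm a q b 0 (d + r)"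
  show "plin (\<lambda>x. ?o (comp_map M2 N1 r f g 0 d x))"
    using plin_lcomp_map[of M2 L L' 0 idm a q b 0 "d + r"] plin_comp_map[of M2 N1 r f g 0 d] by (simp add: plin_def)
  show "plin (\<lambda>x. psc ((-1) powi (q * r)) (lcomp_map M2 L L' r f a3 q b3 0 d x))"
    using plin_lcomp_map[of M2 L L' r f a3 q b3 0 d] by (simp add: plin_def PM.scale_right_distrib mult.commute)
  fix z assume "z \<in> cls M N 0 d ` trees M N 0 d"
  then obtain p m xs where t: "((p, m), xs) \<in> trees M N 0 d" "z = cls M N 0 d ((p, m), xs)" by auto
  have len: "length (snd (ctree r f g ((p, m), xs))) = length xs" by (simp add: ctree_aleaf)
  have tm: "psc (lsign q j (ctree r f g ((p, m), xs))) (cls M2 (dsum L L') 0 (d + r + 0 + q) (etree 0 idm (inl a) q (inr b) j (ctree r f g ((p, m), xs)))) =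
      psc ((-1) powi (q * r)) (psc (lsign q j ((p, m), xs)) (cls M2 (dsum L L') 0 (d + r + q) (etree r f (inl a3) q (inr b3) j ((p, m), xs))))"
    if j: "j < length xs" for j
  proof -
    obtain xs1 e y xs2 where s: "xs = xs1 @ ([], e, y) # xs2" "length xs1 = j" "y \<in> grd N 0 e"
      "leaves0 N xs1" "leaves0 N xs2"
      by (rule leaf_split[OF t(1) j])
    have al: "aleaf a (aleaf g xs1) = aleaf a3 xs1" "aleaf a (aleaf g xs2) = aleaf a3 xs2"
      using s(4,5) ag by (auto intro!: aleaf_aleaf[of _ N])
    have e1: "etree 0 idm (inl a) q (inr b) j (ctree r f g ((p, m), xs)) =
        ((p + r, f (length xs) p m), linl (aleaf a3 xs1) (e + q) (b 0 e (g 0 e y)) (aleaf a3 xs2))"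
      using etree_split[of 0 idm a q b "aleaf g xs1" "p + r" "f (length xs) p m" e "g 0 e y" "aleaf g xs2"]
      by (simp add: ctree_aleaf s(1) s(2)[symmetric] al idm_def)
    have e3: "etree r f (inl a3) q (inr b3) j ((p, m), xs) =
        ((p + r, f (length xs) p m), linl (aleaf a3 xs1) (e + q) (b 0 e (g 0 e y)) (aleaf a3 xs2))"
      using etree_split[of r f a3 q b3 xs1 p m e y xs2] by (simp add: s(1) s(2)[symmetric] bg[OF s(3)])
    have "take j (aleaf g xs) = aleaf g xs1" by (simp add: s(1) s(2)[symmetric])
    hence sg: "lsign q j (ctree r f g ((p, m), xs)) = ((-1) powi (q * r) * lsign q j ((p, m), xs) :: 'k)"
      by (simp add: lsign_def ctree_aleaf s(1) s(2)[symmetric] flip: powi_m1_add) (simp add: algebra_simps)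
    show ?thesis unfolding e1 e3 sg by simp
  qed
  show "?o (comp_map M2 N1 r f g 0 d z) = psc ((-1) powi (q * r)) (lcomp_map M2 L L' r f a3 q b3 0 d z)"
    unfolding t(2) comp_map_cls[OF f flat_ghom[OF fl(1,2) g]] lcomp_map_cls[OF ghom_idm a b fl(2-4)] lcomp_map_cls[OF f a3 b3 fl(1,3,4)]
      esum_def PM.scale_sum_right len snd_conv
    by (intro sum.cong refl tm) simp
qed

lemma comp_idm:
  fixes M :: "('k::field, 'm::ab_group_add) dgs" and N :: "('k, 'n::ab_group_add) dgs"
  assumes x: "x \<in> grd (circ M N) 0 d"
  shows "comp_map M N 0 idm idm 0 d x = x"
proof (rule plin_eq[OF plin_comp_map _ _ x[unfolded grd_circ]])
  show "plin (\<lambda>x. x)" by (simp add: plin_def)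
  fix z assume "z \<in> cls M N 0 d ` trees M N 0 d"
  thus "comp_map M N 0 idm idm 0 d z = z"
    by (auto simp: comp_map_cls[OF ghom_idm ghom_idm] ctree_idm) (simp add: idm_def)
qed

text \<open>Congruence obtained from \<open>lcomp_comp\<close> by taking the inner maps to be
  identities.\<close>

lemma lcomp_cong:
  assumes "ghom 0 M M f" "flat N" "flat L" "flat L'" "glinear 0 N L a" "glinear q N L' b" "glinear 0 N L a'" "glinear q N L' b'"
    and "\<And>e x. x \<in> grd N 0 e \<Longrightarrow> a' 0 e x = a 0 e x" "\<And>e x. x \<in> grd N 0 e \<Longrightarrow> b' 0 e x = b 0 e x"
    and x: "x \<in> grd (circ M N) 0 d"
  shows "lcomp_map M L L' 0 idm a q b 0 d x = lcomp_map M L L' 0 idm a' q b' 0 d x"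
proof -
  show ?thesis
    using lcomp_comp[OF ghom_idm[of M] glinear_idm assms(5-8) assms(2,2-4), where x = x and d = d] assms(9,10) x comp_idm[OF x] by (simp add: idm_def)
qed

section \<open>Independence of the differential\<close>

text \<open>The quasi-free algebra is \<open>circ P C\<close> with another differential. Trees,
  classes and maps between composition products do not see it, and the rules of this section let the
  two be interchanged.\<close>

lemma trees_dif [simp]: "trees M (N\<lparr>dif := D\<rparr>) = trees M N"
  by (simp add: trees_def fun_eq_iff)

lemma comp_rels_dif [simp]: "comp_rels M (N\<lparr>dif := D\<rparr>) n d = comp_rels M N n d"
proof
  show "comp_rels M (N\<lparr>dif := D\<rparr>) n d \<subseteq> comp_rels M N n d"
    by (auto elim!: comp_rels.cases intro: comp_rels.intros)
  show "comp_rels M N n d \<subseteq> comp_rels M (N\<lparr>dif := D\<rparr>) n d"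
    using comp_rels.intros[where N = "N\<lparr>dif := D\<rparr>" and M = M and n = n and d = d]
    by (auto elim!: comp_rels.cases)
qed

lemma cls_dif [simp]: "cls M (N\<lparr>dif := D\<rparr>) = cls M N"
  by (simp add: cls_def comp_rel_def fun_eq_iff)

lemma circ_grd_dif [simp]: "grd (circ M (N\<lparr>dif := D\<rparr>)) = grd (circ M N)"
  by (simp add: grd_circ fun_eq_iff)

lemma dsum_dif: "dsum (N\<lparr>dif := D\<rparr>) L = (dsum N L)\<lparr>dif := dif (dsum (N\<lparr>dif := D\<rparr>) L)\<rparr>"
  by (simp add: dsum_def)

lemma cls_dsum_dif [simp]: "cls M (dsum (N\<lparr>dif := D\<rparr>) L) = cls M (dsum N L)"
  by (subst dsum_dif) simp

lemma comp_map_dif [simp]: "comp_map M (N\<lparr>dif := D\<rparr>) r f g = comp_map M N r f g"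
  by (simp add: comp_map_def)

lemma lcomp_map_dif [simp]: "lcomp_map M (N\<lparr>dif := D\<rparr>) L r f a q b = lcomp_map M N L r f a q b"
  by (simp add: lcomp_map_def)

section \<open>The differential of a twisted map\<close>

lemma plin_dif_circ: "plin (dif (circ M N) n d)"
proof -
  interpret L: Vector_Spaces.linear psc psc "qproj psc (comp_rel M N n (d - 1))" by (rule qproj_comp(1))
  show ?thesis by (simp add: circ_def quotient_def free_comp_def plin_def lext_add lext_psc L.add L.scale)
qed

lemma dif_circ_in:
  assumes M: "ghom (-1) M M (dif M)" and N: "ghom (-1) N N (dif N)" and x: "x \<in> grd (circ M N) n d"
  shows "dif (circ M N) n d x \<in> grd (circ M N) n (d - 1)"
proof (rule plin_in[OF plin_dif_circ _ _ x[unfolded grd_circ]])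
  show "PM.subspace (grd (circ M N) n (d - 1))" using gmodD(2)[OF gmod_circ[of M N]] by simp
  fix z assume "z \<in> cls M N n d ` trees M N n d"
  then obtain t where t: "t \<in> trees M N n d" "z = cls M N n d t" by auto
  have "ctree (-1) (dif M) idm t \<in> trees M N n (d - 1)"
    using ctree_trees[OF t(1) ghom_glinear[OF M] glinear_idm] by simp
  moreover have "etree 0 idm idm (-1) (dif N) j t \<in> trees M N n (d - 1)" if "j < length (snd t)" for j
    using etree_trees[OF t(1) glinear_idm glinear_idm ghom_glinear[OF N] that] by simp
  ultimately show "dif (circ M N) n d z \<in> grd (circ M N) n (d - 1)"
    unfolding t(2) dif_circ_cls[OF M N] esum_def
    by (auto intro!: gmodD(4,7)[OF gmod_circ] gmodD(6)[OF gmod_circ, simplified] intro: cls_in_circ)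
qed

lemma glinear_dsum:
  assumes "glinear p V V' f" "glinear p W W' g"
  shows "glinear p (dsum V W) (dsum V' W') (\<lambda>n d. map_prod (f n d) (g n d))"
  using assms by (auto simp: glinear_def)

lemma etree_idm_split:
  "etree 0 idm idm q b (length xs) ((p, m), xs @ (s, e, x) # ys) = ((p, m), xs @ (s, e + q, b (length s) e x) # ys)"
  unfolding etree_def gtree_def
  by (auto simp: idm_def nth_gleaves nth_append nth_Cons' split_beta intro!: nth_equalityI)

context amd
begin

lemma P_dif: "ghom (-1) P P (dif P)" and M_dif: "glinear (-1) M M (dif M)" and A_dif: "glinear (-1) A A (dif A)"
  using P_smodule A M by (auto simp: smodule_def palgebra_def amodule_def dg_module_def ghom_def)

lemma AM_dif: "ghom (-1) (dsum A M) (dsum A M) (dif (dsum A M))"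
  using flat_ghom[OF AM_flat AM_flat glinear_dsum[OF A_dif M_dif]] by (simp add: dsum_def)

text \<open>The Leibniz rule. The differential hits the root, an ordinary leaf or the leaf carrying
  \<open>b\<close>. The first two cases commute with the construction up to
  \<open>(-1) powi q\<close>; the last leaves the commutator \<open>b'\<close> of \<open>b\<close>
  with the differentials.\<close>

lemma lcomp_dif:
  fixes X :: "('k, 'x::ab_group_add) dgs"
  assumes X: "flat X" and dX: "glinear (-1) X X (dif X)"
    and a: "glinear 0 X A a" and ad: "\<And>e x. x \<in> grd X 0 e \<Longrightarrow> dif A 0 e (a 0 e x) = a 0 (e - 1) (dif X 0 e x)"
    and b: "glinear q X M b" and b': "glinear (q - 1) X M b'"
    and bd: "\<And>e x. x \<in> grd X 0 e \<Longrightarrow> b' 0 e x = dif M 0 (e + q) (b 0 e x) - scl M ((-1) powi q) (b 0 (e - 1) (dif X 0 e x))"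
    and x: "x \<in> grd (circ P X) 0 d"
  shows "dif (circ P (dsum A M)) 0 (d + q) (lcomp_map P A M 0 idm a q b 0 d x) =
    psc ((-1) powi q) (lcomp_map P A M 0 idm a q b 0 (d - 1) (dif (circ P X) 0 d x)) +
    lcomp_map P A M 0 idm a (q - 1) b' 0 d x"
proof (rule plin_eq[OF _ _ _ x[unfolded grd_circ]])
  let ?AM = "dsum A M"
  let ?D = "dif (circ P ?AM) 0 (d + q)" and ?L = "lcomp_map P A M 0 idm a q b"
  show "plin (\<lambda>x. ?D (?L 0 d x))"
    using plin_dif_circ[of P ?AM 0 "d + q"] plin_lcomp_map[of P A M 0 idm a q b 0 d] by (simp add: plin_def)
  show "plin (\<lambda>x. psc ((-1) powi q) (?L 0 (d - 1) (dif (circ P X) 0 d x)) + lcomp_map P A M 0 idm a (q - 1) b' 0 d x)"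
    using plin_dif_circ[of P X 0 d] plin_lcomp_map[of P A M 0 idm a q b 0 "d - 1"] plin_lcomp_map[of P A M 0 idm a "q - 1" b' 0 d]
    by (simp add: plin_def PM.scale_right_distrib mult.commute)
  fix z assume "z \<in> cls P X 0 d ` trees P X 0 d"
  then obtain p m xs where t: "((p, m), xs) \<in> trees P X 0 d" and z: "z = cls P X 0 d ((p, m), xs)" by auto
  let ?t = "((p, m), xs)"
  have gX: "ghom (-1) X X (dif X)" by (rule flat_ghom[OF X X dX])
  define k where "k = length xs"
  define C where "C = cls P ?AM 0 (d + q - 1)"
  define E where "E = (\<lambda>j. etree 0 idm (inl a) q (inr b) j ?t)"
  define G where "G = (\<lambda>i. etree 0 idm idm (-1) (dif X) i ?t)"
  define R where "R = ctree (-1) (dif P) idm ?t"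
  have lE: "length (snd (E j)) = k" "length (snd (G j)) = k" "length (snd R) = k" for j
    by (simp_all add: E_def G_def R_def etree_def gtree_def k_def ctree_aleaf)
  have Ef: "etree 0 idm (inl a) q (inr b) j ?t = E j" "etree 0 idm idm (-1) (dif X) j ?t = G j" for j
    by (simp_all add: E_def G_def)
  have Et: "E j \<in> trees P ?AM 0 (d + q)" if "j < k" for j
    using etree_trees[OF t glinear_idm glinear_inl[OF a M_gmod] glinear_inr[OF b A_gmod]] that by (simp add: E_def k_def)
  have ER: "etree 0 idm (inl a) q (inr b) j R = ctree (-1) (dif P) idm (E j)" if "j < k" for j
    using that unfolding E_def R_def etree_def ctree_def gtree_def
    by (auto simp: k_def idm_def nth_gleaves split_beta intro!: nth_equalityI)
  \<comment> \<open>At different leaves the two operations do not interact as trees; at an ordinary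
    leaf this uses that \<open>a\<close> is a chain map.\<close>
  have EG: "etree 0 idm idm (-1) (dif ?AM) i (E j) = etree 0 idm (inl a) q (inr b) j (G i)" if "i < k" "j < k" "i \<noteq> j" for i j
  proof -
    have "dif A (length (fst (xs ! i))) (fst (snd (xs ! i))) (a (length (fst (xs ! i))) (fst (snd (xs ! i))) (snd (snd (xs ! i)))) =
        a (length (fst (xs ! i))) (fst (snd (xs ! i)) - 1) (dif X (length (fst (xs ! i))) (fst (snd (xs ! i))) (snd (snd (xs ! i))))"
    proof -
      have "xs ! i \<in> set xs" using that by (simp add: k_def)
      hence "fst (xs ! i) = []" "snd (snd (xs ! i)) \<in> grd X 0 (fst (snd (xs ! i)))"
        using t by (cases "xs ! i"; force simp: trees_0_iff)+
      thus ?thesis using ad by simp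
    qed
    moreover have "dif M n e 0 = 0" for n e by (rule glinear_0[OF M_dif M_gmod])
    ultimately show ?thesis
      using that unfolding E_def G_def etree_def gtree_def
      by (auto simp: k_def idm_def nth_gleaves split_beta inl_def inr_def intro!: nth_equalityI)
  qed
  have lR: "lsign q j R = ((-1) powi q * lsign q j ?t :: 'k)" for j
  proof -
    have "lsign q j R = ((-1) powi (q * (p - 1 + degs (take j xs))) :: 'k)"
      by (simp add: R_def ctree_idm lsign_def)
    thus ?thesis by (simp add: lsign_def powi_minus_one)
  qed
  have takeE: "degs (take i (snd (E j))) = degs (take i xs) + (if j < i then q else 0)" if "i < k" for i j
  proof -
    have "i \<le> length (snd (E j))" "i \<le> length xs" using that lE by (auto simp: k_def)
    moreover have "fst (snd (snd (E j) ! l)) = fst (snd (xs ! l)) + (if l = j then q else 0)" if "l < i" for l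
      using that \<open>i < k\<close> by (simp add: E_def etree_def gtree_def nth_gleaves k_def split_beta)
    ultimately show ?thesis by (simp add: degs_take sum.distrib)
  qed
  have takeG: "degs (take j (snd (G i))) = degs (take j xs) - (if i < j then 1 else 0)" if "j < k" for i j
  proof -
    have "j \<le> length (snd (G i))" "j \<le> length xs" using that lE by (auto simp: k_def)
    moreover have "fst (snd (snd (G i) ! l)) = fst (snd (xs ! l)) + (if l = i then -1 else 0)" if "l < j" for l
      using that \<open>j < k\<close> by (simp add: G_def etree_def gtree_def nth_gleaves k_def split_beta)
    ultimately show ?thesis by (simp add: degs_take sum.distrib)
  qed
  have fstE: "fst (fst (E j)) = p" "fst (fst (G j)) = p" for j
    by (simp_all add: E_def G_def etree_def gtree_def)
  have lsE: "lsign (-1) i (E j) = ((-1) powi (- (p + degs (take i xs) + (if j < i then q else 0))) :: 'k)" if "i < k" for i j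
    using takeE[OF that, of j] fstE(1)[of j] by (cases "E j") (auto simp: lsign_def split_beta algebra_simps)
  have lsG: "lsign q j (G i) = ((-1) powi (q * (p + degs (take j xs) - (if i < j then 1 else 0))) :: 'k)" if "j < k" for i j
    using takeG[OF that, of i] fstE(2)[of i] by (cases "G i") (simp add: lsign_def split_beta add_diff_eq)
  \<comment> \<open>For \<open>i < j\<close> the extra \<open>(-1) powi q\<close> arises because
    \<open>b\<close> passes a leaf whose degree has dropped by one; for \<open>j < i\<close> because
    the differential passes a leaf whose degree has risen by \<open>q\<close>.\<close>
  have sne: "lsign q j ?t * lsign (-1) i (E j) = ((-1) powi q * (lsign (-1) i ?t * lsign q j (G i)) :: 'k)"
    if "i < k" "j < k" "i \<noteq> j" for i j
    unfolding lsE[OF that(1)] lsG[OF that(2)] using that(3)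
    by (cases "i < j") (auto simp: lsign_def powi_minus_one)
  have seq: "lsign q j ?t * lsign (-1) j (E j) = (lsign (q - 1) j ?t :: 'k)"
      "(-1) powi q * (lsign (-1) j ?t * lsign q j (G j)) = ((-1) powi q * lsign (q - 1) j ?t :: 'k)" if "j < k" for j
    unfolding lsE[OF that] lsG[OF that] by (auto simp: lsign_def powi_minus_one)
  \<comment> \<open>The three trees differ only in the element of the distinguished leaf, so the
    equation is linear there and amounts to the definition of \<open>b'\<close>.\<close>
  have diag: "C (etree 0 idm idm (-1) (dif ?AM) j (E j)) =
      psc ((-1) powi q) (C (etree 0 idm (inl a) q (inr b) j (G j))) + C (etree 0 idm (inl a) (q - 1) (inr b') j ?t)"
    if j: "j < k" for j
  proof -
    obtain xs1 e y xs2 where s: "xs = xs1 @ ([], e, y) # xs2" "length xs1 = j" "y \<in> grd X 0 e"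
      by (rule leaf_split[OF t j[unfolded k_def]])
    have E': "E j = ((p, m), linl (aleaf a xs1) (e + q) (b 0 e y) (aleaf a xs2))"
      unfolding E_def using etree_split[of 0 idm a q b xs1 p m e y xs2] by (simp add: s(1) s(2)[symmetric] idm_def)
    have G': "G j = ((p, m), xs1 @ ([], e - 1, dif X 0 e y) # xs2)"
      unfolding G_def s(1) using etree_idm_split[of "-1" "dif X" xs1 p m "[]" e y xs2] by (simp add: s(2))
    define TT where "TT = (\<lambda>w :: 'm. ((p, m), linl (aleaf a xs1) (e + q - 1) w (aleaf a xs2)))"
    have dA0: "dif A n e 0 = 0" for n e by (rule glinear_0[OF A_dif A_gmod])
    have 1: "etree 0 idm idm (-1) (dif ?AM) j (E j) = TT (dif M 0 (e + q) (b 0 e y))"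
      unfolding E' TT_def linl_def
      using etree_idm_split[of "-1" "dif ?AM" "injl (aleaf a xs1)" p m "[]" "e + q" "(0, b 0 e y)" "injl (aleaf a xs2)"]
      by (simp add: s(2) dA0 injl_def aleaf_def)
    have 2: "etree 0 idm (inl a) q (inr b) j (G j) = TT (b 0 (e - 1) (dif X 0 e y))"
      unfolding G' TT_def using etree_split[of 0 idm a q b xs1 p m "e - 1" "dif X 0 e y" xs2]
      by (simp add: s(2) idm_def algebra_simps)
    have 3: "etree 0 idm (inl a) (q - 1) (inr b') j ?t = TT (b' 0 e y)"
      unfolding TT_def using etree_split[of 0 idm a "q - 1" b' xs1 p m e y xs2]
      by (simp add: s(1) s(2)[symmetric] idm_def algebra_simps)
    have "etree 0 idm (inl a) (q - 1) (inr b') j ?t \<in> trees P ?AM 0 (d + q - 1)"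
      using etree_trees[OF t glinear_idm glinear_inl[OF a M_gmod] glinear_inr[OF b' A_gmod], of j] j
      by (simp add: k_def algebra_simps)
    hence TTt: "TT w \<in> trees P ?AM 0 (d + q - 1)" if "w \<in> grd M 0 (e + q - 1)" for w
      using that unfolding 3 TT_def linl_trees[OF A_gmod M_gmod] by simp
    have bdy: "b 0 (e - 1) (dif X 0 e y) \<in> grd M 0 (e + q - 1)"
      using glinearD(1)[OF b glinearD(1)[OF dX s(3)]] by (simp add: algebra_simps)
    have b'y: "b' 0 e y \<in> grd M 0 (e + q - 1)" using glinearD(1)[OF b' s(3)] by (simp add: algebra_simps)
    have "dif M 0 (e + q) (b 0 e y) = scl M ((-1) powi q) (b 0 (e - 1) (dif X 0 e y)) + b' 0 e y"
      by (simp add: bd[OF s(3)])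
    thus ?thesis
      unfolding 1 2 3 C_def using linl_add[OF A_gmod M_gmod TTt[OF gmodD(6)[OF M_gmod bdy], unfolded TT_def] b'y]
        linl_scl[OF A_gmod M_gmod TTt[OF bdy, unfolded TT_def]]
      by (simp add: TT_def)
  qed
  have dE: "?D (cls P ?AM 0 (d + q) (E j)) = C (ctree (-1) (dif P) idm (E j)) +
      (\<Sum>i<k. psc (lsign (-1) i (E j)) (C (etree 0 idm idm (-1) (dif ?AM) i (E j))))" for j
    unfolding dif_circ_cls[OF P_dif AM_dif] esum_def lE by (simp add: C_def)
  have "?D (?L 0 d z) = (\<Sum>j<k. psc (lsign q j ?t) (C (ctree (-1) (dif P) idm (E j)) +
      (\<Sum>i<k. psc (lsign (-1) i (E j)) (C (etree 0 idm idm (-1) (dif ?AM) i (E j))))))"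
    unfolding z lcomp_map_cls[OF ghom_idm a b X A_flat M_flat] esum_def plinD(5)[OF plin_dif_circ] plinD(2)[OF plin_dif_circ]
      snd_conv k_def[symmetric] Ef add_0_right dE ..
  also have "\<dots> = (\<Sum>j<k. psc (lsign q j ?t) (C (ctree (-1) (dif P) idm (E j)))) +
      (\<Sum>j<k. \<Sum>i<k. psc (lsign q j ?t * lsign (-1) i (E j)) (C (etree 0 idm idm (-1) (dif ?AM) i (E j))))"
    by (simp add: PM.scale_right_distrib PM.scale_sum_right sum.distrib)
  also have "(\<Sum>j<k. \<Sum>i<k. psc (lsign q j ?t * lsign (-1) i (E j)) (C (etree 0 idm idm (-1) (dif ?AM) i (E j)))) =
      (\<Sum>j<k. \<Sum>i<k. psc ((-1) powi q * (lsign (-1) i ?t * lsign q j (G i))) (C (etree 0 idm (inl a) q (inr b) j (G i))) +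
        (if i = j then psc (lsign (q - 1) j ?t) (C (etree 0 idm (inl a) (q - 1) (inr b') j ?t)) else 0))"
  proof (intro sum.cong refl)
    fix j i assume "j \<in> {..<k}" "i \<in> {..<k}"
    hence ji: "j < k" "i < k" by auto
    show "psc (lsign q j ?t * lsign (-1) i (E j)) (C (etree 0 idm idm (-1) (dif ?AM) i (E j))) =
      psc ((-1) powi q * (lsign (-1) i ?t * lsign q j (G i))) (C (etree 0 idm (inl a) q (inr b) j (G i))) +
        (if i = j then psc (lsign (q - 1) j ?t) (C (etree 0 idm (inl a) (q - 1) (inr b') j ?t)) else 0)"
    proof (cases "i = j")
      case True
      thus ?thesis using seq[OF ji(1)] diag[OF ji(1)] by (simp add: PM.scale_right_distrib mult.commute)
    next
      case False
      thus ?thesis using sne[OF ji(2,1)] EG[OF ji(2,1)] by simp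
    qed
  qed
  also have "\<dots> = (\<Sum>j<k. \<Sum>i<k. psc ((-1) powi q * (lsign (-1) i ?t * lsign q j (G i))) (C (etree 0 idm (inl a) q (inr b) j (G i)))) +
      (\<Sum>j<k. psc (lsign (q - 1) j ?t) (C (etree 0 idm (inl a) (q - 1) (inr b') j ?t)))"
    by (simp add: sum.distrib)
  also have "(\<Sum>j<k. \<Sum>i<k. psc ((-1) powi q * (lsign (-1) i ?t * lsign q j (G i))) (C (etree 0 idm (inl a) q (inr b) j (G i)))) =
    psc ((-1) powi q) (\<Sum>i<k. psc (lsign (-1) i ?t) (\<Sum>j<k. psc (lsign q j (G i)) (C (etree 0 idm (inl a) q (inr b) j (G i)))))"
    by (subst sum.swap) (simp add: PM.scale_sum_right)
  finally have l: "?D (?L 0 d z) = (\<Sum>j<k. psc (lsign q j ?t) (C (ctree (-1) (dif P) idm (E j)))) +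
    (psc ((-1) powi q) (\<Sum>i<k. psc (lsign (-1) i ?t) (\<Sum>j<k. psc (lsign q j (G i)) (C (etree 0 idm (inl a) q (inr b) j (G i))))) +
      (\<Sum>j<k. psc (lsign (q - 1) j ?t) (C (etree 0 idm (inl a) (q - 1) (inr b') j ?t))))" .
  have Lc: "?L 0 (d - 1) (cls P X 0 (d - 1) u) = (\<Sum>j<length (snd u). psc (lsign q j u) (C (etree 0 idm (inl a) q (inr b) j u)))" for u
    unfolding lcomp_map_cls[OF ghom_idm a b X A_flat M_flat] esum_def C_def by (simp add: algebra_simps)
  have "?L 0 (d - 1) (dif (circ P X) 0 d z) = (\<Sum>j<k. psc (lsign q j R) (C (etree 0 idm (inl a) q (inr b) j R))) +
     (\<Sum>i<k. psc (lsign (-1) i ?t) (\<Sum>j<k. psc (lsign q j (G i)) (C (etree 0 idm (inl a) q (inr b) j (G i)))))"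
    unfolding z dif_circ_cls[OF P_dif gX] esum_def plinD(1,5)[OF plin_lcomp_map] plinD(2)[OF plin_lcomp_map]
      snd_conv k_def[symmetric] Ef R_def[symmetric] Lc lE by (simp add: Lc lE)
  moreover have "(\<Sum>j<k. psc (lsign q j R) (C (etree 0 idm (inl a) q (inr b) j R))) =
    psc ((-1) powi q) (\<Sum>j<k. psc (lsign q j ?t) (C (ctree (-1) (dif P) idm (E j))))"
    by (simp add: PM.scale_sum_right lR ER)
  moreover have "psc ((-1) powi q) (psc ((-1) powi q) w) = w" for w :: "('p, 'a \<times> 'm) tree \<Rightarrow>\<^sub>0 'k"
    by (simp add: powi_m1_sq)
  moreover have "lcomp_map P A M 0 idm a (q - 1) b' 0 d z = (\<Sum>j<k. psc (lsign (q - 1) j ?t) (C (etree 0 idm (inl a) (q - 1) (inr b') j ?t)))"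
    unfolding z lcomp_map_cls[OF ghom_idm a b' X A_flat M_flat] esum_def C_def k_def by (simp add: algebra_simps)
  ultimately show "?D (?L 0 d z) = psc ((-1) powi q) (?L 0 (d - 1) (dif (circ P X) 0 d z)) + lcomp_map P A M 0 idm a (q - 1) b' 0 d z"
    unfolding l by (simp add: PM.scale_right_distrib add.assoc)
qed

lemma \<gamma>M_dif:
  assumes "y \<in> grd (circ_lin P A M) 0 d"
  shows "dif M 0 d (\<gamma>M 0 d y) = \<gamma>M 0 (d - 1) (dif (circ P (dsum A M)) 0 d y)"
  using M assms by (auto simp: amodule_def dg_hom_def eq_on_def gcomp_def)

text \<open>Since \<open>\<gamma>M\<close> is a chain map, \<open>lcomp_dif\<close> descends to
  \<open>M\<close>: the commutator of a map built from \<open>a\<close> and \<open>b\<close> is the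
  map built from \<open>a\<close> and the commutator of \<open>b\<close>.\<close>

lemma twist_dif:
  assumes X: "flat X" and dX: "glinear (-1) X X (dif X)"
    and a: "glinear 0 X A a" and ad: "\<And>e x. x \<in> grd X 0 e \<Longrightarrow> dif A 0 e (a 0 e x) = a 0 (e - 1) (dif X 0 e x)"
    and b: "glinear q X M b" and b': "glinear (q - 1) X M b'"
    and bd: "\<And>e x. x \<in> grd X 0 e \<Longrightarrow> b' 0 e x = dif M 0 (e + q) (b 0 e x) - scl M ((-1) powi q) (b 0 (e - 1) (dif X 0 e x))"
    and x: "x \<in> grd (circ P X) 0 d"
  shows "dif M 0 (d + q) (\<gamma>M 0 (d + q) (lcomp_map P A M 0 idm a q b 0 d x)) -
      scl M ((-1) powi q) (\<gamma>M 0 (d - 1 + q) (lcomp_map P A M 0 idm a q b 0 (d - 1) (dif (circ P X) 0 d x))) =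
    \<gamma>M 0 (d + (q - 1)) (lcomp_map P A M 0 idm a (q - 1) b' 0 d x)"
proof -
  note gb = glinear_lcomp_map[OF ghom_idm[of P] a b X A_flat M_flat]
  note gb' = glinear_lcomp_map[OF ghom_idm[of P] a b' X A_flat M_flat]
  have y: "lcomp_map P A M 0 idm a q b 0 d x \<in> grd (circ_lin P A M) 0 (d + q)"
    using glinearD(1)[OF gb x] by simp
  have "dif (circ P X) 0 d x \<in> grd (circ P X) 0 (d - 1)"
    by (rule dif_circ_in[OF P_dif flat_ghom[OF X X dX] x])
  from glinearD(1)[OF gb this] have w: "lcomp_map P A M 0 idm a q b 0 (d - 1) (dif (circ P X) 0 d x) \<in> grd (circ_lin P A M) 0 (d + q - 1)"
    by (simp add: algebra_simps)
  have v: "lcomp_map P A M 0 idm a (q - 1) b' 0 d x \<in> grd (circ_lin P A M) 0 (d + q - 1)"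
    using glinearD(1)[OF gb' x] by (simp add: algebra_simps)
  have e: "d - 1 + q = d + q - 1" "d + (q - 1) = d + q - 1" by simp_all
  have ld: "dif (circ P (dsum A M)) 0 (d + q) (lcomp_map P A M 0 idm a q b 0 d x) =
    psc ((-1) powi q) (lcomp_map P A M 0 idm a q b 0 (d - 1) (dif (circ P X) 0 d x)) +
    lcomp_map P A M 0 idm a (q - 1) b' 0 d x"
    by (rule lcomp_dif[OF X dX a _ b b' _ x]) (use ad bd in auto)
  show ?thesis
    unfolding \<gamma>M_dif[OF y] ld e
      glinearD(2)[OF \<gamma>M_lin gmodD(6)[OF gmod_circ_lin w, simplified] v] \<gamma>M_psc[OF w] by simp
qed

lemma \<gamma>M_unit:
  assumes "y \<in> grd M 0 d"
  shows "\<gamma>M 0 d (cls P (dsum A M) 0 d ((0, \<eta>1), [([], d, (0, y))])) = y"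
proof -
  have "(\<gamma>M \<bullet>[0] iota P \<eta> (dsum A M) \<bullet>[0] inrm) 0 d y = idm 0 d y"
    using M assms unfolding amodule_def eq_on_def by blast
  thus ?thesis by (simp add: gcomp_def inrm_def iota idm_def)
qed

text \<open>A one-leaf tree on the unit has a single summand without sign, and the unit axiom of
  \<open>M\<close> evaluates it to the value of \<open>b\<close>.\<close>

lemma twist_iota:
  assumes X: "flat X" and a: "glinear 0 X A a" and b: "glinear q X M b" and x: "x \<in> grd X 0 d"
  shows "\<gamma>M 0 (d + q) (lcomp_map P A M 0 idm a q b 0 d (iota P \<eta> X 0 d x)) = b 0 d x"
proof -
  have t: "((0, \<eta>1), [([], d, x)]) \<in> trees P X 0 d" using x \<eta>1_in by (simp add: trees_0_iff)
  have "etree 0 idm (inl a) q (inr b) 0 ((0, \<eta>1), [([], d, x)]) = ((0, \<eta>1), [([], d + q, (0, b 0 d x))])"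
    using etree_split[of 0 idm a q b "[]" 0 \<eta>1 d x "[]"] by (simp add: linl_def idm_def)
  moreover have "b 0 d x \<in> grd M 0 (d + q)" by (rule glinearD(1)[OF b x])
  ultimately show ?thesis
    using twist_cls[OF X a b t] by (simp add: iota \<gamma>M_unit lsign_def gmodD(10)[OF M_gmod])
qed

end

section \<open>Derivations of a quasi-free algebra\<close>

text \<open>One statement for the whole linear dependence on \<open>b\<close>: \<open>c = 1\<close>
  gives sums, a zero first term gives multiples, and \<open>c = 0\<close> gives congruence for maps
  that agree in arity zero.\<close>

lemma lcomp_add:
  fixes M :: "('k::field, 'm::ab_group_add) dgs" and N :: "('k, 'n::ab_group_add) dgs"
    and L :: "('k, 'l::ab_group_add) dgs" and L' :: "('k, 'l'::ab_group_add) dgs"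
  assumes f: "ghom r M M2 f" and a: "glinear 0 N L a" and b: "glinear q N L' b" "glinear q N L' b'" "glinear q N L' b3"
    and fl: "flat N" "flat L" "flat L'"
    and b3: "\<And>e x. x \<in> grd N 0 e \<Longrightarrow> b3 0 e x = b 0 e x + scl L' c (b' 0 e x)"
    and x: "x \<in> grd (circ M N) 0 d"
  shows "lcomp_map M2 L L' r f a q b3 0 d x =
    lcomp_map M2 L L' r f a q b 0 d x + psc c (lcomp_map M2 L L' r f a q b' 0 d x)"
proof (rule plin_eq[OF plin_lcomp_map _ _ x[unfolded grd_circ]])
  show "plin (\<lambda>x. lcomp_map M2 L L' r f a q b 0 d x + psc c (lcomp_map M2 L L' r f a q b' 0 d x))"
    using plin_lcomp_map[of M2 L L' r f a q b 0 d] plin_lcomp_map[of M2 L L' r f a q b' 0 d]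
    by (simp add: plin_def PM.scale_right_distrib mult.commute)
  fix z assume "z \<in> cls M N 0 d ` trees M N 0 d"
  then obtain p m xs where t: "((p, m), xs) \<in> trees M N 0 d" "z = cls M N 0 d ((p, m), xs)" by auto
  have tm: "cls M2 (dsum L L') 0 (d + r + q) (etree r f (inl a) q (inr b3) j ((p, m), xs)) =
      cls M2 (dsum L L') 0 (d + r + q) (etree r f (inl a) q (inr b) j ((p, m), xs)) +
      psc c (cls M2 (dsum L L') 0 (d + r + q) (etree r f (inl a) q (inr b') j ((p, m), xs)))" if j: "j < length xs" for j
  proof -
    obtain xs1 e y xs2 where s: "xs = xs1 @ ([], e, y) # xs2" "length xs1 = j" "y \<in> grd N 0 e"
      by (rule leaf_split[OF t(1) j])
    define T where "T = (\<lambda>w :: 'l'. ((p + r, f (length xs) p m), linl (aleaf a xs1) (e + q) w (aleaf a xs2)))"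
    have e: "etree r f (inl a) q (inr h) j ((p, m), xs) = T (h 0 e y)" for h
      using etree_split[of r f a q h xs1 p m e y xs2] by (simp add: T_def s(1) s(2)[symmetric])
    have T: "T (h 0 e y) \<in> trees M2 (dsum L L') 0 (d + r + q)" if "glinear q N L' h" for h
      using etree_trees[OF t(1) ghom_glinear[OF f] glinear_inl[OF a flatD(1)[OF fl(3)]] glinear_inr[OF that flatD(1)[OF fl(2)]], of j] j
      unfolding e by simp
    note g = flatD(1)[OF fl(2)] flatD(1)[OF fl(3)]
    have in': "scl L' c (b' 0 e y) \<in> grd L' 0 (e + q)" using glinearD(1)[OF b(2) s(3)] gmodD(6)[OF g(2)] by blast
    show ?thesis
      unfolding e b3[OF s(3)] using linl_add[OF g T[OF b(1), unfolded T_def] in'] linl_scl[OF g T[OF b(2), unfolded T_def], of c]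
      by (simp add: T_def)
  qed
  show "lcomp_map M2 L L' r f a q b3 0 d z =
    lcomp_map M2 L L' r f a q b 0 d z + psc c (lcomp_map M2 L L' r f a q b' 0 d z)"
    unfolding t(2) lcomp_map_cls[OF f a b(1) fl] lcomp_map_cls[OF f a b(2) fl] lcomp_map_cls[OF f a b(3) fl] esum_def
    by (simp add: tm PM.scale_right_distrib sum.distrib PM.scale_sum_right mult.commute)
qed

section \<open>Derivations of the quasi-free algebra and their restriction to generators\<close>

locale qfr = amd P \<gamma> \<eta> A \<gamma>A M \<gamma>M
  for P :: "('k::field_char_0, 'p::ab_group_add) dgs" and \<gamma> \<eta>
    and A :: "('k, 'a::ab_group_add) dgs" and \<gamma>A and M :: "('k, 'm::ab_group_add) dgs" and \<gamma>M +
  fixes C :: "('k, 'c::ab_group_add) dgs" and Q :: "('k, 'q::ab_group_add) dgs" and \<alpha> \<Delta>C \<phi> f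
  assumes C: "dg_module C" and \<Delta>C: "ghom 0 C (circ Q C) \<Delta>C" and \<alpha>: "ghom (-1) Q P \<alpha>" and \<phi>: "glinear 0 C A \<phi>"
    and res: "palgebra_hom P \<gamma> \<eta> (quasi_free P \<gamma> \<eta> Q \<alpha> C \<Delta>C) (free_mult P \<gamma> C) A \<gamma>A f"
    and f_iota: "eq_on C (f \<bullet>[0] iota P \<eta> C) \<phi>"
begin

abbreviation "F \<equiv> circ P C"
abbreviation "B \<equiv> quasi_free P \<gamma> \<eta> Q \<alpha> C \<Delta>C"

lemmas C_flat = dg_module_flat[OF C]
lemmas C_gmod = flatD(1)[OF C_flat]
lemmas F_flat = flat_circ[OF C_flat, of P]

lemma C_dif: "glinear (-1) C C (dif C)"
  using C by (auto simp: smodule_def dg_module_def ghom_def)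

lemma B_eq: "grd B = grd F" "scl B = psc" "cls P B = cls P F" "trees P B = trees P F" "grd (circ P B) = grd (circ P F)"
  "lcomp_map P B M r h a q b = lcomp_map P F M r h a q b"
  by (simp_all add: quasi_free_def)

lemma glinear_B: "glinear p B W h \<longleftrightarrow> glinear p F W h" "glinear p V B h' \<longleftrightarrow> glinear p V F h'"
  by (simp_all add: glinear_def B_eq)

lemma B_flat: "flat B" and B_dif: "glinear (-1) B B (dif B)"
  and B_dd: "x \<in> grd F 0 d \<Longrightarrow> dif B 0 (d - 1) (dif B 0 d x) = 0"
  and B_mult: "z \<in> grd (circ P F) 0 d \<Longrightarrow> dif B 0 d (free_mult P \<gamma> C 0 d z) = free_mult P \<gamma> C 0 (d - 1) (dif (circ P B) 0 d z)"
  and f_lin: "glinear 0 F A f"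
  and f_dif: "x \<in> grd F 0 d \<Longrightarrow> dif A 0 d (f 0 d x) = f 0 (d - 1) (dif B 0 d x)"
  and f_mult: "z \<in> grd (circ P F) 0 d \<Longrightarrow> f 0 d (free_mult P \<gamma> C 0 d z) = \<gamma>A 0 d (comp_map P A 0 idm f 0 d z)"
proof -
  have B: "palgebra P \<gamma> \<eta> B (free_mult P \<gamma> C)" and f: "dg_hom B A f" "eq_on (circ P B) (f \<bullet>[0] free_mult P \<gamma> C) (\<gamma>A \<bullet>[0] comp_map P A 0 idm f)"
    using res by (auto simp: palgebra_hom_def)
  show "flat B" using B by (auto simp: palgebra_def dg_module_flat)
  show "glinear (-1) B B (dif B)" "x \<in> grd F 0 d \<Longrightarrow> dif B 0 (d - 1) (dif B 0 d x) = 0"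
    using B by (auto simp: palgebra_def dg_module_def smodule_def ghom_def B_eq)
  show "z \<in> grd (circ P F) 0 d \<Longrightarrow> dif B 0 d (free_mult P \<gamma> C 0 d z) = free_mult P \<gamma> C 0 (d - 1) (dif (circ P B) 0 d z)"
    using B by (auto simp: palgebra_def dg_hom_def eq_on_def B_eq gcomp_def)
  show "glinear 0 F A f" using f(1) by (simp add: dg_hom_def ghom_def glinear_B)
  show "x \<in> grd F 0 d \<Longrightarrow> dif A 0 d (f 0 d x) = f 0 (d - 1) (dif B 0 d x)"
    using f(1) by (auto simp: dg_hom_def eq_on_def B_eq gcomp_def)
  show "z \<in> grd (circ P F) 0 d \<Longrightarrow> f 0 d (free_mult P \<gamma> C 0 d z) = \<gamma>A 0 d (comp_map P A 0 idm f 0 d z)"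
    using f(2) by (auto simp: eq_on_def B_eq gcomp_def)
qed

lemma iota_ghom: "ghom 0 C F (iota P \<eta> C)"
  by (rule flat_ghom[OF C_flat F_flat glinear_iota[OF C_gmod]])

lemma f_iota0: "x \<in> grd C 0 d \<Longrightarrow> f 0 d (iota P \<eta> C 0 d x) = \<phi> 0 d x"
  using f_iota by (simp add: eq_on_def gcomp_def)

lemma iotas_in: "y \<in> grd F 0 d \<Longrightarrow> comp_map P F 0 idm (iota P \<eta> C) 0 d y \<in> grd (circ P F) 0 d"
  using glinearD(1)[OF glinear_comp_map[OF ghom_idm iota_ghom]] by simp

text \<open>A morphism out of a free algebra is determined on generators: apply its multiplicativity
  to an element written as a product of generators by \<open>free_mult_iotas\<close>.\<close>

lemma f_eq:
  assumes y: "y \<in> grd F 0 d"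
  shows "f 0 d y = \<gamma>A 0 d (comp_map P A 0 idm \<phi> 0 d y)"
proof -
  have "f 0 d y = \<gamma>A 0 d (comp_map P A 0 idm f 0 d (comp_map P F 0 idm (iota P \<eta> C) 0 d y))"
    using f_mult[OF iotas_in[OF y]] free_mult_iotas[OF C_flat y] by simp
  also have "comp_map P A 0 idm f 0 d (comp_map P F 0 idm (iota P \<eta> C) 0 d y) = comp_map P A 0 idm \<phi> 0 d y"
    by (rule comp_comp[OF ghom_idm ghom_glinear[OF iota_ghom] f_lin \<phi> C_flat F_flat A_flat _ y]) (simp add: f_iota0)
  finally show ?thesis .
qed

text \<open>The derivation condition, with the two arity-zero composites collapsed into one.\<close>

definition deriv :: "int \<Rightarrow> (('p, 'c) tree \<Rightarrow>\<^sub>0 'k, 'm) gmap \<Rightarrow> bool" where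
  "deriv p D \<longleftrightarrow> (\<forall>d. \<forall>z\<in>grd (circ P F) 0 d.
     D 0 d (free_mult P \<gamma> C 0 d z) = \<gamma>M 0 (d + p) (lcomp_map P A M 0 idm f p D 0 d z))"

lemma FF_zero: "n > 0 \<Longrightarrow> grd (circ P F) n d = {0}"
  by (rule flatD(2)[OF flat_circ[OF F_flat]])

lemma deriv_iff:
  assumes D: "glinear p F M D"
  shows "eq_on (circ P B) (D \<bullet>[0] free_mult P \<gamma> C)
    (\<gamma>M \<bullet>[p] lcomp_map P A M 0 idm (f \<bullet>[0] fstm) 0 sndm \<bullet>[p] lcomp_map P B M 0 idm idm p D) \<longleftrightarrow> deriv p D"
proof -
  let ?R = "\<gamma>M \<bullet>[p] lcomp_map P A M 0 idm (f \<bullet>[0] fstm) 0 sndm \<bullet>[p] lcomp_map P B M 0 idm idm p D"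
  have R: "?R 0 d z = \<gamma>M 0 (d + p) (lcomp_map P A M 0 idm f p D 0 d z)" if "z \<in> grd (circ P F) 0 d" for d z
  proof -
    have "glinear (p + 0) F M D" using D by simp
    from lcomp_lcomp[OF ghom_idm glinear_idm D f_lin glinear_idm f_lin this F_flat F_flat M_flat A_flat M_flat _ _ that]
    show ?thesis by (simp add: gcomp_def B_eq idm_def)
  qed
  have Z: "(D \<bullet>[0] free_mult P \<gamma> C) n d z = ?R n d z" if "n > 0" "z \<in> grd (circ P F) n d" for n d z
  proof -
    have "z = 0" using FF_zero that by auto
    moreover have "D n d 0 = 0" "\<gamma>M n (d + p) 0 = 0"
      using glinear_0[OF D flatD(1)[OF F_flat]] glinear_0[OF \<gamma>M_lin gmod_circ_lin] by auto
    ultimately show ?thesis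
      by (simp add: gcomp_def plinD(3)[OF plin_free_mult] plinD(3)[OF plin_lcomp_map])
  qed
  show ?thesis (is "?l = _")
  proof
    assume ?l
    show "deriv p D" unfolding deriv_def
    proof (intro allI ballI)
      fix d z assume z: "z \<in> grd (circ P F) 0 d"
      hence "(D \<bullet>[0] free_mult P \<gamma> C) 0 d z = ?R 0 d z" using \<open>?l\<close> unfolding eq_on_def B_eq(5) by blast
      thus "D 0 d (free_mult P \<gamma> C 0 d z) = \<gamma>M 0 (d + p) (lcomp_map P A M 0 idm f p D 0 d z)"
        unfolding R[OF z] by (simp add: gcomp_def)
    qed
  next
    assume d: "deriv p D"
    show ?l unfolding eq_on_def B_eq(5)
    proof (intro allI ballI)
      fix n d z assume z: "z \<in> grd (circ P F) n d"
      show "(D \<bullet>[0] free_mult P \<gamma> C) n d z = ?R n d z"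
      proof (cases "n = 0")
        case True
        have z0: "z \<in> grd (circ P F) 0 d" using z True by simp
        show ?thesis using d z0 unfolding True R[OF z0] by (simp add: gcomp_def deriv_def)
      next
        case False
        thus ?thesis using Z z by blast
      qed
    qed
  qed
qed

abbreviation "der p g \<equiv> \<gamma>M \<bullet>[p] lcomp_map P A M 0 idm \<phi> p g"

lemma der_lin: "glinear p C M g \<Longrightarrow> glinear p F M (der p g)"
  by (rule twist_lin[OF C_flat \<phi>])

lemma der_iota:
  assumes "glinear p C M g" "x \<in> grd C 0 d"
  shows "der p g 0 d (iota P \<eta> C 0 d x) = g 0 d x"
  using twist_iota[OF C_flat \<phi> assms] by (simp add: gcomp_def)

text \<open>\<open>twist_mult\<close> yields the rule with \<open>\<gamma>A\<close> after P(\<phi>)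
  in the place of the augmentation, and \<open>f_eq\<close> identifies the two.\<close>

lemma deriv_der:
  assumes g: "glinear p C M g"
  shows "deriv p (der p g)"
  unfolding deriv_def
proof (intro allI ballI)
  fix d z assume z: "z \<in> grd (circ P F) 0 d"
  have "der p g 0 d (free_mult P \<gamma> C 0 d z) =
      \<gamma>M 0 (d + p) (lcomp_map P A M 0 idm (\<gamma>A \<bullet>[0] comp_map P A 0 idm \<phi>) p (der p g) 0 d z)"
    using twist_mult[OF C_flat \<phi> g z] by (simp add: gcomp_def)
  also have "lcomp_map P A M 0 idm (\<gamma>A \<bullet>[0] comp_map P A 0 idm \<phi>) p (der p g) 0 d z =
      lcomp_map P A M 0 idm f p (der p g) 0 d z"
    by (rule lcomp_cong[OF ghom_idm F_flat A_flat M_flat alg_lin[OF C_flat \<phi>] der_lin[OF g] f_lin der_lin[OF g] _ _ z])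
      (simp_all add: f_eq gcomp_def)
  finally show "der p g 0 d (free_mult P \<gamma> C 0 d z) = \<gamma>M 0 (d + p) (lcomp_map P A M 0 idm f p (der p g) 0 d z)" .
qed

text \<open>As for \<open>f_eq\<close>: the derivation rule is applied to an element written as a
  product of generators.\<close>

lemma deriv_eq:
  assumes D: "glinear p F M D" "deriv p D" and y: "y \<in> grd F 0 d"
  shows "D 0 d y = der p (D \<bullet>[0] iota P \<eta> C) 0 d y"
proof -
  have g: "glinear p C M (D \<bullet>[0] iota P \<eta> C)"
    using glinear_gcomp[OF ghom_glinear[OF iota_ghom] D(1)] by simp
  have "D 0 d y = \<gamma>M 0 (d + p) (lcomp_map P A M 0 idm f p D 0 d (comp_map P F 0 idm (iota P \<eta> C) 0 d y))"
    using D(2) iotas_in[OF y] free_mult_iotas[OF C_flat y] unfolding deriv_def by metis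
  also have "lcomp_map P A M 0 idm f p D 0 d (comp_map P F 0 idm (iota P \<eta> C) 0 d y) =
      lcomp_map P A M 0 idm \<phi> p (D \<bullet>[0] iota P \<eta> C) 0 d y"
    using lcomp_comp[OF ghom_idm[of P] ghom_glinear[OF iota_ghom] f_lin D(1) \<phi> g C_flat F_flat A_flat M_flat _ _ y]
    by (simp add: f_iota0 gcomp_def)
  finally show ?thesis by (simp add: gcomp_def)
qed

lemma \<eta>1_dif: "dif P (Suc 0) 0 \<eta>1 = 0"
proof -
  have "(1 :: 'k) \<in> grd unit_smod (Suc 0) 0" by (simp add: unit_smod_def)
  hence "dif P (Suc 0) 0 \<eta>1 = \<eta> (Suc 0) (-1) (dif unit_smod (Suc 0) 0 (1 :: 'k))"
    using \<eta>_dg by (auto simp: dg_hom_def eq_on_def gcomp_def)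
  \<comment> \<open>Zero is written as a multiple, so that homogeneity of \<open>\<eta>\<close>
    shows its image to vanish.\<close>
  also have "\<dots> = \<eta> (Suc 0) (-1) (scl unit_smod 0 0)" by (simp add: unit_smod_def)
  also have "\<dots> = scl P 0 (\<eta> (Suc 0) (-1) 0)"
    by (rule glinearD(3)[OF ghom_glinear[OF \<eta>_ghom]]) (simp add: unit_smod_def)
  finally show ?thesis by (simp add: gmodD(8)[OF P_gmod])
qed

lemma dif_iota:
  assumes c: "c \<in> grd C 0 d"
  shows "dif F 0 d (iota P \<eta> C 0 d c) = iota P \<eta> C 0 (d - 1) (dif C 0 d c)"
proof -
  have gC: "ghom (-1) C C (dif C)" by (rule flat_ghom[OF C_flat C_flat C_dif])
  have dc: "dif C 0 d c \<in> grd C 0 (d - 1)" using glinearD(1)[OF C_dif c] by simp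
  have "((-1, 0), [([], d, c)]) \<in> trees P C 0 (d - 1)"
    using c gmodD(3)[OF P_gmod] by (simp add: trees_0_iff)
  hence z: "cls P C 0 (d - 1) ((-1, 0), [([], d, c)]) = 0"
    using cls_scl_root[of "-1" 0 "[([], d, c)]" P C 0 "d - 1" 0] by (simp add: gmodD(8)[OF P_gmod])
  show ?thesis
    unfolding iota dif_circ_cls[OF P_dif gC] esum_def
    using etree_idm_split[of "-1" "dif C" "[]" 0 \<eta>1 "[]" d c "[]"]
    by (simp add: ctree_idm \<eta>1_dif z lsign_def)
qed

abbreviation "\<delta>C \<equiv> comp_map P C (-1) \<alpha> idm \<bullet>[0] \<Delta>C"

lemma \<delta>C_lin: "glinear (-1) C F \<delta>C"
  using glinear_gcomp[OF ghom_glinear[OF \<Delta>C] glinear_comp_map[OF \<alpha> ghom_idm[of C]]] by simp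

text \<open>On a generator there is just one leaf: \<open>\<Delta>C\<close> expands it,
  \<open>\<alpha>\<close> acts on the root of the expansion, and grafting the result on the unit
  changes nothing. The unit has degree 0, so no sign appears.\<close>

lemma delta_iota:
  assumes c: "c \<in> grd C 0 d"
  shows "delta_l P \<gamma> \<eta> Q \<alpha> C \<Delta>C 0 d (iota P \<eta> C 0 d c) = \<delta>C 0 d c"
proof -
  have QF: "flat (circ Q C)" by (rule flat_circ[OF C_flat])
  have D: "\<Delta>C 0 d c \<in> grd (circ Q C) 0 d" using glinearD(1)[OF ghom_glinear[OF \<Delta>C] c] by simp
  define w where "w = \<delta>C 0 d c"
  have w: "w \<in> grd F 0 (d - 1)" using glinearD(1)[OF \<delta>C_lin c] by (simp add: w_def)
  have t1: "((0, \<eta>1), linl [] d (\<Delta>C 0 d c) []) \<in> trees P (dsum C (circ Q C)) 0 d"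
    using D \<eta>1_in by (simp add: linl_trees[OF C_gmod flatD(1)[OF QF]])
  have s1: "lcomp_map P C (circ Q C) 0 idm idm 0 \<Delta>C 0 d (iota P \<eta> C 0 d c) =
      cls P (dsum C (circ Q C)) 0 d ((0, \<eta>1), linl [] d (\<Delta>C 0 d c) [])"
    unfolding iota lcomp_map_cls[OF ghom_idm glinear_idm ghom_glinear[OF \<Delta>C] C_flat C_flat QF] esum_def
    using etree_split[of 0 idm idm 0 \<Delta>C "[]" 0 \<eta>1 d c "[]"] by (simp add: lsign_def) (simp add: idm_def)
  have s2: "lcomp_map P C F 0 idm fstm (-1) (comp_map P C (-1) \<alpha> idm \<bullet>[0] sndm) 0 d
      (cls P (dsum C (circ Q C)) 0 d ((0, \<eta>1), linl [] d (\<Delta>C 0 d c) [])) =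
      cls P (dsum C F) 0 (d - 1) ((0, \<eta>1), linl [] (d - 1) w [])"
    using lcomp_lin[OF ghom_idm[of P] glinear_idm[of C] glinear_comp_map[OF \<alpha> ghom_idm[of C]] C_flat QF C_flat F_flat t1]
    by (simp add: w_def gcomp_def) (simp add: idm_def)
  have cp: "ghom 0 (dsum C F) F (copair (iota P \<eta> C) idm)"
    by (rule flat_ghom[OF flat_dsum[OF C_flat F_flat] F_flat])
      (auto simp: glinear_def copair_def idm_def glinearD[OF ghom_glinear[OF iota_ghom]] scl_circ
        PM.scale_right_distrib intro!: gmodD(4)[OF flatD(1)[OF F_flat]] iota_in)
  have s3: "comp_map P F 0 idm (copair (iota P \<eta> C) idm) 0 (d - 1) (cls P (dsum C F) 0 (d - 1) ((0, \<eta>1), linl [] (d - 1) w [])) =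
      iota P \<eta> F 0 (d - 1) w"
    using glinear_0[OF ghom_glinear[OF iota_ghom] C_gmod, of 0 "d - 1"]
    unfolding comp_map_cls[OF ghom_idm cp] iota[of F]
    by (simp add: ctree_eq linl_def copair_def) (simp add: idm_def)
  show ?thesis
    unfolding delta_l_def
    using s1 s2 s3 free_mult_iota[OF C_flat w] by (simp add: gcomp_def free_mult_def w_def)
qed

text \<open>The differential of Hom(C, M) before values outside the components are set to 0;
  \<open>ddif\<close> is its counterpart for derivations.\<close>

definition hdif :: "int \<Rightarrow> ('c, 'm) gmap \<Rightarrow> ('c, 'm) gmap" where
  "hdif p g = (\<lambda>n d x. (dif M \<bullet>[p] g) n d x - scl M ((-1) powi p) ((g \<bullet>[-1] dif C) n d x)
        + twisted_action P \<alpha> \<Delta>C A \<phi> M \<gamma>M p g n d x)"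

definition ddif :: "int \<Rightarrow> (('p, 'c) tree \<Rightarrow>\<^sub>0 'k, 'm) gmap \<Rightarrow> (('p, 'c) tree \<Rightarrow>\<^sub>0 'k, 'm) gmap" where
  "ddif p D = (\<lambda>n d x. (dif M \<bullet>[p] D) n d x - scl M ((-1) powi p) ((D \<bullet>[-1] dif B) n d x))"

lemma glinear_minus:
  assumes "glinear p V M g" "glinear p V M h"
  shows "glinear p V M (\<lambda>n d x. g n d x - scl M c (h n d x))"
  using glinearD[OF assms(1)] glinearD[OF assms(2)]
  by (auto simp: glinear_def gmodD[OF M_gmod] intro!: gmodD(5,6)[OF M_gmod] simp: mult.commute)

lemma ddif_lin:
  assumes "glinear p F M D" shows "glinear (p - 1) F M (ddif p D)"
proof -
  have "glinear (p - 1) F M (dif M \<bullet>[p] D)" using glinear_gcomp[OF assms M_dif] by simp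
  moreover have "glinear (p - 1) F M (D \<bullet>[-1] dif B)"
    using glinear_gcomp[OF B_dif[unfolded glinear_B] assms] by simp
  ultimately show ?thesis unfolding ddif_def by (rule glinear_minus)
qed

text \<open>The twisting term enters here with sign minus, from the definition of the differential
  of the quasi-free algebra. On it \<open>D\<close> gives \<open>(-1) powi p\<close> times the
  twisted action, because a map of degree \<open>p\<close> passes \<open>\<alpha>\<close>. The same
  factor in the commutator cancels this one, and both minus signs together give a plus.\<close>

lemma ddif_iota:
  assumes D: "glinear p F M D" "deriv p D" and c: "c \<in> grd C 0 d"
  shows "ddif p D 0 d (iota P \<eta> C 0 d c) = hdif p (D \<bullet>[0] iota P \<eta> C) 0 d c"
proof -
  define g where "g = D \<bullet>[0] iota P \<eta> C"
  have g: "glinear p C M g"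
    unfolding g_def using glinear_gcomp[OF ghom_glinear[OF iota_ghom] D(1)] by simp
  have \<Delta>: "\<Delta>C 0 d c \<in> grd (circ Q C) 0 d" using glinearD(1)[OF ghom_glinear[OF \<Delta>C] c] by simp
  define y where "y = lcomp_map P A M (-1) \<alpha> \<phi> p g 0 d (\<Delta>C 0 d c)"
  have y: "y \<in> grd (circ_lin P A M) 0 (d - 1 + p)"
    using glinearD(1)[OF glinear_lcomp_map[OF \<alpha> \<phi> g C_flat A_flat M_flat] \<Delta>] by (simp add: y_def algebra_simps)
  have w: "\<delta>C 0 d c \<in> grd F 0 (d - 1)" using glinearD(1)[OF \<delta>C_lin c] by simp
  have "lcomp_map P A M 0 idm \<phi> p g 0 (d - 1) (\<delta>C 0 d c) = psc ((-1) powi (p * -1)) y"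
    unfolding y_def using lcomp_comp[OF \<alpha> glinear_idm \<phi> g \<phi> g C_flat C_flat A_flat M_flat _ _ \<Delta>]
    by (simp add: gcomp_def) (simp add: idm_def)
  hence Dw: "D 0 (d - 1) (\<delta>C 0 d c) = scl M ((-1) powi p) (\<gamma>M 0 (d - 1 + p) y)"
    using deriv_eq[OF D w] \<gamma>M_psc[OF y] by (simp add: gcomp_def g_def powi_minus_one)
  have i: "iota P \<eta> C 0 (d - 1) (dif C 0 d c) \<in> grd F 0 (d - 1)"
    using glinearD(1)[OF C_dif c] by (intro iota_in) simp
  have "dif B 0 d (iota P \<eta> C 0 d c) = iota P \<eta> C 0 (d - 1) (dif C 0 d c) - \<delta>C 0 d c"
    by (simp add: quasi_free_def dif_iota[OF c] delta_iota[OF c])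
  hence "D 0 (d - 1) (dif B 0 d (iota P \<eta> C 0 d c)) = g 0 (d - 1) (dif C 0 d c) - scl M ((-1) powi p) (\<gamma>M 0 (d - 1 + p) y)"
    using glinear_diff[OF D(1) flatD(1)[OF F_flat] M_gmod i w] Dw by (simp add: g_def gcomp_def)
  moreover have "twisted_action P \<alpha> \<Delta>C A \<phi> M \<gamma>M p g 0 d c = \<gamma>M 0 (d - 1 + p) y"
    by (simp add: twisted_action_def gcomp_def y_def add_diff_eq diff_add_eq)
  ultimately show ?thesis
    unfolding g_def[symmetric]
    by (simp add: ddif_def hdif_def gcomp_def gmodD[OF M_gmod] powi_m1_sq) (simp add: g_def gcomp_def)
qed

text \<open>The commutator of a derivation with the differentials is a derivation:
  \<open>twist_dif\<close> is used over the quasi-free algebra itself, with the chain map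
  \<open>f\<close> for \<open>a\<close> and \<open>D\<close> for \<open>b\<close>.\<close>

lemma deriv_ddif:
  assumes D: "glinear p F M D" "deriv p D"
  shows "deriv (p - 1) (ddif p D)"
  unfolding deriv_def
proof (intro allI ballI)
  fix d z assume z: "z \<in> grd (circ P F) 0 d"
  have gB: "ghom (-1) B B (dif B)" by (rule flat_ghom[OF B_flat B_flat B_dif])
  have dz: "dif (circ P B) 0 d z \<in> grd (circ P F) 0 (d - 1)"
    using dif_circ_in[OF P_dif gB, of z 0 d] z by (simp add: B_eq)
  have "ddif p D 0 d (free_mult P \<gamma> C 0 d z) =
      dif M 0 (d + p) (\<gamma>M 0 (d + p) (lcomp_map P A M 0 idm f p D 0 d z)) -
      scl M ((-1) powi p) (\<gamma>M 0 (d - 1 + p) (lcomp_map P A M 0 idm f p D 0 (d - 1) (dif (circ P B) 0 d z)))"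
    using D(2) z dz by (simp add: ddif_def gcomp_def B_mult[OF z] deriv_def)
  also have "\<dots> = \<gamma>M 0 (d + (p - 1)) (lcomp_map P A M 0 idm f (p - 1) (ddif p D) 0 d z)"
    by (rule twist_dif[OF B_flat B_dif])
      (simp_all only: glinear_B B_eq f_lin D ddif_lin f_dif z, simp add: ddif_def gcomp_def)
  finally show "ddif p D 0 d (free_mult P \<gamma> C 0 d z) = \<gamma>M 0 (d + (p - 1)) (lcomp_map P A M 0 idm f (p - 1) (ddif p D) 0 d z)" .
qed

lemma M_dd: "x \<in> grd M 0 d \<Longrightarrow> dif M 0 (d - 1) (dif M 0 d x) = 0"
  using M by (auto simp: amodule_def dg_module_def smodule_def)

lemma ddif_ddif:
  assumes D: "glinear p F M D" and x: "x \<in> grd F 0 d"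
  shows "ddif (p - 1) (ddif p D) 0 d x = 0"
proof -
  have dx: "dif B 0 d x \<in> grd F 0 (d - 1)" using glinearD(1)[OF B_dif, of x 0 d] x by (simp add: B_eq)
  have 1: "D 0 d x \<in> grd M 0 (d + p)" "D 0 (d - 1) (dif B 0 d x) \<in> grd M 0 (d + p - 1)"
    using glinearD(1)[OF D x] glinearD(1)[OF D dx] by (simp_all add: algebra_simps)
  have 2: "dif M 0 (d + p) (D 0 d x) \<in> grd M 0 (d + p - 1)" using glinearD(1)[OF M_dif 1(1)] by simp
  have s: "(-1 :: 'k) powi (p - 1) = - ((-1) powi p)" by (simp add: powi_minus_one)
  have e: "d - 1 + p = d + p - 1" "d + (p - 1) = d + p - 1" by simp_all
  have 3: "dif M 0 (d + p - 1) (dif M 0 (d + p) (D 0 d x) - scl M ((-1) powi p) (D 0 (d - 1) (dif B 0 d x))) =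
      - scl M ((-1) powi p) (dif M 0 (d + p - 1) (D 0 (d - 1) (dif B 0 d x)))"
    using glinear_diff[OF M_dif M_gmod M_gmod 2 gmodD(6)[OF M_gmod 1(2)]] M_dd[OF 1(1)] glinearD(3)[OF M_dif 1(2)] by simp
  have ms: "scl M (- c) y = - scl M c y" for c y
    using gmodD(13)[OF M_gmod, of "-1" c y] gmodD(14)[OF M_gmod, of "scl M c y"] by simp
  show ?thesis
    using B_dd[OF x] glinear_0[OF D flatD(1)[OF F_flat]]
    by (simp add: ddif_def gcomp_def s e 3 gmodD[OF M_gmod] ms)
qed

end

section \<open>The free module\<close>

lemma lcomp_zero:
  assumes "ghom r M M2 f" "glinear 0 N L a" "glinear q N L' b" "flat N" "flat L" "flat L'"
    and "\<And>e x. x \<in> grd N 0 e \<Longrightarrow> b 0 e x = 0" and "x \<in> grd (circ M N) 0 d"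
  shows "lcomp_map M2 L L' r f a q b 0 d x = 0"
  using lcomp_add[OF assms(1,2,3,3,3,4-6) _ assms(8), of 1] assms(7) gmodD(9)[OF flatD(1)[OF assms(6)]] by simp

lemma span_pair:
  assumes "gmod V" "gmod W"
  shows "a \<in> module.span (scl V) G \<Longrightarrow> (a, 0) \<in> module.span (scl (dsum V W)) (G \<times> {0})"
    and "b \<in> module.span (scl W) H \<Longrightarrow> (0, b) \<in> module.span (scl (dsum V W)) ({0} \<times> H)"
proof -
  interpret V: vector_space "scl V" by (rule gmodD(1)[OF assms(1)])
  interpret W: vector_space "scl W" by (rule gmodD(1)[OF assms(2)])
  interpret S: vector_space "scl (dsum V W)" by (rule gmodD(1)[OF gmod_dsum[OF assms]])
  show "(a, 0) \<in> S.span (G \<times> {0})" if "a \<in> V.span G"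
    using that
  proof (induction rule: V.span_induct_alt)
    case base show ?case using S.span_zero unfolding zero_prod_def .
  next
    case (step c x y)
    have "(x, 0) \<in> S.span (G \<times> {0})" using step(1) by (intro S.span_base) simp
    note S.span_add[OF S.span_scale[OF this, of c] step(2)]
    moreover have "scl (dsum V W) c (x, 0) + (y, 0) = (scl V c x + y, 0)" by simp
    ultimately show ?case by metis
  qed
  show "(0, b) \<in> S.span ({0} \<times> H)" if "b \<in> W.span H"
    using that
  proof (induction rule: W.span_induct_alt)
    case base show ?case using S.span_zero unfolding zero_prod_def .
  next
    case (step c x y)
    have "(0, x) \<in> S.span ({0} \<times> H)" using step(1) by (intro S.span_base) simp
    note S.span_add[OF S.span_scale[OF this, of c] step(2)]
    moreover have "scl (dsum V W) c (0, x) + (0, y) = (0, scl W c x + y)" by simp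
    ultimately show ?case by metis
  qed
qed

lemma circ_lin_gen_span:
  fixes M :: "('k::field, 'm::ab_group_add) dgs" and V :: "('k, 'v::ab_group_add) dgs" and W :: "('k, 'w::ab_group_add) dgs"
  assumes V: "gmod V" "\<And>e. GV e \<subseteq> grd V 0 e" "\<And>e. grd V 0 e \<subseteq> module.span (scl V) (GV e)"
    and W: "gmod W" "\<And>e. GW e \<subseteq> grd W 0 e" "\<And>e. grd W 0 e \<subseteq> module.span (scl W) (GW e)"
  shows "grd (circ_lin M V W) 0 d \<subseteq> PM.span (cls M (dsum V W) 0 d `
    {((p, m), linl xs e y ys) | p m xs e y ys. ((p, m), linl xs e y ys) \<in> trees M (dsum V W) 0 d \<and>
      (\<forall>(s, e, x)\<in>set xs \<union> set ys. s = [] \<and> x \<in> GV e) \<and> y \<in> GW e})" (is "_ \<subseteq> PM.span (_ ` ?T)")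
  unfolding circ_lin_gen[OF V(1) W(1)]
proof (rule PM.span_minimal[OF _ PM.subspace_span], rule subsetI)
  fix z assume "z \<in> cls M (dsum V W) 0 d ` {((p, m), linl xs e y ys) | p m xs e y ys. ((p, m), linl xs e y ys) \<in> trees M (dsum V W) 0 d}"
  then obtain p m xs e y ys where t: "((p, m), linl xs e y ys) \<in> trees M (dsum V W) 0 d"
    and z: "z = cls M (dsum V W) 0 d ((p, m), linl xs e y ys)" by auto
  let ?zs = "linl xs e y ys"
  \<comment> \<open>Generators slot by slot: at the distinguished position they lie in the second
    summand, elsewhere in the first. A tree with leaves chosen in this way is again of the form
    \<open>linl\<close>.\<close>
  define G where "G = (\<lambda>i. if i = length xs then {0} \<times> GW e else GV (fst (snd (?zs ! i))) \<times> {0 :: 'w})"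
  note t' = t[unfolded linl_trees[OF V(1) W(1)]] and tn = t[unfolded mem_trees_nth]
  have zm: "?zs ! length xs = ([], e, (0, y))" by (simp add: linl_def nth_append)
  have zi: "snd (snd (snd (?zs ! i))) = 0" if "i < length ?zs" "i \<noteq> length xs" for i
    using that by (auto simp: linl_def injl_def nth_append nth_Cons' split_beta)
  have ze: "fst (?zs ! i) = []" if "i < length ?zs" for i
    using t nth_mem[OF that] by (auto simp: trees_0_iff split_beta)
  have 1: "G i \<subseteq> grd (dsum V W) (length (fst (?zs ! i))) (fst (snd (?zs ! i)))" if "i < length ?zs" for i
    using V(2) W(2) gmodD(3)[OF V(1)] gmodD(3)[OF W(1)] ze[OF that] by (auto simp: G_def zm)
  have 2: "snd (snd (?zs ! i)) \<in> module.span (scl (dsum V W)) (G i)" if "i < length ?zs" for i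
  proof (cases "i = length xs")
    case True
    thus ?thesis using span_pair(2)[OF V(1) W(1)] W(3)[of e] t' by (auto simp: G_def zm)
  next
    case False
    have e: "snd (snd (?zs ! i)) = (fst (snd (snd (?zs ! i))), 0)" using zi[OF that False] by (simp add: prod_eq_iff)
    have "snd (snd (?zs ! i)) \<in> grd (dsum V W) (length (fst (?zs ! i))) (fst (snd (?zs ! i)))" using tn that by blast
    hence "fst (snd (snd (?zs ! i))) \<in> grd V 0 (fst (snd (?zs ! i)))" using ze[OF that] by (auto simp: mem_Times_iff)
    moreover have "G i = GV (fst (snd (?zs ! i))) \<times> {0}" using False by (simp add: G_def)
    ultimately show ?thesis by (subst e) (simp only: span_pair(1)[OF V(1) W(1) subsetD[OF V(3)]])
  qed
  have "cls M (dsum V W) 0 d ` {((p, m), zs') | zs'. length zs' = length ?zs \<and>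
    (\<forall>i<length ?zs. fst (zs' ! i) = fst (?zs ! i) \<and> fst (snd (zs' ! i)) = fst (snd (?zs ! i)) \<and> snd (snd (zs' ! i)) \<in> G i)}
    \<subseteq> cls M (dsum V W) 0 d ` ?T"
  proof (intro image_mono subsetI, clarify)
    fix zs' assume l: "length zs' = length ?zs"
      and h: "\<forall>i<length ?zs. fst (zs' ! i) = fst (?zs ! i) \<and> fst (snd (zs' ! i)) = fst (snd (?zs ! i)) \<and> snd (snd (zs' ! i)) \<in> G i"
    have mf: "map fst zs' = map fst ?zs" by (rule nth_equalityI) (use l h in auto)
    have "degs zs' = degs ?zs" unfolding degs_nth l using h by simp
    moreover have "snd (snd (zs' ! i)) \<in> grd (dsum V W) (length (fst (zs' ! i))) (fst (snd (zs' ! i)))" if "i < length zs'" for i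
      using that subsetD[OF 1] h l by metis
    ultimately have tr: "((p, m), zs') \<in> trees M (dsum V W) 0 d" using tn l unfolding mem_trees_nth mf by metis
    define y' where "y' = snd (snd (snd (zs' ! length xs)))"
    have k: "length xs < length ?zs" by simp
    have zk: "zs' ! length xs = ([], e, (0, y'))" and gy: "y' \<in> GW e"
      using h[rule_format, OF k] by (auto simp: zm G_def y'_def prod_eq_iff mem_Times_iff)
    have gi: "fst (snd (snd (zs' ! i))) \<in> GV (fst (snd (zs' ! i)))" "snd (snd (snd (zs' ! i))) = 0" "fst (zs' ! i) = []"
      if "i < length ?zs" "i \<noteq> length xs" for i
      using h[rule_format, OF that(1)] that(2) ze[OF that(1)] by (auto simp: G_def mem_Times_iff)
    obtain xs' ys' where eq: "zs' = linl xs' e y' ys'" "length xs' = length xs"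
      using linl_ex[OF _ zk gi(2)] k l by metis
    have "s = [] \<and> x \<in> GV e'" if m: "(s, e', x) \<in> set xs' \<union> set ys'" for s e' x
    proof -
      obtain i where i: "i < length ?zs" "i \<noteq> length xs" "zs' ! i = (s, e', (x, 0))"
      proof -
        consider i where "i < length xs'" "xs' ! i = (s, e', x)" | i where "i < length ys'" "ys' ! i = (s, e', x)"
          using m unfolding Un_iff in_set_conv_nth by blast
        thus ?thesis
        proof cases
          case 1
          thus ?thesis using that[of i] eq l by (simp add: linl_def injl_def nth_append)
        next
          case (2 i)
          thus ?thesis using that[of "Suc (length xs + i)"] eq l by (simp add: linl_def injl_def nth_append)
        qed
      qed
      show ?thesis using gi[OF i(1,2)] unfolding i(3) by simp
    qed
    hence gx: "\<forall>(s, e, x)\<in>set xs' \<union> set ys'. s = [] \<and> x \<in> GV e" by blast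
    show "\<exists>p' m' xs e y ys. ((p, m), zs') = ((p', m'), linl xs e y ys) \<and> ((p', m'), linl xs e y ys) \<in> trees M (dsum V W) 0 d \<and>
      (\<forall>(s, e, x)\<in>set xs \<union> set ys. s = [] \<and> x \<in> GV e) \<and> y \<in> GW e"
      using gx gy tr unfolding eq by (intro exI conjI) (rule refl, assumption+)
  qed
  thus "z \<in> PM.span (cls M (dsum V W) 0 d ` ?T)"
    unfolding z using cls_span[OF gmod_dsum[OF V(1) W(1)] t 1 2] PM.span_mono by blast
qed

section \<open>Extension of maps from N to the free A-module on N\<close>

locale fmd = amd P \<gamma> \<eta> A \<gamma>A M \<gamma>M
  for P :: "('k::field_char_0, 'p::ab_group_add) dgs" and \<gamma> \<eta>
    and A :: "('k, 'a::ab_group_add) dgs" and \<gamma>A and M :: "('k, 'm::ab_group_add) dgs" and \<gamma>M +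
  fixes N :: "('k, 'n::ab_group_add) dgs"
  assumes N_flat: "flat N"
begin

abbreviation "X \<equiv> dsum A N"
abbreviation "L \<equiv> circ_lin P A N"
abbreviation "mu \<equiv> lmult P \<gamma> A N"
abbreviation "R \<equiv> tens_rel P \<gamma> \<eta> A \<gamma>A N"
abbreviation "T \<equiv> tens P \<gamma> \<eta> A \<gamma>A N"
abbreviation "pr \<equiv> tens_proj P \<gamma> \<eta> A \<gamma>A N"
abbreviation "tact \<equiv> tens_act P \<gamma> \<eta> A \<gamma>A N"
abbreviation "PA \<equiv> circ P A"
abbreviation "ext p g \<equiv> \<gamma>M \<bullet>[p] lcomp_map P A M 0 idm fstm p (g \<bullet>[0] sndm)"

lemmas X_flat = flat_dsum[OF A_flat N_flat] and L_flat = flat_circ_lin[OF A_flat N_flat, of P]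
lemmas N_gmod = flatD(1)[OF N_flat]
lemmas X_gmod = flatD(1)[OF X_flat]
lemmas PA_flat = flat_circ[OF A_flat, of P]

lemma gsnd: "glinear p N V g \<Longrightarrow> glinear p (dsum W N) V (g \<bullet>[0] sndm)"
  using glinear_gcomp[OF glinear_sndm[of W N]] by fastforce

lemma afst: "glinear p A V g \<Longrightarrow> glinear p (dsum A W) V (g \<bullet>[0] fstm)"
  using glinear_gcomp[OF glinear_fstm[of A W]] by fastforce

lemma ext_lin: "glinear p N M g \<Longrightarrow> glinear p (circ P X) M (ext p g)"
  by (rule twist_lin[OF X_flat glinear_fstm gsnd])

lemma ext_lin_L: "glinear p N M g \<Longrightarrow> glinear p L M (ext p g)"
  by (rule glinear_sub[OF ext_lin]) (simp_all add: circ_lin_sub)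

lemma ext_linl:
  assumes g: "glinear p N M g" and t: "((q, m), linl xs e y ys) \<in> trees P X 0 d"
  shows "ext p g 0 d (cls P X 0 d ((q, m), linl xs e y ys)) = scl M ((-1) powi (p * (q + degs xs)))
    (\<gamma>M 0 (d + p) (cls P (dsum A M) 0 (d + p) ((q, m), linl xs (e + p) (g 0 e y) ys)))"
proof -
  note ll = lcomp_lin[OF ghom_idm[of P] glinear_idm[of A] g A_flat N_flat A_flat M_flat t]
  have y: "y \<in> grd N 0 e" using t by (simp add: linl_trees[OF A_gmod N_gmod])
  have "((q, m), linl xs (e + p) (g 0 e y) ys) \<in> trees P (dsum A M) 0 (d + p)"
    using t glinearD(1)[OF g y] by (simp add: linl_trees[OF A_gmod N_gmod] linl_trees[OF A_gmod M_gmod])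
  from cls_in_circ_lin[OF this lin_tree_linl] show ?thesis
    using ll \<gamma>M_psc by (simp add: gcomp_def) (simp add: idm_def)
qed

text \<open>The extension applies \<open>g\<close> to the component in \<open>N\<close> of one leaf,
  which is 0 in trees whose leaves all come from \<open>A\<close>.\<close>

lemma ext_inl:
  assumes g: "glinear p N M g" and u: "u \<in> grd PA 0 d"
  shows "ext p g 0 d (comp_map P X 0 idm inlm 0 d u) = 0"
proof -
  have z: "glinear p A M (\<lambda>n d x. 0)"
    by (auto simp: glinear_def gmodD(3)[OF M_gmod] gmodD(9)[OF M_gmod])
  have "lcomp_map P A M 0 idm fstm p (g \<bullet>[0] sndm) 0 d (comp_map P X 0 idm inlm 0 d u) =
      lcomp_map P A M 0 idm idm p (\<lambda>n d x. 0) 0 d u"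
    using lcomp_comp[OF ghom_idm[of P] ghom_glinear[OF inlm_ghom[OF N_flat]] glinear_fstm gsnd[OF g] glinear_idm z A_flat X_flat A_flat M_flat _ _ u]
      glinear_0[OF g N_gmod]
    by (simp add: inlm_def fstm_def sndm_def gcomp_def) (simp add: idm_def)
  also have "\<dots> = 0" by (rule lcomp_zero[OF ghom_idm glinear_idm z A_flat A_flat M_flat _ u]) simp
  finally show ?thesis by (simp add: gcomp_def glinear_0[OF \<gamma>M_lin gmod_circ_lin])
qed

lemma fst_inl:
  assumes u: "u \<in> grd PA 0 d"
  shows "comp_map P A 0 idm fstm 0 d (comp_map P X 0 idm inlm 0 d u) = u"
  using comp_comp[OF ghom_idm ghom_glinear[OF inlm_ghom[OF N_flat]] glinear_fstm glinear_idm A_flat X_flat A_flat _ u] comp_idm[OF u]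
  by (simp add: inlm_def fstm_def) (simp add: idm_def)

lemma fst_lin:
  assumes v: "v \<in> grd L 0 d"
  shows "comp_map P A 0 idm fstm 0 d v = 0"
proof (rule plin_eq[OF plin_comp_map _ _ v[unfolded circ_lin_gen[OF A_gmod N_gmod]]])
  show "plin (\<lambda>x. 0)" by (simp add: plin_def)
  fix z assume "z \<in> cls P X 0 d ` {((p, m), linl xs e y ys) | p m xs e y ys. ((p, m), linl xs e y ys) \<in> trees P X 0 d}"
  then obtain p m xs e y ys where t: "((p, m), linl xs e y ys) \<in> trees P X 0 d"
    and z: "z = cls P X 0 d ((p, m), linl xs e y ys)" by auto
  have f: "ghom 0 X A fstm" by (rule flat_ghom[OF X_flat A_flat glinear_fstm])
  have "((p, m), aleaf fstm (linl xs e y ys)) \<in> trees P A 0 d"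
    using ctree_trees[OF t glinear_idm[of P] ghom_glinear[OF f]] by (simp add: ctree_aleaf) (simp add: idm_def)
  moreover have "snd (snd (aleaf fstm (linl xs e y ys) ! length xs)) = 0"
    by (simp add: linl_def nth_append fstm_def)
  ultimately have "cls P A 0 d ((p, m), aleaf fstm (linl xs e y ys)) = 0"
    by (intro cls_zero_at[of _ _ _ _ _ _ _ "length xs"]) (auto simp: A_gmod)
  thus "comp_map P A 0 idm fstm 0 d z = 0"
    unfolding z comp_map_cls[OF ghom_idm f] by (simp add: ctree_aleaf) (simp add: idm_def)
qed

text \<open>\<open>twist_mult\<close> for the sum of \<open>A\<close> and \<open>N\<close>, with the
  first projection as \<open>a\<close>. The inclusion in \<open>lmult\<close> then disappears: on
  P(A) the extension vanishes (\<open>ext_inl\<close>) and the projection gives back the element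
  (\<open>fst_inl\<close>), while on P(A, N) the projection vanishes
  (\<open>fst_lin\<close>).\<close>

lemma ext_mu:
  assumes g: "glinear p N M g" and x: "x \<in> grd (circ_lin P PA L) 0 d"
  shows "ext p g 0 d (mu 0 d x) =
    \<gamma>M 0 (d + p) (lcomp_map P A M 0 idm (\<gamma>A \<bullet>[0] fstm) p (ext p g \<bullet>[0] sndm) 0 d x)"
proof -
  let ?\<kappa> = "copair (comp_map P X 0 idm inlm) idm"
  have x': "x \<in> grd (circ P (dsum PA L)) 0 d" using x circ_lin_sub by blast
  note \<kappa> = kap_lin[OF N_flat]
  note fl = flat_dsum[OF PA_flat L_flat] flat_circ[OF X_flat, of P]
  have y: "comp_map P (circ P X) 0 idm ?\<kappa> 0 d x \<in> grd (circ P (circ P X)) 0 d"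
    using glinearD(1)[OF glinear_comp_map[OF ghom_idm \<kappa>] x'] by simp
  have a3: "glinear 0 (dsum PA L) A (\<gamma>A \<bullet>[0] fstm)"
    using glinear_gcomp[OF glinear_fstm[of PA L] \<gamma>A_lin] by simp
  have b3: "glinear p (dsum PA L) M (ext p g \<bullet>[0] sndm)"
    using glinear_gcomp[OF glinear_sndm[of PA L] ext_lin_L[OF g]] by simp
  note cp = glinear_comp_map[OF ghom_idm[of P] inlm_ghom[OF N_flat]]
  note pf = glinear_comp_map[OF ghom_idm[of P] flat_ghom[OF X_flat A_flat glinear_fstm]]
  have k: "?\<kappa> 0 e z = comp_map P X 0 idm inlm 0 e (fst z) + snd z" for e z
    by (cases z) (simp add: copair_def, simp add: idm_def)
  have ext_k: "(\<gamma>A \<bullet>[0] fstm) 0 e z = (\<gamma>A \<bullet>[0] comp_map P A 0 idm fstm) 0 e (?\<kappa> 0 e z)"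
    "(ext p g \<bullet>[0] sndm) 0 e z = ext p g 0 e (?\<kappa> 0 e z)" if "z \<in> grd (dsum PA L) 0 e" for e z
  proof -
    have z: "fst z \<in> grd PA 0 e" "snd z \<in> grd L 0 e" using that by auto
    note z = z subsetD[OF circ_lin_sub z(2)]
    have i: "comp_map P X 0 idm inlm 0 e (fst z) \<in> grd (circ P X) 0 e"
      using glinearD(1)[OF cp z(1)] by simp
    show "(\<gamma>A \<bullet>[0] fstm) 0 e z = (\<gamma>A \<bullet>[0] comp_map P A 0 idm fstm) 0 e (?\<kappa> 0 e z)"
      using glinearD(2)[OF pf i z(3)] by (simp add: k gcomp_def fst_inl[OF z(1)] fst_lin[OF z(2)]) (simp add: fstm_def)
    show "(ext p g \<bullet>[0] sndm) 0 e z = ext p g 0 e (?\<kappa> 0 e z)"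
      using glinearD(2)[OF ext_lin[OF g] i z(3)] ext_inl[OF g z(1)] by (simp add: k) (simp add: gcomp_def sndm_def)
  qed
  have "ext p g 0 d (mu 0 d x) = \<gamma>M 0 (d + p) (lcomp_map P A M 0 idm (\<gamma>A \<bullet>[0] comp_map P A 0 idm fstm) p (ext p g) 0 d
      (comp_map P (circ P X) 0 idm ?\<kappa> 0 d x))"
    using twist_mult[OF X_flat glinear_fstm gsnd[OF g] y] unfolding lmult_eq by (simp add: gcomp_def)
  also have "lcomp_map P A M 0 idm (\<gamma>A \<bullet>[0] comp_map P A 0 idm fstm) p (ext p g) 0 d (comp_map P (circ P X) 0 idm ?\<kappa> 0 d x) =
      lcomp_map P A M 0 idm (\<gamma>A \<bullet>[0] fstm) p (ext p g \<bullet>[0] sndm) 0 d x"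
    using lcomp_comp[OF ghom_idm[of P] ghom_glinear[OF \<kappa>] alg_lin[OF X_flat glinear_fstm] ext_lin[OF g] a3 b3 fl A_flat M_flat _ _ x', OF ext_k]
    by simp
  finally show ?thesis .
qed

lemma plin_mu: "plin (mu n d)"
  unfolding lmult_eq using plin_free_mult[of P \<gamma> X n d]
    plin_comp_map[of P "circ P X" 0 idm "copair (comp_map P X 0 idm inlm) idm" n d]
  by (simp add: plin_def)

text \<open>On generators \<open>lmult_uleaves\<close> displays the product as a multiple of a tree
  with exactly one leaf in \<open>N\<close>, so linearity in \<open>N\<close> is preserved.\<close>

lemma mu_in:
  assumes x: "x \<in> grd (circ_lin P PA L) 0 d"
  shows "mu 0 d x \<in> grd L 0 d"
proof -
  let ?GV = "\<lambda>e. cls P A 0 e ` trees P A 0 e"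
  let ?GW = "\<lambda>e. cls P X 0 e ` {((p, m), linl xs e' y ys) | p m xs e' y ys. ((p, m), linl xs e' y ys) \<in> trees P X 0 e}"
  have V: "?GV e \<subseteq> grd PA 0 e" "grd PA 0 e \<subseteq> module.span (scl PA) (?GV e)" for e
    using cls_in_circ[of _ P A 0 e] by (auto simp: grd_circ)
  have W: "?GW e \<subseteq> grd L 0 e" "grd L 0 e \<subseteq> module.span (scl L) (?GW e)" for e
    by (simp_all add: circ_lin_gen[OF A_gmod N_gmod] PM.span_superset)
  show ?thesis
  proof (rule plin_in[OF plin_mu _ _ subsetD[OF circ_lin_gen_span[OF gmod_circ V gmod_circ_lin W] x]])
    show "PM.subspace (grd L 0 d)" using gmodD(2)[OF gmod_circ_lin[of P A N]] by simp
    fix z assume "z \<in> cls P (dsum PA L) 0 d ` {((p, m), linl xs e y ys) | p m xs e y ys.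
      ((p, m), linl xs e y ys) \<in> trees P (dsum PA L) 0 d \<and>
      (\<forall>(s, e, x)\<in>set xs \<union> set ys. s = [] \<and> x \<in> ?GV e) \<and> y \<in> ?GW e}"
    then obtain p m xs e y ys where z: "z = cls P (dsum PA L) 0 d ((p, m), linl xs e y ys)"
      and t: "((p, m), linl xs e y ys) \<in> trees P (dsum PA L) 0 d"
      and g: "\<forall>(s, e, x)\<in>set xs \<union> set ys. s = [] \<and> x \<in> ?GV e" "y \<in> ?GW e" by blast
    have ul: "\<exists>us. zs = uleaves P A us \<and> set us \<subseteq> utrees P A" if "\<forall>(s, e, x)\<in>set zs. s = [] \<and> x \<in> ?GV e" for zs
      using uleaves_ex[of zs P A "\<lambda>_. True"] that by auto
    obtain us1 where "xs = uleaves P A us1 \<and> set us1 \<subseteq> utrees P A"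
      using ul[OF conjunct1[OF g(1)[unfolded ball_Un]]] by (rule exE)
    moreover obtain us2 where "ys = uleaves P A us2 \<and> set us2 \<subseteq> utrees P A"
      using ul[OF conjunct2[OF g(1)[unfolded ball_Un]]] by (rule exE)
    ultimately have us: "xs = uleaves P A us1" "set us1 \<subseteq> utrees P A" "ys = uleaves P A us2" "set us2 \<subseteq> utrees P A"
      by simp_all
    obtain r xs' e' y' ys' where v: "(r, linl xs' e' y' ys') \<in> trees P X 0 e" "y = cls P X 0 e (r, linl xs' e' y' ys')"
      using g(2) by blast
    have e: "e = tdeg (r, linl xs' e' y' ys')" using trees_tdeg[OF v(1)] by simp
    have vu: "(r, linl xs' e' y' ys') \<in> utrees P X" using v(1) by (simp add: utrees_iff)
    note t' = t[unfolded linl_trees[OF gmod_circ gmod_circ_lin]]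
    have m: "m \<in> grd P (Suc (length us1 + length us2)) p" using t' by (simp add: us)
    have D: "d = p + (rdeg (map ctl us1 @ (r, linl xs' e' y' ys') # map ctl us2) + ldeg (map ctl us1 @ (r, linl xs' e' y' ys') # map ctl us2))"
      using t' by (simp add: us degs_uleaves ctl_lists e tdeg_def)
    note lm = lmult_uleaves[OF N_flat m us(2,4) refl vu D]
    show "mu 0 d z \<in> grd L 0 d"
      unfolding z us(1,3) v(2) e lm(1)
      by (rule PM.subspace_scale[OF \<open>PM.subspace (grd L 0 d)\<close> cls_in_circ_lin[OF lm(2) lin_tree_linl]])
  qed
qed

abbreviation "jj \<equiv> iota P \<eta> X \<bullet>[0] inrm"

lemma jj_eq: "jj 0 d y = cls P X 0 d ((0, \<eta>1), linl [] d y [])"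
  by (simp add: gcomp_def iota inrm_def linl_def)

lemma jj_in: "y \<in> grd N 0 d \<Longrightarrow> jj 0 d y \<in> grd L 0 d"
  unfolding jj_eq by (rule cls_in_circ_lin[OF _ lin_tree_linl]) (simp add: linl_trees[OF A_gmod N_gmod] \<eta>1_in)

lemma inr_lin: "glinear 0 N X inrm"
  by (auto simp: glinear_def inrm_def gmodD(3)[OF A_gmod] gmodD(9)[OF A_gmod])

lemma jj_lin: "glinear 0 N L jj"
proof (rule flat_glinearI[OF N_flat L_flat])
  have l: "glinear 0 N (circ P X) jj" using glinear_gcomp[OF inr_lin glinear_iota[OF X_gmod]] by simp
  show "jj 0 d (x + y) = jj 0 d x + jj 0 d y" if "x \<in> grd N 0 d" "y \<in> grd N 0 d" for d x y
    using glinearD(2)[OF l that] .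
  show "jj 0 d (scl N c x) = scl L c (jj 0 d x)" if "x \<in> grd N 0 d" for d c x
    using glinearD(3)[OF l that] by simp
  show "jj (Suc n) d 0 = 0" for n d by (rule glinear_0[OF l N_gmod])
qed (simp add: jj_in)

lemma ext_jj:
  assumes g: "glinear p N M g" and y: "y \<in> grd N 0 d"
  shows "ext p g 0 d (jj 0 d y) = g 0 d y"
proof -
  have "((0, \<eta>1), linl [] d y []) \<in> trees P X 0 d" using y \<eta>1_in by (simp add: linl_trees[OF A_gmod N_gmod])
  from ext_linl[OF g this] \<gamma>M_unit[of "g 0 d y" "d + p"] glinearD(1)[OF g y]
  show ?thesis unfolding jj_eq by (simp add: linl_def gmodD(10)[OF M_gmod])
qed

abbreviation "rg n d x \<equiv> mu n d (lcomp_map P PA L 0 idm fstm 0 (jj \<bullet>[0] sndm) n d x) -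
  lcomp_map P A N 0 idm (\<gamma>A \<bullet>[0] fstm) 0 sndm n d x"

lemma R_eq: "R n d = PM.span (rg n d ` grd (circ_lin P PA N) n d)"
proof -
  have "iota P \<eta> X \<bullet>[0] inrm \<bullet>[0] sndm = jj \<bullet>[0] sndm" by (simp add: gcomp_def)
  thus ?thesis by (simp add: tens_rel_def gcomp_def)
qed

lemma R_subspace: "PM.subspace (R n d)"
  unfolding R_eq by (rule PM.subspace_span)

lemma rl1_lin: "glinear 0 (circ P (dsum PA N)) (circ_lin P PA L) (lcomp_map P PA L 0 idm fstm 0 (jj \<bullet>[0] sndm))"
  using glinear_lcomp_map[OF ghom_idm glinear_fstm gsnd[OF jj_lin] flat_dsum[OF PA_flat N_flat] PA_flat L_flat, of P] by simp

lemma gaf: "glinear 0 (dsum PA W) A (\<gamma>A \<bullet>[0] fstm)"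
  using glinear_gcomp[OF glinear_fstm[of PA W] \<gamma>A_lin] by simp

lemma rl2_lin: "glinear 0 (circ P (dsum PA N)) L (lcomp_map P A N 0 idm (\<gamma>A \<bullet>[0] fstm) 0 sndm)"
  using glinear_lcomp_map[OF ghom_idm gaf glinear_sndm flat_dsum[OF PA_flat N_flat] A_flat N_flat, of P] by simp

lemma rg_in:
  assumes "x \<in> grd (circ_lin P PA N) 0 d"
  shows "rg 0 d x \<in> grd L 0 d"
proof -
  note x = subsetD[OF circ_lin_sub assms]
  show ?thesis
    using glinearD(1)[OF rl1_lin x] glinearD(1)[OF rl2_lin x] by (intro gmodD(5)[OF gmod_circ_lin] mu_in) simp_all
qed

lemma R_in: "R n d \<subseteq> grd L n d"
  unfolding R_eq
proof (rule PM.span_minimal)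
  show "PM.subspace (grd L n d)" using gmodD(2)[OF gmod_circ_lin[of P A N]] by simp
  show "rg n d ` grd (circ_lin P PA N) n d \<subseteq> grd L n d"
  proof (cases "n = 0")
    case True thus ?thesis using rg_in by blast
  next
    case False
    hence "grd (circ_lin P PA N) n d = {0}" using flatD(2)[OF flat_circ_lin[OF PA_flat N_flat]] by simp
    thus ?thesis
      by (simp add: plinD(3)[OF plin_mu] plinD(3)[OF plin_lcomp_map] gmodD(3)[OF gmod_circ_lin])
  qed
qed

text \<open>The two maps of the coequalizer agree after extension: \<open>ext_mu\<close> evaluates
  the trees over \<open>A\<close> by \<open>\<gamma>A\<close>, and the unit put on the element of
  \<open>N\<close> is removed by \<open>ext_jj\<close>.\<close>

lemma ext_rg:
  assumes g: "glinear p N M g" and x: "x \<in> grd (circ_lin P PA N) 0 d"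
  shows "ext p g 0 d (rg 0 d x) = 0"
proof -
  note x' = subsetD[OF circ_lin_sub x]
  have g3: "glinear p (dsum PA N) M (g \<bullet>[0] sndm)" by (rule gsnd[OF g])
  hence g3': "glinear (0 + p) (dsum PA N) M (g \<bullet>[0] sndm)" by simp
  note fl = flat_dsum[OF PA_flat N_flat]
  have y: "lcomp_map P PA L 0 idm fstm 0 (jj \<bullet>[0] sndm) 0 d x \<in> grd (circ_lin P PA L) 0 d"
    using glinearD(1)[OF rl1_lin x'] by simp
  have z: "lcomp_map P A N 0 idm (\<gamma>A \<bullet>[0] fstm) 0 sndm 0 d x \<in> grd L 0 d"
    using glinearD(1)[OF rl2_lin x'] by simp
  have "lcomp_map P A M 0 idm (\<gamma>A \<bullet>[0] fstm) p (ext p g \<bullet>[0] sndm) 0 d (lcomp_map P PA L 0 idm fstm 0 (jj \<bullet>[0] sndm) 0 d x) =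
    lcomp_map P A M 0 idm (\<gamma>A \<bullet>[0] fstm) p (g \<bullet>[0] sndm) 0 d x"
    using lcomp_lcomp[OF ghom_idm[of P] glinear_fstm gsnd[OF jj_lin] \<gamma>A_lin ext_lin_L[OF g] gaf g3' fl PA_flat L_flat A_flat M_flat _ _ x']
      ext_jj[OF g] by (auto simp: gcomp_def sndm_def fstm_def)
  moreover have "lcomp_map P A M 0 idm fstm p (g \<bullet>[0] sndm) 0 d (lcomp_map P A N 0 idm (\<gamma>A \<bullet>[0] fstm) 0 sndm 0 d x) =
    lcomp_map P A M 0 idm (\<gamma>A \<bullet>[0] fstm) p (g \<bullet>[0] sndm) 0 d x"
    using lcomp_lcomp[OF ghom_idm[of P] gaf glinear_sndm glinear_idm g gaf g3' fl A_flat N_flat A_flat M_flat _ _ x']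
    by (auto simp: gcomp_def) (simp add: idm_def)
  ultimately have "ext p g 0 d (mu 0 d (lcomp_map P PA L 0 idm fstm 0 (jj \<bullet>[0] sndm) 0 d x)) =
      ext p g 0 d (lcomp_map P A N 0 idm (\<gamma>A \<bullet>[0] fstm) 0 sndm 0 d x)"
    unfolding ext_mu[OF g y] by (simp add: gcomp_def)
  thus ?thesis using glinear_diff[OF ext_lin_L[OF g] gmod_circ_lin M_gmod mu_in[OF y] z] by simp
qed

lemma ext_R:
  assumes g: "glinear p N M g" and x: "x \<in> R 0 d"
  shows "ext p g 0 d x = 0"
proof (rule span_map_eq[where f = "ext p g 0 d" and g = "\<lambda>x. 0" and s = "scl M", OF _ _ _ _ _ x[unfolded R_eq]])
  note in' = subsetD[OF R_in, unfolded R_eq]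
  show "ext p g 0 d (x + y) = ext p g 0 d x + ext p g 0 d y"
    if "x \<in> PM.span (rg 0 d ` grd (circ_lin P PA N) 0 d)" "y \<in> PM.span (rg 0 d ` grd (circ_lin P PA N) 0 d)" for x y
    using glinearD(2)[OF ext_lin_L[OF g] in'[OF that(1)] in'[OF that(2)]] .
  show "ext p g 0 d (psc c x) = scl M c (ext p g 0 d x)"
    if "x \<in> PM.span (rg 0 d ` grd (circ_lin P PA N) 0 d)" for c x
    using glinearD(3)[OF ext_lin_L[OF g] in'[OF that]] by simp
qed (auto simp: ext_rg[OF g] gmodD(9)[OF M_gmod])

lemma pr_eq: "pr n d = qproj psc (R n d)"
  by (simp add: tens_proj_def)

lemmas pr_props = PM.qproj_props[OF R_subspace, folded pr_eq]

lemma pr_plin: "plin (pr n d)"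
proof -
  interpret V: Vector_Spaces.linear psc psc "pr n d" by (rule pr_props(1))
  show ?thesis by (simp add: plin_def V.add V.scale)
qed

lemma T_simps: "grd T n d = pr n d ` grd L n d" "scl T = psc"
  "dif T n d x = pr n (d - 1) (dif (circ P X) n d x)" "act T n d \<sigma> x = pr n d (act L n d \<sigma> x)"
  by (simp_all add: tens_def quotient_def pr_eq circ_lin_def)

lemma pr_in_L: "y \<in> grd L n d \<Longrightarrow> pr n d y \<in> grd L n d"
  using gmodD(5)[OF gmod_circ_lin, of y P A N n d "y - pr n d y"] subsetD[OF R_in pr_props(2)[of y n d]] by simp

text \<open>The quotient is realised as a complement of the relations, so its elements lie in P(A,
  N) and the extension applies to them directly.\<close>

lemma T_sub: "grd T n d \<subseteq> grd L n d"
  unfolding T_simps using pr_in_L by blast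

lemma pr_in: "y \<in> grd L n d \<Longrightarrow> pr n d y \<in> grd T n d"
  by (simp add: T_simps)

lemma pr_pr: "pr n d (pr n d y) = pr n d y"
  using pr_props(3)[OF pr_props(2)[of y n d]] plinD(4)[OF pr_plin] by simp

lemma pr_T: "x \<in> grd T n d \<Longrightarrow> pr n d x = x"
  unfolding T_simps using pr_pr by auto

lemma T_flat: "flat T"
proof -
  have "PM.subspace (grd T n d)" for n d
  proof (rule PM.subspaceI)
    show "0 \<in> grd T n d" using pr_in[OF gmodD(3)[OF gmod_circ_lin]] by (simp add: plinD(3)[OF pr_plin])
    show "x + y \<in> grd T n d" if "x \<in> grd T n d" "y \<in> grd T n d" for x y
      using pr_in[OF gmodD(4)[OF gmod_circ_lin subsetD[OF T_sub that(1)] subsetD[OF T_sub that(2)]]] that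
      by (simp add: plinD(1)[OF pr_plin] pr_T)
    show "psc c x \<in> grd T n d" if "x \<in> grd T n d" for c x
      using pr_in[OF gmodD(6)[OF gmod_circ_lin subsetD[OF T_sub that], of c]] that
      by (simp add: plinD(2)[OF pr_plin] pr_T)
  qed
  hence f1: "gmod T" by (simp add: gmod_def T_simps(2) PM.vector_space_axioms)
  have f2: "grd T n d = {0}" if "n > 0" for n d
    using flatD(2)[OF L_flat that] T_sub[of n d] gmodD(3)[OF f1, of n d] by auto
  have f3: "act T 0 d id x = x" if "x \<in> grd T 0 d" for d x
    using flatD(3)[OF L_flat subsetD[OF T_sub that]] pr_T[OF that] by (simp add: T_simps(4))
  have f4: "act T n d \<sigma> 0 = 0" if "\<sigma> permutes {..<n}" for n d \<sigma>
    using flatD(4)[OF L_flat that] by (simp add: T_simps(4) plinD(3)[OF pr_plin])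
  show ?thesis
    unfolding flat_def by (intro conjI allI ballI impI) (rule f1, erule f2, erule f3, erule f4)
qed

lemmas T_gmod = flatD(1)[OF T_flat]

lemma ext_pr:
  assumes g: "glinear p N M g" and y: "y \<in> grd L 0 d"
  shows "ext p g 0 d (pr 0 d y) = ext p g 0 d y"
  using ext_R[OF g pr_props(2)[of y 0 d]] glinear_diff[OF ext_lin_L[OF g] gmod_circ_lin M_gmod y pr_in_L[OF y]] by simp

lemma ext_lin_T: "glinear p N M g \<Longrightarrow> glinear p T M (ext p g)"
  by (rule glinear_sub[OF ext_lin_L]) (simp_all add: T_sub T_simps(2))

lemma snd_T: "glinear 0 (dsum W T) L sndm"
  by (rule glinear_super[OF glinear_sndm]) (simp_all add: T_sub T_simps(2))

abbreviation "tlift \<equiv> lcomp_map P PA L 0 idm (iota P \<eta> A \<bullet>[0] fstm) 0 sndm"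

lemma tact_eq: "tact n d x = pr n d (mu n d (tlift n d x))"
  by (simp add: tens_act_def gcomp_def)

lemma tlift_lin: "glinear 0 (circ P (dsum A T)) (circ_lin P PA L) tlift"
  using glinear_lcomp_map[OF ghom_idm afst[OF glinear_iota[OF A_gmod]] snd_T flat_dsum[OF A_flat T_flat] PA_flat L_flat, of P] by simp

lemma tlift_in: "x \<in> grd (circ_lin P A T) 0 d \<Longrightarrow> tlift 0 d x \<in> grd (circ_lin P PA L) 0 d"
  using glinearD(1)[OF tlift_lin subsetD[OF circ_lin_sub]] by simp

lemma tact_in: "x \<in> grd (circ_lin P A T) 0 d \<Longrightarrow> tact 0 d x \<in> grd T 0 d"
  unfolding tact_eq by (intro pr_in mu_in tlift_in)

lemma \<gamma>A_iota: "a \<in> grd A 0 d \<Longrightarrow> \<gamma>A 0 d (iota P \<eta> A 0 d a) = a"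
  using A by (simp add: palgebra_def eq_on_def gcomp_def) (simp add: idm_def)

text \<open>The projection disappears because the extension kills the relations;
  \<open>ext_mu\<close> evaluates the product; the units put on the leaves in \<open>A\<close> are
  removed by the unit axiom of \<open>A\<close>.\<close>

lemma ext_tact:
  assumes g: "glinear p N M g" and x: "x \<in> grd (circ_lin P A T) 0 d"
  shows "ext p g 0 d (tact 0 d x) = \<gamma>M 0 (d + p) (lcomp_map P A M 0 idm fstm p (ext p g \<bullet>[0] sndm) 0 d x)"
proof -
  have e: "glinear p (dsum A T) M (ext p g \<bullet>[0] sndm)" using glinear_gcomp[OF glinear_sndm[of A T] ext_lin_T[OF g]] by simp
  hence e': "glinear (0 + p) (dsum A T) M (ext p g \<bullet>[0] sndm)" by simp
  have "lcomp_map P A M 0 idm (\<gamma>A \<bullet>[0] fstm) p (ext p g \<bullet>[0] sndm) 0 d (tlift 0 d x) =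
      lcomp_map P A M 0 idm fstm p (ext p g \<bullet>[0] sndm) 0 d x"
    using lcomp_lcomp[OF ghom_idm[of P] afst[OF glinear_iota[OF A_gmod]] snd_T \<gamma>A_lin ext_lin_L[OF g] glinear_fstm e'
        flat_dsum[OF A_flat T_flat] PA_flat L_flat A_flat M_flat _ _ subsetD[OF circ_lin_sub x]] \<gamma>A_iota
    by (auto simp: gcomp_def fstm_def)
  thus ?thesis
    unfolding tact_eq ext_pr[OF g mu_in[OF tlift_in[OF x]]] ext_mu[OF g tlift_in[OF x]] by simp
qed

section \<open>Stability of the relations of the free module under grafting\<close>

abbreviation "FX \<equiv> circ P X"
abbreviation "\<iota>X \<equiv> iota P \<eta> X"
abbreviation "\<iota>A \<equiv> iota P \<eta> A"
abbreviation "ial \<equiv> aleaf (\<iota>X \<bullet>[0] inlm)"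
abbreviation "\<kappa>A \<equiv> comp_map P X 0 idm inlm"

lemmas FX_flat = flat_circ[OF X_flat, of P]

abbreviation "ialeaf xs \<equiv> leaves0 A xs"

text \<open>The composite of \<open>r\<close> with \<open>u\<close>, of arity \<open>n\<close>, in position \<open>k\<close> and with units elsewhere.\<close>

definition gmid :: "int \<times> 'p \<Rightarrow> nat \<Rightarrow> int \<times> 'p \<Rightarrow> nat \<Rightarrow> nat \<Rightarrow> 'p" where
  "gmid r k u n l = gam P \<gamma> r (replicate k ((0, \<eta>1), [([], 0, 0 :: 'p)]) @ (u, replicate n ([], 0, 0)) # replicate l ((0, \<eta>1), [([], 0, 0)]))"

text \<open>Leaves in \<open>A\<close> padded by units: grafting one tree in a single position
  becomes grafting a whole row.\<close>

definition utl :: "(nat list \<times> int \<times> 'a) list \<Rightarrow> ('p, ('p, 'a \<times> 'n) tree \<Rightarrow>\<^sub>0 'k) tree list" where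
  "utl xs = map (\<lambda>(s, e, a). ((0, \<eta>1), [([], e, \<iota>X 0 e (a, 0))])) xs"

lemma utl_facts [simp]:
  "rdeg (utl xs) = 0" "ldeg (utl xs) = degs xs" "aexp (utl xs) = 0" "length (utl xs) = length xs"
  by (induction xs) (auto simp: utl_def)

lemma utl_concat: "ialeaf xs \<Longrightarrow> concat (map snd (utl xs)) = ial xs"
  by (induction xs) (auto simp: utl_def gcomp_def inlm_def)

text \<open>\<open>free_mult_graft\<close> for a row that is trivial except at \<open>U\<close>; the
  sign comes from moving the root of \<open>U\<close> past the leaves \<open>xs\<close>. The new
  root depends on \<open>U\<close> only through its root and its number of leaves, so the two sides
  of a relation can be grafted with the same result at the root.\<close>

lemma root_graft:
  assumes xs: "ialeaf xs" "ialeaf ys" and m: "m \<in> grd P (Suc (length xs + length ys)) p"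
    and U: "U = ((q, \<mu>), ws)" "U \<in> utrees P FX" and d: "d = p + degs xs + tdeg U + degs ys"
  defines "gm \<equiv> gmid (p, m) (length xs) (q, \<mu>) (length ws) (length ys)"
  shows "free_mult P \<gamma> X 0 d (cls P FX 0 d ((p, m), ial xs @ ([], tdeg U, free_mult P \<gamma> X 0 (tdeg U) (cls P FX 0 (tdeg U) U)) # ial ys)) =
      psc ((-1) powi (degs xs * q)) (free_mult P \<gamma> X 0 d (cls P FX 0 d ((p + q, gm), ial xs @ ws @ ial ys)))" (is ?g1)
    and "((p + q, gm), ial xs @ ws @ ial ys) \<in> trees P FX 0 d"
proof -
  define Us where "Us = utl xs @ U # utl ys"
  have ax: "(a, 0) \<in> grd X 0 e" if "a \<in> grd A 0 e" for a e using that gmodD(3)[OF N_gmod] by simp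
  have ut: "set (utl zs) \<subseteq> utrees P FX" if "ialeaf zs" for zs
    using that \<eta>1_in by (auto simp: utl_def utrees_eq intro!: iota_in ax)
  have Ust: "set Us \<subseteq> utrees P FX" using ut[OF xs(1)] ut[OF xs(2)] U(2) by (simp add: Us_def)
  have mU: "m \<in> grd P (length Us) p" using m by (simp add: Us_def)
  have rd: "rdeg Us = q" and ae: "aexp Us = degs xs * q" by (simp_all add: Us_def U(1))
  have D: "d = p + (rdeg Us + ldeg Us)" by (simp add: d Us_def U(1))
  have fm: "map (\<lambda>U. ([], tdeg U, free_mult P \<gamma> X 0 (tdeg U) (cls P FX 0 (tdeg U) U))) (utl zs) = ial zs" if "ialeaf zs" for zs
    using that
  proof (induction zs)
    case (Cons z zs)
    obtain e a where z: "z = ([], e, a)" "a \<in> grd A 0 e" using Cons.prems by (cases z) auto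
    have "free_mult P \<gamma> X 0 e (iota P \<eta> FX 0 e (\<iota>X 0 e (a, 0))) = \<iota>X 0 e (a, 0)"
      by (rule free_mult_iota[OF X_flat iota_in[OF ax[OF z(2)]]])
    hence "free_mult P \<gamma> X 0 e (cls P FX 0 e ((0, \<eta>1), [([], e, \<iota>X 0 e (a, 0))])) = \<iota>X 0 e (a, 0)"
      by (simp only: iota[of FX] upt_0)
    moreover have "ialeaf zs" using Cons.prems by simp
    ultimately show ?case using Cons.IH z(1) by (simp add: utl_def gcomp_def inlm_def)
  qed (simp add: utl_def)
  have cm: "concat (map snd Us) = ial xs @ ws @ ial ys"
    by (simp add: Us_def U(1) utl_concat[OF xs(1)] utl_concat[OF xs(2)])
  have rl: "map (\<lambda>u. (fst u, length (snd u))) (utl zs) = replicate (length zs) ((0, \<eta>1), 1)" for zs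
    by (induction zs) (auto simp: utl_def)
  have gm: "gam P \<gamma> (p, m) Us = gm"
    unfolding gm_def gmid_def Us_def U(1) by (rule conjunct1[OF gam_cong]) (simp add: rl)
  show "((p + q, gm), ial xs @ ws @ ial ys) \<in> trees P FX 0 d"
    using graft_trees[OF mU Ust D] unfolding rd gm cm .
  show ?g1
    using free_mult_graft[OF X_flat mU Ust D] unfolding rd gm cm ae by (simp add: Us_def fm[OF xs(1)] fm[OF xs(2)])
qed

lemma kA_iota: "a \<in> grd A 0 e \<Longrightarrow> \<kappa>A 0 e (\<iota>A 0 e a) = (\<iota>X \<bullet>[0] inlm) 0 e a"
  unfolding gcomp_def iota comp_map_cls[OF ghom_idm inlm_ghom[OF N_flat]]
  by (simp add: ctree_aleaf) (simp add: inlm_def, simp add: idm_def)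

lemma kA_ial: "ialeaf xs \<Longrightarrow> aleaf \<kappa>A (aleaf \<iota>A xs) = ial xs"
  by (rule aleaf_aleaf[of _ A], assumption, rule kA_iota[symmetric])

lemma ial_injl: "ial xs = aleaf \<iota>X (injl xs)"
  by (induction xs) (auto simp: gcomp_def inlm_def)

lemma gA_iota: "ialeaf xs \<Longrightarrow> aleaf \<gamma>A (aleaf \<iota>A xs) = xs"
  using aleaf_aleaf[of xs A idm \<gamma>A \<iota>A] by (simp add: \<gamma>A_iota) (simp add: \<gamma>A_iota idm_def)

lemma free_mult_iotas_cls:
  assumes t: "((p, m), zs) \<in> trees P X 0 d"
  shows "free_mult P \<gamma> X 0 d (cls P FX 0 d ((p, m), aleaf \<iota>X zs)) = cls P X 0 d ((p, m), zs)"
proof -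
  have "ghom 0 X FX \<iota>X" by (rule flat_ghom[OF X_flat FX_flat glinear_iota[OF X_gmod]])
  from comp_map_cls[OF ghom_idm[of P] this, of 0 d "((p, m), zs)"] free_mult_iotas[OF X_flat cls_in_circ[OF t]]
  show ?thesis by (simp add: ctree_aleaf) (simp add: idm_def)
qed

text \<open>The action on the free module before projection: \<open>m\<close> applied to elements
  \<open>xs\<close> and \<open>ys\<close> of \<open>A\<close> and to an element \<open>r\<close> of
  P(A, N).\<close>

abbreviation "om d p m xs e ys r \<equiv> mu 0 d (cls P (dsum PA L) 0 d ((p, m), linl (aleaf \<iota>A xs) e r (aleaf \<iota>A ys)))"

lemma om_eq:
  assumes "ialeaf xs" "ialeaf ys"
  shows "om d p m xs e ys r = free_mult P \<gamma> X 0 d (cls P FX 0 d ((p, m), ial xs @ ([], e, r) # ial ys))"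
  unfolding lmult_linl[OF N_flat] kA_ial[OF assms(1)] kA_ial[OF assms(2)] ..

lemma iA_leaves: "ialeaf xs \<Longrightarrow> leaves0 PA (aleaf \<iota>A xs)"
  by (auto simp: aleaf_def intro!: iota_in)

lemma om_tree:
  assumes "ialeaf xs" "ialeaf ys" "m \<in> grd P (Suc (length xs + length ys)) p" "d = p + degs xs + e + degs ys" "r \<in> grd L 0 e"
  shows "((p, m), linl (aleaf \<iota>A xs) e r (aleaf \<iota>A ys)) \<in> trees P (dsum PA L) 0 d"
  using assms iA_leaves[OF assms(1)] iA_leaves[OF assms(2)]
  unfolding linl_trees[OF gmod_circ gmod_circ_lin] by (simp add: ball_Un)

lemma om_lin:
  assumes a: "ialeaf xs" "ialeaf ys" "m \<in> grd P (Suc (length xs + length ys)) p" "d = p + degs xs + e + degs ys"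
    and r: "r \<in> grd L 0 e"
  shows "r' \<in> grd L 0 e \<Longrightarrow> om d p m xs e ys (r + r') = om d p m xs e ys r + om d p m xs e ys r'"
    and "om d p m xs e ys (psc c r) = psc c (om d p m xs e ys r)"
  using linl_add[OF gmod_circ gmod_circ_lin om_tree[OF a r], of r'] linl_scl[OF gmod_circ gmod_circ_lin om_tree[OF a r], of c]
  by (simp_all add: plinD(1,2)[OF plin_mu])

text \<open>The module action is computed on representatives, so relations must be sent to
  relations. Grafting a generating relation into the distinguished leaf gives, up to sign, another
  generating relation: both of its sides acquire the same root \<open>gm\<close>, and the
  surrounding elements of \<open>A\<close> are carried along unchanged.\<close>

lemma om_rg_gen:
  assumes a: "ialeaf xs" "ialeaf ys" "m \<in> grd P (Suc (length xs + length ys)) p" "d = p + degs xs + e + degs ys"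
    and t: "((q, \<mu>), linl zs e' c zs') \<in> trees P (dsum PA N) 0 e"
  shows "om d p m xs e ys (rg 0 e (cls P (dsum PA N) 0 e ((q, \<mu>), linl zs e' c zs'))) \<in> R 0 d"
proof -
  note t' = t[unfolded linl_trees[OF gmod_circ N_gmod]]
  have c: "c \<in> grd N 0 e'" and jc: "jj 0 e' c \<in> grd L 0 e'" using t' jj_in by simp_all
  have zl: "leaves0 PA zs" "leaves0 PA zs'"
    using t' by (auto simp: ball_Un)
  have gl: "ialeaf (aleaf \<gamma>A us)" if "leaves0 PA us" for us
    using that glinearD(1)[OF \<gamma>A_lin, of _ 0] by (fastforce simp: aleaf_def)
  define U1 where "U1 = ((q, \<mu>), aleaf \<kappa>A zs @ ([], e', jj 0 e' c) # aleaf \<kappa>A zs')"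
  define U2 where "U2 = ((q, \<mu>), aleaf \<iota>X (linl (aleaf \<gamma>A zs) e' c (aleaf \<gamma>A zs')))"
  define n where "n = Suc (length zs + length zs')"
  define gm where "gm = gmid (p, m) (length xs) (q, \<mu>) n (length ys)"
  \<comment> \<open>The element of P(P(A), N) whose relation is the grafted one. The outer leaves
    \<open>xs\<close> and \<open>ys\<close> enter as generators of P(A), on which composing by
    \<open>\<gamma>\<close> and evaluating by \<open>\<gamma>A\<close> are both harmless.\<close>
  define z' where "z' = cls P (dsum PA N) 0 d ((p + q, gm), linl (aleaf \<iota>A xs @ zs) e' c (zs' @ aleaf \<iota>A ys))"
  have kl: "leaves0 FX (aleaf \<kappa>A us)" if "leaves0 PA us" for us
    using that glinearD(1)[OF glinear_comp_map[OF ghom_idm[of P] inlm_ghom[OF N_flat]], of _ 0] by (fastforce simp: aleaf_def)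
  have t2: "((q, \<mu>), linl (aleaf \<gamma>A zs) e' c (aleaf \<gamma>A zs')) \<in> trees P X 0 e"
    using t' gl[OF zl(1)] gl[OF zl(2)] unfolding linl_trees[OF A_gmod N_gmod] by (simp add: ball_Un)
  have U1t: "U1 \<in> trees P FX 0 e"
    using t' kl[OF zl(1)] kl[OF zl(2)] subsetD[OF circ_lin_sub jc] by (simp add: U1_def trees_0_iff ball_Un)
  have U2t: "U2 \<in> trees P FX 0 e"
    using ctree_trees[OF t2 glinear_idm[of P] glinear_iota[OF X_gmod]] by (simp add: U2_def ctree_aleaf) (simp add: idm_def)
  have td: "tdeg U1 = e" "tdeg U2 = e" using trees_tdeg[OF U1t] trees_tdeg[OF U2t] by auto
  have U: "U1 \<in> utrees P FX" "U2 \<in> utrees P FX" using U1t U2t td by (simp_all add: utrees_iff)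
  have D: "d = p + degs xs + tdeg U1 + degs ys" "d = p + degs xs + tdeg U2 + degs ys" using a(4) td by simp_all
  have l1: "lcomp_map P PA L 0 idm fstm 0 (jj \<bullet>[0] sndm) 0 e (cls P (dsum PA N) 0 e ((q, \<mu>), linl zs e' c zs')) =
      cls P (dsum PA L) 0 e ((q, \<mu>), linl zs e' (jj 0 e' c) zs')"
    using lcomp_lin[OF ghom_idm[of P] glinear_idm[of PA] jj_lin PA_flat N_flat PA_flat L_flat t] by simp (simp add: idm_def)
  have l2: "lcomp_map P A N 0 idm (\<gamma>A \<bullet>[0] fstm) 0 sndm 0 e (cls P (dsum PA N) 0 e ((q, \<mu>), linl zs e' c zs')) =
      cls P X 0 e ((q, \<mu>), linl (aleaf \<gamma>A zs) e' c (aleaf \<gamma>A zs'))"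
    using lcomp_lin[OF ghom_idm[of P] \<gamma>A_lin glinear_idm[of N] PA_flat N_flat A_flat N_flat t] by simp (simp add: idm_def)
  have r: "rg 0 e (cls P (dsum PA N) 0 e ((q, \<mu>), linl zs e' c zs')) =
      free_mult P \<gamma> X 0 e (cls P FX 0 e U1) - free_mult P \<gamma> X 0 e (cls P FX 0 e U2)"
    unfolding l1 l2 lmult_linl[OF N_flat] U1_def U2_def free_mult_iotas_cls[OF t2] ..
  note g1 = root_graft[OF a(1-3) U1_def U(1) D(1)] and g2 = root_graft[OF a(1-3) U2_def U(2) D(2)]
  have n1: "length (aleaf \<kappa>A zs @ ([], e', jj 0 e' c) # aleaf \<kappa>A zs') = n"
    and n2: "length (aleaf \<iota>X (linl (aleaf \<gamma>A zs) e' c (aleaf \<gamma>A zs'))) = n" by (simp_all add: n_def)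
  note g1 = g1[unfolded n1, folded gm_def] and g2 = g2[unfolded n2, folded gm_def]
  have gmt: "gm \<in> grd P (Suc (length (aleaf \<iota>A xs @ zs) + length (zs' @ aleaf \<iota>A ys))) (p + q)"
    using g1(2) unfolding trees_0_iff by (simp add: add.assoc)
  have dd: "p + q + degs (aleaf \<iota>A xs @ zs) + e' + degs (zs' @ aleaf \<iota>A ys) = d" using a(4) t' by simp
  have tz: "((p + q, gm), linl (aleaf \<iota>A xs @ zs) e' c (zs' @ aleaf \<iota>A ys)) \<in> trees P (dsum PA N) 0 d"
    using gmt dd c zl iA_leaves[OF a(1)] iA_leaves[OF a(2)] unfolding linl_trees[OF gmod_circ N_gmod] by (simp add: ball_Un)
  have tx: "((p + q, gm), linl (xs @ aleaf \<gamma>A zs) e' c (aleaf \<gamma>A zs' @ ys)) \<in> trees P X 0 d"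
    using gmt dd c gl[OF zl(1)] gl[OF zl(2)] a(1,2) unfolding linl_trees[OF A_gmod N_gmod] by (simp add: ball_Un)
  have z1: "lcomp_map P PA L 0 idm fstm 0 (jj \<bullet>[0] sndm) 0 d z' =
      cls P (dsum PA L) 0 d ((p + q, gm), linl (aleaf \<iota>A xs @ zs) e' (jj 0 e' c) (zs' @ aleaf \<iota>A ys))"
    unfolding z'_def using lcomp_lin[OF ghom_idm[of P] glinear_idm[of PA] jj_lin PA_flat N_flat PA_flat L_flat tz]
    by simp (simp add: idm_def)
  have z2: "lcomp_map P A N 0 idm (\<gamma>A \<bullet>[0] fstm) 0 sndm 0 d z' =
      cls P X 0 d ((p + q, gm), linl (xs @ aleaf \<gamma>A zs) e' c (aleaf \<gamma>A zs' @ ys))"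
    unfolding z'_def using lcomp_lin[OF ghom_idm[of P] \<gamma>A_lin glinear_idm[of N] PA_flat N_flat A_flat N_flat tz]
    by (simp add: gA_iota[OF a(1)] gA_iota[OF a(2)]) (simp add: idm_def)
  have o1: "om d p m xs e ys (free_mult P \<gamma> X 0 e (cls P FX 0 e U1)) =
      psc ((-1) powi (degs xs * q)) (mu 0 d (lcomp_map P PA L 0 idm fstm 0 (jj \<bullet>[0] sndm) 0 d z'))"
    unfolding om_eq[OF a(1,2)] z1 lmult_linl[OF N_flat] using g1(1) by (simp add: td kA_ial[OF a(1)] kA_ial[OF a(2)])
  have "ial xs @ aleaf \<iota>X (linl (aleaf \<gamma>A zs) e' c (aleaf \<gamma>A zs')) @ ial ys =
      aleaf \<iota>X (linl (xs @ aleaf \<gamma>A zs) e' c (aleaf \<gamma>A zs' @ ys))" by (simp add: ial_injl linl_def)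
  hence o2: "om d p m xs e ys (free_mult P \<gamma> X 0 e (cls P FX 0 e U2)) =
      psc ((-1) powi (degs xs * q)) (lcomp_map P A N 0 idm (\<gamma>A \<bullet>[0] fstm) 0 sndm 0 d z')"
    unfolding om_eq[OF a(1,2)] z2 using g2(1) free_mult_iotas_cls[OF tx] by (simp add: td)
  have zin: "z' \<in> grd (circ_lin P PA N) 0 d" unfolding z'_def by (rule cls_in_circ_lin[OF tz lin_tree_linl])
  have v2: "free_mult P \<gamma> X 0 e (cls P FX 0 e U2) \<in> grd L 0 e"
    unfolding U2_def free_mult_iotas_cls[OF t2] by (rule cls_in_circ_lin[OF t2 lin_tree_linl])
  have rin: "rg 0 e (cls P (dsum PA N) 0 e ((q, \<mu>), linl zs e' c zs')) \<in> grd L 0 e"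
    by (rule rg_in[OF cls_in_circ_lin[OF t lin_tree_linl]])
  have v1: "free_mult P \<gamma> X 0 e (cls P FX 0 e U1) \<in> grd L 0 e"
    using gmodD(4)[OF gmod_circ_lin rin v2] unfolding r by simp
  have v2': "psc (-1) (free_mult P \<gamma> X 0 e (cls P FX 0 e U2)) \<in> grd L 0 e"
    using gmodD(6)[OF gmod_circ_lin v2, of "-1"] by (simp only: scl_circ_lin)
  have s: "u - v = u + psc (-1) v" for u v :: "('p, 'a \<times> 'n) tree \<Rightarrow>\<^sub>0 'k" by simp
  have "om d p m xs e ys (free_mult P \<gamma> X 0 e (cls P FX 0 e U1) - free_mult P \<gamma> X 0 e (cls P FX 0 e U2)) =
      om d p m xs e ys (free_mult P \<gamma> X 0 e (cls P FX 0 e U1)) - om d p m xs e ys (free_mult P \<gamma> X 0 e (cls P FX 0 e U2))"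
    unfolding s om_lin(1)[OF a v1 v2'] om_lin(2)[OF a v2] ..
  also have "\<dots> = psc ((-1) powi (degs xs * q)) (rg 0 d z')"
    unfolding o1 o2 by (simp add: PM.scale_right_diff_distrib)
  also have "\<dots> \<in> R 0 d"
    by (rule PM.subspace_scale[OF R_subspace]) (use zin in \<open>auto simp: R_eq intro: PM.span_base\<close>)
  finally show ?thesis unfolding r .
qed

lemma om_R:
  assumes a: "ialeaf xs" "ialeaf ys" "m \<in> grd P (Suc (length xs + length ys)) p" "d = p + degs xs + e + degs ys"
    and r: "r \<in> R 0 e"
  shows "om d p m xs e ys r \<in> R 0 d"
proof (rule span_map_in[OF R_subspace PM.vector_space_axioms _ _ _ r[unfolded R_eq]])
  note in' = subsetD[OF R_in, unfolded R_eq]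
  show "om d p m xs e ys (x + y) = om d p m xs e ys x + om d p m xs e ys y"
    if "x \<in> PM.span (rg 0 e ` grd (circ_lin P PA N) 0 e)" "y \<in> PM.span (rg 0 e ` grd (circ_lin P PA N) 0 e)" for x y
    by (rule om_lin(1)[OF a in'[OF that(1)] in'[OF that(2)]])
  show "om d p m xs e ys (psc c x) = psc c (om d p m xs e ys x)"
    if "x \<in> PM.span (rg 0 e ` grd (circ_lin P PA N) 0 e)" for c x
    by (rule om_lin(2)[OF a in'[OF that]])
  fix r assume "r \<in> rg 0 e ` grd (circ_lin P PA N) 0 e"
  then obtain z where z: "r = rg 0 e z" "z \<in> grd (circ_lin P PA N) 0 e" by blast
  have rp: "rg 0 e (x + y) = rg 0 e x + rg 0 e y" "rg 0 e (psc c x) = psc c (rg 0 e x)" for x y c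
    by (simp_all add: plinD(1,2)[OF plin_mu] plinD(1,2)[OF plin_lcomp_map] PM.scale_right_diff_distrib)
  show "om d p m xs e ys r \<in> R 0 d"
    unfolding z(1)
  proof (rule span_map_in[OF R_subspace PM.vector_space_axioms _ _ _ z(2)[unfolded circ_lin_gen[OF gmod_circ N_gmod]]])
    note ri = rg_in[unfolded circ_lin_gen[OF gmod_circ N_gmod]]
    fix x y c assume x: "x \<in> PM.span (cls P (dsum PA N) 0 e `
      {((p, m), linl xs e1 y ys) | p m xs e1 y ys. ((p, m), linl xs e1 y ys) \<in> trees P (dsum PA N) 0 e})"
    have xi: "rg 0 e x \<in> grd L 0 e" by (rule rg_in) (use x in \<open>simp add: circ_lin_gen[OF gmod_circ N_gmod]\<close>)
    show "om d p m xs e ys (rg 0 e (psc c x)) = psc c (om d p m xs e ys (rg 0 e x))"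
      unfolding rp by (rule om_lin(2)[OF a xi])
    assume y: "y \<in> PM.span (cls P (dsum PA N) 0 e `
      {((p, m), linl xs e1 y ys) | p m xs e1 y ys. ((p, m), linl xs e1 y ys) \<in> trees P (dsum PA N) 0 e})"
    have yi: "rg 0 e y \<in> grd L 0 e" by (rule rg_in) (use y in \<open>simp add: circ_lin_gen[OF gmod_circ N_gmod]\<close>)
    show "om d p m xs e ys (rg 0 e (x + y)) = om d p m xs e ys (rg 0 e x) + om d p m xs e ys (rg 0 e y)"
      unfolding rp by (rule om_lin(1)[OF a xi yi])
  qed (auto intro!: om_rg_gen[OF a])
qed

text \<open>The class of a tree is its root acting on the class of its leaf in \<open>N\<close>;
  hence the free module is generated by \<open>N\<close>. Passing from the generator to its
  projection changes it by a relation, and \<open>om_R\<close> shows that the action does not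
  notice.\<close>

lemma tact_gen:
  assumes t: "((p, m), linl xs e c ys) \<in> trees P X 0 d"
  shows "tact 0 d (cls P (dsum A T) 0 d ((p, m), linl xs e (pr 0 e (jj 0 e c)) ys)) = pr 0 d (cls P X 0 d ((p, m), linl xs e c ys))" (is ?g1)
    and "((p, m), linl xs e (pr 0 e (jj 0 e c)) ys) \<in> trees P (dsum A T) 0 d"
proof -
  note t' = t[unfolded linl_trees[OF A_gmod N_gmod]]
  have a: "ialeaf xs" "ialeaf ys" "m \<in> grd P (Suc (length xs + length ys)) p" "d = p + degs xs + e + degs ys"
    using t' by (auto simp: ball_Un)
  have jc: "jj 0 e c \<in> grd L 0 e" using t' jj_in by simp
  show tT: "((p, m), linl xs e (pr 0 e (jj 0 e c)) ys) \<in> trees P (dsum A T) 0 d"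
    using t' pr_in[OF jc] unfolding linl_trees[OF A_gmod T_gmod] by simp
  define r where "r = jj 0 e c - pr 0 e (jj 0 e c)"
  have r: "r \<in> R 0 e" unfolding r_def by (rule pr_props(2))
  have rL: "r \<in> grd L 0 e" by (rule subsetD[OF R_in r])
  have "om d p m xs e ys (pr 0 e (jj 0 e c) + r) = om d p m xs e ys (pr 0 e (jj 0 e c)) + om d p m xs e ys r"
    by (rule om_lin(1)[OF a pr_in_L[OF jc] rL])
  hence "pr 0 d (om d p m xs e ys (jj 0 e c)) = pr 0 d (om d p m xs e ys (pr 0 e (jj 0 e c)))"
    using pr_props(3)[OF om_R[OF a r]] by (simp add: r_def plinD(1)[OF pr_plin])
  moreover have "ial xs @ ([], e, jj 0 e c) # ial ys = aleaf \<iota>X (linl xs e c ys)"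
    by (simp add: ial_injl linl_def) (simp add: gcomp_def inrm_def)
  hence "om d p m xs e ys (jj 0 e c) = cls P X 0 d ((p, m), linl xs e c ys)"
    unfolding om_eq[OF a(1,2)] using free_mult_iotas_cls[OF t] by simp
  moreover have "tlift 0 d (cls P (dsum A T) 0 d ((p, m), linl xs e (pr 0 e (jj 0 e c)) ys)) =
      cls P (dsum PA L) 0 d ((p, m), linl (aleaf \<iota>A xs) e (pr 0 e (jj 0 e c)) (aleaf \<iota>A ys))"
  proof -
    have "glinear 0 T L idm" by (rule glinear_super[OF glinear_idm]) (simp_all add: T_sub T_simps(2))
    from lcomp_lin[OF ghom_idm[of P] glinear_iota[OF A_gmod] this A_flat T_flat PA_flat L_flat tT]
    show ?thesis by simp (simp add: idm_def)
  qed
  ultimately show ?g1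
    unfolding tact_eq by simp
qed

definition alin :: "int \<Rightarrow> (('p, 'a \<times> 'n) tree \<Rightarrow>\<^sub>0 'k, 'm) gmap \<Rightarrow> bool" where
  "alin p h \<longleftrightarrow> (\<forall>d. \<forall>x\<in>grd (circ_lin P A T) 0 d.
     h 0 d (tact 0 d x) = \<gamma>M 0 (d + p) (lcomp_map P A M 0 idm fstm p (h \<bullet>[0] sndm) 0 d x))"

abbreviation "gen h \<equiv> h \<bullet>[0] pr \<bullet>[0] jj"

lemma pr_lin: "glinear 0 L T pr"
proof (rule flat_glinearI[OF L_flat T_flat])
  show "pr 0 d x \<in> grd T 0 (d + 0)" if "x \<in> grd L 0 d" for d x using pr_in[OF that] by simp
qed (simp_all add: plinD[OF pr_plin] T_simps(2))

lemma gen_lin: "glinear p T M h \<Longrightarrow> glinear p N M (gen h)"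
  using glinear_gcomp[OF glinear_gcomp[OF jj_lin pr_lin], of p M h] by simp

text \<open>By \<open>tact_gen\<close> every element is a combination of actions on classes of
  generators, and linearity over \<open>A\<close> evaluates \<open>h\<close> there exactly as the
  extension does.\<close>

lemma alin_eq:
  assumes h: "glinear p T M h" "alin p h" and x: "x \<in> grd T 0 d"
  shows "h 0 d x = ext p (gen h) 0 d x"
proof -
  note g = gen_lin[OF h(1)]
  have hl: "glinear p L M (h \<bullet>[0] pr)" using glinear_gcomp[OF pr_lin h(1)] by simp
  have "(h \<bullet>[0] pr) 0 d x = ext p (gen h) 0 d x"
  proof (rule glinear_span_eq[OF hl ext_lin_L[OF g] _ circ_lin_gen[OF A_gmod N_gmod] _ subsetD[OF T_sub x]])
    fix z assume "z \<in> cls P X 0 d ` {((p, m), linl xs e y ys) | p m xs e y ys. ((p, m), linl xs e y ys) \<in> trees P X 0 d}"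
    then obtain q m xs e y ys where z: "z = cls P X 0 d ((q, m), linl xs e y ys)"
      and t: "((q, m), linl xs e y ys) \<in> trees P X 0 d" by auto
    let ?w = "cls P (dsum A T) 0 d ((q, m), linl xs e (pr 0 e (jj 0 e y)) ys)"
    note tg = tact_gen[OF t]
    have y: "y \<in> grd N 0 e" using t by (simp add: linl_trees[OF A_gmod N_gmod])
    have hy: "gen h 0 e y = h 0 e (pr 0 e (jj 0 e y))" by (simp add: gcomp_def)
    have tM: "((q, m), linl xs (e + p) (gen h 0 e y) ys) \<in> trees P (dsum A M) 0 (d + p)"
      using t glinearD(1)[OF g y] unfolding linl_trees[OF A_gmod N_gmod] linl_trees[OF A_gmod M_gmod] by simp
    have "lcomp_map P A M 0 idm fstm p (h \<bullet>[0] sndm) 0 d ?w = psc ((-1) powi (p * (q + degs xs)))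
        (cls P (dsum A M) 0 (d + p) ((q, m), linl xs (e + p) (gen h 0 e y) ys))"
      using lcomp_lin[OF ghom_idm[of P] glinear_idm[of A] h(1) A_flat T_flat A_flat M_flat tg(2)] unfolding hy
      by simp (simp add: idm_def)
    moreover have "h 0 d (tact 0 d ?w) = \<gamma>M 0 (d + p) (lcomp_map P A M 0 idm fstm p (h \<bullet>[0] sndm) 0 d ?w)"
      using h(2) cls_in_circ_lin[OF tg(2) lin_tree_linl] unfolding alin_def by blast
    ultimately have "h 0 d (pr 0 d z) = scl M ((-1) powi (p * (q + degs xs)))
        (\<gamma>M 0 (d + p) (cls P (dsum A M) 0 (d + p) ((q, m), linl xs (e + p) (gen h 0 e y) ys)))"
      unfolding tg(1) z using \<gamma>M_psc[OF cls_in_circ_lin[OF tM lin_tree_linl]] by simp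
    thus "(h \<bullet>[0] pr) 0 d z = ext p (gen h) 0 d z"
      unfolding z ext_linl[OF g t] by (simp add: gcomp_def)
  qed simp
  thus ?thesis using pr_T[OF x] by (simp add: gcomp_def)
qed

end

section \<open>The twisted differential on the free module over C\<close>

sublocale qfr \<subseteq> fmd P \<gamma> \<eta> A \<gamma>A M \<gamma>M C
  by unfold_locales (rule C_flat)

lemma lin_tree_map:
  fixes f :: "('n::zero \<times> 'l::zero, 'n \<times> 'l) gmap"
  assumes "lin_tree (r, xs)" "length ys = length xs"
    and "\<And>i. i < length xs \<Longrightarrow> (fst (snd (snd (xs ! i))) = 0 \<longrightarrow> fst (snd (snd (ys ! i))) = 0) \<and>
      (snd (snd (snd (xs ! i))) = 0 \<longrightarrow> snd (snd (snd (ys ! i))) = (0::'l'::zero))"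
  shows "lin_tree (r', ys)"
proof -
  obtain j where j: "j < length xs" "\<forall>i<length xs. case xs ! i of (s, e, x, y) \<Rightarrow> if i = j then x = 0 else y = 0"
    using assms(1) unfolding lin_tree_def by auto
  show ?thesis
    unfolding lin_tree_def prod.case assms(2) using j assms(3) by (intro exI[of _ j]) (auto simp: split_beta split: if_splits)
qed

context fmd
begin

lemma X_dif: "glinear (-1) N N (dif N) \<Longrightarrow> glinear (-1) X X (dif X)"
  using glinear_dsum[OF A_dif] by (simp add: dsum_def)

text \<open>The differential acts on each summand separately and sends 0 to 0, so the distinguished
  leaf keeps its position.\<close>

lemma dif_L:
  assumes dN: "glinear (-1) N N (dif N)" and x: "x \<in> grd L 0 d"
  shows "dif (circ P X) 0 d x \<in> grd L 0 (d - 1)"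
proof (rule plin_in[OF plin_dif_circ _ _ x[unfolded grd_circ_lin]])
  show s: "PM.subspace (grd L 0 (d - 1))" using gmodD(2)[OF gmod_circ_lin[of P A N]] by simp
  fix z assume "z \<in> cls P X 0 d ` {t \<in> trees P X 0 d. lin_tree t}"
  then obtain p m xs where t: "((p, m), xs) \<in> trees P X 0 d" "lin_tree ((p, m), xs)"
    and z: "z = cls P X 0 d ((p, m), xs)" by auto
  have dX: "ghom (-1) X X (dif X)" by (rule flat_ghom[OF X_flat X_flat X_dif[OF dN]])
  have d0: "dif A n e 0 = 0" "dif N n e 0 = 0" for n e
    using glinear_0[OF A_dif A_gmod] glinear_0[OF dN N_gmod] by auto
  have "cls P X 0 (d - 1) (ctree (-1) (dif P) idm ((p, m), xs)) \<in> grd L 0 (d - 1)"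
    using ctree_trees[OF t(1) ghom_glinear[OF P_dif] glinear_idm] t(2)
    by (intro cls_in_circ_lin) (auto simp: ctree_idm lin_tree_def)
  moreover have "cls P X 0 (d - 1) (etree 0 idm idm (-1) (dif X) j ((p, m), xs)) \<in> grd L 0 (d - 1)" if "j < length xs" for j
  proof (rule cls_in_circ_lin)
    show "etree 0 idm idm (-1) (dif X) j ((p, m), xs) \<in> trees P X 0 (d - 1)"
      using etree_trees[OF t(1) glinear_idm glinear_idm ghom_glinear[OF dX], of j] that by simp
    show "lin_tree (etree 0 idm idm (-1) (dif X) j ((p, m), xs))"
      unfolding etree_def gtree_def prod.case
      by (rule lin_tree_map[OF t(2)]) (auto simp: nth_gleaves split_beta d0, auto simp: idm_def)
  qed
  ultimately show "dif (circ P X) 0 d z \<in> grd L 0 (d - 1)"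
    unfolding z dif_circ_cls[OF P_dif dX] esum_def
    by (intro PM.subspace_add[OF s] PM.subspace_sum[OF s] PM.subspace_scale[OF s]) auto
qed

lemma ext_dif:
  assumes dN: "glinear (-1) N N (dif N)" and g: "glinear p N M g" and g': "glinear (p - 1) N M g'"
    and d: "\<And>e x. x \<in> grd N 0 e \<Longrightarrow> g' 0 e x = dif M 0 (e + p) (g 0 e x) - scl M ((-1) powi p) (g 0 (e - 1) (dif N 0 e x))"
    and t: "t \<in> grd (circ P X) 0 d"
  shows "dif M 0 (d + p) (ext p g 0 d t) - scl M ((-1) powi p) (ext p g 0 (d - 1) (dif (circ P X) 0 d t)) =
    ext (p - 1) g' 0 d t"
proof -
  have a: "dif A 0 e (fstm 0 e x) = fstm 0 (e - 1) (dif X 0 e x)" for e x by (simp add: fstm_def)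
  have b: "(g' \<bullet>[0] sndm) 0 e x = dif M 0 (e + p) ((g \<bullet>[0] sndm) 0 e x) -
    scl M ((-1) powi p) ((g \<bullet>[0] sndm) 0 (e - 1) (dif X 0 e x))" if "x \<in> grd X 0 e" for e x
    using that d[of "snd x" e] by (auto simp: gcomp_def sndm_def)
  show ?thesis
    using twist_dif[OF X_flat X_dif[OF dN] glinear_fstm a gsnd[OF g] gsnd[OF g'] b t] by (simp add: gcomp_def)
qed

end

context qfr
begin

abbreviation "tw p g \<equiv> twisted_action P \<alpha> \<Delta>C A \<phi> M \<gamma>M p g"

lemma tw_lin:
  assumes g: "glinear p C M g"
  shows "glinear (p - 1) C M (tw p g)"
proof -
  have "glinear (p - 1) (circ Q C) (circ_lin P A M) (lcomp_map P A M (-1) \<alpha> \<phi> p g)"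
    using glinear_lcomp_map[OF \<alpha> \<phi> g C_flat A_flat M_flat] by simp
  from glinear_gcomp[OF glinear_gcomp[OF ghom_glinear[OF \<Delta>C] this] \<gamma>M_lin] show ?thesis
    by (simp add: twisted_action_def)
qed

definition cdif :: "int \<Rightarrow> ('c, 'm) gmap \<Rightarrow> ('c, 'm) gmap" where
  "cdif p g = (\<lambda>n d x. (dif M \<bullet>[p] g) n d x - scl M ((-1) powi p) ((g \<bullet>[-1] dif C) n d x))"

lemma cdif_lin:
  assumes g: "glinear p C M g"
  shows "glinear (p - 1) C M (cdif p g)"
proof -
  have "glinear (p - 1) C M (dif M \<bullet>[p] g)" "glinear (p - 1) C M (g \<bullet>[-1] dif C)"
    using glinear_gcomp[OF g M_dif] glinear_gcomp[OF C_dif g] by simp_all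
  thus ?thesis unfolding cdif_def by (rule glinear_minus)
qed

lemma hdif_eq: "hdif p g n d x = cdif p g n d x + tw p g n d x"
  by (simp add: hdif_def cdif_def)

lemma hdif_lin:
  assumes g: "glinear p C M g"
  shows "glinear (p - 1) C M (hdif p g)"
  using glinearD[OF cdif_lin[OF g]] glinearD[OF tw_lin[OF g]]
  by (auto simp: glinear_def hdif_eq gmodD(11)[OF M_gmod] intro!: gmodD(4)[OF M_gmod])

abbreviation "gd \<equiv> pr \<bullet>[-1] lcomp_map P A C (-1) \<alpha> \<phi> 0 idm \<bullet>[0] \<Delta>C"

lemma gd_lin: "glinear (-1) C T gd"
proof -
  have "glinear (-1) (circ Q C) L (lcomp_map P A C (-1) \<alpha> \<phi> 0 idm)"
    using glinear_lcomp_map[OF \<alpha> \<phi> glinear_idm[of C] C_flat A_flat C_flat] by simp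
  from glinear_gcomp[OF glinear_gcomp[OF ghom_glinear[OF \<Delta>C] this] pr_lin] show ?thesis by simp
qed

text \<open>Extending \<open>g\<close> after the map that defines the twisting term on generators:
  \<open>g\<close> is applied to the factor left untouched and has to pass \<open>\<alpha>\<close>,
  whence the sign.\<close>

lemma ext_gd:
  assumes g: "glinear p C M g" and c: "c \<in> grd C 0 e"
  shows "ext p g 0 (e - 1) (gd 0 e c) = scl M ((-1) powi p) (tw p g 0 e c)"
proof -
  have y: "\<Delta>C 0 e c \<in> grd (circ Q C) 0 e" using glinearD(1)[OF ghom_glinear[OF \<Delta>C] c] by simp
  have l: "lcomp_map P A C (-1) \<alpha> \<phi> 0 idm 0 e (\<Delta>C 0 e c) \<in> grd L 0 (e - 1)"
    using glinearD(1)[OF glinear_lcomp_map[OF \<alpha> \<phi> glinear_idm[of C] C_flat A_flat C_flat] y] by simp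
  have g': "glinear (0 + p) C M g" using g by simp
  have v: "lcomp_map P A M (-1) \<alpha> \<phi> p g 0 e (\<Delta>C 0 e c) \<in> grd (circ_lin P A M) 0 (e - 1 + p)"
    using glinearD(1)[OF glinear_lcomp_map[OF \<alpha> \<phi> g C_flat A_flat M_flat] y] by (simp add: algebra_simps)
  have "lcomp_map P A M 0 idm fstm p (g \<bullet>[0] sndm) 0 (e - 1) (lcomp_map P A C (-1) \<alpha> \<phi> 0 idm 0 e (\<Delta>C 0 e c)) =
      psc ((-1) powi (p * -1)) (lcomp_map P A M (-1) \<alpha> \<phi> p g 0 e (\<Delta>C 0 e c))"
    using lcomp_lcomp[OF \<alpha> \<phi> glinear_idm[of C] glinear_idm[of A] g \<phi> g' C_flat A_flat C_flat A_flat M_flat _ _ y]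
    by simp (simp add: idm_def)
  hence "ext p g 0 (e - 1) (lcomp_map P A C (-1) \<alpha> \<phi> 0 idm 0 e (\<Delta>C 0 e c)) = scl M ((-1) powi p) (tw p g 0 e c)"
    using \<gamma>M_psc[OF v] by (simp add: gcomp_def twisted_action_def powi_minus_one add_diff_eq diff_add_eq)
  thus ?thesis using ext_pr[OF g l] by (simp add: gcomp_def)
qed

abbreviation "dphi \<equiv> delta_phi P \<gamma> \<eta> \<alpha> C \<Delta>C A \<gamma>A \<phi>"

lemma dphi_eq: "dphi n d t = tact n (d - 1) (lcomp_map P A T 0 idm fstm (-1) (gd \<bullet>[0] sndm) n d t)"
  by (simp add: delta_phi_def tens_ext_def gcomp_def)

lemma dphi_arg:
  assumes t: "t \<in> grd (circ P X) 0 d"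
  shows "lcomp_map P A T 0 idm fstm (-1) (gd \<bullet>[0] sndm) 0 d t \<in> grd (circ_lin P A T) 0 (d - 1)"
  using glinearD(1)[OF glinear_lcomp_map[OF ghom_idm glinear_fstm gsnd[OF gd_lin] X_flat A_flat T_flat] t] by simp

text \<open>The twisting term is itself the extension of \<open>gd\<close>. By
  \<open>ext_tact\<close> the extension of \<open>g\<close> moves through the action to the
  distinguished leaf, where \<open>ext_gd\<close> evaluates it.\<close>

lemma ext_dphi:
  assumes g: "glinear p C M g" and t: "t \<in> grd (circ P X) 0 d"
    and w: "glinear (p - 1) C M w" "\<And>e c. c \<in> grd C 0 e \<Longrightarrow> w 0 e c = scl M ((-1) powi p) (tw p g 0 e c)"
  shows "ext p g 0 (d - 1) (dphi 0 d t) = ext (p - 1) w 0 d t"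
proof -
  have w': "glinear (-1 + p) X M (w \<bullet>[0] sndm)" using gsnd[OF w(1)] by simp
  have bb: "(w \<bullet>[0] sndm) 0 e x = ext p g 0 (e + -1) ((gd \<bullet>[0] sndm) 0 e x)" if "x \<in> grd X 0 e" for e x
    using that ext_gd[OF g, of "snd x" e] w(2)[of "snd x" e] by (auto simp: gcomp_def sndm_def)
  have "lcomp_map P A M 0 idm fstm p (ext p g \<bullet>[0] sndm) 0 (d - 1) (lcomp_map P A T 0 idm fstm (-1) (gd \<bullet>[0] sndm) 0 d t) =
      lcomp_map P A M 0 idm fstm (p - 1) (w \<bullet>[0] sndm) 0 d t"
    using lcomp_lcomp[OF ghom_idm[of P] glinear_fstm gsnd[OF gd_lin] glinear_idm[of A] ext_lin_T[OF g] glinear_fstm w'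
        X_flat A_flat T_flat A_flat M_flat _ _ t, OF _ bb]
    by simp (simp add: idm_def)
  thus ?thesis
    unfolding dphi_eq ext_tact[OF g dphi_arg[OF t]] by (simp add: gcomp_def diff_add_eq add_diff_eq)
qed

lemma dif_T_in:
  assumes t: "t \<in> grd T 0 d"
  shows "dif T 0 d t \<in> grd T 0 (d - 1)" "dphi 0 d t \<in> grd T 0 (d - 1)"
  using pr_in[OF dif_L[OF C_dif subsetD[OF T_sub t]]] tact_in[OF dphi_arg[OF subsetD[OF circ_lin_sub subsetD[OF T_sub t]]]]
  by (simp_all add: T_simps(3) dphi_eq)

text \<open>\<open>ext_dif\<close> treats the untwisted part, \<open>ext_dphi\<close> the twisting
  term, whose sign \<open>(-1) powi p\<close> cancels that of the commutator. The map
  \<open>h\<close> need agree with the extension on components only, so that its cut-off version is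
  covered.\<close>

lemma mdif_ext:
  assumes g: "glinear p C M g" and h: "\<And>e x. x \<in> grd T 0 e \<Longrightarrow> h 0 e x = ext p g 0 e x" and t: "t \<in> grd T 0 d"
  shows "dif M 0 (d + p) (h 0 d t) - scl M ((-1) powi p) (h 0 (d - 1) (dif T 0 d t - dphi 0 d t)) =
    ext (p - 1) (hdif p g) 0 d t"
proof -
  let ?s = "(-1 :: 'k) powi p"
  have tL: "t \<in> grd L 0 d" by (rule subsetD[OF T_sub t])
  have tX: "t \<in> grd (circ P X) 0 d" by (rule subsetD[OF circ_lin_sub tL])
  define w where "w = (\<lambda>n e c. scl M ?s (tw p g n e c))"
  have w: "glinear (p - 1) C M w"
    using glinearD[OF tw_lin[OF g]]
    by (auto simp: w_def glinear_def gmodD(11,13)[OF M_gmod] mult.commute intro!: gmodD(6)[OF M_gmod])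
  have "h 0 (d - 1) (dif T 0 d t - dphi 0 d t) = ext p g 0 (d - 1) (dif T 0 d t) - ext p g 0 (d - 1) (dphi 0 d t)"
    unfolding h[OF gmodD(5)[OF T_gmod dif_T_in[OF t]]]
    by (rule glinear_diff[OF ext_lin_T[OF g] T_gmod M_gmod dif_T_in[OF t]])
  also have "ext p g 0 (d - 1) (dif T 0 d t) = ext p g 0 (d - 1) (dif (circ P X) 0 d t)"
    unfolding T_simps(3) by (rule ext_pr[OF g dif_L[OF C_dif tL]])
  also have "ext p g 0 (d - 1) (dphi 0 d t) = ext (p - 1) w 0 d t"
    by (rule ext_dphi[OF g tX w]) (simp add: w_def)
  finally have 1: "h 0 (d - 1) (dif T 0 d t - dphi 0 d t) = ext p g 0 (d - 1) (dif (circ P X) 0 d t) - ext (p - 1) w 0 d t" .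
  have 2: "dif M 0 (d + p) (ext p g 0 d t) - scl M ?s (ext p g 0 (d - 1) (dif (circ P X) 0 d t)) = ext (p - 1) (cdif p g) 0 d t"
    by (rule ext_dif[OF C_dif g cdif_lin[OF g] _ tX]) (simp add: cdif_def gcomp_def)
  have hw: "hdif p g 0 e x = cdif p g 0 e x + scl M ?s (w 0 e x)" for e x
    by (simp add: hdif_eq w_def gmodD(10,13)[OF M_gmod] powi_m1_sq)
  have "lcomp_map P A M 0 idm fstm (p - 1) (hdif p g \<bullet>[0] sndm) 0 d t =
      lcomp_map P A M 0 idm fstm (p - 1) (cdif p g \<bullet>[0] sndm) 0 d t + psc ?s (lcomp_map P A M 0 idm fstm (p - 1) (w \<bullet>[0] sndm) 0 d t)"
    by (rule lcomp_add[OF ghom_idm glinear_fstm gsnd[OF cdif_lin[OF g]] gsnd[OF w] gsnd[OF hdif_lin[OF g]] X_flat A_flat M_flat _ tX])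
      (simp add: gcomp_def hw)
  moreover have v: "lcomp_map P A M 0 idm fstm (p - 1) (b \<bullet>[0] sndm) 0 d t \<in> grd (circ_lin P A M) 0 (d + (p - 1))"
    if "glinear (p - 1) C M b" for b
    using glinearD(1)[OF glinear_lcomp_map[OF ghom_idm glinear_fstm gsnd[OF that] X_flat A_flat M_flat] tX] by simp
  ultimately have 3: "ext (p - 1) (hdif p g) 0 d t = ext (p - 1) (cdif p g) 0 d t + scl M ?s (ext (p - 1) w 0 d t)"
    using glinearD(2)[OF \<gamma>M_lin v[OF cdif_lin[OF g]], of "psc ?s (lcomp_map P A M 0 idm fstm (p - 1) (w \<bullet>[0] sndm) 0 d t)"]
      \<gamma>M_psc[OF v[OF w]] gmodD(6)[OF gmod_circ_lin v[OF w], of ?s]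
    by (simp add: gcomp_def)
  show ?thesis unfolding h[OF t] 1 3 2[symmetric] by (simp add: gmodD(12)[OF M_gmod])
qed

end

section \<open>Isomorphisms of complexes of maps\<close>

text \<open>Only \<open>V\<close> is known to be a dg module. A linear bijection commuting with the
  differentials carries the subspace property, linearity of the differential and its vanishing
  square over to \<open>W\<close>.\<close>

lemma dg_iso_transport:
  fixes V :: "('k::field_char_0, 'v::ab_group_add) dgs" and W :: "('k, 'w::ab_group_add) dgs"
  assumes V: "dg_module V" "\<And>n d \<sigma> x. act V n d \<sigma> x = x"
    and W: "vector_space (scl W)" "\<And>n d. n > 0 \<Longrightarrow> grd W n d = {0}" "\<And>n d \<sigma> x. act W n d \<sigma> x = x" "\<And>n d. n > 0 \<Longrightarrow> dif W n d 0 = 0"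
    and F: "\<And>d. bij_betw (F d) (grd V 0 d) (grd W 0 d)"
      "\<And>d x y. x \<in> grd V 0 d \<Longrightarrow> y \<in> grd V 0 d \<Longrightarrow> F d (x + y) = F d x + F d y"
      "\<And>d c x. x \<in> grd V 0 d \<Longrightarrow> F d (scl V c x) = scl W c (F d x)"
      "\<And>d x. x \<in> grd V 0 d \<Longrightarrow> dif W 0 d (F d x) = F (d - 1) (dif V 0 d x)"
  shows "dg_iso V W"
proof -
  interpret W: vector_space "scl W" by fact
  have Vs: "gmod V" "\<And>n d. n > 0 \<Longrightarrow> grd V n d = {0}" "glinear (-1) V V (dif V)"
    "\<And>n d x. x \<in> grd V n d \<Longrightarrow> dif V n (d - 1) (dif V n d x) = 0"
    using V(1) smodule_gmod[of V] by (auto simp: dg_module_def smodule_def ghom_def)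
  have F0: "F d 0 = 0" for d using F(2)[OF gmodD(3)[OF Vs(1)] gmodD(3)[OF Vs(1)]] by simp
  have img: "grd W 0 d = F d ` grd V 0 d" for d using F(1)[of d] by (simp add: bij_betw_def)
  have sub: "W.subspace (grd W n d)" for n d
  proof (cases "n = 0")
    case True
    show ?thesis unfolding True img
    proof (rule W.subspaceI)
      show "0 \<in> F d ` grd V 0 d" using F0 gmodD(3)[OF Vs(1)] by (metis image_eqI)
      fix x y c assume "x \<in> F d ` grd V 0 d"
      then obtain u where u: "x = F d u" "u \<in> grd V 0 d" by blast
      show "scl W c x \<in> F d ` grd V 0 d"
        unfolding u(1) F(3)[OF u(2), symmetric] by (rule imageI[OF gmodD(6)[OF Vs(1) u(2)]])
      assume "y \<in> F d ` grd V 0 d"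
      then obtain v where v: "y = F d v" "v \<in> grd V 0 d" by blast
      show "x + y \<in> F d ` grd V 0 d"
        unfolding u(1) v(1) F(2)[OF u(2) v(2), symmetric] by (rule imageI[OF gmodD(4)[OF Vs(1) u(2) v(2)]])
    qed
  qed (simp add: W(2) W.subspace_0)
  have dV: "dif V 0 d u \<in> grd V 0 (d - 1)" if "u \<in> grd V 0 d" for u d using glinearD(1)[OF Vs(3) that] by simp
  have dW: "glinear (-1) W W (dif W)"
    unfolding glinear_def
  proof (intro allI conjI ballI)
    fix n d x c assume x: "x \<in> grd W n d"
    show "dif W n d x \<in> grd W n (d + -1)"
    proof (cases "n = 0")
      case True
      then obtain u where "x = F d u" "u \<in> grd V 0 d" using x img by auto
      thus ?thesis using True F(4) dV img by auto
    qed (use x W(2,4) in auto)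
    show "dif W n d (scl W c x) = scl W c (dif W n d x)"
    proof (cases "n = 0")
      case True
      then obtain u where u: "x = F d u" "u \<in> grd V 0 d" using x img by auto
      show ?thesis
        using True F(3)[OF u(2)] F(4)[OF gmodD(6)[OF Vs(1) u(2)]] F(4)[OF u(2)] glinearD(3)[OF Vs(3) u(2)] F(3)[OF dV[OF u(2)]]
        by (simp add: u(1))
    qed (use x W(2,4) in auto)
    fix y assume y: "y \<in> grd W n d"
    show "dif W n d (x + y) = dif W n d x + dif W n d y"
    proof (cases "n = 0")
      case True
      then obtain u v where u: "x = F d u" "u \<in> grd V 0 d" and v: "y = F d v" "v \<in> grd V 0 d" using x y img by auto
      show ?thesis
        using True F(2)[OF u(2) v(2)] F(4)[OF gmodD(4)[OF Vs(1) u(2) v(2)]] F(4)[OF u(2)] F(4)[OF v(2)]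
          glinearD(2)[OF Vs(3) u(2) v(2)] F(2)[OF dV[OF u(2)] dV[OF v(2)]]
        by (simp add: u(1) v(1))
    qed (use x y W(2,4) in auto)
  qed
  have ddW: "dif W n (d - 1) (dif W n d x) = 0" if x: "x \<in> grd W n d" for n d x
  proof (cases "n = 0")
    case True
    then obtain u where u: "x = F d u" "u \<in> grd V 0 d" using x img by auto
    show ?thesis using True F(4)[OF u(2)] F(4)[OF dV[OF u(2)]] Vs(4)[OF u(2)] F0 by (simp add: u(1))
  qed (use x W(2,4) in auto)
  have "smodule W"
    unfolding smodule_def ghom_def using W(1,3) sub dW ddW by simp
  hence dgW: "dg_module W" using W(2) by (simp add: dg_module_def)
  define G where "G = (\<lambda>(n :: nat) d x. if n = 0 then F d x else (0 :: 'w))"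
  have bij: "bij_betw (G n d) (grd V n d) (grd W n d)" for n d
    by (cases "n = 0") (use F(1)[of d] Vs(2) W(2) in \<open>auto simp: G_def bij_betw_def inj_on_def\<close>)
  have G: "glinear 0 V W G"
    unfolding glinear_def G_def using F(2,3) img Vs(2) W(2) by auto
  have "eq_on V (dif W \<bullet>[0] G) (G \<bullet>[-1] dif V)"
    unfolding eq_on_def gcomp_def G_def using F(4) W(4) by auto
  hence "dg_hom V W G" using G V(2) W(3) by (simp add: dg_hom_def ghom_def)
  thus ?thesis using V(1) dgW bij unfolding dg_iso_def by blast
qed

text \<open>Transport first makes \<open>W\<close> a dg module; then the same lemma applies to the
  inverse bijections.\<close>

lemma dg_iso_transport_inv:
  fixes V :: "('k::field_char_0, 'v::ab_group_add) dgs" and W :: "('k, 'w::ab_group_add) dgs"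
  assumes V: "dg_module V" "\<And>n d \<sigma> x. act V n d \<sigma> x = x" "\<And>n d. n > 0 \<Longrightarrow> dif V n d 0 = 0"
    and W: "vector_space (scl W)" "\<And>n d. n > 0 \<Longrightarrow> grd W n d = {0}" "\<And>n d \<sigma> x. act W n d \<sigma> x = x" "\<And>n d. n > 0 \<Longrightarrow> dif W n d 0 = 0"
    and F: "\<And>d. bij_betw (F d) (grd V 0 d) (grd W 0 d)"
      "\<And>d x y. x \<in> grd V 0 d \<Longrightarrow> y \<in> grd V 0 d \<Longrightarrow> F d (x + y) = F d x + F d y"
      "\<And>d c x. x \<in> grd V 0 d \<Longrightarrow> F d (scl V c x) = scl W c (F d x)"
      "\<And>d x. x \<in> grd V 0 d \<Longrightarrow> dif W 0 d (F d x) = F (d - 1) (dif V 0 d x)"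
  shows "dg_iso W V"
proof -
  have Vs: "gmod V" "\<And>n d. n > 0 \<Longrightarrow> grd V n d = {0}" "glinear (-1) V V (dif V)"
    using V(1) smodule_gmod[of V] by (auto simp: dg_module_def smodule_def ghom_def)
  have "dg_iso V W" by (rule dg_iso_transport[OF V(1,2) W F])
  hence dgW: "dg_module W" by (simp add: dg_iso_def)
  define H where "H = (\<lambda>d. inv_into (grd V 0 d) (F d))"
  have HF: "H d (F d u) = u" if "u \<in> grd V 0 d" for u d
    unfolding H_def by (rule inv_into_f_f) (use F(1)[of d] that in \<open>auto simp: bij_betw_def\<close>)
  have img: "grd W 0 d = F d ` grd V 0 d" for d using F(1)[of d] by (simp add: bij_betw_def)
  show ?thesis
  proof (rule dg_iso_transport[OF dgW W(3) gmodD(1)[OF Vs(1)] Vs(2) V(2,3), where F = H])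
    show "bij_betw (H d) (grd W 0 d) (grd V 0 d)" for d
      unfolding H_def by (rule bij_betw_inv_into[OF F(1)])
    fix d x y c assume "x \<in> grd W 0 d"
    then obtain u where u: "x = F d u" "u \<in> grd V 0 d" using img by auto
    show "H d (scl W c x) = scl V c (H d x)"
      unfolding u(1) F(3)[OF u(2), symmetric] HF[OF u(2)] by (rule HF[OF gmodD(6)[OF Vs(1) u(2)]])
    have "dif V 0 d u \<in> grd V 0 (d - 1)" using glinearD(1)[OF Vs(3) u(2)] by simp
    thus "dif V 0 d (H d x) = H (d - 1) (dif W 0 d x)"
      unfolding u(1) F(4)[OF u(2)] HF[OF u(2)] by (simp add: HF)
    assume "y \<in> grd W 0 d"
    then obtain v where v: "y = F d v" "v \<in> grd V 0 d" using img by auto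
    show "H d (x + y) = H d x + H d y"
      unfolding u(1) v(1) F(2)[OF u(2) v(2), symmetric] HF[OF u(2)] HF[OF v(2)] by (rule HF[OF gmodD(4)[OF Vs(1) u(2) v(2)]])
  qed
qed

definition restr :: "('k, 'v) dgs \<Rightarrow> ('v, 'w::zero) gmap \<Rightarrow> ('v, 'w) gmap" where
  "restr V f = (\<lambda>n d x. if x \<in> grd V n d then f n d x else 0)"

lemma restr_eq [simp]: "x \<in> grd V n d \<Longrightarrow> restr V f n d x = f n d x"
  by (simp add: restr_def)

lemma glinear_cong:
  assumes "glinear p V W f" "gmod V" "\<And>n d x. x \<in> grd V n d \<Longrightarrow> g n d x = f n d x"
  shows "glinear p V W g"
  using glinearD[OF assms(1)] gmodD(4,6)[OF assms(2)] unfolding glinear_def by (simp add: assms(3))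

lemma gmaps_lin: "f \<in> gmaps p V W \<Longrightarrow> glinear p V W f"
  by (simp add: gmaps_def ghom_def)

lemma gmapsI:
  assumes "flat V" "flat W" "glinear p V W f" "\<And>n d x. x \<notin> grd V n d \<Longrightarrow> f n d x = 0"
  shows "f \<in> gmaps p V W"
  using assms flat_ghom by (auto simp: gmaps_def)

lemma restr_gmaps:
  assumes "flat V" "flat W" "glinear p V W f"
  shows "restr V f \<in> gmaps p V W"
  using assms by (intro gmapsI glinear_cong[OF assms(3) flatD(1)]) (simp_all add: restr_def)

text \<open>Values in arity zero determine an element of such a complex: in positive arity the
  components are 0, and outside the components the value is 0 by convention.\<close>

lemma gmaps_eqI:
  assumes V: "flat V" and f: "f \<in> gmaps p V W" and g: "g \<in> gmaps p V W"
    and eq: "\<And>d x. x \<in> grd V 0 d \<Longrightarrow> f 0 d x = g 0 d x"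
  shows "f = g"
proof (intro ext)
  fix n d x
  show "f n d x = g n d x"
  proof (cases "x \<in> grd V n d")
    case True
    show ?thesis
    proof (cases "n = 0")
      case False
      hence "x = 0" using True flatD(2)[OF V] by auto
      thus ?thesis
        using glinear_0[OF gmaps_lin[OF f] flatD(1)[OF V]] glinear_0[OF gmaps_lin[OF g] flatD(1)[OF V]] by simp
    qed (use True eq in simp)
  qed (use f g in \<open>simp add: gmaps_def\<close>)
qed

lemma gmaps_comb:
  assumes "flat V" "flat W" "f \<in> gmaps p V W" "g \<in> gmaps p V W"
  shows "f + g \<in> gmaps p V W" "(\<lambda>n d x. scl W c (f n d x)) \<in> gmaps p V W" "0 \<in> gmaps p V W"
proof -
  note l = glinearD[OF gmaps_lin[OF assms(3)]] and l' = glinearD[OF gmaps_lin[OF assms(4)]] and W = flatD(1)[OF assms(2)]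
  show "f + g \<in> gmaps p V W"
    using assms l l' by (intro gmapsI) (auto simp: glinear_def gmaps_def gmodD(11)[OF W] intro!: gmodD(4)[OF W])
  show "(\<lambda>n d x. scl W c (f n d x)) \<in> gmaps p V W"
    using assms l by (intro gmapsI) (auto simp: glinear_def gmaps_def gmodD(9,11,13)[OF W] mult.commute intro!: gmodD(6)[OF W])
  show "0 \<in> gmaps p V W"
    using assms by (intro gmapsI) (auto simp: glinear_def gmodD(3,9)[OF W])
qed

lemma vector_space_maps: "vector_space (scl W) \<Longrightarrow> vector_space (\<lambda>c f n d x. scl W c (f n d x))"
  by (auto simp: vector_space_def fun_eq_iff)

context amd
begin

lemma \<gamma>M_comb:
  assumes "flat X" "ghom r K P h" "glinear 0 X A a" "glinear q X M b" "glinear q X M b'" "glinear q X M b3"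
    and "\<And>e x. x \<in> grd X 0 e \<Longrightarrow> b3 0 e x = b 0 e x + scl M c (b' 0 e x)"
    and x: "x \<in> grd (circ K X) 0 d"
  shows "\<gamma>M 0 (d + r + q) (lcomp_map P A M r h a q b3 0 d x) =
    \<gamma>M 0 (d + r + q) (lcomp_map P A M r h a q b 0 d x) + scl M c (\<gamma>M 0 (d + r + q) (lcomp_map P A M r h a q b' 0 d x))"
proof -
  have v: "lcomp_map P A M r h a q b 0 d x \<in> grd (circ_lin P A M) 0 (d + r + q)" if "glinear q X M b" for b
    using glinearD(1)[OF glinear_lcomp_map[OF assms(2,3) that assms(1) A_flat M_flat] x] by (simp add: add.assoc)
  have "lcomp_map P A M r h a q b3 0 d x = lcomp_map P A M r h a q b 0 d x + psc c (lcomp_map P A M r h a q b' 0 d x)"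
    by (rule lcomp_add[OF assms(2-6) assms(1) A_flat M_flat _ x]) (rule assms(7))
  thus ?thesis
    using glinearD(2)[OF \<gamma>M_lin v[OF assms(4)], of "psc c (lcomp_map P A M r h a q b' 0 d x)"]
      gmodD(6)[OF gmod_circ_lin v[OF assms(5)], of c] \<gamma>M_psc[OF v[OF assms(5)]] by simp
qed

end

section \<open>Hom(C, M) as a dg module, and the frame for both isomorphisms\<close>

context qfr
begin

lemma hdif_comb:
  assumes g: "glinear p C M g" "glinear p C M g'" "glinear p C M g3"
    and eq: "\<And>e x. x \<in> grd C 0 e \<Longrightarrow> g3 0 e x = g 0 e x + scl M c (g' 0 e x)" and x: "x \<in> grd C 0 d"
  shows "hdif p g3 0 d x = hdif p g 0 d x + scl M c (hdif p g' 0 d x)"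
proof -
  have y: "\<Delta>C 0 d x \<in> grd (circ Q C) 0 d" using glinearD(1)[OF ghom_glinear[OF \<Delta>C] x] by simp
  have "tw p g3 0 d x = tw p g 0 d x + scl M c (tw p g' 0 d x)"
    using \<gamma>M_comb[OF C_flat \<alpha> \<phi> g eq y] by (simp add: twisted_action_def gcomp_def diff_add_eq add_diff_eq)
  moreover have "cdif p g3 0 d x = cdif p g 0 d x + scl M c (cdif p g' 0 d x)"
  proof -
    have dx: "dif C 0 d x \<in> grd C 0 (d - 1)" using glinearD(1)[OF C_dif x] by simp
    have i: "g 0 d x \<in> grd M 0 (d + p)" "g' 0 d x \<in> grd M 0 (d + p)" using glinearD(1)[OF g(1) x] glinearD(1)[OF g(2) x] by auto
    show ?thesis
      using glinearD(2)[OF M_dif i(1) gmodD(6)[OF M_gmod i(2), of c]] glinearD(3)[OF M_dif i(2), of c]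
      by (simp add: cdif_def gcomp_def eq[OF x] eq[OF dx] gmodD(11-13)[OF M_gmod] mult.commute)
  qed
  ultimately show ?thesis by (simp add: hdif_eq gmodD(11)[OF M_gmod])
qed

lemma der_comb:
  assumes g: "glinear p C M g" "glinear p C M g'" "glinear p C M g3"
    and eq: "\<And>e x. x \<in> grd C 0 e \<Longrightarrow> g3 0 e x = g 0 e x + scl M c (g' 0 e x)" and x: "x \<in> grd F 0 d"
  shows "der p g3 0 d x = der p g 0 d x + scl M c (der p g' 0 d x)"
  using \<gamma>M_comb[OF C_flat ghom_idm[of P] \<phi> g eq x] by (simp add: gcomp_def)

lemma ext_comb:
  assumes g: "glinear p C M g" "glinear p C M g'" "glinear p C M g3"
    and eq: "\<And>e x. x \<in> grd C 0 e \<Longrightarrow> g3 0 e x = g 0 e x + scl M c (g' 0 e x)" and x: "x \<in> grd T 0 d"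
  shows "ext p g3 0 d x = ext p g 0 d x + scl M c (ext p g' 0 d x)"
proof -
  have e: "(g3 \<bullet>[0] sndm) 0 e x = (g \<bullet>[0] sndm) 0 e x + scl M c ((g' \<bullet>[0] sndm) 0 e x)" if "x \<in> grd X 0 e" for e x
    using that eq[of "snd x" e] by (auto simp: gcomp_def sndm_def)
  from \<gamma>M_comb[OF X_flat ghom_idm[of P] glinear_fstm gsnd[OF g(1)] gsnd[OF g(2)] gsnd[OF g(3)] e subsetD[OF circ_lin_sub subsetD[OF T_sub x]]]
  show ?thesis by (simp add: gcomp_def)
qed

lemma M_scl01: "scl M 0 y = 0" "scl M 1 y = y"
  by (simp_all add: gmodD(8,10)[OF M_gmod])

lemma hdif_cong:
  assumes "glinear p C M g" "glinear p C M g'" "\<And>e x. x \<in> grd C 0 e \<Longrightarrow> g' 0 e x = g 0 e x" "x \<in> grd C 0 d"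
  shows "hdif p g' 0 d x = hdif p g 0 d x"
  using hdif_comb[OF assms(1,1,2) _ assms(4), of 0] assms(3) by (simp add: M_scl01)

lemma der_cong:
  assumes "glinear p C M g" "glinear p C M g'" "\<And>e x. x \<in> grd C 0 e \<Longrightarrow> g' 0 e x = g 0 e x" "x \<in> grd F 0 d"
  shows "der p g' 0 d x = der p g 0 d x"
  using der_comb[OF assms(1,1,2) _ assms(4), of 0] assms(3) by (simp add: M_scl01)

lemma ext_cong:
  assumes "glinear p C M g" "glinear p C M g'" "\<And>e x. x \<in> grd C 0 e \<Longrightarrow> g' 0 e x = g 0 e x" "x \<in> grd T 0 d"
  shows "ext p g' 0 d x = ext p g 0 d x"
  using ext_comb[OF assms(1,1,2) _ assms(4), of 0] assms(3) by (simp add: M_scl01)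

abbreviation "HC \<equiv> hom_complex P \<alpha> C \<Delta>C A \<phi> M \<gamma>M"
abbreviation "DC \<equiv> der_complex P A B (free_mult P \<gamma> C) f M \<gamma>M"
abbreviation "AC \<equiv> module_hom_complex P \<gamma> \<eta> \<alpha> C \<Delta>C A \<gamma>A \<phi> M \<gamma>M"

lemma HC_simps:
  "scl HC = (\<lambda>c g n d x. scl M c (g n d x))" "grd HC n p = (if n = 0 then gmaps p C M else {0})"
  "dif HC n p g = (if n = 0 then restr C (hdif p g) else 0)" "act HC n p \<sigma> g = g"
  by (auto simp: hom_complex_def map_complex_def restr_def hdif_def)

text \<open>The square is computed on derivations: \<open>der p g\<close> restricts to
  \<open>g\<close> on generators, and restriction turns \<open>ddif\<close> into
  \<open>hdif\<close>, so \<open>ddif_ddif\<close> gives the claim.\<close>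

lemma HC_dd:
  assumes g: "glinear p C M g" and x: "x \<in> grd C 0 d"
  shows "hdif (p - 1) (restr C (hdif p g)) 0 d x = 0"
proof -
  define D where "D = der p g"
  have D: "glinear p F M D" "deriv p D" unfolding D_def by (rule der_lin[OF g], rule deriv_der[OF g])
  define D1 where "D1 = ddif p D"
  have D1: "glinear (p - 1) F M D1" "deriv (p - 1) D1"
    unfolding D1_def by (rule ddif_lin[OF D(1)], rule deriv_ddif[OF D])
  have l: "glinear p C M (D \<bullet>[0] iota P \<eta> C)" "glinear (p - 1) C M (D1 \<bullet>[0] iota P \<eta> C)"
    using glinear_gcomp[OF ghom_glinear[OF iota_ghom] D(1)] glinear_gcomp[OF ghom_glinear[OF iota_ghom] D1(1)] by simp_all
  have "hdif (p - 1) (restr C (hdif p g)) 0 d x = hdif (p - 1) (D1 \<bullet>[0] iota P \<eta> C) 0 d x"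
  proof (rule hdif_cong[OF l(2) gmaps_lin[OF restr_gmaps[OF C_flat M_flat hdif_lin[OF g]]] _ x])
    fix e y assume y: "y \<in> grd C 0 e"
    have "(D1 \<bullet>[0] iota P \<eta> C) 0 e y = hdif p (D \<bullet>[0] iota P \<eta> C) 0 e y"
      using ddif_iota[OF D y] by (simp add: D1_def gcomp_def)
    also have "\<dots> = hdif p g 0 e y"
      by (rule hdif_cong[OF g l(1) _ y]) (use der_iota[OF g] in \<open>simp add: D_def gcomp_def\<close>)
    finally show "restr C (hdif p g) 0 e y = (D1 \<bullet>[0] iota P \<eta> C) 0 e y" using y by simp
  qed
  also have "\<dots> = ddif (p - 1) D1 0 d (iota P \<eta> C 0 d x)" using ddif_iota[OF D1 x] by simp
  also have "\<dots> = 0" unfolding D1_def by (rule ddif_ddif[OF D(1) iota_in[OF x]])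
  finally show ?thesis .
qed

lemma HC_dg_module: "dg_module HC"
proof -
  have vs: "vector_space (scl HC)" unfolding HC_simps by (rule vector_space_maps[OF gmodD(1)[OF M_gmod]])
  interpret H: vector_space "scl HC" by (rule vs)
  note gc = gmaps_comb[OF C_flat M_flat]
  have z: "0 \<in> gmaps p C M" for p
    by (rule gmapsI[OF C_flat M_flat]) (auto simp: glinear_def gmodD(3,9)[OF M_gmod])
  have sub: "H.subspace (grd HC n p)" for n p
  proof (cases "n = 0")
    case True
    show ?thesis by (rule H.subspaceI) (use True gc z in \<open>auto simp: HC_simps\<close>)
  qed (simp add: HC_simps H.subspace_0[unfolded HC_simps] H.subspace_single_0[unfolded HC_simps])
  have dg: "restr C (hdif p g) \<in> gmaps (p - 1) C M" if "g \<in> gmaps p C M" for p g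
    by (rule restr_gmaps[OF C_flat M_flat hdif_lin[OF gmaps_lin[OF that]]])
  have da: "restr C (hdif p (g + g')) = restr C (hdif p g) + restr C (hdif p g')" if "g \<in> gmaps p C M" "g' \<in> gmaps p C M" for p g g'
  proof (rule gmaps_eqI[OF C_flat dg[OF gc(1)[OF that]] gc(1)[OF dg[OF that(1)] dg[OF that(2)]]])
    fix d x assume x: "x \<in> grd C 0 d"
    show "restr C (hdif p (g + g')) 0 d x = (restr C (hdif p g) + restr C (hdif p g')) 0 d x"
      using hdif_comb[OF gmaps_lin[OF that(1)] gmaps_lin[OF that(2)] gmaps_lin[OF gc(1)[OF that]] _ x, of 1] x
      by (simp add: M_scl01)
  qed
  have ds: "restr C (hdif p (\<lambda>n d x. scl M c (g n d x))) = (\<lambda>n d x. scl M c (restr C (hdif p g) n d x))" if "g \<in> gmaps p C M" for p g c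
  proof (rule gmaps_eqI[OF C_flat dg[OF gc(2)[OF that that]] gc(2)[OF dg[OF that] dg[OF that]]])
    fix d x assume x: "x \<in> grd C 0 d"
    \<comment> \<open>Additivity at \<open>0 + 0\<close> shows that this value equals its own
      double.\<close>
    have h0: "hdif p 0 0 d x = 0"
      using hdif_comb[OF gmaps_lin[OF z] gmaps_lin[OF z] gmaps_lin[OF z] _ x, of 1 p] by (simp add: M_scl01)
    show "restr C (hdif p (\<lambda>n d x. scl M c (g n d x))) 0 d x = scl M c (restr C (hdif p g) 0 d x)"
      using hdif_comb[OF gmaps_lin[OF z] gmaps_lin[OF that] gmaps_lin[OF gc(2)[OF that that]] _ x, of c] x h0 by simp
  qed
  have dl: "glinear (-1) HC HC (dif HC)"
    unfolding glinear_def using dg da ds by (auto simp: HC_simps gmodD(9)[OF M_gmod] zero_fun_def)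
  have dd: "dif HC n (p - 1) (dif HC n p g) = 0" if "g \<in> grd HC n p" for n p g
  proof (cases "n = 0")
    case True
    hence g: "g \<in> gmaps p C M" using that by (simp add: HC_simps)
    have "restr C (hdif (p - 1) (restr C (hdif p g))) = 0"
      by (rule gmaps_eqI[OF C_flat dg[OF dg[OF g]] z]) (simp add: HC_dd[OF gmaps_lin[OF g]])
    thus ?thesis using True by (simp add: HC_simps)
  qed (simp add: HC_simps)
  show ?thesis
    unfolding dg_module_def smodule_def ghom_def
    using vs sub dl dd by (simp add: HC_simps(4)) (simp add: HC_simps(2))
qed

text \<open>Common frame for both isomorphisms: \<open>E\<close> extends a map from the generators,
  \<open>J\<close> restricts it back. The condition on \<open>E\<close> with a scalar gives
  additivity, homogeneity and, for \<open>c = 0\<close>, independence of the values outside arity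
  zero. Both directions are provided because Hom(C, M) stands on the right of one isomorphism and on
  the left of the other.\<close>

lemma HC_iso:
  fixes V :: "('k, 'v::ab_group_add) dgs" and Y :: "('k, ('v, 'm) gmap) dgs"
  assumes V: "flat V"
    and Y: "scl Y = (\<lambda>c h n d x. scl M c (h n d x))" "\<And>n p. n > 0 \<Longrightarrow> grd Y n p = {0}"
      "\<And>n p \<sigma> h. act Y n p \<sigma> h = h" "\<And>n p. n > 0 \<Longrightarrow> dif Y n p 0 = 0" "\<And>p. grd Y 0 p \<subseteq> gmaps p V M"
    and E: "\<And>p g. glinear p C M g \<Longrightarrow> glinear p V M (E p g)"
      "\<And>p g g' g3 c d x. glinear p C M g \<Longrightarrow> glinear p C M g' \<Longrightarrow> glinear p C M g3 \<Longrightarrow>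
        (\<And>e x. x \<in> grd C 0 e \<Longrightarrow> g3 0 e x = g 0 e x + scl M c (g' 0 e x)) \<Longrightarrow> x \<in> grd V 0 d \<Longrightarrow>
        E p g3 0 d x = E p g 0 d x + scl M c (E p g' 0 d x)"
      "\<And>p g. g \<in> gmaps p C M \<Longrightarrow> restr V (E p g) \<in> grd Y 0 p"
      "\<And>p g. g \<in> gmaps p C M \<Longrightarrow> dif Y 0 p (restr V (E p g)) = restr V (E (p - 1) (restr C (hdif p g)))"
    and J: "\<And>p h. glinear p V M h \<Longrightarrow> glinear p C M (J h)"
      "\<And>p g d x. g \<in> gmaps p C M \<Longrightarrow> x \<in> grd C 0 d \<Longrightarrow> J (restr V (E p g)) 0 d x = g 0 d x"
      "\<And>p h d x. h \<in> grd Y 0 p \<Longrightarrow> x \<in> grd V 0 d \<Longrightarrow> E p (J h) 0 d x = h 0 d x"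
  shows "dg_iso HC Y" and "dg_iso Y HC"
proof -
  let ?F = "\<lambda>p g. restr V (E p g)"
  note gc = gmaps_comb[OF C_flat M_flat] and gv = gmaps_comb[OF V M_flat]
  have Fm: "?F p g \<in> gmaps p V M" if "g \<in> gmaps p C M" for p g
    by (rule restr_gmaps[OF V M_flat E(1)[OF gmaps_lin[OF that]]])
  have Jm: "restr C (J h) \<in> gmaps p C M" if "h \<in> grd Y 0 p" for p h
    by (rule restr_gmaps[OF C_flat M_flat J(1)[OF gmaps_lin[OF subsetD[OF Y(5) that]]]])
  have bij: "bij_betw (?F p) (grd HC 0 p) (grd Y 0 p)" for p
    unfolding HC_simps
  proof (rule bij_betw_byWitness[where f' = "\<lambda>h. restr C (J h)"])
    show "\<forall>g\<in>if 0 = (0 :: nat) then gmaps p C M else {0}. restr C (J (?F p g)) = g"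
      using gmaps_eqI[OF C_flat Jm[OF E(3)]] J(2) by simp
    show "\<forall>h\<in>grd Y 0 p. ?F p (restr C (J h)) = h"
    proof
      fix h assume h: "h \<in> grd Y 0 p"
      show "?F p (restr C (J h)) = h"
      proof (rule gmaps_eqI[OF V Fm[OF Jm[OF h]] subsetD[OF Y(5) h]])
        fix d x assume x: "x \<in> grd V 0 d"
        note l = J(1)[OF gmaps_lin[OF subsetD[OF Y(5) h]]]
        show "?F p (restr C (J h)) 0 d x = h 0 d x"
          using E(2)[OF l l gmaps_lin[OF Jm[OF h]] _ x, of 0] J(3)[OF h x] x by (simp add: M_scl01)
      qed
    qed
  qed (use E(3) Jm in auto)
  have add: "?F p (g + g') = ?F p g + ?F p g'" if "g \<in> grd HC 0 p" "g' \<in> grd HC 0 p" for p g g'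
  proof -
    have g: "g \<in> gmaps p C M" "g' \<in> gmaps p C M" using that by (simp_all add: HC_simps)
    show ?thesis
      by (rule gmaps_eqI[OF V Fm[OF gc(1)[OF g]] gv(1)[OF Fm[OF g(1)] Fm[OF g(2)]]])
        (use E(2)[OF gmaps_lin[OF g(1)] gmaps_lin[OF g(2)] gmaps_lin[OF gc(1)[OF g]], of 1] in \<open>simp add: M_scl01\<close>)
  qed
  have scl: "?F p (scl HC c g) = scl Y c (?F p g)" if "g \<in> grd HC 0 p" for p c g
    unfolding HC_simps(1) Y(1)
  proof -
    have g: "g \<in> gmaps p C M" using that by (simp add: HC_simps)
    note z = gmaps_lin[OF gc(3)[OF g g]]
    show "?F p (\<lambda>n d x. scl M c (g n d x)) = (\<lambda>n d x. scl M c (?F p g n d x))"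
      by (rule gmaps_eqI[OF V Fm[OF gc(2)[OF g g]] gv(2)[OF Fm[OF g] Fm[OF g]]])
        (use E(2)[OF z gmaps_lin[OF g] gmaps_lin[OF gc(2)[OF g g]], of c] E(2)[OF z z z, of 1] in \<open>simp add: M_scl01\<close>)
  qed
  have dif: "dif Y 0 p (?F p g) = ?F (p - 1) (dif HC 0 p g)" if "g \<in> grd HC 0 p" for p g
    using E(4) that by (simp add: HC_simps)
  have vs: "vector_space (scl Y)" unfolding Y(1) by (rule vector_space_maps[OF gmodD(1)[OF M_gmod]])
  show "dg_iso HC Y"
    by (rule dg_iso_transport[where F = ?F, OF HC_dg_module HC_simps(4) vs Y(2-4) bij add scl dif])
  show "dg_iso Y HC"
    by (rule dg_iso_transport_inv[where F = ?F, OF HC_dg_module HC_simps(4) _ vs Y(2-4) bij add scl dif]) (simp add: HC_simps)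
qed

section \<open>Derivations and module maps compared with Hom(C, M)\<close>

abbreviation "thD p g \<equiv> restr F (der p g)"

lemma gmaps_B: "gmaps p B M = gmaps p F M"
proof -
  have "ghom p B M h \<longleftrightarrow> ghom p F M h" for h
    using flat_ghom[OF B_flat M_flat] flat_ghom[OF F_flat M_flat] glinear_B(1)[of p M h] by (auto simp: ghom_def)
  thus ?thesis by (simp add: gmaps_def B_eq)
qed

lemma DC_simps:
  "scl DC = (\<lambda>c g n d x. scl M c (g n d x))" "n > 0 \<Longrightarrow> grd DC n p = {0}"
  "grd DC 0 p = {D \<in> gmaps p F M. deriv p D}"
  "dif DC n p D = (if n = 0 then restr F (ddif p D) else 0)" "act DC n p \<sigma> D = D"
proof -
  show "grd DC 0 p = {D \<in> gmaps p F M. deriv p D}"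
    unfolding der_complex_def map_complex_def gmaps_B using deriv_iff[OF gmaps_lin] by auto
qed (auto simp: der_complex_def map_complex_def restr_def ddif_def B_eq)

lemma deriv_cong:
  assumes D: "glinear p F M D" "deriv p D" and E: "glinear p F M E" "\<And>d x. x \<in> grd F 0 d \<Longrightarrow> E 0 d x = D 0 d x"
  shows "deriv p E"
  unfolding deriv_def
proof (intro allI ballI)
  fix d z assume z: "z \<in> grd (circ P F) 0 d"
  have "lcomp_map P A M 0 idm f p D 0 d z = lcomp_map P A M 0 idm f p E 0 d z"
    by (rule lcomp_cong[OF ghom_idm F_flat A_flat M_flat f_lin D(1) f_lin E(1) _ E(2) z]) simp
  thus "E 0 d (free_mult P \<gamma> C 0 d z) = \<gamma>M 0 (d + p) (lcomp_map P A M 0 idm f p E 0 d z)"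
    using D(2) z E(2)[OF free_mult_in[OF C_flat z]] by (simp add: deriv_def)
qed

lemma thD_in:
  assumes g: "g \<in> gmaps p C M"
  shows "thD p g \<in> gmaps p F M" "deriv p (thD p g)"
proof -
  note gl = gmaps_lin[OF g]
  show i: "thD p g \<in> gmaps p F M" by (rule restr_gmaps[OF F_flat M_flat der_lin[OF gl]])
  show "deriv p (thD p g)" by (rule deriv_cong[OF der_lin[OF gl] deriv_der[OF gl] gmaps_lin[OF i]]) simp
qed

text \<open>By \<open>deriv_ddif\<close> the differential of the extended derivation is again a
  derivation, hence determined by its values on generators, and these are given by
  \<open>ddif_iota\<close>.\<close>

lemma thD_dif:
  assumes g: "g \<in> gmaps p C M"
  shows "restr F (ddif p (thD p g)) = thD (p - 1) (restr C (hdif p g))"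
proof -
  note D = gmaps_lin[OF thD_in(1)[OF g]] thD_in(2)[OF g]
  note gl = gmaps_lin[OF g]
  have h: "restr C (hdif p g) \<in> gmaps (p - 1) C M" by (rule restr_gmaps[OF C_flat M_flat hdif_lin[OF gl]])
  have il: "glinear p C M (thD p g \<bullet>[0] iota P \<eta> C)"
    using glinear_gcomp[OF ghom_glinear[OF iota_ghom] D(1)] by simp
  have il': "glinear (p - 1) C M (ddif p (thD p g) \<bullet>[0] iota P \<eta> C)"
    using glinear_gcomp[OF ghom_glinear[OF iota_ghom] ddif_lin[OF D(1)]] by simp
  show ?thesis
  proof (rule gmaps_eqI[OF F_flat restr_gmaps[OF F_flat M_flat ddif_lin[OF D(1)]] thD_in(1)[OF h]])
    fix d y assume y: "y \<in> grd F 0 d"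
    have "ddif p (thD p g) 0 d y = der (p - 1) (ddif p (thD p g) \<bullet>[0] iota P \<eta> C) 0 d y"
      by (rule deriv_eq[OF ddif_lin[OF D(1)] deriv_ddif[OF D] y])
    also have "\<dots> = der (p - 1) (restr C (hdif p g)) 0 d y"
    proof (rule der_cong[OF gmaps_lin[OF h] il' _ y])
      fix e x assume x: "x \<in> grd C 0 e"
      have "(ddif p (thD p g) \<bullet>[0] iota P \<eta> C) 0 e x = hdif p (thD p g \<bullet>[0] iota P \<eta> C) 0 e x"
        using ddif_iota[OF D x] by (simp add: gcomp_def)
      also have "\<dots> = hdif p g 0 e x"
      proof (rule hdif_cong[OF gl il _ x])
        fix e x assume x: "x \<in> grd C 0 e"
        show "(thD p g \<bullet>[0] iota P \<eta> C) 0 e x = g 0 e x"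
          using der_iota[OF gl x] restr_eq[OF iota_in[OF x], of "der p g"] by (simp add: gcomp_def)
      qed
      finally show "(ddif p (thD p g) \<bullet>[0] iota P \<eta> C) 0 e x = restr C (hdif p g) 0 e x" using x by simp
    qed
    finally show "restr F (ddif p (thD p g)) 0 d y = thD (p - 1) (restr C (hdif p g)) 0 d y" using y by simp
  qed
qed

abbreviation "thA p g \<equiv> restr T (ext p g)"

lemma alin_iff:
  assumes h: "glinear p T M h"
  shows "eq_on (circ_lin P A T) (h \<bullet>[0] tact) (\<gamma>M \<bullet>[p] lcomp_map P A M 0 idm fstm p (h \<bullet>[0] sndm)) \<longleftrightarrow> alin p h"
proof
  assume "eq_on (circ_lin P A T) (h \<bullet>[0] tact) (\<gamma>M \<bullet>[p] lcomp_map P A M 0 idm fstm p (h \<bullet>[0] sndm))"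
  thus "alin p h" by (simp add: eq_on_def alin_def gcomp_def)
next
  assume a: "alin p h"
  show "eq_on (circ_lin P A T) (h \<bullet>[0] tact) (\<gamma>M \<bullet>[p] lcomp_map P A M 0 idm fstm p (h \<bullet>[0] sndm))"
    unfolding eq_on_def
  proof (intro allI ballI)
    fix n d x assume x: "x \<in> grd (circ_lin P A T) n d"
    show "(h \<bullet>[0] tact) n d x = (\<gamma>M \<bullet>[p] lcomp_map P A M 0 idm fstm p (h \<bullet>[0] sndm)) n d x"
    proof (cases "n = 0")
      case True
      have x0: "x \<in> grd (circ_lin P A T) 0 d" using x True by simp
      show ?thesis using a x0 unfolding True by (simp add: alin_def gcomp_def)
    next
      case False
      hence "x = 0" using x flatD(2)[OF flat_circ_lin[OF A_flat T_flat]] by auto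
      thus ?thesis
        using glinear_0[OF h T_gmod] glinear_0[OF \<gamma>M_lin gmod_circ_lin]
        by (simp add: gcomp_def tact_eq plinD(3)[OF plin_lcomp_map] plinD(3)[OF plin_mu] plinD(3)[OF pr_plin])
    qed
  qed
qed

definition mdif :: "int \<Rightarrow> (('p, 'a \<times> 'c) tree \<Rightarrow>\<^sub>0 'k, 'm) gmap \<Rightarrow> (('p, 'a \<times> 'c) tree \<Rightarrow>\<^sub>0 'k, 'm) gmap" where
  "mdif p h = (\<lambda>n d x. (dif M \<bullet>[p] h) n d x - scl M ((-1) powi p) (h n (d - 1) (dif T n d x - dphi n d x)))"

lemma AC_simps:
  "scl AC = (\<lambda>c g n d x. scl M c (g n d x))" "n > 0 \<Longrightarrow> grd AC n p = {0}"
  "grd AC 0 p = {h \<in> gmaps p T M. alin p h}"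
  "dif AC n p h = (if n = 0 then restr T (mdif p h) else 0)" "act AC n p \<sigma> h = h"
proof -
  show "grd AC 0 p = {h \<in> gmaps p T M. alin p h}"
    unfolding module_hom_complex_def Let_def map_complex_def using alin_iff[OF gmaps_lin] by auto
qed (auto simp: module_hom_complex_def Let_def map_complex_def restr_def mdif_def)

lemma thA_in:
  assumes g: "g \<in> gmaps p C M"
  shows "thA p g \<in> gmaps p T M" "alin p (thA p g)"
proof -
  note gl = gmaps_lin[OF g]
  show i: "thA p g \<in> gmaps p T M" by (rule restr_gmaps[OF T_flat M_flat ext_lin_T[OF gl]])
  have sn: "glinear p (dsum A T) M (h \<bullet>[0] sndm)" if "glinear p T M h" for h
    using glinear_gcomp[OF glinear_sndm[of A T] that] by simp
  show "alin p (thA p g)"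
    unfolding alin_def
  proof (intro allI ballI)
    fix d x assume x: "x \<in> grd (circ_lin P A T) 0 d"
    have "lcomp_map P A M 0 idm fstm p (ext p g \<bullet>[0] sndm) 0 d x = lcomp_map P A M 0 idm fstm p (thA p g \<bullet>[0] sndm) 0 d x"
      by (rule lcomp_cong[OF ghom_idm flat_dsum[OF A_flat T_flat] A_flat M_flat glinear_fstm sn[OF ext_lin_T[OF gl]] glinear_fstm
            sn[OF gmaps_lin[OF i]] _ _ subsetD[OF circ_lin_sub x]]) (auto simp: gcomp_def sndm_def)
    thus "thA p g 0 d (tact 0 d x) = \<gamma>M 0 (d + p) (lcomp_map P A M 0 idm fstm p (thA p g \<bullet>[0] sndm) 0 d x)"
      using ext_tact[OF gl x] tact_in[OF x] by simp
  qed
qed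

text \<open>In arity zero this is \<open>mdif_ext\<close>; in positive arity and outside the
  components both sides vanish.\<close>

lemma thA_dif:
  assumes g: "g \<in> gmaps p C M"
  shows "restr T (mdif p (thA p g)) = thA (p - 1) (restr C (hdif p g))"
proof -
  note gl = gmaps_lin[OF g]
  have h: "restr C (hdif p g) \<in> gmaps (p - 1) C M" by (rule restr_gmaps[OF C_flat M_flat hdif_lin[OF gl]])
  have eq: "mdif p (thA p g) 0 d t = ext (p - 1) (restr C (hdif p g)) 0 d t" if t: "t \<in> grd T 0 d" for d t
  proof -
    have "mdif p (thA p g) 0 d t = ext (p - 1) (hdif p g) 0 d t"
      using mdif_ext[where h = "thA p g", OF gl restr_eq t] by (simp add: mdif_def gcomp_def)
    also have "\<dots> = ext (p - 1) (restr C (hdif p g)) 0 d t"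
      by (rule ext_cong[OF gmaps_lin[OF h] hdif_lin[OF gl] _ t]) simp
    finally show ?thesis .
  qed
  show ?thesis
  proof (intro ext)
    fix n d t
    show "restr T (mdif p (thA p g)) n d t = thA (p - 1) (restr C (hdif p g)) n d t"
    proof (cases "t \<in> grd T n d")
      case True
      show ?thesis
      proof (cases "n = 0")
        case False
        hence t0: "t = 0" using True flatD(2)[OF T_flat] by auto
        have z: "thA p g n e 0 = 0" "ext (p - 1) (restr C (hdif p g)) n e 0 = 0" for e
          using glinear_0[OF gmaps_lin[OF thA_in(1)[OF g]] T_gmod] glinear_0[OF ext_lin_T[OF gmaps_lin[OF h]] T_gmod] by auto
        have "dif T n d 0 = 0" "dphi n d 0 = 0"
          by (simp_all add: T_simps(3) dphi_eq tact_eq plinD(3)[OF plin_lcomp_map] plinD(3)[OF plin_mu] plinD(3)[OF pr_plin] plinD(3)[OF plin_dif_circ])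
        hence "mdif p h n d 0 = 0" if "\<And>e. h n e 0 = 0" for h
          using that by (simp add: mdif_def gcomp_def glinear_0[OF M_dif M_gmod] gmodD(9)[OF M_gmod])
        thus ?thesis using True z unfolding t0 by simp
      qed (use True eq in simp)
    qed (simp add: restr_def)
  qed
qed

lemma DC_iso: "dg_iso DC HC"
proof (rule HC_iso(2)[where E = der and J = "\<lambda>D. D \<bullet>[0] iota P \<eta> C"])
  show "(thD p g \<bullet>[0] iota P \<eta> C) 0 d x = g 0 d x" if "g \<in> gmaps p C M" "x \<in> grd C 0 d" for p g d x
    using der_iota[OF gmaps_lin[OF that(1)] that(2)] restr_eq[OF iota_in[OF that(2)], of "der p g"] by (simp add: gcomp_def)
  show "glinear p C M (D \<bullet>[0] iota P \<eta> C)" if "glinear p F M D" for p D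
    using glinear_gcomp[OF ghom_glinear[OF iota_ghom] that] by simp
qed (auto simp: F_flat DC_simps der_lin der_comb thD_in thD_dif gmaps_lin deriv_eq[symmetric])

lemma AC_iso: "dg_iso HC AC"
proof (rule HC_iso(1)[where E = "\<lambda>p g. ext p g" and J = "\<lambda>h. gen h"])
  show "gen (thA p g) 0 d x = g 0 d x" if "g \<in> gmaps p C M" "x \<in> grd C 0 d" for p g d x
  proof -
    note l = gmaps_lin[OF that(1)] and j = jj_in[OF that(2)]
    have "gen (thA p g) 0 d x = thA p g 0 d (pr 0 d (jj 0 d x))" by (simp add: gcomp_def)
    thus ?thesis unfolding restr_eq[OF pr_in[OF j]] ext_pr[OF l j] ext_jj[OF l that(2)] .
  qed
qed (auto simp: T_flat AC_simps ext_lin_T ext_comb thA_in thA_dif gmaps_lin alin_eq[symmetric] gen_lin)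

end

theorem theorem2p4p2:
  fixes P :: "('k::field_char_0, 'p::ab_group_add) dgs"
    and Q :: "('k, 'q::ab_group_add) dgs"
    and A :: "('k, 'a::ab_group_add) dgs"
    and C :: "('k, 'c::ab_group_add) dgs"
    and M :: "('k, 'm::ab_group_add) dgs"
  assumes "operad P \<gamma> \<eta>" and "augmented P \<gamma> \<eta>"
    and "cooperad Q \<Delta> \<epsilon>" and "coaugmented Q \<Delta> \<epsilon>"
    and "operadic_twisting Q \<Delta> \<epsilon> P \<gamma> \<eta> \<alpha>"
    and "palgebra P \<gamma> \<eta> A \<gamma>A" and "nonneg_graded A"
    and "qcoalgebra Q \<Delta> \<epsilon> C \<Delta>C"
    and "algebraic_twisting P \<alpha> C \<Delta>C A \<gamma>A \<phi>"
    and "quasi_free_resolution P \<gamma> \<eta> Q \<alpha> C \<Delta>C A \<gamma>A f"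
    and "eq_on C (f \<bullet>[0] iota P \<eta> C) \<phi>"
    and "amodule P \<gamma> \<eta> A \<gamma>A M \<gamma>M"
  shows "dg_iso (der_complex P A (quasi_free P \<gamma> \<eta> Q \<alpha> C \<Delta>C) (free_mult P \<gamma> C) f M \<gamma>M)
                (hom_complex P \<alpha> C \<Delta>C A \<phi> M \<gamma>M)
       \<and> dg_iso (hom_complex P \<alpha> C \<Delta>C A \<phi> M \<gamma>M)
                (module_hom_complex P \<gamma> \<eta> \<alpha> C \<Delta>C A \<gamma>A \<phi> M \<gamma>M)"
proof -
  interpret qfr P \<gamma> \<eta> A \<gamma>A M \<gamma>M C Q \<alpha> \<Delta>C \<phi> f
    using assms
    by unfold_locales (auto simp: qcoalgebra_def dg_hom_def operadic_twisting_def algebraic_twisting_def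
        quasi_free_resolution_def ghom_def)
  show ?thesis using DC_iso AC_iso by blast
qed

end
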